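(* Put $(\mathcal R/p)_{\rm red}:=(R/\sqrt{pR},N)$ and let $\mathsf{DA}_R^{\rm str}$ be the category of strict Dieudonné algebras over $R$. There is a functor $$\mathcal W\Omega^*_{-/\mathcal R}\colon \mathrm{lPoly}_{(\mathcal R/p)_{\rm red}}\longrightarrow \mathsf{DA}_R^{\rm str}$$ characterized as follows. For $\mathcal P_0=(P_0,L_P)\in\mathrm{lPoly}_{(\mathcal R/p)_{\rm red}}$ let $\mathcal P$ be its standard $p$-complete polynomial $F$-lift over $\mathcal R$ and put $\mathbf W_{\mathcal R}(\mathcal P_0):=\operatorname{WSat}(\widehat\Omega^*_{\mathcal P/\mathcal R})\in(\mathsf{DA}^{\log,s}_{\mathcal R})^{\rm str}$. Then $\mathcal W\Omega^*_{\mathcal P_0/\mathcal R}$ is the underlying strict Dieudonné algebra of $\mathbf W_{\mathcal R}(\mathcal P_0)$. Let $q_{\mathcal P}\colon\widehat\Omega^*_{\mathcal P/\mathcal R}\to\mathbf W_{\mathcal R}(\mathcal P_0)$ be the unit map and let $$e_{\mathcal P_0}\colon\mathcal P_0\longrightarrow\bigl((\mathbf W_{\mathcal R}(\mathcal P_0)^0/p)_{\rm red},L_P\bigr)$$ be its reduction on degree zero. For a morphism $u\colon\mathcal P_0\to\mathcal Q_0$, the morphism $\mathbf W_{\mathcal R}(u)\colon\mathbf W_{\mathcal R}(\mathcal P_0)\to\mathbf W_{\mathcal R}(\mathcal Q_0)$ is the unique strict logarithmic Dieudonné algebra morphism satisfying $$(\mathbf W_{\mathcal R}(u)^0/p)_{\rm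 red}\circ e_{\mathcal P_0}=e_{\mathcal Q_0}\circ u$$ (as morphisms of pre-log rings). Precomposing with reduction gives, in particular, a functor on $\mathrm{lPoly}_{\mathcal R/p}$.
   Context: Base. $k$ is a perfect field of characteristic $p>0$. A pre-log ring is a pair $(A,\alpha\colon L\to A)$ of a commutative ring and a monoid map from a commutative monoid $L$ to $(A,\cdot)$. $\mathcal R=(R,\alpha_R\colon N\to R)$ is a pre-log ring with $R$ a $p$-complete $p$-torsion free $W(k)$-algebra with a fixed lift $F_R\colon R\to R$ of the Frobenius of $R/p$, and there is a decomposition of monoids $N=N_1\oplus N_2$ with $\alpha_R(N_2\setminus\{0\})\subset pR$ and $F_R(\alpha_R(n))=\alpha_R(n)^p$ for $n\in N_1$. $\mathcal R/p=(R/p,N)$. Polynomial objects. For a pre-log ring $\mathcal S=(S,N)$, $\mathrm{lPoly}_{\mathcal S}$ is the full subcategory of pre-log $\mathcal S$-algebras spanned by the free ones: $S[X_1,\dots,X_n,Y_1,\dots,Y_m]$ with pre-log structure $\mathbb N^m\oplus N$, $e_i\mapsto Y_i$, and the given map on $N$. The standard $p$-complete polynomial $F$-lift over $\mathcal R$ of such an object over $(\mathcal R/p)_{\rm red}$ is the $p$-completion of $R[X,Y]$ with pre-log structure $\mathbb N^m\oplus N$ and Frobenius lift extending $F_R$ and sending each variable to its $p$-th power. $F$-pre-log algebras. An $F$-pre-log algebra over $\mathcal R$ is a pre-log $\mathcal R$-algebra $(A,\alpha\colon L\to A)$ with an $F_R$-semilinear lift $F_A\colon A\to A$ of the Frobenius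 of $A/p$; it is special if $L=L^o\oplus N$ (with $N\to L$ the second inclusion) and $F_A(\alpha(l))=\alpha(l)^p$ for $l\in L^o$. Dieudonné algebras (Bhatt--Lurie--Mathew). A Dieudonné algebra is a strictly graded-commutative dg ring $(A^*,d)$, $A^i=0$ for $i<0$, with a graded ring endomorphism $F$ with $dF=pFd$ and $F(x)\equiv x^p\bmod p$ for $x\in A^0$. It is saturated if $p$-torsion free and $F\colon A^*\to\{x\in A^*:dx\in pA^{*+1}\}$ is bijective; then $V$ is the unique map with $FV=p$. A saturated one is strict if $A^*\to\varprojlim_rA^*/(V^rA^*+dV^rA^* )$ is an isomorphism. Log Dieudonné algebras. A (pre-)log Dieudonné algebra over $\mathcal R$ is $(A^*,d,F,\alpha\colon L\to A^0,\delta\colon L\to A^1)$ with $(A^*,d)$ a strict cdga over $R$, $(A^*,d,F)$ a Dieudonné algebra, $(A^0,\alpha,F|_{A^0})$ an $F$-pre-log algebra over $\mathcal R$, $\delta$ a monoid map with $F\delta=\delta$, $d\delta=0$, and $(d,\delta)$ a log derivation over $\mathcal R$ (so $d\alpha(l)=\alpha(l)\delta(l)$, $\delta|_N=0$). It is special if $(A^0,\alpha,F)$ is; it is strict if its underlying Dieudonné algebra is. A morphism is a pair $(f,\psi)$ of a morphism $f$ of Dieudonné algebras over $R$ and a monoid map $\psi\colon L_A\to L_B$ over $N$ with $f\delta_A=\delta_B\psi$ and with $f,\psi$ compatible with the induced maps $L_A\to(A^0/p)_{\rm red}$, $L_B\to(B^0/p)_{\rm red}$ (only after passing to these reduced quotients).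 $\mathsf{DA}^{\log,s}_{\mathcal R}$ is the category of $p$-torsion free special pre-log Dieudonné algebras, $(\mathsf{DA}^{\log,s}_{\mathcal R})^{\rm str}$ the full subcategory of strict ones, and $\operatorname{WSat}$ the left adjoint of the inclusion (saturation followed by strictification of the underlying Dieudonné algebra, keeping the monoid and composing $\alpha,\delta$ with the unit). Log de Rham complex. For $\mathcal P$ the standard $p$-complete polynomial $F$-lift over $\mathcal R$ of an object $\mathcal P_0\in\mathrm{lPoly}_{(\mathcal R/p)_{\rm red}}$, $\widehat\Omega^*_{\mathcal P/\mathcal R}\in\mathsf{DA}^{\log,s}_{\mathcal R}$ is the $p$-completed relative log de Rham complex $\widehat\omega^*_{\mathcal P/\mathcal R}=\varprojlim_n \omega^*_{\mathcal P/\mathcal R}/p^n$ with its $d$, the maps $\alpha$ and $\delta=d\log$, and the unique graded ring map $F$ extending the Frobenius lift with $F(dx)=x^{p-1}dx+d\bigl(\tfrac{F(x)-x^p}{p}\bigr)$ and $F(d\log l)=d\log l$. *)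

theory Defs
  imports "HOL-Library.Poly_Mapping" "HOL-Library.Multiset" "HOL-Computational_Algebra.Primes" "HOL-Algebra.QuotRing"
begin

section \<open>Categories and functors\<close>

record ('o, 'm) cat =
  Obj :: "'o set"
  Hom :: "'o \<Rightarrow> 'o \<Rightarrow> 'm set"
  Idm :: "'o \<Rightarrow> 'm"
  Comp :: "'o \<Rightarrow> 'm \<Rightarrow> 'm \<Rightarrow> 'm"
    \<comment> \<open>\<open>Comp C a g f\<close> is \<open>g\<close> after \<open>f\<close>, where \<open>a\<close> is the source of \<open>f\<close>\<close>

locale category =
  fixes C :: "('o, 'm) cat"
  assumes id_Hom: "a \<in> Obj C \<Longrightarrow> Idm C a \<in> Hom C a a"
    and comp_Hom: "\<lbrakk>a \<in> Obj C; b \<in> Obj C; c \<in> Obj C; f \<in> Hom C a b; g \<in> Hom C b c\<rbrakk>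
      \<Longrightarrow> Comp C a g f \<in> Hom C a c"
    and comp_id_right: "\<lbrakk>a \<in> Obj C; b \<in> Obj C; f \<in> Hom C a b\<rbrakk> \<Longrightarrow> Comp C a f (Idm C a) = f"
    and comp_id_left: "\<lbrakk>a \<in> Obj C; b \<in> Obj C; f \<in> Hom C a b\<rbrakk> \<Longrightarrow> Comp C a (Idm C b) f = f"
    and comp_assoc: "\<lbrakk>a \<in> Obj C; b \<in> Obj C; c \<in> Obj C; d \<in> Obj C;
        f \<in> Hom C a b; g \<in> Hom C b c; h \<in> Hom C c d\<rbrakk>
      \<Longrightarrow> Comp C a h (Comp C a g f) = Comp C a (Comp C b h g) f"

locale functor_between = source: category C + target: category D
  for C :: "('o, 'm) cat" and D :: "('o2, 'm2) cat" +
  fixes Fo :: "'o \<Rightarrow> 'o2" and Fm :: "'o \<Rightarrow> 'o \<Rightarrow> 'm \<Rightarrow> 'm2"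
  assumes obj: "a \<in> Obj C \<Longrightarrow> Fo a \<in> Obj D"
    and hom: "\<lbrakk>a \<in> Obj C; b \<in> Obj C; f \<in> Hom C a b\<rbrakk> \<Longrightarrow> Fm a b f \<in> Hom D (Fo a) (Fo b)"
    and ident: "a \<in> Obj C \<Longrightarrow> Fm a a (Idm C a) = Idm D (Fo a)"
    and comp: "\<lbrakk>a \<in> Obj C; b \<in> Obj C; c \<in> Obj C; f \<in> Hom C a b; g \<in> Hom C b c\<rbrakk>
      \<Longrightarrow> Fm a c (Comp C a g f) = Comp D (Fo a) (Fm b c g) (Fm a b f)"


section \<open>Multiples of p, reduction, completion\<close>

text \<open>Monoid maps preserve the unit; \<^const>\<open>hom\<close> does not ask for this.\<close>

definition monoid_maps :: "('a, 'm) monoid_scheme \<Rightarrow> ('b, 'n) monoid_scheme \<Rightarrow> ('a \<Rightarrow> 'b) set" where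
  "monoid_maps G H = {h \<in> hom G H. h \<one>\<^bsub>G\<^esub> = \<one>\<^bsub>H\<^esub>}"

definition mults :: "nat \<Rightarrow> ('a, 'm) ring_scheme \<Rightarrow> 'a set" where
  "mults q G = (\<lambda>x. [q] \<cdot>\<^bsub>G\<^esub> x) ` carrier G"

definition torsion_free :: "nat \<Rightarrow> ('a, 'm) ring_scheme \<Rightarrow> bool" where
  "torsion_free p G \<longleftrightarrow> (\<forall>x \<in> carrier G. [p] \<cdot>\<^bsub>G\<^esub> x = \<zero>\<^bsub>G\<^esub> \<longrightarrow> x = \<zero>\<^bsub>G\<^esub>)"

definition rad :: "nat \<Rightarrow> ('a, 'm) ring_scheme \<Rightarrow> 'a set" where
  "rad p A = {x \<in> carrier A. \<exists>n::nat. x [^]\<^bsub>A\<^esub> n \<in> mults p A}"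

text \<open>\<open>(A/p)\<^sub>r\<^sub>e\<^sub>d\<close> is \<open>A\<close> modulo the radical of \<open>pA\<close>.\<close>

definition red_ring :: "nat \<Rightarrow> ('a, 'm) ring_scheme \<Rightarrow> 'a set ring" where
  "red_ring p A = A Quot rad p A"

definition red_class :: "nat \<Rightarrow> ('a, 'm) ring_scheme \<Rightarrow> 'a \<Rightarrow> 'a set" where
  "red_class p A x = rad p A +>\<^bsub>A\<^esub> x"

text \<open>Maps on cosets induced by maps on representatives: all members of the union agree
  whenever the induced map is well defined.\<close>

definition coset_map :: "('b, 'm) ring_scheme \<Rightarrow> 'b set \<Rightarrow> ('a \<Rightarrow> 'b) \<Rightarrow> 'a set \<Rightarrow> 'b set" where
  "coset_map H K f X = (\<Union>x\<in>X. K +>\<^bsub>H\<^esub> f x)"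

definition coset_map2 ::
  "('c, 'm) ring_scheme \<Rightarrow> 'c set \<Rightarrow> ('a \<Rightarrow> 'b \<Rightarrow> 'c) \<Rightarrow> 'a set \<Rightarrow> 'b set \<Rightarrow> 'c set" where
  "coset_map2 H K f X Y = (\<Union>x\<in>X. \<Union>y\<in>Y. K +>\<^bsub>H\<^esub> f x y)"

text \<open>The limit of \<open>G / Fil r\<close> for a decreasing filtration \<open>Fil\<close>: sequences of cosets, each
  contained in its predecessor.\<close>

definition lim_ring :: "('a, 'm) ring_scheme \<Rightarrow> (nat \<Rightarrow> 'a set) \<Rightarrow> (nat \<Rightarrow> 'a set) ring" where
  "lim_ring G Fil =
    \<lparr>carrier = {x. \<forall>r. x r \<in> carrier (G Quot Fil r) \<and> x (Suc r) \<subseteq> x r},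
     mult = (\<lambda>x y r. x r \<otimes>\<^bsub>G Quot Fil r\<^esub> y r),
     one = (\<lambda>r. \<one>\<^bsub>G Quot Fil r\<^esub>),
     zero = (\<lambda>r. \<zero>\<^bsub>G Quot Fil r\<^esub>),
     add = (\<lambda>x y r. x r \<oplus>\<^bsub>G Quot Fil r\<^esub> y r)\<rparr>"

definition to_lim :: "('a, 'm) ring_scheme \<Rightarrow> (nat \<Rightarrow> 'a set) \<Rightarrow> 'a \<Rightarrow> nat \<Rightarrow> 'a set" where
  "to_lim G Fil x = (\<lambda>r. Fil r +>\<^bsub>G\<^esub> x)"

definition lim_complete :: "('a, 'm) ring_scheme \<Rightarrow> (nat \<Rightarrow> 'a set) \<Rightarrow> bool" where
  "lim_complete G Fil \<longleftrightarrow> bij_betw (to_lim G Fil) (carrier G) (carrier (lim_ring G Fil))"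

abbreviation p_fil :: "nat \<Rightarrow> ('a, 'm) ring_scheme \<Rightarrow> nat \<Rightarrow> 'a set" where
  "p_fil p G \<equiv> \<lambda>r. mults (p ^ r) G"

definition frobenius_lift :: "nat \<Rightarrow> ('a, 'm) ring_scheme \<Rightarrow> ('a \<Rightarrow> 'a) \<Rightarrow> bool" where
  "frobenius_lift p A F \<longleftrightarrow>
    F \<in> ring_hom A A \<and> (\<forall>x \<in> carrier A. F x \<ominus>\<^bsub>A\<^esub> x [^]\<^bsub>A\<^esub> p \<in> mults p A)"


section \<open>Witt vectors\<close>

text \<open>Integer polynomials in variables indexed by \<^typ>\<open>nat\<close>; variable \<open>2 i\<close> is \<open>X\<^sub>i\<close>
  and variable \<open>2 i + 1\<close> is \<open>Y\<^sub>i\<close>.\<close>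

type_synonym zpoly = "(nat \<Rightarrow>\<^sub>0 nat) \<Rightarrow>\<^sub>0 int"

definition zvar :: "nat \<Rightarrow> zpoly" where
  "zvar i = Poly_Mapping.single (Poly_Mapping.single i 1) 1"

definition ghost :: "nat \<Rightarrow> (nat \<Rightarrow> zpoly) \<Rightarrow> nat \<Rightarrow> zpoly" where
  "ghost p Z n = (\<Sum>i\<le>n. of_nat (p ^ i) * Z i ^ (p ^ (n - i)))"

text \<open>The solution \<open>Z\<close> of \<open>ghost p Z n = w n\<close> for all \<open>n\<close>; for the two \<open>w\<close> used below
  all the coefficientwise divisions are exact.\<close>

function unghost :: "nat \<Rightarrow> (nat \<Rightarrow> zpoly) \<Rightarrow> nat \<Rightarrow> zpoly" where
  "unghost p w n = Poly_Mapping.map (\<lambda>c. c div int (p ^ n))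
     (w n - (\<Sum>i<n. of_nat (p ^ i) * unghost p w i ^ (p ^ (n - i))))"
  by auto
termination
  by (relation "measure (\<lambda>(p, w, n). n)") auto

declare unghost.simps [simp del]

definition witt_sum :: "nat \<Rightarrow> nat \<Rightarrow> zpoly" where
  "witt_sum p = unghost p
     (\<lambda>n. ghost p (\<lambda>i. zvar (2 * i)) n + ghost p (\<lambda>i. zvar (2 * i + 1)) n)"

definition witt_prod :: "nat \<Rightarrow> nat \<Rightarrow> zpoly" where
  "witt_prod p = unghost p
     (\<lambda>n. ghost p (\<lambda>i. zvar (2 * i)) n * ghost p (\<lambda>i. zvar (2 * i + 1)) n)"

definition zeval :: "('a, 'm) ring_scheme \<Rightarrow> (nat \<Rightarrow> 'a) \<Rightarrow> (nat \<Rightarrow> 'a) \<Rightarrow> zpoly \<Rightarrow> 'a" where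
  "zeval k x y P = (\<Oplus>\<^bsub>k\<^esub>m\<in>Poly_Mapping.keys P. [Poly_Mapping.lookup P m] \<cdot>\<^bsub>k\<^esub>
     (\<Otimes>\<^bsub>k\<^esub>i\<in>Poly_Mapping.keys m.
        (if even i then x (i div 2) else y (i div 2)) [^]\<^bsub>k\<^esub> Poly_Mapping.lookup m i))"

definition witt_ring :: "nat \<Rightarrow> ('a, 'm) ring_scheme \<Rightarrow> (nat \<Rightarrow> 'a) ring" where
  "witt_ring p k =
    \<lparr>carrier = {x. \<forall>i. x i \<in> carrier k},
     mult = (\<lambda>x y n. zeval k x y (witt_prod p n)),
     one = (\<lambda>i. if i = 0 then \<one>\<^bsub>k\<^esub> else \<zero>\<^bsub>k\<^esub>),
     zero = (\<lambda>i. \<zero>\<^bsub>k\<^esub>),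
     add = (\<lambda>x y n. zeval k x y (witt_sum p n))\<rparr>"


section \<open>Pre-log rings and pre-log algebras\<close>

text \<open>The monoids are written multiplicatively, as in HOL-Algebra.\<close>

record ('a, 'l) prelog =
  pring :: "'a ring"
  pmon :: "'l monoid"
  palpha :: "'l \<Rightarrow> 'a"

record ('a, 'l) fprelog = "('a, 'l) prelog" +
  pfrob :: "'a \<Rightarrow> 'a"

record ('a, 'l, 's, 'n) prelog_alg = "('a, 'l) prelog" +
  rstr :: "'s \<Rightarrow> 'a"
  nstr :: "'n \<Rightarrow> 'l"

definition prelog_ring :: "('a, 'l, 'z) prelog_scheme \<Rightarrow> bool" where
  "prelog_ring A \<longleftrightarrow>
    cring (pring A) \<and> comm_monoid (pmon A) \<and> palpha A \<in> monoid_maps (pmon A) (pring A)"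

definition prelog_hom ::
  "('a, 'l, 'y) prelog_scheme \<Rightarrow> ('b, 'k, 'z) prelog_scheme \<Rightarrow> ('a \<Rightarrow> 'b) \<Rightarrow> ('l \<Rightarrow> 'k) \<Rightarrow> bool" where
  "prelog_hom A B f \<psi> \<longleftrightarrow>
    f \<in> ring_hom (pring A) (pring B) \<and> \<psi> \<in> monoid_maps (pmon A) (pmon B) \<and>
    (\<forall>l \<in> carrier (pmon A). f (palpha A l) = palpha B (\<psi> l))"

definition prelog_alg_hom ::
  "('s, 'n, 'x) prelog_scheme \<Rightarrow> ('a, 'l, 's, 'n, 'y) prelog_alg_scheme \<Rightarrow>
   ('b, 'k, 's, 'n, 'z) prelog_alg_scheme \<Rightarrow> ('a \<Rightarrow> 'b) \<Rightarrow> ('l \<Rightarrow> 'k) \<Rightarrow> bool" where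
  "prelog_alg_hom S A B f \<psi> \<longleftrightarrow>
    prelog_hom A B f \<psi> \<and>
    (\<forall>s \<in> carrier (pring S). f (rstr A s) = rstr B s) \<and>
    (\<forall>n \<in> carrier (pmon S). \<psi> (nstr A n) = nstr B n)"

text \<open>The standing assumptions on the base: \<open>\<iota>\<close> makes \<open>R\<close> a \<open>W(k)\<close>-algebra, and
  \<open>N\<close> is the internal direct sum of \<open>N1\<close> and \<open>N2\<close>.\<close>

locale log_base =
  fixes p :: nat and k :: "'k ring" and \<iota> :: "(nat \<Rightarrow> 'k) \<Rightarrow> 'r"
    and B :: "('r, 'n) fprelog" and N1 N2 :: "'n set"
  assumes prime_p: "prime p"
    and field_k: "field k"
    and char_k: "[p] \<cdot>\<^bsub>k\<^esub> \<one>\<^bsub>k\<^esub> = \<zero>\<^bsub>k\<^esub>"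
    and perfect_k: "\<forall>x \<in> carrier k. \<exists>y \<in> carrier k. y [^]\<^bsub>k\<^esub> p = x"
    and prelog: "prelog_ring B"
    and p_complete: "lim_complete (pring B) (p_fil p (pring B))"
    and p_torsion_free: "torsion_free p (pring B)"
    and witt_algebra: "\<iota> \<in> ring_hom (witt_ring p k) (pring B)"
    and frobenius: "frobenius_lift p (pring B) (pfrob B)"
    and N1: "submonoid N1 (pmon B)"
    and N2: "submonoid N2 (pmon B)"
    and decomp: "bij_betw (\<lambda>(a, b). a \<otimes>\<^bsub>pmon B\<^esub> b) (N1 \<times> N2) (carrier (pmon B))"
    and alpha_N2: "palpha B ` (N2 - {\<one>\<^bsub>pmon B\<^esub>}) \<subseteq> mults p (pring B)"
    and alpha_N1: "\<forall>n \<in> N1. pfrob B (palpha B n) = palpha B n [^]\<^bsub>pring B\<^esub> p"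

definition base_mod :: "nat \<Rightarrow> ('r, 'n, 'z) prelog_scheme \<Rightarrow> ('r set, 'n) prelog" where
  "base_mod p B = \<lparr>pring = pring B Quot mults p (pring B), pmon = pmon B,
     palpha = (\<lambda>n. mults p (pring B) +>\<^bsub>pring B\<^esub> palpha B n)\<rparr>"

definition base_red :: "nat \<Rightarrow> ('r, 'n, 'z) prelog_scheme \<Rightarrow> ('r set, 'n) prelog" where
  "base_red p B = \<lparr>pring = red_ring p (pring B), pmon = pmon B,
     palpha = (\<lambda>n. red_class p (pring B) (palpha B n))\<rparr>"


section \<open>Free pre-log algebras\<close>

text \<open>As in the library theory \<open>Indexed_Polynomials\<close>, a monomial is a multiset of variables
  and a polynomial is its coefficient function. \<open>Inl i\<close> is the variable \<open>X\<^sub>i\<close> and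
  \<open>Inr j\<close> the variable \<open>Y\<^sub>j\<close>.\<close>

type_synonym 'r mpoly = "(nat + nat) multiset \<Rightarrow> 'r"

definition vars :: "nat \<times> nat \<Rightarrow> (nat + nat) set" where
  "vars = (\<lambda>(n, m). Inl ` {..<n} \<union> Inr ` {..<m})"

definition mpoly_ring :: "('r, 'm) ring_scheme \<Rightarrow> nat \<times> nat \<Rightarrow> 'r mpoly ring" where
  "mpoly_ring R nm =
    \<lparr>carrier = {f. (\<forall>M. f M \<in> carrier R) \<and> finite {M. f M \<noteq> \<zero>\<^bsub>R\<^esub>} \<and>
                   (\<forall>M. f M \<noteq> \<zero>\<^bsub>R\<^esub> \<longrightarrow> set_mset M \<subseteq> vars nm)},
     mult = (\<lambda>f g M. \<Oplus>\<^bsub>R\<^esub>U\<in>{U. U \<subseteq># M}. f U \<otimes>\<^bsub>R\<^esub> g (M - U)),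
     one = (\<lambda>M. if M = {#} then \<one>\<^bsub>R\<^esub> else \<zero>\<^bsub>R\<^esub>),
     zero = (\<lambda>M. \<zero>\<^bsub>R\<^esub>),
     add = (\<lambda>f g M. f M \<oplus>\<^bsub>R\<^esub> g M)\<rparr>"

definition mpoly_monom :: "('r, 'm) ring_scheme \<Rightarrow> 'r \<Rightarrow> (nat + nat) multiset \<Rightarrow> 'r mpoly" where
  "mpoly_monom R c U = (\<lambda>M. if M = U then c else \<zero>\<^bsub>R\<^esub>)"

text \<open>The monoid \<open>\<nat>\<^sup>m\<close>; the singleton \<open>{#j#}\<close> is the basis vector \<open>e\<^sub>j\<close>.\<close>

definition free_mon :: "nat \<Rightarrow> nat multiset monoid" where
  "free_mon m = \<lparr>carrier = {v. set_mset v \<subseteq> {..<m}}, mult = (+), one = {#}\<rparr>"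

definition lpoly_obj ::
  "('s, 'n, 'z) prelog_scheme \<Rightarrow> nat \<times> nat \<Rightarrow> ('s mpoly, nat multiset \<times> 'n, 's, 'n) prelog_alg" where
  "lpoly_obj S nm =
    \<lparr>pring = mpoly_ring (pring S) nm,
     pmon = free_mon (snd nm) \<times>\<times> pmon S,
     palpha = (\<lambda>(v, n). mpoly_monom (pring S) (palpha S n) (image_mset Inr v)),
     rstr = (\<lambda>s. mpoly_monom (pring S) s {#}),
     nstr = (\<lambda>n. ({#}, n))\<rparr>"

text \<open>Objects are given by their numbers \<open>(n, m)\<close> of variables. Morphisms are pairs of a ring
  map and a monoid map, made extensional so that equality of morphisms is HOL equality.\<close>

definition lPoly ::
  "('s, 'n, 'z) prelog_scheme \<Rightarrow>
   (nat \<times> nat, ('s mpoly \<Rightarrow> 's mpoly) \<times> (nat multiset \<times> 'n \<Rightarrow> nat multiset \<times> 'n)) cat" where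
  "lPoly S =
    \<lparr>Obj = UNIV,
     Hom = (\<lambda>P Q. {(f, \<psi>). prelog_alg_hom S (lpoly_obj S P) (lpoly_obj S Q) f \<psi> \<and>
             f \<in> extensional (carrier (pring (lpoly_obj S P))) \<and>
             \<psi> \<in> extensional (carrier (pmon (lpoly_obj S P)))}),
     Idm = (\<lambda>P. (\<lambda>x\<in>carrier (pring (lpoly_obj S P)). x, \<lambda>l\<in>carrier (pmon (lpoly_obj S P)). l)),
     Comp = (\<lambda>P (g, \<chi>) (f, \<psi>). (compose (carrier (pring (lpoly_obj S P))) g f,
                                 compose (carrier (pmon (lpoly_obj S P))) \<chi> \<psi>))\<rparr>"

text \<open>Reduction of coefficients \<open>R/p \<rightarrow> (R/p)\<^sub>r\<^sub>e\<^sub>d\<close>, and the base change of morphisms along it.\<close>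

definition coeff_red :: "nat \<Rightarrow> ('r, 'n, 'z) prelog_scheme \<Rightarrow> 'r set mpoly \<Rightarrow> 'r set mpoly" where
  "coeff_red p B g = (\<lambda>M. coset_map (pring B) (rad p (pring B)) (\<lambda>x. x) (g M))"

definition reduce_mor ::
  "nat \<Rightarrow> ('r, 'n, 'z) prelog_scheme \<Rightarrow> nat \<times> nat \<Rightarrow> nat \<times> nat \<Rightarrow>
   ('r set mpoly \<Rightarrow> 'r set mpoly) \<times> 'h \<Rightarrow> ('r set mpoly \<Rightarrow> 'r set mpoly) \<times> 'h" where
  "reduce_mor p B P Q = (\<lambda>(f, \<psi>).
    (\<lambda>g\<in>carrier (pring (lpoly_obj (base_red p B) P)).
        the_elem ((\<lambda>h. coeff_red p B (f h)) `
          {h \<in> carrier (pring (lpoly_obj (base_mod p B) P)). coeff_red p B h = g}),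
     \<psi>))"

text \<open>The Frobenius lift \<open>\<Sum> c\<^sub>U X\<^sup>U \<mapsto> \<Sum> F(c\<^sub>U) X\<^sup>p\<^sup>U\<close> on polynomials.\<close>

definition mpoly_frob :: "nat \<Rightarrow> ('r, 'n, 'z) fprelog_scheme \<Rightarrow> 'r mpoly \<Rightarrow> 'r mpoly" where
  "mpoly_frob p B f = (\<lambda>M. if \<exists>U. M = repeat_mset p U
     then pfrob B (f (THE U. M = repeat_mset p U)) else \<zero>\<^bsub>pring B\<^esub>)"

definition std_lift ::
  "nat \<Rightarrow> ('r, 'n, 'z) prelog_scheme \<Rightarrow> nat \<times> nat \<Rightarrow>
   (nat \<Rightarrow> 'r mpoly set, nat multiset \<times> 'n, 'r, 'n) prelog_alg" where
  "std_lift p B nm = (let A = lpoly_obj B nm; c = to_lim (pring A) (p_fil p (pring A)) in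
    \<lparr>pring = lim_ring (pring A) (p_fil p (pring A)),
     pmon = pmon A,
     palpha = (\<lambda>l. c (palpha A l)),
     rstr = (\<lambda>r. c (rstr A r)),
     nstr = nstr A\<rparr>)"

definition std_frob ::
  "nat \<Rightarrow> ('r, 'n, 'z) fprelog_scheme \<Rightarrow> nat \<times> nat \<Rightarrow> (nat \<Rightarrow> 'r mpoly set) \<Rightarrow> nat \<Rightarrow> 'r mpoly set" where
  "std_frob p B nm x = (let A = pring (lpoly_obj B nm) in
    (\<lambda>r. coset_map A (p_fil p A r) (mpoly_frob p B) (x r)))"


section \<open>Differential graded algebras and Dieudonne algebras\<close>

text \<open>Of each ring record \<open>gr A i\<close> only the additive group is relevant; products of
  homogeneous elements are taken with \<open>gmul\<close>. Graded pieces in negative degree are zero and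
  not represented. \<open>rmap\<close> is the structure map \<open>R \<rightarrow> A\<^sup>0\<close>.\<close>

record ('a, 'r) cdga =
  gr :: "nat \<Rightarrow> 'a ring"
  gmul :: "nat \<Rightarrow> nat \<Rightarrow> 'a \<Rightarrow> 'a \<Rightarrow> 'a"
  gone :: 'a
  dif :: "nat \<Rightarrow> 'a \<Rightarrow> 'a"
  rmap :: "'r \<Rightarrow> 'a"

record ('a, 'r) dieu = "('a, 'r) cdga" +
  frob :: "nat \<Rightarrow> 'a \<Rightarrow> 'a"

record ('a, 'r, 'l, 'n) log_dieu = "('a, 'r) dieu" +
  lmon :: "'l monoid"
  lalpha :: "'l \<Rightarrow> 'a"
  lnstr :: "'n \<Rightarrow> 'l"
  dlog :: "'l \<Rightarrow> 'a"

definition deg0 :: "('a, 'r, 'z) cdga_scheme \<Rightarrow> 'a ring" where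
  "deg0 A = \<lparr>carrier = carrier (gr A 0), mult = gmul A 0 0, one = gone A,
     zero = \<zero>\<^bsub>gr A 0\<^esub>, add = add (gr A 0)\<rparr>"

definition gsign :: "nat \<Rightarrow> ('a, 'm) ring_scheme \<Rightarrow> 'a \<Rightarrow> 'a" where
  "gsign i G x = (if even i then x else \<ominus>\<^bsub>G\<^esub> x)"

locale strict_cdga =
  fixes R :: "('r, 'y) ring_scheme" and A :: "('a, 'r, 'z) cdga_scheme"
  assumes gr_group: "abelian_group (gr A i)"
    and gmul_closed: "\<lbrakk>x \<in> carrier (gr A i); y \<in> carrier (gr A j)\<rbrakk> \<Longrightarrow> gmul A i j x y \<in> carrier (gr A (i + j))"
    and gone_closed: "gone A \<in> carrier (gr A 0)"
    and distrib_l: "\<lbrakk>x \<in> carrier (gr A i); x' \<in> carrier (gr A i); y \<in> carrier (gr A j)\<rbrakk> \<Longrightarrow>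
      gmul A i j (x \<oplus>\<^bsub>gr A i\<^esub> x') y = gmul A i j x y \<oplus>\<^bsub>gr A (i + j)\<^esub> gmul A i j x' y"
    and distrib_r: "\<lbrakk>x \<in> carrier (gr A i); y \<in> carrier (gr A j); y' \<in> carrier (gr A j)\<rbrakk> \<Longrightarrow>
      gmul A i j x (y \<oplus>\<^bsub>gr A j\<^esub> y') = gmul A i j x y \<oplus>\<^bsub>gr A (i + j)\<^esub> gmul A i j x y'"
    and assoc: "\<lbrakk>x \<in> carrier (gr A i); y \<in> carrier (gr A j); z \<in> carrier (gr A l)\<rbrakk> \<Longrightarrow>
      gmul A (i + j) l (gmul A i j x y) z = gmul A i (j + l) x (gmul A j l y z)"
    and gone_l: "x \<in> carrier (gr A i) \<Longrightarrow> gmul A 0 i (gone A) x = x"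
    and gcomm: "\<lbrakk>x \<in> carrier (gr A i); y \<in> carrier (gr A j)\<rbrakk> \<Longrightarrow>
      gmul A i j x y = gsign (i * j) (gr A (i + j)) (gmul A j i y x)"
    and odd_square: "\<lbrakk>odd i; x \<in> carrier (gr A i)\<rbrakk> \<Longrightarrow> gmul A i i x x = \<zero>\<^bsub>gr A (i + i)\<^esub>"
    and dif_hom: "dif A i \<in> hom (add_monoid (gr A i)) (add_monoid (gr A (Suc i)))"
    and dif_dif: "x \<in> carrier (gr A i) \<Longrightarrow> dif A (Suc i) (dif A i x) = \<zero>\<^bsub>gr A (Suc (Suc i))\<^esub>"
    and leibniz: "\<lbrakk>x \<in> carrier (gr A i); y \<in> carrier (gr A j)\<rbrakk> \<Longrightarrow>
      dif A (i + j) (gmul A i j x y) = gmul A (Suc i) j (dif A i x) y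
        \<oplus>\<^bsub>gr A (Suc (i + j))\<^esub> gsign i (gr A (Suc (i + j))) (gmul A i (Suc j) x (dif A j y))"
    and rmap_hom: "rmap A \<in> ring_hom R (deg0 A)"
    and dif_rmap: "r \<in> carrier R \<Longrightarrow> dif A 0 (rmap A r) = \<zero>\<^bsub>gr A 1\<^esub>"

definition graded_ring_hom ::
  "('a, 'r, 'y) cdga_scheme \<Rightarrow> ('b, 's, 'z) cdga_scheme \<Rightarrow> (nat \<Rightarrow> 'a \<Rightarrow> 'b) \<Rightarrow> bool" where
  "graded_ring_hom A B f \<longleftrightarrow>
    (\<forall>i. f i \<in> hom (add_monoid (gr A i)) (add_monoid (gr B i))) \<and>
    (\<forall>i j. \<forall>x \<in> carrier (gr A i). \<forall>y \<in> carrier (gr A j).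
       f (i + j) (gmul A i j x y) = gmul B i j (f i x) (f j y)) \<and>
    f 0 (gone A) = gone B"

text \<open>Dieudonne algebras over \<open>R\<close>, where \<open>FR\<close> is the Frobenius lift on \<open>R\<close>.\<close>

locale dieudonne_algebra = strict_cdga R A
  for R :: "('r, 'y) ring_scheme" and A :: "('a, 'r, 'z) dieu_scheme" +
  fixes p :: nat and FR :: "'r \<Rightarrow> 'r"
  assumes frob_hom: "graded_ring_hom A A (frob A)"
    and dif_frob: "x \<in> carrier (gr A i) \<Longrightarrow>
      dif A i (frob A i x) = [p] \<cdot>\<^bsub>gr A (Suc i)\<^esub> frob A (Suc i) (dif A i x)"
    and frob_lift: "frobenius_lift p (deg0 A) (frob A 0)"
    and frob_rmap: "r \<in> carrier R \<Longrightarrow> frob A 0 (rmap A r) = rmap A (FR r)"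

definition dieu_torsion_free :: "nat \<Rightarrow> ('a, 'r, 'z) cdga_scheme \<Rightarrow> bool" where
  "dieu_torsion_free p A \<longleftrightarrow> (\<forall>i. torsion_free p (gr A i))"

definition saturated :: "nat \<Rightarrow> ('a, 'r, 'z) dieu_scheme \<Rightarrow> bool" where
  "saturated p A \<longleftrightarrow> dieu_torsion_free p A \<and>
    (\<forall>i. bij_betw (frob A i) (carrier (gr A i))
           {x \<in> carrier (gr A i). dif A i x \<in> mults p (gr A (Suc i))})"

definition ver :: "nat \<Rightarrow> ('a, 'r, 'z) dieu_scheme \<Rightarrow> nat \<Rightarrow> 'a \<Rightarrow> 'a" where
  "ver p A i x = (THE y. y \<in> carrier (gr A i) \<and> frob A i y = [p] \<cdot>\<^bsub>gr A i\<^esub> x)"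

text \<open>The degree \<open>i\<close> part of \<open>V\<^sup>r A + d V\<^sup>r A\<close>.\<close>

definition V_fil :: "nat \<Rightarrow> ('a, 'r, 'z) dieu_scheme \<Rightarrow> nat \<Rightarrow> nat \<Rightarrow> 'a set" where
  "V_fil p A i r = ((ver p A i ^^ r) ` carrier (gr A i)) <+>\<^bsub>gr A i\<^esub>
     (case i of 0 \<Rightarrow> {\<zero>\<^bsub>gr A 0\<^esub>}
      | Suc j \<Rightarrow> (\<lambda>x. dif A j ((ver p A j ^^ r) x)) ` carrier (gr A j))"

definition strict :: "nat \<Rightarrow> ('a, 'r, 'z) dieu_scheme \<Rightarrow> bool" where
  "strict p A \<longleftrightarrow> saturated p A \<and> (\<forall>i. lim_complete (gr A i) (V_fil p A i))"

definition dieu_hom ::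
  "('r, 'x) ring_scheme \<Rightarrow> ('a, 'r, 'y) dieu_scheme \<Rightarrow> ('b, 'r, 'z) dieu_scheme \<Rightarrow>
   (nat \<Rightarrow> 'a \<Rightarrow> 'b) \<Rightarrow> bool" where
  "dieu_hom R A B f \<longleftrightarrow> graded_ring_hom A B f \<and>
    (\<forall>i. \<forall>x \<in> carrier (gr A i). f (Suc i) (dif A i x) = dif B i (f i x)) \<and>
    (\<forall>i. \<forall>x \<in> carrier (gr A i). f i (frob A i x) = frob B i (f i x)) \<and>
    (\<forall>r \<in> carrier R. f 0 (rmap A r) = rmap B r)"

definition DA_str :: "nat \<Rightarrow> ('r, 'n, 'z) fprelog_scheme \<Rightarrow> (('a, 'r) dieu, nat \<Rightarrow> 'a \<Rightarrow> 'a) cat" where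
  "DA_str p B =
    \<lparr>Obj = {A. dieudonne_algebra (pring B) A p (pfrob B) \<and> strict p A},
     Hom = (\<lambda>A A'. {f. dieu_hom (pring B) A A' f \<and> (\<forall>i. f i \<in> extensional (carrier (gr A i)))}),
     Idm = (\<lambda>A i. \<lambda>x\<in>carrier (gr A i). x),
     Comp = (\<lambda>A g f i. compose (carrier (gr A i)) (g i) (f i))\<rparr>"


section \<open>Log Dieudonne algebras\<close>

locale log_dieudonne_algebra =
  dieudonne_algebra "pring B" A p "pfrob B"
  for B :: "('r, 'n, 'y) fprelog_scheme" and A :: "('a, 'r, 'l, 'n, 'z) log_dieu_scheme" and p +
  assumes lmon: "comm_monoid (lmon A)"
    and lalpha: "lalpha A \<in> monoid_maps (lmon A) (deg0 A)"
    and lnstr: "lnstr A \<in> monoid_maps (pmon B) (lmon A)"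
    and lalpha_lnstr: "n \<in> carrier (pmon B) \<Longrightarrow> lalpha A (lnstr A n) = rmap A (palpha B n)"
    and dlog: "dlog A \<in> monoid_maps (lmon A) (add_monoid (gr A 1))"
    and frob_dlog: "l \<in> carrier (lmon A) \<Longrightarrow> frob A 1 (dlog A l) = dlog A l"
    and dif_dlog: "l \<in> carrier (lmon A) \<Longrightarrow> dif A 1 (dlog A l) = \<zero>\<^bsub>gr A 2\<^esub>"
    and dif_lalpha: "l \<in> carrier (lmon A) \<Longrightarrow> dif A 0 (lalpha A l) = gmul A 0 1 (lalpha A l) (dlog A l)"
    and dlog_lnstr: "n \<in> carrier (pmon B) \<Longrightarrow> dlog A (lnstr A n) = \<zero>\<^bsub>gr A 1\<^esub>"

definition special ::
  "nat \<Rightarrow> ('r, 'n, 'y) prelog_scheme \<Rightarrow> ('a, 'r, 'l, 'n, 'z) log_dieu_scheme \<Rightarrow> bool" where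
  "special p B A \<longleftrightarrow> (\<exists>L. submonoid L (lmon A) \<and>
    bij_betw (\<lambda>(l, n). l \<otimes>\<^bsub>lmon A\<^esub> lnstr A n) (L \<times> carrier (pmon B)) (carrier (lmon A)) \<and>
    (\<forall>l \<in> L. frob A 0 (lalpha A l) = lalpha A l [^]\<^bsub>deg0 A\<^esub> p))"

definition DA_log_s :: "nat \<Rightarrow> ('r, 'n, 'y) fprelog_scheme \<Rightarrow> ('a, 'r, 'l, 'n) log_dieu set" where
  "DA_log_s p B = {A. log_dieudonne_algebra B A p \<and> dieu_torsion_free p A \<and> special p B A}"

definition DA_log_s_str :: "nat \<Rightarrow> ('r, 'n, 'y) fprelog_scheme \<Rightarrow> ('a, 'r, 'l, 'n) log_dieu set" where
  "DA_log_s_str p B = {A \<in> DA_log_s p B. strict p A}"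

definition log_dieu_hom ::
  "nat \<Rightarrow> ('r, 'n, 'x) prelog_scheme \<Rightarrow> ('a, 'r, 'l, 'n, 'y) log_dieu_scheme \<Rightarrow>
   ('b, 'r, 'k, 'n, 'z) log_dieu_scheme \<Rightarrow> (nat \<Rightarrow> 'a \<Rightarrow> 'b) \<Rightarrow> ('l \<Rightarrow> 'k) \<Rightarrow> bool" where
  "log_dieu_hom p B A A' f \<psi> \<longleftrightarrow> dieu_hom (pring B) A A' f \<and>
    \<psi> \<in> monoid_maps (lmon A) (lmon A') \<and>
    (\<forall>n \<in> carrier (pmon B). \<psi> (lnstr A n) = lnstr A' n) \<and>
    (\<forall>l \<in> carrier (lmon A). f 1 (dlog A l) = dlog A' (\<psi> l)) \<and>
    (\<forall>l \<in> carrier (lmon A).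
       red_class p (deg0 A') (f 0 (lalpha A l)) = red_class p (deg0 A') (lalpha A' (\<psi> l)))"

definition log_dieu_Hom ::
  "nat \<Rightarrow> ('r, 'n, 'x) prelog_scheme \<Rightarrow> ('a, 'r, 'l, 'n, 'y) log_dieu_scheme \<Rightarrow>
   ('b, 'r, 'k, 'n, 'z) log_dieu_scheme \<Rightarrow> ((nat \<Rightarrow> 'a \<Rightarrow> 'b) \<times> ('l \<Rightarrow> 'k)) set" where
  "log_dieu_Hom p B A A' = {(f, \<psi>). log_dieu_hom p B A A' f \<psi> \<and>
    (\<forall>i. f i \<in> extensional (carrier (gr A i))) \<and> \<psi> \<in> extensional (carrier (lmon A))}"

definition red_prelog ::
  "nat \<Rightarrow> ('a, 'r, 'l, 'n, 'z) log_dieu_scheme \<Rightarrow> ('a set, 'l) prelog" where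
  "red_prelog p A = \<lparr>pring = red_ring p (deg0 A), pmon = lmon A,
     palpha = (\<lambda>l. red_class p (deg0 A) (lalpha A l))\<rparr>"


section \<open>Saturation and strictification\<close>

text \<open>For \<open>M\<close> \<open>p\<close>-torsion free the saturation is the colimit of
  \<open>M \<rightarrow> \<eta>\<^sub>p M \<rightarrow> \<eta>\<^sub>p\<eta>\<^sub>p M \<rightarrow> \<dots>\<close> along the maps \<open>\<alpha>\<^sub>F = p\<^sup>i F\<close> (in degree \<open>i\<close>). The \<open>n\<close>-th term
  consists in degree \<open>i\<close> of the \<open>p\<^sup>n\<^sup>i y\<close> with \<open>y \<in> M\<^sup>i\<close> and \<open>d y \<in> p\<^sup>n M\<^sup>i\<^sup>+\<^sup>1\<close>. We store \<open>y\<close>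
  instead: then the transition maps become \<open>F\<close>, the product that of \<open>M\<close>, and the differential
  \<open>p\<^sup>-\<^sup>n d\<close>. An element of the colimit is the class of a pair \<open>(n, y)\<close>.\<close>

definition sat_stage :: "nat \<Rightarrow> ('a, 'r, 'z) dieu_scheme \<Rightarrow> nat \<Rightarrow> nat \<Rightarrow> 'a set" where
  "sat_stage p M i n = {y \<in> carrier (gr M i). dif M i y \<in> mults (p ^ n) (gr M (Suc i))}"

definition sat_class :: "nat \<Rightarrow> ('a, 'r, 'z) dieu_scheme \<Rightarrow> nat \<Rightarrow> nat \<times> 'a \<Rightarrow> (nat \<times> 'a) set" where
  "sat_class p M i = (\<lambda>(n, y). {(m, z). z \<in> sat_stage p M i m \<and>
     (\<exists>t \<ge> max m n. (frob M i ^^ (t - n)) y = (frob M i ^^ (t - m)) z)})"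

definition sat_gr :: "nat \<Rightarrow> ('a, 'r, 'z) dieu_scheme \<Rightarrow> nat \<Rightarrow> (nat \<times> 'a) set ring" where
  "sat_gr p M i =
    \<lparr>carrier = {sat_class p M i (n, y) | n y. y \<in> sat_stage p M i n},
     mult = undefined, one = undefined,
     zero = sat_class p M i (0, \<zero>\<^bsub>gr M i\<^esub>),
     add = (\<lambda>X Y. \<Union>{sat_class p M i (n, x \<oplus>\<^bsub>gr M i\<^esub> y) | n x y. (n, x) \<in> X \<and> (n, y) \<in> Y})\<rparr>"

definition saturation :: "nat \<Rightarrow> ('a, 'r, 'z) dieu_scheme \<Rightarrow> ((nat \<times> 'a) set, 'r) dieu" where
  "saturation p M =
    \<lparr>gr = sat_gr p M,
     gmul = (\<lambda>i j X Y. \<Union>{sat_class p M (i + j) (n, gmul M i j x y) | n x y. (n, x) \<in> X \<and> (n, y) \<in> Y}),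
     gone = sat_class p M 0 (0, gone M),
     dif = (\<lambda>i X. \<Union>{sat_class p M (Suc i)
         (n, THE z. z \<in> carrier (gr M (Suc i)) \<and> [(p ^ n)] \<cdot>\<^bsub>gr M (Suc i)\<^esub> z = dif M i y) | n y. (n, y) \<in> X}),
     rmap = (\<lambda>r. sat_class p M 0 (0, rmap M r)),
     frob = (\<lambda>i X. \<Union>{sat_class p M i (n, frob M i y) | n y. (n, y) \<in> X})\<rparr>"

definition cdga_lim ::
  "('a, 'r, 'z) cdga_scheme \<Rightarrow> (nat \<Rightarrow> nat \<Rightarrow> 'a set) \<Rightarrow> (nat \<Rightarrow> 'a set, 'r) cdga" where
  "cdga_lim C Fil =
    \<lparr>gr = (\<lambda>i. lim_ring (gr C i) (Fil i)),
     gmul = (\<lambda>i j x y r. coset_map2 (gr C (i + j)) (Fil (i + j) r) (gmul C i j) (x r) (y r)),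
     gone = to_lim (gr C 0) (Fil 0) (gone C),
     dif = (\<lambda>i x r. coset_map (gr C (Suc i)) (Fil (Suc i) r) (dif C i) (x r)),
     rmap = (\<lambda>r. to_lim (gr C 0) (Fil 0) (rmap C r))\<rparr>"

text \<open>\<open>F\<close> maps \<open>V\<^sup>r\<^sup>+\<^sup>1 M + d V\<^sup>r\<^sup>+\<^sup>1 M\<close> to \<open>V\<^sup>r M + d V\<^sup>r M\<close>.\<close>

definition strictification :: "nat \<Rightarrow> ('a, 'r, 'z) dieu_scheme \<Rightarrow> (nat \<Rightarrow> 'a set, 'r) dieu" where
  "strictification p M = cdga.extend (cdga_lim M (V_fil p M))
    (dieu.fields (\<lambda>i x r. coset_map (gr M i) (V_fil p M i r) (frob M i) (x (Suc r))))"

definition wsat_unit ::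
  "nat \<Rightarrow> ('a, 'r, 'z) dieu_scheme \<Rightarrow> nat \<Rightarrow> 'a \<Rightarrow> nat \<Rightarrow> (nat \<times> 'a) set set" where
  "wsat_unit p M i x =
    to_lim (gr (saturation p M) i) (V_fil p (saturation p M) i) (sat_class p M i (0, x))"

text \<open>\<open>WSat\<close> is the left adjoint of the inclusion of the strict objects, given by its
  construction; \<open>wsat_unit\<close> is the unit of the adjunction.\<close>

definition WSat ::
  "nat \<Rightarrow> ('a, 'r, 'l, 'n, 'z) log_dieu_scheme \<Rightarrow> (nat \<Rightarrow> (nat \<times> 'a) set set, 'r, 'l, 'n) log_dieu" where
  "WSat p M = dieu.extend (strictification p (saturation p M))
    (log_dieu.fields (lmon M) (\<lambda>l. wsat_unit p M 0 (lalpha M l)) (lnstr M)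
       (\<lambda>l. wsat_unit p M 1 (dlog M l)))"


section \<open>The log de Rham complex\<close>

text \<open>For a pre-log algebra \<open>A\<close> over \<open>S\<close>, \<open>\<omega>\<^sup>1\<close> is the \<open>pring A\<close>-module generated by symbols \<open>d b\<close>
  and \<open>dlog l\<close> (\<open>l\<close> in the monoid) with the usual relations, and \<open>\<omega>\<^sup>i\<close> is its \<open>i\<close>-th exterior
  power. As an abelian group, \<open>\<omega>\<^sup>i\<close> is generated by pairs \<open>(a, w)\<close> of a coefficient and a word
  of \<open>i\<close> symbols, standing for \<open>a w\<^sub>1 \<and> \<dots> \<and> w\<^sub>i\<close>.\<close>

datatype ('a, 'l) dsym = Dsym 'a | Lsym 'l

type_synonym ('a, 'l) form = "('a \<times> ('a, 'l) dsym list) \<Rightarrow>\<^sub>0 int"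

definition dsyms :: "('a, 'l, 'z) prelog_scheme \<Rightarrow> ('a, 'l) dsym set" where
  "dsyms A = Dsym ` carrier (pring A) \<union> Lsym ` carrier (pmon A)"

definition form_mult :: "('a, 'l, 'z) prelog_scheme \<Rightarrow> ('a, 'l) form \<Rightarrow> ('a, 'l) form \<Rightarrow> ('a, 'l) form" where
  "form_mult A x y =
    frag_extend (\<lambda>(a, w). frag_extend (\<lambda>(b, v). frag_of (a \<otimes>\<^bsub>pring A\<^esub> b, w @ v)) y) x"

definition form_dif :: "('a, 'l, 'z) prelog_scheme \<Rightarrow> ('a, 'l) form \<Rightarrow> ('a, 'l) form" where
  "form_dif A = frag_extend (\<lambda>(a, w). frag_of (\<one>\<^bsub>pring A\<^esub>, Dsym a # w))"

definition free_forms :: "('a, 'l, 'z) prelog_scheme \<Rightarrow> nat \<Rightarrow> ('a, 'l) form ring" where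
  "free_forms A i =
    \<lparr>carrier = {x. Poly_Mapping.keys x \<subseteq> carrier (pring A) \<times> {w. length w = i \<and> set w \<subseteq> dsyms A}},
     mult = form_mult A, one = frag_of (\<one>\<^bsub>pring A\<^esub>, []), zero = 0, add = (+)\<rparr>"

inductive_set form_rel ::
  "('s, 'n, 'y) prelog_scheme \<Rightarrow> ('a, 'l, 's, 'n, 'z) prelog_alg_scheme \<Rightarrow> nat \<Rightarrow> ('a, 'l) form set"
  for S :: "('s, 'n, 'y) prelog_scheme" and A :: "('a, 'l, 's, 'n, 'z) prelog_alg_scheme" and i :: nat
  where
    rel_zero: "0 \<in> form_rel S A i"
  | rel_diff: "\<lbrakk>x \<in> form_rel S A i; y \<in> form_rel S A i\<rbrakk> \<Longrightarrow> x - y \<in> form_rel S A i"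
  | rel_coeff: "\<lbrakk>a \<in> carrier (pring A); b \<in> carrier (pring A); set w \<subseteq> dsyms A; length w = i\<rbrakk> \<Longrightarrow>
      frag_of (a \<oplus>\<^bsub>pring A\<^esub> b, w) - (frag_of (a, w) + frag_of (b, w)) \<in> form_rel S A i"
  | rel_d_add: "\<lbrakk>a \<in> carrier (pring A); b \<in> carrier (pring A); c \<in> carrier (pring A);
        set u \<subseteq> dsyms A; set v \<subseteq> dsyms A; Suc (length u + length v) = i\<rbrakk> \<Longrightarrow>
      frag_of (a, u @ Dsym (b \<oplus>\<^bsub>pring A\<^esub> c) # v)
        - (frag_of (a, u @ Dsym b # v) + frag_of (a, u @ Dsym c # v)) \<in> form_rel S A i"
  | rel_d_mult: "\<lbrakk>a \<in> carrier (pring A); b \<in> carrier (pring A); c \<in> carrier (pring A);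
        set u \<subseteq> dsyms A; set v \<subseteq> dsyms A; Suc (length u + length v) = i\<rbrakk> \<Longrightarrow>
      frag_of (a, u @ Dsym (b \<otimes>\<^bsub>pring A\<^esub> c) # v)
        - (frag_of (a \<otimes>\<^bsub>pring A\<^esub> b, u @ Dsym c # v) + frag_of (a \<otimes>\<^bsub>pring A\<^esub> c, u @ Dsym b # v))
        \<in> form_rel S A i"
  | rel_d_base: "\<lbrakk>a \<in> carrier (pring A); s \<in> carrier (pring S);
        set u \<subseteq> dsyms A; set v \<subseteq> dsyms A; Suc (length u + length v) = i\<rbrakk> \<Longrightarrow>
      frag_of (a, u @ Dsym (rstr A s) # v) \<in> form_rel S A i"
  | rel_dlog_mult: "\<lbrakk>a \<in> carrier (pring A); l \<in> carrier (pmon A); m \<in> carrier (pmon A);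
        set u \<subseteq> dsyms A; set v \<subseteq> dsyms A; Suc (length u + length v) = i\<rbrakk> \<Longrightarrow>
      frag_of (a, u @ Lsym (l \<otimes>\<^bsub>pmon A\<^esub> m) # v)
        - (frag_of (a, u @ Lsym l # v) + frag_of (a, u @ Lsym m # v)) \<in> form_rel S A i"
  | rel_dlog_base: "\<lbrakk>a \<in> carrier (pring A); n \<in> carrier (pmon S);
        set u \<subseteq> dsyms A; set v \<subseteq> dsyms A; Suc (length u + length v) = i\<rbrakk> \<Longrightarrow>
      frag_of (a, u @ Lsym (nstr A n) # v) \<in> form_rel S A i"
  | rel_log: "\<lbrakk>a \<in> carrier (pring A); l \<in> carrier (pmon A);
        set u \<subseteq> dsyms A; set v \<subseteq> dsyms A; Suc (length u + length v) = i\<rbrakk> \<Longrightarrow>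
      frag_of (a, u @ Dsym (palpha A l) # v)
        - frag_of (a \<otimes>\<^bsub>pring A\<^esub> palpha A l, u @ Lsym l # v) \<in> form_rel S A i"
  | rel_square: "\<lbrakk>a \<in> carrier (pring A); s \<in> dsyms A;
        set u \<subseteq> dsyms A; set v \<subseteq> dsyms A; Suc (Suc (length u + length v)) = i\<rbrakk> \<Longrightarrow>
      frag_of (a, u @ s # s # v) \<in> form_rel S A i"
  | rel_swap: "\<lbrakk>a \<in> carrier (pring A); s \<in> dsyms A; t \<in> dsyms A;
        set u \<subseteq> dsyms A; set v \<subseteq> dsyms A; Suc (Suc (length u + length v)) = i\<rbrakk> \<Longrightarrow>
      frag_of (a, u @ s # t # v) + frag_of (a, u @ t # s # v) \<in> form_rel S A i"

definition form_class ::
  "('s, 'n, 'y) prelog_scheme \<Rightarrow> ('a, 'l, 's, 'n, 'z) prelog_alg_scheme \<Rightarrow>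
   nat \<Rightarrow> 'a \<times> ('a, 'l) dsym list \<Rightarrow> ('a, 'l) form set" where
  "form_class S A i g = form_rel S A i +>\<^bsub>free_forms A i\<^esub> frag_of g"

definition log_de_rham ::
  "('s, 'n, 'y) prelog_scheme \<Rightarrow> ('a, 'l, 's, 'n, 'z) prelog_alg_scheme \<Rightarrow> (('a, 'l) form set, 's) cdga" where
  "log_de_rham S A =
    \<lparr>gr = (\<lambda>i. free_forms A i Quot form_rel S A i),
     gmul = (\<lambda>i j. coset_map2 (free_forms A (i + j)) (form_rel S A (i + j)) (form_mult A)),
     gone = form_class S A 0 (\<one>\<^bsub>pring A\<^esub>, []),
     dif = (\<lambda>i. coset_map (free_forms A (Suc i)) (form_rel S A (Suc i)) (form_dif A)),
     rmap = (\<lambda>s. form_class S A 0 (rstr A s, []))\<rparr>"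

definition log_de_rham_hat ::
  "nat \<Rightarrow> ('s, 'n, 'y) prelog_scheme \<Rightarrow> ('a, 'l, 's, 'n, 'z) prelog_alg_scheme \<Rightarrow>
   (nat \<Rightarrow> ('a, 'l) form set set, 's) cdga" where
  "log_de_rham_hat p S A = (let C = log_de_rham S A in cdga_lim C (\<lambda>i. p_fil p (gr C i)))"

definition hat_class ::
  "nat \<Rightarrow> ('s, 'n, 'y) prelog_scheme \<Rightarrow> ('a, 'l, 's, 'n, 'z) prelog_alg_scheme \<Rightarrow>
   nat \<Rightarrow> 'a \<times> ('a, 'l) dsym list \<Rightarrow> nat \<Rightarrow> ('a, 'l) form set set" where
  "hat_class p S A i g = (let G = gr (log_de_rham S A) i in to_lim G (p_fil p G) (form_class S A i g))"

text \<open>The characterisation of the Frobenius of the completed complex: it extends the given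
  lift \<open>FA\<close>, and \<open>y\<close> plays the role of \<open>(F(x) - x\<^sup>p)/p\<close>.\<close>

definition is_log_frob ::
  "nat \<Rightarrow> ('s, 'n, 'y) prelog_scheme \<Rightarrow> ('a, 'l, 's, 'n, 'z) prelog_alg_scheme \<Rightarrow> ('a \<Rightarrow> 'a) \<Rightarrow>
   (nat \<Rightarrow> (nat \<Rightarrow> ('a, 'l) form set set) \<Rightarrow> nat \<Rightarrow> ('a, 'l) form set set) \<Rightarrow> bool" where
  "is_log_frob p S A FA F \<longleftrightarrow> (let C = log_de_rham_hat p S A in
    graded_ring_hom C C F \<and>
    (\<forall>i. F i \<in> extensional (carrier (gr C i))) \<and>
    (\<forall>a \<in> carrier (pring A). F 0 (hat_class p S A 0 (a, [])) = hat_class p S A 0 (FA a, [])) \<and>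
    (\<forall>x \<in> carrier (gr C 0). \<exists>y \<in> carrier (gr C 0).
       [p] \<cdot>\<^bsub>deg0 C\<^esub> y = F 0 x \<ominus>\<^bsub>deg0 C\<^esub> x [^]\<^bsub>deg0 C\<^esub> p \<and>
       F 1 (dif C 0 x) =
         gmul C 0 1 (x [^]\<^bsub>deg0 C\<^esub> (p - 1)) (dif C 0 x) \<oplus>\<^bsub>gr C 1\<^esub> dif C 0 y) \<and>
    (\<forall>l \<in> carrier (pmon A). F 1 (hat_class p S A 1 (\<one>\<^bsub>pring A\<^esub>, [Lsym l]))
       = hat_class p S A 1 (\<one>\<^bsub>pring A\<^esub>, [Lsym l])))"

definition Omega_hat ::
  "nat \<Rightarrow> ('s, 'n, 'y) prelog_scheme \<Rightarrow> ('a, 'l, 's, 'n, 'z) prelog_alg_scheme \<Rightarrow> ('a \<Rightarrow> 'a) \<Rightarrow>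
   (nat \<Rightarrow> ('a, 'l) form set set, 's, 'l, 'n) log_dieu" where
  "Omega_hat p S A FA = dieu.extend
    (cdga.extend (log_de_rham_hat p S A) (dieu.fields (THE F. is_log_frob p S A FA F)))
    (log_dieu.fields (pmon A) (\<lambda>l. hat_class p S A 0 (palpha A l, [])) (nstr A)
       (\<lambda>l. hat_class p S A 1 (\<one>\<^bsub>pring A\<^esub>, [Lsym l])))"


section \<open>The saturated log de Rham--Witt complex of a free pre-log algebra\<close>

abbreviation Omega_std where
  "Omega_std p B P \<equiv> Omega_hat p B (std_lift p B P) (std_frob p B P)"

definition W_obj where
  "W_obj p B P = WSat p (Omega_std p B P)"

definition W_unit where
  "W_unit p B P = wsat_unit p (Omega_std p B P)"

text \<open>The identification of \<open>P\<^sub>0\<close> with \<open>(P/p)\<^sub>r\<^sub>e\<^sub>d\<close>: lift the coefficients to \<open>R\<close>, pass to the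
  \<open>p\<close>-completion and take the class.\<close>

definition std_ident where
  "std_ident p B P g = (let A = pring (lpoly_obj B P) in
    the_elem ((\<lambda>h. red_class p (pring (std_lift p B P)) (to_lim A (p_fil p A) h)) `
      {h \<in> carrier A. (\<lambda>M. red_class p (pring B) (h M)) = g}))"

text \<open>The reduction of the unit in degree 0, \<open>P\<^sub>0 = (P/p)\<^sub>r\<^sub>e\<^sub>d \<rightarrow> (W\<^sup>0/p)\<^sub>r\<^sub>e\<^sub>d\<close>. Its monoid
  component is the identity.\<close>

definition e_ring where
  "e_ring p B P g = coset_map (deg0 (W_obj p B P)) (rad p (deg0 (W_obj p B P)))
    (\<lambda>x. W_unit p B P 0 (hat_class p B (std_lift p B P) 0 (x, []))) (std_ident p B P g)"

definition lifts_mor where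
  "lifts_mor p B P Q = (\<lambda>(u, \<chi>) (f, \<psi>).
    (\<forall>x \<in> carrier (pring (lpoly_obj (base_red p B) P)).
       coset_map (deg0 (W_obj p B Q)) (rad p (deg0 (W_obj p B Q))) (f 0) (e_ring p B P x)
         = e_ring p B Q (u x)) \<and>
    (\<forall>l \<in> carrier (pmon (lpoly_obj (base_red p B) P)). \<psi> l = \<chi> l))"

definition W_mor where
  "W_mor p B P Q u = (THE g. g \<in> log_dieu_Hom p B (W_obj p B P) (W_obj p B Q) \<and> lifts_mor p B P Q u g)"

definition WOmega where
  "WOmega p B P = dieu.truncate (W_obj p B P)"

definition WOmega_mor where
  "WOmega_mor p B P Q u = fst (W_mor p B P Q u)"

end

(* In a strict Dieudonne algebra the radical of p E^0 is V E^0, and a residue class modulo V E^0 has a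
unique lift t with F t = t^p. So a morphism out of WSat of the standard lift must send each variable to
the lift of its prescribed residue class; sending the variables there commutes with Frobenius and
extends over completion, saturation and strictification. The completed log de Rham complex is
p-torsion free because contraction with the dual log derivations reads off coefficients of forms. *)
theory Submission
  imports Defs "HOL-Algebra.Free_Abelian_Groups"
begin

text \<open>Two obstacles shape the argument. A variable Y_j may be sent to a monoid element whose
  constant part has a nontrivial factor in N2. Then alpha of that element is divisible by p, its
  residue class is 0 and so is the Teichmueller lift, whereas alpha itself is in general neither 0
  nor a Teichmueller element. Hence morphisms can respect alpha only after reduction. What log forms
  need is the equation dt = t dlog; it holds for N1, where alpha is its own Teichmueller lift, and
  trivially for t = 0. This is the use of the decomposition of N. The other obstacle is torsion.
  Frobenius on one-forms is dF divided by p, so torsion-freeness comes before F exists at all. The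
  one-forms of the completed polynomial ring are generated by dX_i and dlog Y_j only modulo each
  p^n, so divisibility by p^n is decided for each n separately, and the completion assembles the
  answers. Functoriality is free: identities and composites satisfy the condition that determines a
  morphism uniquely.\<close>

abbreviation in_car ("(_ :[_])" [51, 0] 50) where "x :[G] \<equiv> x \<in> carrier G"
abbreviation add_in ("(_ +[_] _)" [65, 0, 66] 65) where "x +[G] y \<equiv> x \<oplus>\<^bsub>G\<^esub> y"
abbreviation minus_in ("(_ -[_] _)" [65, 0, 66] 65) where "x -[G] y \<equiv> x \<ominus>\<^bsub>G\<^esub> y"
abbreviation neg_in ("(-[_] _)" [0, 81] 80) where "-[G] x \<equiv> \<ominus>\<^bsub>G\<^esub> x"
abbreviation mult_in ("(_ *[_] _)" [70, 0, 71] 70) where "x *[G] y \<equiv> x \<otimes>\<^bsub>G\<^esub> y"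
abbreviation zero_in ("0[_]") where "0[G] \<equiv> \<zero>\<^bsub>G\<^esub>"
abbreviation one_in ("1[_]") where "1[G] \<equiv> \<one>\<^bsub>G\<^esub>"
abbreviation nmul_in ("(_ .[_] _)" [81, 0, 81] 80) where "n .[G] x \<equiv> [n] \<cdot>\<^bsub>G\<^esub> x"
abbreviation pow_in ("(_ [^][_] _)" [75, 0, 75] 75) where "x [^][G] n \<equiv> x [^]\<^bsub>G\<^esub> n"
abbreviation rcos_in ("(_ +>[_] _)" [66, 0, 67] 66) where "H +>[G] x \<equiv> H +>\<^bsub>G\<^esub> x"
abbreviation set_add_in ("(_ <+>[_] _)" [60, 0, 61] 60) where "H <+>[G] K \<equiv> H <+>\<^bsub>G\<^esub> K"
abbreviation asub where "asub \<equiv> additive_subgroup"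
abbreviation frg where "frg \<equiv> frag_of"
abbreviation lob where "lob \<equiv> lpoly_obj"
abbreviation mpr where "mpr \<equiv> mpoly_ring"
abbreviation rdr where "rdr \<equiv> red_ring"
abbreviation rcl where "rcl \<equiv> red_class"
abbreviation pr where "pr \<equiv> pring"
abbreviation rhom where "rhom \<equiv> ring_hom"


lemmas sub_zero = additive_subgroup.zero_closed and sub_plus = additive_subgroup.a_closed and rh_cl = ring_hom_closed and rh_mul = ring_hom_mult and rh_one = ring_hom_one and rh_add = ring_hom_add and grh_def = graded_ring_hom_def and mm_def = monoid_maps_def and idl_r = ideal.I_r_closed

section \<open>Abelian groups\<close>

abbreviation ahom :: "('a, 'm) ring_scheme => ('b, 'n) ring_scheme => ('a => 'b) set" where
 "ahom G H \<equiv> hom (add_monoid G) (add_monoid H)"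

context abelian_group
begin

lemma neg_0 [simp]: "\<ominus> \<zero>=\<zero>" using r_neg[OF zero_closed] by simp

text \<open>Registers the additive laws alone with \<open>algebra\<close>. The graded pieces are
  ring records whose multiplication carries no information, so identities in them have to be
  normalised as identities of abelian groups.\<close>

lemmas abelian_grp_simprules
 [algebra add: abelian_group "ring.zero G" "ring.add G" "a_inv G" "a_minus G"] =
 a_closed zero_closed a_inv_closed minus_closed
 a_assoc l_zero l_neg a_comm minus_eq
 r_zero r_neg r_neg2 r_neg1 minus_add minus_minus neg_0 a_lcomm

lemma nm_cl [simp, intro]: "x:[G]==>[n] \<cdot> x:[G]" for n :: nat by (rule add.nat_pow_closed)
lemma nm_0 [simp]: "[(0::nat)] \<cdot> x=\<zero>" by (rule add.nat_pow_0)
lemma nm_Suc: "[Suc n] \<cdot> x=[n] \<cdot> x \<oplus> x" by (rule add.nat_pow_Suc)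
lemma nm_1 [simp]: "x:[G]==>[Suc 0] \<cdot> x=x" by (simp add: nm_Suc)
lemma nm_add: "x:[G]==>[(m + n)] \<cdot> x=[m] \<cdot> x \<oplus> [n] \<cdot> x" for m n :: nat by (simp add: add.nat_pow_mult)
lemma nmul_zero [simp]: "[n] \<cdot> \<zero>=\<zero>" for n :: nat by (rule add.nat_pow_one)
lemma nm_nm: "x:[G]==>[m] \<cdot> ([n] \<cdot> x)=[(m * n)] \<cdot> x" for m n :: nat by (simp add: add.nat_pow_pow mult.commute)
lemma nm_dist: "x:[G]==>y:[G]==>[n] \<cdot> (x \<oplus> y)=[n] \<cdot> x \<oplus> [n] \<cdot> y" for n :: nat by (rule add.nat_pow_distrib)
lemma nm_neg: "x:[G]==>[n] \<cdot> (\<ominus> x)=\<ominus> ([n] \<cdot> x)" for n :: nat by (induction n) (simp_all add: nm_Suc minus_add a_comm neg_0)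
lemma nm_sub: "x:[G]==>y:[G]==>[n] \<cdot> (x \<ominus> y)=[n] \<cdot> x \<ominus> [n] \<cdot> y" for n :: nat by (simp add: minus_eq nm_dist nm_neg)
lemma add_minus_cancel: "x:[G]==>y:[G]==>x \<oplus> (y \<ominus> x)=y" by algebra
lemma sub_self [simp]: "x:[G]==>x \<ominus> x=\<zero>" by (simp add: minus_eq r_neg)
lemma sub_0_iff: "x:[G]==>y:[G]==>x \<ominus> y=\<zero> \<longleftrightarrow> x=y" by (metis add_minus_cancel sub_self r_zero)
lemma sub_0_right [simp]: "x:[G]==>x \<ominus> \<zero>=x" by (simp add: minus_eq)

lemma nm_inj:
 assumes "torsion_free p G" "x:[G]" "y:[G]" "[p] \<cdot> x=[p] \<cdot> y"
 shows "x=y"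
proof -
 have "[p] \<cdot> (x \<ominus> y)=\<zero>" using assms by (simp add: nm_sub)
 thus ?thesis using assms unfolding torsion_free_def by (metis sub_0_iff minus_closed)
qed

lemma tf_power:
 assumes "torsion_free p G" shows "torsion_free (p ^ n) G"
proof (induction n)
 case 0 thus ?case by (simp add: torsion_free_def)
next
 case (Suc n)
 show ?case unfolding torsion_free_def
 proof (intro ballI impI)
  fix x assume x: "x:[G]" and z: "[(p ^ Suc n)] \<cdot> x=\<zero>"
  have "[p] \<cdot> ([(p ^ n)] \<cdot> x)=\<zero>" using x z by (simp add: nm_nm)
  hence "[(p ^ n)] \<cdot> x=\<zero>" using assms x unfolding torsion_free_def by blast
  thus "x=\<zero>" using Suc.IH x unfolding torsion_free_def by blast
 qed
qed

lemma subgroupI: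
 assumes "H <= carrier G" "\<zero> : H" "!!x y. x : H==>y : H==>x \<ominus> y : H"
 shows "asub H G"
proof (rule additive_subgroupI, rule group.subgroupI[OF a_group])
 show "H <= carrier (add_monoid G)" "H ~= {}" using assms by auto
 have neg: "\<ominus> y : H" if "y : H" for y using assms(3)[OF assms(2) that] that assms(1) by (simp add: minus_eq subset_iff)
 thus "!!a. a : H==>inv\<^bsub>add_monoid G\<^esub> a : H" by (simp add: a_inv_def)
 fix a b assume ab: "a : H" "b : H"
 have "a \<ominus> (\<ominus> b) : H" using neg[OF ab(2)] ab assms(3) by auto
 thus "a *[add_monoid G]b : H" using ab assms(1) by (simp add: minus_eq subset_iff)
qed

lemma sub_car: "x : H==>asub H G==>x:[G]" by (rule additive_subgroup.a_Hcarr)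
lemma sub_sub: "asub H G==>x : H==>y : H==>x \<ominus> y : H" by (simp add: minus_eq sub_plus additive_subgroup.a_inv_closed)
lemma sub_nm: "asub H G==>x : H==>[n] \<cdot> x : H" for n :: nat by (induction n) (simp_all add: nm_Suc sub_plus sub_zero)

lemma sub_sub_cm:
 assumes "asub H G" "x:[G]" "y:[G]" "x \<ominus> y : H" shows "y \<ominus> x : H"
proof -
 have "\<ominus> (x \<ominus> y)=y \<ominus> x" using assms by algebra
 thus ?thesis using additive_subgroup.a_inv_closed[OF assms(1,4)] by simp
qed

lemma sub_sub_tr:
 assumes "asub H G" "x:[G]" "y:[G]" "z:[G]"
  "x \<ominus> y : H" "y \<ominus> z : H" shows "x \<ominus> z : H"
proof -
 have "(x \<ominus> y) \<oplus> (y \<ominus> z)=x \<ominus> z" using assms(2-4) by algebra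
 thus ?thesis using sub_plus[OF assms(1,5,6)] by simp
qed

lemma sub_sub_add:
 assumes "asub H G" "x:[G]" "y:[G]" "x':[G]" "y':[G]"
  "x \<ominus> x' : H" "y \<ominus> y' : H" shows "(x \<oplus> y) \<ominus> (x' \<oplus> y') : H"
proof -
 have "(x \<ominus> x') \<oplus> (y \<ominus> y')=(x \<oplus> y) \<ominus> (x' \<oplus> y')" using assms(2-5) by algebra
 thus ?thesis using sub_plus[OF assms(1,6,7)] by simp
qed

lemma sub_mem_cg:
 assumes "asub H G" "x:[G]" "y:[G]" "x \<ominus> y : H"
 shows "x : H \<longleftrightarrow> y : H"
proof -
 have e: "x=(x \<ominus> y) \<oplus> y" "y=x \<ominus> (x \<ominus> y)" using assms(2,3) by algebra+
 show ?thesis using e sub_plus[OF assms(1,4)] sub_sub[OF assms(1) _ assms(4)] by metis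
qed

lemma cos_mem:
 assumes "asub H G" "x:[G]"
 shows "z : H +> x \<longleftrightarrow> z:[G] & z \<ominus> x : H"
proof -
 interpret abelian_subgroup H G by (rule abelian_subgroupI3[OF assms(1) abelian_group_axioms])
 show ?thesis using a_rcos_module[OF assms(2)] a_elemrcos_carrier[OF assms(2)] by (auto simp: minus_eq)
qed

lemma cos_self: "asub H G==>x:[G]==>x : H +> x" by (simp add: cos_mem sub_zero)

lemma cos_eq_iff:
 assumes "asub H G" "x:[G]" "y:[G]"
 shows "H +> x=H +> y \<longleftrightarrow> x \<ominus> y : H"
proof
 assume "H +> x=H +> y"
 hence "x : H +> y" using cos_self[OF assms(1,2)] by simp
 thus "x \<ominus> y : H" by (simp add: cos_mem assms)
next
 assume d: "x \<ominus> y : H"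
 have d': "y \<ominus> x : H" by (rule sub_sub_cm[OF assms(1-3) d])
 show "H +> x=H +> y"
 proof (rule Set.set_eqI)
  fix z show "z : H +> x \<longleftrightarrow> z : H +> y" using sub_sub_tr[OF assms(1) _ assms(2,3) _ d, of z]
    sub_sub_tr[OF assms(1) _ assms(3,2) _ d', of z] unfolding cos_mem[OF assms(1,2)] cos_mem[OF assms(1,3)] by blast
 qed
qed

lemma cos_eqI:
 assumes "asub H G" "x:[G]" "y:[G]" "x \<ominus> y : H"
 shows "H +> x=H +> y" using assms by (simp add: cos_eq_iff)

lemma cos_0: "asub H G==>H +> \<zero>=H" using sub_car[of _ H] by (auto simp: cos_mem)
lemma cos_eq_self: "asub H G==>x:[G]==>H +> x=H \<longleftrightarrow> x : H" using cos_eq_iff[of H x \<zero>] by (simp add: cos_0)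

lemma coset_add:
 assumes "asub H G" "x:[G]" "y:[G]"
 shows "(H +> x) <+> (H +> y)=H +> (x \<oplus> y)" using abelian_subgroup.a_rcos_sum[OF abelian_subgroupI3[OF assms(1) abelian_group_axioms]] assms by simp

lemma quot_car: "X:[G Quot H] \<longleftrightarrow> (\<exists>x\<in>carrier G. X=H +> x)" by (auto simp: FactRing_def A_RCOSETS_def')

text \<open>\<open>coset_map\<close> takes a union over all representatives; once every
  representative yields the same coset, the union collapses to it. Well-definedness of a map on a
  quotient is thus checked once, as the last hypothesis here.\<close>

lemma cos_map_cos:
 assumes "asub K G" "x:[G]"
  and "!!z. z:[G]==>z \<ominus> x : K==>H +>[E] f z=H +>[E] f x"
 shows "coset_map E H f (K +> x)=H +>[E] f x"
proof -
 have "coset_map E H f (K +> x)=(\<Union>z\<in>K +> x. H +>[E] f x)" unfolding coset_map_def by (rule SUP_cong) (use assms in \<open>simp_all add: cos_mem\<close>)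
 thus ?thesis using cos_self[OF assms(1,2)] by auto
qed

end

lemma quot_s [simp]:
 "0[G Quot H]=H" "1[G Quot H]=H +>[G] 1[G]" "X +[G Quot H]Y=X <+>[G] Y"
 "X *[G Quot H]Y=[mod H:] X \<Otimes>\<^bsub>G\<^esub> Y" by (simp_all add: FactRing_def)

lemma cos_map2_cos:
 assumes "abelian_group G" "asub K G" "x:[G]"
  and "abelian_group G'" "asub K' G'" "y:[G']"
  and "!!z w. z:[G]==>z -[G]x : K==>w:[G']==>w -[G']y : K'
   ==>H +>[E] f z w=H +>[E] f x y"
 shows "coset_map2 E H f (K +>[G] x) (K' +>[G'] y)=H +>[E] f x y"
proof -
 have a: "!!z. z : K +>[G] x \<longleftrightarrow> z:[G] & z -[G]x : K" by (rule abelian_group.cos_mem[OF assms(1-3)])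
 have b: "!!z. z : K' +>[G'] y \<longleftrightarrow> z:[G'] & z -[G']y : K'" by (rule abelian_group.cos_mem[OF assms(4-6)])
 have "x : K +>[G] x" "y : K' +>[G'] y" by (rule abelian_group.cos_self[OF assms(1-3)], rule abelian_group.cos_self[OF assms(4-6)])
 moreover have "coset_map2 E H f (K +>[G] x) (K' +>[G'] y) =
   (\<Union>z\<in>K +>[G] x. \<Union>w\<in>K' +>[G'] y. H +>[E] f x y)" unfolding coset_map2_def
 proof (rule SUP_cong[OF refl], rule SUP_cong[OF refl])
  fix z w assume zw: "z : K +>[G] x" "w : K' +>[G'] y"
  show "H +>[E] f z w=H +>[E] f x y" using zw[unfolded a b] assms(7) by blast
 qed
 ultimately show ?thesis by auto
qed

lemma abelian_grp_quot:
 assumes "abelian_group G" "asub H G"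
 shows "abelian_group (G Quot H)"
proof -
 interpret abelian_group G by fact
 interpret H: additive_subgroup H G by fact
 show ?thesis
 proof (rule abelian_groupI)
  fix x assume "x:[G Quot H]"
  then obtain a where a: "a:[G]" "x=H +>[G] a" by (auto simp: quot_car)
  have "H +>[G] (-[G] a):[G Quot H]" using a by (auto simp: quot_car)
  moreover have "(H +>[G] (-[G] a)) +[G Quot H]x=0[G Quot H]" using a assms by (simp add: coset_add l_neg cos_0)
  ultimately show "\<exists>y\<in>carrier (G Quot H). y +[G Quot H]x=0[G Quot H]" by blast
 next
  have "H +>[G] 0[G]:[G Quot H]" by (auto simp: quot_car)
  thus "0[G Quot H]:[G Quot H]" by (simp add: cos_0 assms)
 next
  fix x assume "x:[G Quot H]"
  then obtain a where a: "a:[G]" "x=H +>[G] a" by (auto simp: quot_car)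
  show "0[G Quot H] +[G Quot H]x=x" using coset_add[OF assms(2) zero_closed a(1)] a by (simp add: cos_0 assms)
 qed (auto simp: quot_car coset_add assms a_ac)
qed

lemma quot_hom: "abelian_group G==>asub H G==>(%x. H +>[G] x) : ahom G (G Quot H)" by (auto simp: hom_def abelian_group.quot_car abelian_group.coset_add)

lemma ahI:
 "(!!x. x:[G]==>h x:[H]) ==>
  (!!x y. x:[G]==>y:[G]==>h (x +[G]y)=h x +[H]h y)==>h : ahom G H" by (auto simp: hom_def)

lemma ah_cl: "h : ahom G H==>x:[G]==>h x:[H]" by (auto simp: hom_def)
lemma ah_add: "h : ahom G H==>x:[G]==>y:[G]==>h (x +[G]y)=h x +[H]h y" by (auto simp: hom_def)
lemma ah_comp: "h : ahom G H==>k : ahom H K==>(%x. k (h x)) : ahom G K" by (auto simp: hom_def Pi_iff)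

locale gpair = G: abelian_group G + H: abelian_group H
 for G :: "('a, 'm) ring_scheme" and H :: "('b, 'n) ring_scheme"
begin

lemma ah_0: assumes "h : ahom G H" shows "h 0[G]=0[H]"
proof -
 have "h 0[G] +[H]h 0[G]=h 0[G] +[H]0[H]" using ah_add[OF assms, of "0[G]" "0[G]"] ah_cl[OF assms G.zero_closed] by simp
 thus ?thesis using ah_cl[OF assms G.zero_closed] by (metis H.add.l_cancel_one H.r_zero)
qed

lemma ah_neg: assumes "h : ahom G H" "x:[G]" shows "h (-[G] x)=-[H]h x"
proof -
 have "h (-[G] x) +[H]h x=0[H]" using ah_add[OF assms(1), of "-[G] x" x] assms by (simp add: G.l_neg ah_0)
 thus ?thesis using ah_cl[OF assms(1)] assms(2) by (metis G.a_inv_closed H.minus_equality)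
qed

lemma ah_sub:
 "h : ahom G H==>x:[G]==>y:[G]==>h (x -[G]y)=h x -[H]h y" by (simp add: G.minus_eq H.minus_eq ah_add ah_neg)

lemma ah_nm: "h : ahom G H==>x:[G]==>h (n .[G] x)=n .[H] h x" for n :: nat by (induction n) (simp_all add: ah_0 ah_add G.nm_Suc H.nm_Suc)
lemma ah_muls: assumes "h : ahom G H" "x : mults n G" shows "h x : mults n H" using assms by (auto simp: mults_def ah_nm ah_cl)
lemma ah_kernel: "h : ahom G H==>asub K H==>asub {x : carrier G. h x : K} G" by (intro G.subgroupI) (auto simp: ah_0 ah_sub H.sub_sub sub_zero)

lemma ah_img: assumes "h : ahom G H" "asub K G" shows "asub (h ` K) H"
proof -
 have K: "K <= carrier G" "0[G] : K" using assms(2) by (auto simp: additive_subgroup.a_subset sub_zero)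
 show ?thesis
 proof (rule H.subgroupI)
  show "h ` K <= carrier H" using K ah_cl[OF assms(1)] by auto
  show "0[H] : h ` K" using K ah_0[OF assms(1)] by force
  fix x y assume "x : h ` K" "y : h ` K"
  then obtain a b where "a : K" "b : K" "x=h a" "y=h b" by auto
  thus "x -[H]y : h ` K" using K ah_sub[OF assms(1), of a b] G.sub_sub[OF assms(2)] by (metis image_eqI subsetD)
 qed
qed

end

lemmas gpairI = gpair.intro

context abelian_group
begin

lemma nm_ah: "(%x. [n] \<cdot> x) : ahom G G" for n :: nat by (intro ahI) (auto simp: nm_dist)
lemma muls_mem: "x:[G]==>[n] \<cdot> x : mults n G" by (auto simp: mults_def)
lemma muls_car: "x : mults n G==>x:[G]" by (auto simp: mults_def)

lemma muls_sub: "asub (mults n G) G"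
proof -
 interpret gpair G G by unfold_locales
 have "asub (carrier G) G" by (rule subgroupI) auto
 thus ?thesis unfolding mults_def using ah_img nm_ah by blast
qed

lemma muls_dvd: assumes "m dvd n" shows "mults n G <= mults m G"
proof -
 obtain k where k: "n=m * k" using assms by blast
 have "[n] \<cdot> x : mults m G" if "x:[G]" for x using that muls_mem[of "[k] \<cdot> x" m] by (simp add: nm_nm k)
 thus ?thesis by (auto simp: mults_def)
qed

lemma muls_nm: "x : mults m G==>[n] \<cdot> x : mults (n * m) G" by (auto simp: mults_def nm_nm)

lemma muls_can:
 assumes "torsion_free q G" "x:[G]" "[q] \<cdot> x : mults (q * m) G" shows "x : mults m G"
proof -
 obtain y where y: "y:[G]" "[q] \<cdot> x=[(q * m)] \<cdot> y" using assms by (auto simp: mults_def)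
 hence "[q] \<cdot> x=[q] \<cdot> ([m] \<cdot> y)" by (simp add: nm_nm)
 hence "x=[m] \<cdot> y" using nm_inj[OF assms(1,2)] y by auto
 thus ?thesis using y by (auto simp: mults_def)
qed

end

section \<open>Filtered groups and their completions\<close>

text \<open>Coherent sequences of representatives in \<open>G\<close>. A point of the completion is
  a sequence of cosets; computing with representatives turns the operations on it into termwise
  operations, at the price of checking coherence.\<close>

definition chr :: "('a, 'm) ring_scheme => (nat => 'a set) => (nat => 'a) => bool" where
 "chr G Fil m \<longleftrightarrow> (\<forall>r. m r:[G] & m (Suc r) -[G]m r : Fil r)"

definition lim_of :: "('a, 'm) ring_scheme => (nat => 'a set) => (nat => 'a) => nat => 'a set" where
 "lim_of G Fil m=(%r. Fil r +>[G] m r)"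

text \<open>The kernel of the projection to the \<open>r\<close>-th quotient, that is, the
  filtration which the completion inherits.\<close>

definition lim_fil :: "('a, 'm) ring_scheme => (nat => 'a set) => nat => (nat => 'a set) set" where
 "lim_fil G Fil r={x : carrier (lim_ring G Fil). x r=Fil r}"

locale filg = abelian_group G for G :: "('a, 'm) ring_scheme" (structure) +
 fixes Fil :: "nat => 'a set"
 assumes Fil_sub: "asub (Fil r) G"
  and Fil_Suc: "Fil (Suc r) <= Fil r"
begin

abbreviation "L \<equiv> lim_ring G Fil"

lemma Fil_mono: "r <= s==>Fil s <= Fil r" using Fil_Suc by (rule lift_Suc_antimono_le)
lemma Fil_car: "x : Fil r==>x:[G]" using Fil_sub[of r] by (auto dest: additive_subgroup.a_subset)
lemma Fil_0: "\<zero> : Fil r" using Fil_sub by (rule sub_zero)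
lemma coh_car: "chr G Fil m==>m r:[G]" by (simp add: chr_def)

lemma coh_le:
 assumes "chr G Fil m" "r <= s" shows "m s \<ominus> m r : Fil r" using assms(2)
proof (induction s rule: dec_induct)
 case base
 thus ?case using coh_car[OF assms(1)] Fil_0 by simp
next
 case (step n)
 have "m (Suc n) \<ominus> m n : Fil r" using assms(1) Fil_mono[OF step.hyps(1)] by (auto simp: chr_def)
 thus ?case using step.IH coh_car[OF assms(1)] Fil_sub sub_sub_tr by metis
qed

lemma chr_const: "x:[G]==>chr G Fil (%_. x)" by (simp add: chr_def Fil_0)
lemma coh_add: "chr G Fil m==>chr G Fil m'==>chr G Fil (%r. m r \<oplus> m' r)" unfolding chr_def using Fil_sub sub_sub_add by auto

lemma coh_neg: assumes "chr G Fil m" shows "chr G Fil (%r. \<ominus> m r)"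
proof -
 have "\<ominus> m (Suc r) \<ominus> \<ominus> m r=m r \<ominus> m (Suc r)" for r using assms unfolding chr_def by (simp add: minus_eq a_comm)
 thus ?thesis using assms Fil_sub sub_sub_cm unfolding chr_def by auto
qed

lemma lim_of_carrier: assumes "chr G Fil m" shows "lim_of G Fil m:[L]"
proof -
 have "Fil (Suc r) +> m (Suc r) <= Fil r +> m r" for r using assms Fil_Suc[of r] Fil_sub by (auto simp: chr_def cos_mem) (meson sub_sub_tr subsetD)
 thus ?thesis using assms by (auto simp: lim_ring_def lim_of_def quot_car chr_def)
qed

lemma lim_car: "x:[L] \<longleftrightarrow> (\<exists>m. chr G Fil m & x=lim_of G Fil m)"
proof
 assume x: "x:[L]"
 hence "\<forall>r. \<exists>a\<in>carrier G. x r=Fil r +> a" by (auto simp: lim_ring_def quot_car)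
 then obtain m where m: "!!r. m r:[G]" "!!r. x r=Fil r +> m r" by metis
 have "m (Suc r) : Fil r +> m r" for r using x m cos_self[OF Fil_sub m(1), of "Suc r" "Suc r"] by (auto simp: lim_ring_def)
 hence "chr G Fil m" using m by (simp add: chr_def cos_mem Fil_sub)
 thus "\<exists>m. chr G Fil m & x=lim_of G Fil m" using m(2) by (auto simp: lim_of_def)
qed (auto intro: lim_of_carrier)

lemma lim_cs:
 assumes "x:[L]" obtains m where "chr G Fil m" "x=lim_of G Fil m" using assms by (auto simp: lim_car)

lemma lim_eq_iff:
 assumes "!!r. m r:[G]" "!!r. m' r:[G]"
 shows "lim_of G Fil m=lim_of G Fil m' \<longleftrightarrow> (\<forall>r. m r \<ominus> m' r : Fil r)" using assms by (auto simp: lim_of_def fun_eq_iff cos_eq_iff Fil_sub)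

lemma lim_add:
 "(!!r. m r:[G])==>(!!r. m' r:[G]) ==>
  lim_of G Fil m +[L]lim_of G Fil m'=lim_of G Fil (%r. m r \<oplus> m' r)" by (simp add: lim_ring_def lim_of_def coset_add Fil_sub)

lemma lim_0: "0[L]=lim_of G Fil (%_. \<zero>)" by (simp add: lim_ring_def lim_of_def cos_0 Fil_sub)
lemma to_lim_eq: "to_lim G Fil x=lim_of G Fil (%_. x)" by (simp add: to_lim_def lim_of_def)

lemma lim_grp: "abelian_group L"
proof (rule abelian_groupI)
 fix x y assume "x:[L]" "y:[L]"
 then obtain m n where mn: "chr G Fil m" "x=lim_of G Fil m" "chr G Fil n" "y=lim_of G Fil n" by (auto simp: lim_car)
 show "x +[L]y:[L]" using mn by (simp add: lim_add coh_car lim_of_carrier coh_add)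
 show "x +[L]y=y +[L]x" using mn by (simp add: lim_add coh_car a_comm)
 fix z assume "z:[L]"
 then obtain k where "chr G Fil k" "z=lim_of G Fil k" by (auto simp: lim_car)
 thus "x +[L]y +[L]z=x +[L](y +[L]z)" using mn by (simp add: lim_add coh_car a_assoc)
next
 show "0[L]:[L]" by (simp add: lim_0 lim_of_carrier chr_const)
next
 fix x assume "x:[L]"
 then obtain m where m: "chr G Fil m" "x=lim_of G Fil m" by (auto simp: lim_car)
 show "0[L] +[L]x=x" using m by (simp add: lim_add coh_car lim_0)
 have "lim_of G Fil (%r. \<ominus> m r) +[L]x=0[L]" using m by (simp add: lim_add coh_car lim_0 l_neg)
 thus "\<exists>y\<in>carrier L. y +[L]x=0[L]" using m lim_of_carrier coh_neg by blast
qed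

sublocale lim: abelian_group L by (rule lim_grp)

lemma lim_neg:
 assumes "chr G Fil m" shows "-[L] lim_of G Fil m=lim_of G Fil (%r. \<ominus> m r)"
proof (rule lim.minus_equality)
 show "lim_of G Fil (%r. \<ominus> m r) +[L]lim_of G Fil m=0[L]" using assms by (simp add: lim_add coh_car lim_0 l_neg)
qed (use assms in \<open>auto intro: lim_of_carrier coh_neg\<close>)

lemma lim_sub:
 "chr G Fil m==>chr G Fil m' ==>
  lim_of G Fil m -[L]lim_of G Fil m'=lim_of G Fil (%r. m r \<ominus> m' r)" by (simp add: lim.minus_eq minus_eq lim_neg lim_add coh_car)

lemma to_lim_hom: "to_lim G Fil : ahom G L" by (rule ahI) (simp_all add: to_lim_eq lim_of_carrier chr_const lim_add)

lemma coh_nm: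
 fixes n :: nat
 assumes "chr G Fil m" shows "chr G Fil (%r. [n] \<cdot> m r)" using assms unfolding chr_def by (auto simp: nm_sub[symmetric] sub_nm Fil_sub)

lemma lim_nm:
 fixes n :: nat
 assumes "chr G Fil m" shows "n .[L] lim_of G Fil m=lim_of G Fil (%r. [n] \<cdot> m r)"
proof (induction n)
 case 0 thus ?case by (simp add: lim_0)
next
 case (Suc n)
 show ?case using assms by (simp add: lim.nm_Suc nm_Suc Suc lim_add coh_car)
qed

lemma lim_fil_iff:
 assumes "chr G Fil m" shows "lim_of G Fil m : lim_fil G Fil r \<longleftrightarrow> m r : Fil r" using assms lim_of_carrier by (simp add: lim_fil_def lim_of_def cos_eq_self Fil_sub coh_car)

lemma lim_filt: "filg L (lim_fil G Fil)"
proof (intro filg.intro filg_axioms.intro lim_grp)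
 fix r
 show "asub (lim_fil G Fil r) L"
 proof (rule lim.subgroupI)
  show "lim_fil G Fil r <= carrier L" by (auto simp: lim_fil_def)
  show "0[L] : lim_fil G Fil r" by (simp add: lim_0 lim_fil_iff chr_const Fil_0)
  fix x y assume xy: "x : lim_fil G Fil r" "y : lim_fil G Fil r"
  hence "x:[L]" "y:[L]" by (auto simp: lim_fil_def)
  then obtain m n where "chr G Fil m" "x=lim_of G Fil m" "chr G Fil n" "y=lim_of G Fil n" by (auto simp: lim_car)
  moreover from this have "chr G Fil (%r. m r \<ominus> n r)" using coh_add[OF _ coh_neg] by (simp add: minus_eq)
  ultimately show "x -[L]y : lim_fil G Fil r" using xy sub_sub[OF Fil_sub] by (simp add: lim_sub lim_fil_iff)
 qed
 show "lim_fil G Fil (Suc r) <= lim_fil G Fil r"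
 proof
  fix x assume x: "x : lim_fil G Fil (Suc r)"
  then obtain m where m: "chr G Fil m" "x=lim_of G Fil m" by (auto simp: lim_fil_def lim_car)
  have "m (Suc r) : Fil r" using x m Fil_Suc by (auto simp: lim_fil_iff)
  hence "m r : Fil r" using m(1) sub_mem_cg[OF Fil_sub, of "m (Suc r)" "m r" r] by (auto simp: chr_def)
  thus "x : lim_fil G Fil r" using m by (simp add: lim_fil_iff)
 qed
qed

lemma lim_dn:
 assumes "x:[L]" obtains g where "g:[G]" "x -[L]to_lim G Fil g : lim_fil G Fil r"
proof -
 obtain m where m: "chr G Fil m" "x=lim_of G Fil m" using assms by (auto simp: lim_car)
 have c: "chr G Fil (%s. m s \<ominus> m r)" using coh_add[OF m(1) coh_neg[OF chr_const]] m(1) by (simp add: minus_eq coh_car)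
 have "x -[L]to_lim G Fil (m r) : lim_fil G Fil r" using m by (simp add: to_lim_eq lim_sub chr_const coh_car lim_fil_iff[OF c] Fil_0)
 thus ?thesis using that m(1) coh_car by blast
qed

text \<open>Injectivity of the canonical map is separatedness of the filtration, surjectivity is
  convergence of coherent sequences.\<close>

lemma lim_cmp_iff:
 "lim_complete G Fil \<longleftrightarrow> (\<forall>x\<in>carrier G. (\<forall>r. x : Fil r) --> x=\<zero>) &
   (\<forall>m. chr G Fil m --> (\<exists>x\<in>carrier G. \<forall>r. x \<ominus> m r : Fil r))" (is "_ \<longleftrightarrow> ?S & ?C")
proof -
 have inj: "inj_on (to_lim G Fil) (carrier G) \<longleftrightarrow> ?S"
 proof
  assume i: "inj_on (to_lim G Fil) (carrier G)"
  show ?S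
  proof (intro ballI impI)
   fix x assume x: "x:[G]" "\<forall>r. x : Fil r"
   have "to_lim G Fil x=to_lim G Fil \<zero>" using x by (simp add: to_lim_eq lim_eq_iff)
   thus "x=\<zero>" using i x by (simp add: inj_on_def)
  qed
 next
  assume S: ?S
  show "inj_on (to_lim G Fil) (carrier G)" using S by (auto simp: inj_on_def to_lim_eq lim_eq_iff) (metis sub_0_iff minus_closed)
 qed
 have sur: "to_lim G Fil ` carrier G=carrier L \<longleftrightarrow> ?C"
 proof
  assume s: "to_lim G Fil ` carrier G=carrier L"
  show ?C
  proof (intro allI impI)
   fix m assume m: "chr G Fil m"
   then obtain x where "x:[G]" "to_lim G Fil x=lim_of G Fil m" using s lim_of_carrier by (metis imageE)
   thus "\<exists>x\<in>carrier G. \<forall>r. x \<ominus> m r : Fil r"  using m by (auto simp: to_lim_eq lim_eq_iff coh_car)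
  qed
 next
  assume C: ?C
  have "y : to_lim G Fil ` carrier G" if y: "y:[L]" for y
  proof -
   obtain m where m: "chr G Fil m" "y=lim_of G Fil m" using y by (auto simp: lim_car)
   then obtain x where x: "x:[G]" "\<forall>r. x \<ominus> m r : Fil r" using C by blast
   have "to_lim G Fil x=y" using x m by (simp add: to_lim_eq lim_eq_iff coh_car)
   thus ?thesis using x by blast
  qed
  thus "to_lim G Fil ` carrier G=carrier L" using ah_cl[OF to_lim_hom] by auto
 qed
 show ?thesis by (simp only: lim_complete_def bij_betw_def inj sur)
qed

lemma cmp_sep: "lim_complete G Fil==>x:[G]==>(!!r. x : Fil r)==>x=\<zero>" by (simp add: lim_cmp_iff)

lemma cmp_eqI:
 assumes "lim_complete G Fil" "x:[G]" "y:[G]" "!!r. x \<ominus> y : Fil r" shows "x=y" using cmp_sep[OF assms(1), of "x \<ominus> y"] assms sub_0_iff by auto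

text \<open>Diagonal argument: a coherent sequence of points of the limit, given by representatives
  \<open>n r\<close>, converges to the point represented by the diagonal
  \<open>n r r\<close>.\<close>

lemma lim_cmp_lim: "lim_complete L (lim_fil G Fil)"
proof -
 interpret LF: filg L "lim_fil G Fil" by (rule lim_filt)
 show ?thesis unfolding LF.lim_cmp_iff
 proof (intro conjI ballI impI allI)
  fix x assume "x:[L]" "\<forall>r. x : lim_fil G Fil r"
  thus "x=0[L]" by (auto simp: lim_fil_def lim_0 lim_of_def cos_0 Fil_sub)
 next
  fix M assume M: "chr L (lim_fil G Fil) M"
  have "\<exists>n. chr G Fil n & M r=lim_of G Fil n" for r using M by (auto simp: chr_def lim_car)
  then obtain n where n: "!!r. chr G Fil (n r)" "!!r. M r=lim_of G Fil (n r)" by metis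
  have c: "chr G Fil (%s. n r s \<ominus> n r' s)" for r r' using coh_add[OF n(1) coh_neg[OF n(1)]] by (simp add: minus_eq)
  have le: "n (Suc r) r \<ominus> n r r : Fil r" for r
  proof -
   have "M (Suc r) -[L]M r : lim_fil G Fil r" using M by (simp add: chr_def)
   thus ?thesis by (simp add: n(2) lim_sub n(1) lim_fil_iff[OF c])
  qed
  have nc: "n r s:[G]" for r s using n(1) by (rule coh_car)
  have d: "chr G Fil (%r. n r r)" unfolding chr_def
  proof (intro allI conjI nc)
   fix r
   have "n (Suc r) (Suc r) \<ominus> n (Suc r) r : Fil r" using n(1)[of "Suc r"] by (simp add: chr_def)
   thus "n (Suc r) (Suc r) \<ominus> n r r : Fil r" using le nc Fil_sub sub_sub_tr by metis
  qed
  have "lim_of G Fil (%r. n r r) -[L]M r : lim_fil G Fil r" for r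
  proof -
   have "chr G Fil (%s. n s s \<ominus> n r s)" using coh_add[OF d coh_neg[OF n(1)]] by (simp add: minus_eq)
   thus ?thesis by (simp add: n(2) lim_sub n(1) d lim_fil_iff nc Fil_0)
  qed
  thus "\<exists>x\<in>carrier L. \<forall>r. x -[L]M r : lim_fil G Fil r" using lim_of_carrier[OF d] by blast
 qed
qed

end

lemma pf_filt: "abelian_group G==>filg G (p_fil p G)" by (simp add: filg_def filg_axioms_def abelian_group.muls_sub
   abelian_group.muls_dvd)

text \<open>A convergent series \<open>\<Sum> p\<^sup>j c\<^sub>j\<close> realises an element of the kernel as a multiple of \<open>p\<^sup>r\<close>.\<close>

lemma lim_fil_p:
 assumes "abelian_group G"
 shows "lim_fil G (p_fil p G) r=mults (p ^ r) (lim_ring G (p_fil p G))"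
proof -
 interpret filg G "p_fil p G" by (rule pf_filt[OF assms])
 show ?thesis
 proof (intro equalityI subsetI)
  fix x assume "x : mults (p ^ r) L"
  then obtain a where "a:[L]" "x=(p ^ r) .[L] a" by (auto simp: mults_def[of "p ^ r" L])
  then obtain m where m: "chr G (p_fil p G) m" "x=(p ^ r) .[L] lim_of G (p_fil p G) m" by (metis lim_cs)
  thus "x : lim_fil G (p_fil p G) r" by (simp add: lim_nm lim_fil_iff coh_nm muls_mem coh_car)
 next
  fix x assume x: "x : lim_fil G (p_fil p G) r"
  then obtain m where m: "chr G (p_fil p G) m" "x=lim_of G (p_fil p G) m" by (auto simp: lim_fil_def lim_car)
  note mc = coh_car[OF m(1)]
  have "m r : mults (p ^ r) G" using x m by (simp add: lim_fil_iff)
  then obtain b where b: "b:[G]" "m r=(p ^ r) .[G] b" by (auto simp: mults_def)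
  have "\<exists>c\<in>carrier G. m (Suc s) -[G]m s=(p ^ s) .[G] c" for s using m(1) by (auto simp: chr_def mults_def)
  then obtain c where c: "!!s. c s:[G]" "!!s. m (Suc s) -[G]m s=(p ^ s) .[G] c s" by metis
  define y where "y=rec_nat b (%s t. t +[G](p ^ s) .[G] c (s + r))"
  have y0: "y 0=b" and ys: "y (Suc s)=y s +[G](p ^ s) .[G] c (s + r)" for s by (simp_all add: y_def)
  have yc: "y s:[G]" for s by (induction s) (simp_all add: y0 ys b c)
  have ycoh: "chr G (p_fil p G) y"
  proof -
   have "y (Suc s) -[G]y s=(p ^ s) .[G] c (s + r)" for s
   proof -
    have "(p ^ s) .[G] c (s + r):[G]" by (simp add: c)
    with yc[of s] show ?thesis unfolding ys by algebra
   qed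
   thus ?thesis by (auto simp: chr_def yc c muls_mem)
  qed
  have eq: "(p ^ r) .[G] y s=m (s + r)" for s
  proof (induction s)
   case (Suc s)
   have "(p ^ r) .[G] y (Suc s)=m (s + r) +[G](p ^ (s + r)) .[G] c (s + r)" by (simp add: ys nm_dist yc c Suc nm_nm power_add mult.commute)
   also have "\<dots>=m (Suc s + r)" using c(2)[of "s + r", symmetric] mc[of "s + r"] mc[of "Suc (s + r)"] by (simp add: add_minus_cancel)
   finally show ?case .
  qed (simp add: y0 b)
  have "x=(p ^ r) .[L] lim_of G (p_fil p G) y"
  proof -
   have "m s -[G]m (s + r) : p_fil p G s" for s using coh_le[OF m(1), of s "s + r"] mc by (auto intro: sub_sub_cm Fil_sub)
   thus ?thesis unfolding m(2) by (simp add: lim_nm ycoh lim_eq_iff mc yc eq)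
  qed
  thus "x : mults (p ^ r) L" using lim_of_carrier[OF ycoh] by (auto simp: mults_def)
 qed
qed

lemma lim_p_cmp:
 assumes "abelian_group G"
 shows "lim_complete (lim_ring G (p_fil p G)) (p_fil p (lim_ring G (p_fil p G)))"
proof -
 interpret filg G "p_fil p G" by (rule pf_filt[OF assms])
 have "p_fil p (lim_ring G (p_fil p G))=lim_fil G (p_fil p G)" by (simp add: fun_eq_iff lim_fil_p[OF assms])
 thus ?thesis using lim_cmp_lim by simp
qed

text \<open>Division by \<open>p\<close> costs one filtration step, so the terms
  \<open>m (Suc r)\<close> land in \<open>Fil r\<close>; coherence carries this back to
  \<open>m r\<close>. The lemma serves both the p-adic filtration and the V-filtration.\<close>

lemma lim_tf:
 assumes "filg G Fil"
  and "!!r x. x:[G]==>p .[G] x : Fil (Suc r)==>x : Fil r"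
 shows "torsion_free p (lim_ring G Fil)"
proof -
 interpret filg G Fil by fact
 show ?thesis unfolding torsion_free_def
 proof (intro ballI impI)
  fix x assume "x:[L]" and z: "p .[L] x=0[L]"
  then obtain m where m: "chr G Fil m" "x=lim_of G Fil m" by (auto simp: lim_car)
  have "p .[G] m (Suc r) : Fil (Suc r)" for r using z m by (simp add: lim_nm lim_0 lim_eq_iff coh_car)
  hence "m (Suc r) : Fil r" for r using assms(2) coh_car[OF m(1)] by blast
  hence "m r : Fil r" for r using m(1) sub_mem_cg[OF Fil_sub, of "m (Suc r)" "m r" r] by (auto simp: chr_def)
  thus "x=0[L]" using m by (simp add: lim_0 lim_eq_iff coh_car)
 qed
qed

section \<open>Extending additive maps to completions\<close>

text \<open>Extension by continuity. The value is pinned down by all representatives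
  \<open>g\<close> of \<open>x\<close> at every level rather than by a chosen coherent sequence, so
  no choice enters and additivity is a matter of uniqueness.\<close>

definition lim_ext ::
 "('a, 'm) ring_scheme => (nat => 'a set) => ('b, 'n) ring_scheme => (nat => 'b set) => ('a => 'b) => (nat => 'a set) => 'b" where
 "lim_ext G Fil E FilE \<phi> x=(THE e. e:[E] & (\<forall>r. \<forall>g\<in>x r. e -[E]\<phi> g : FilE r))"

locale film = G: filg G Fil + E: filg E FilE
 for G :: "('a, 'm) ring_scheme" and Fil and E :: "('b, 'n) ring_scheme" and FilE +
 fixes \<phi> :: "'a => 'b"
 assumes complete: "lim_complete E FilE"
  and phi: "\<phi> : ahom G E"
  and phi_fil: "x : Fil r==>\<phi> x : FilE r"
begin

sublocale gpair G E by unfold_locales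

sublocale lim_pair: gpair G.L E by unfold_locales

abbreviation "ext \<equiv> lim_ext G Fil E FilE \<phi>"

lemma ext_uniq:
 assumes m: "chr G Fil m" and e: "e:[E]" "!!r. e -[E]\<phi> (m r) : FilE r"
 shows "ext (lim_of G Fil m)=e" unfolding lim_ext_def
proof (rule the_equality)
 show "e:[E] & (\<forall>r. \<forall>g\<in>lim_of G Fil m r. e -[E]\<phi> g : FilE r)"
 proof (intro conjI allI ballI e)
  fix r g assume "g : lim_of G Fil m r"
  hence g: "g:[G]" "g -[G]m r : Fil r" using G.coh_car[OF m] by (auto simp: lim_of_def G.cos_mem G.Fil_sub)
  have "\<phi> (m r) -[E]\<phi> g : FilE r" using phi_fil[OF g(2)] g(1) G.coh_car[OF m] phi ah_cl[OF phi] by (simp add: ah_sub) (blast intro: E.sub_sub_cm E.Fil_sub)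
  thus "e -[E]\<phi> g : FilE r" using e g(1) G.coh_car[OF m] ah_cl[OF phi] E.sub_sub_tr[OF E.Fil_sub] by blast
 qed
next
 fix e' assume e': "e':[E] & (\<forall>r. \<forall>g\<in>lim_of G Fil m r. e' -[E]\<phi> g : FilE r)"
 show "e'=e"
 proof (rule E.cmp_eqI[OF complete])
  fix r
  have "m r : lim_of G Fil m r" using G.coh_car[OF m] by (simp add: lim_of_def G.cos_self G.Fil_sub)
  thus "e' -[E]e : FilE r" using e e' G.coh_car[OF m] ah_cl[OF phi] E.Fil_sub by (meson E.sub_sub_cm E.sub_sub_tr)
 qed (use e e' in auto)
qed

lemma ext_lim:
 assumes m: "chr G Fil m"
 shows "ext (lim_of G Fil m):[E] & (\<forall>r. ext (lim_of G Fil m) -[E]\<phi> (m r) : FilE r)"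
proof -
 have "chr E FilE (%r. \<phi> (m r))" using m phi_fil ah_cl[OF phi] phi by (auto simp: chr_def simp flip: ah_sub)
 then obtain e where "e:[E]" "!!r. e -[E]\<phi> (m r) : FilE r" using complete E.lim_cmp_iff by blast
 thus ?thesis using ext_uniq[OF m] by simp
qed

lemma ext_to_lim: "g:[G]==>ext (to_lim G Fil g)=\<phi> g" using ext_uniq[of "%_. g" "\<phi> g"] by (simp add: G.to_lim_eq G.chr_const ah_cl[OF phi] E.Fil_0)

lemma ext_hom: "ext : ahom G.L E"
proof (rule ahI)
 fix x assume "x:[G.L]"
 then obtain m where m: "chr G Fil m" "x=lim_of G Fil m" by (auto simp: G.lim_car)
 thus "ext x:[E]" using ext_lim by blast
 fix y assume "y:[G.L]"
 then obtain n where n: "chr G Fil n" "y=lim_of G Fil n" by (auto simp: G.lim_car)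
 note c = G.coh_car[OF m(1)] G.coh_car[OF n(1)]
 have "ext (lim_of G Fil (%r. m r +[G]n r))=ext x +[E]ext y"
 proof (rule ext_uniq)
  fix r show "ext x +[E]ext y -[E]\<phi> (m r +[G]n r) : FilE r" using ext_lim[OF m(1)] ext_lim[OF n(1)] c m n by (simp add: ah_add[OF phi] E.sub_sub_add E.Fil_sub ah_cl[OF phi])
 qed (use ext_lim[OF m(1)] ext_lim[OF n(1)] m n in \<open>auto simp: G.coh_add\<close>)
 thus "ext (x +[G.L]y)=ext x +[E]ext y" by (simp add: m n G.lim_add c)
qed

lemma ext_fil: assumes "x : lim_fil G Fil r" shows "ext x : FilE r"
proof -
 obtain m where m: "chr G Fil m" "x=lim_of G Fil m" using assms by (auto simp: lim_fil_def G.lim_car)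
 have "m r : Fil r" using assms m G.lim_fil_iff by simp
 hence "\<phi> (m r) : FilE r" by (rule phi_fil)
 thus ?thesis using ext_lim[OF m(1)] m(2) E.sub_mem_cg[OF E.Fil_sub] G.coh_car[OF m(1)] ah_cl[OF phi] by blast
qed

end

text \<open>Density: the image of \<open>G\<close> approximates every point of the completion, so
  two filtered maps that agree on it differ by an element of every \<open>FilE r\<close>.\<close>

lemma lim_hom_eqI:
 assumes "filg G Fil" "filg E FilE"
  and sep: "!!e. e:[E]==>(!!r. e : FilE r)==>e=0[E]"
  and h: "h : ahom (lim_ring G Fil) E" "!!r x. x : lim_fil G Fil r==>h x : FilE r"
  and k: "k : ahom (lim_ring G Fil) E" "!!r x. x : lim_fil G Fil r==>k x : FilE r"
  and eq: "!!g. g:[G]==>h (to_lim G Fil g)=k (to_lim G Fil g)"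
  and x: "x:[lim_ring G Fil]"
 shows "h x=k x"
proof -
 interpret G: filg G Fil by fact
 interpret E: filg E FilE by fact
 interpret gpair G.L E by unfold_locales
 note hc = ah_cl[OF h(1)] and kc = ah_cl[OF k(1)]
 have "h x -[E]k x=0[E]"
 proof (rule sep)
  fix r
  obtain g where g: "g:[G]" "x -[G.L]to_lim G Fil g : lim_fil G Fil r" using G.lim_dn[OF x] by blast
  have t: "to_lim G Fil g:[G.L]" by (rule ah_cl[OF G.to_lim_hom g(1)])
  have "h x -[E]h (to_lim G Fil g) : FilE r" "k x -[E]k (to_lim G Fil g) : FilE r" using h(2)[OF g(2)] k(2)[OF g(2)] by (simp_all only: ah_sub[OF h(1) x t] ah_sub[OF k(1) x t])
  thus "h x -[E]k x : FilE r" using eq[OF g(1)] hc[OF x] kc[OF x] kc[OF t] E.Fil_sub by (metis E.sub_sub_cm E.sub_sub_tr)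
 qed (use hc[OF x] kc[OF x] in auto)
 thus ?thesis using hc[OF x] kc[OF x] by (simp add: E.sub_0_iff)
qed

definition p_sep :: "nat => ('a, 'm) ring_scheme => bool" where
 "p_sep p E \<longleftrightarrow> (\<forall>e\<in>carrier E. (\<forall>r. e : mults (p ^ r) E) --> e=0[E])"

text \<open>An additive map carries multiples of \<open>p ^ r\<close> to multiples of
  \<open>p ^ r\<close>, so for p-adic filtrations the continuity hypotheses of
  \<open>lim_hom_eqI\<close> are automatic. This is the form in which density is applied to
  completed polynomials and forms.\<close>

lemma lim_p_hom_eqI:
 assumes "abelian_group G" "abelian_group E" "p_sep p E"
  and "h : ahom (lim_ring G (p_fil p G)) E" "k : ahom (lim_ring G (p_fil p G)) E"
  and "!!g. g:[G]==>h (to_lim G (p_fil p G) g)=k (to_lim G (p_fil p G) g)"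
  and "x:[lim_ring G (p_fil p G)]"
 shows "h x=k x"
proof -
 interpret G: filg G "p_fil p G" by (rule pf_filt) fact
 interpret E: abelian_group E by fact
 interpret gpair G.L E by unfold_locales
 show ?thesis by (rule lim_hom_eqI[OF pf_filt[OF assms(1)] pf_filt[OF assms(2), of p] _ assms(4) _ assms(5) _ assms(6,7)])
   (use assms in \<open>auto simp: p_sep_def lim_fil_p[OF assms(1)] intro: ah_muls\<close>)
qed

lemma lim_p_sep:
 assumes "abelian_group G" shows "p_sep p (lim_ring G (p_fil p G))"
proof -
 interpret G: filg G "p_fil p G" by (rule pf_filt) fact
 interpret L: filg G.L "p_fil p G.L" by (rule pf_filt) (rule G.lim_grp)
 show ?thesis unfolding p_sep_def using L.cmp_sep[OF lim_p_cmp[OF assms]] by blast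
qed

section \<open>Graded algebras and their completions\<close>

lemma add_mon_deg0: "add_monoid (deg0 A)=add_monoid (gr A 0)" by (simp add: deg0_def)

text \<open>\<open>deg0 A\<close> and \<open>gr A 0\<close> are different records with the same
  additive part. The rules move additive notions to \<open>gr A 0\<close>.\<close>

lemma deg0_s [simp]:
 "carrier (deg0 A)=carrier (gr A 0)" "mult (deg0 A)=gmul A 0 0" "one (deg0 A)=gone A"
 "ring.zero (deg0 A)=ring.zero (gr A 0)" "add (deg0 A)=add (gr A 0)"
 "a_inv (deg0 A)=a_inv (gr A 0)" "a_minus (deg0 A)=a_minus (gr A 0)"
 "add_pow (deg0 A) (n::nat)=add_pow (gr A 0) n"
 "a_r_coset (deg0 A)=a_r_coset (gr A 0)"
 "asub H (deg0 A)=asub H (gr A 0)"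
 "mults n (deg0 A)=mults n (gr A 0)"
proof -
 show i: "a_inv (deg0 A)=a_inv (gr A 0)" by (auto simp: a_inv_def[abs_def] deg0_def)
 thus "a_minus (deg0 A)=a_minus (gr A 0)" by (auto simp: a_minus_def[abs_def] deg0_def)
 show "add_pow (deg0 A) n=add_pow (gr A 0) n" for n :: nat by (auto simp: add_pow_def[abs_def] deg0_def)
 thus "mults n (deg0 A)=mults n (gr A 0)" by (simp add: mults_def deg0_def)
 show "a_r_coset (deg0 A)=a_r_coset (gr A 0)" by (auto simp: a_r_coset_def deg0_def)
 show "asub H (deg0 A)=asub H (gr A 0)" by (simp add: additive_subgroup_def deg0_def)
qed (simp_all add: deg0_def)

lemma rhI:
 assumes "!!x. x:[R]==>h x:[S]"
  and "!!x y. x:[R]==>y:[R]==>h (x *[R]y)=h x *[S]h y"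
  and "!!x y. x:[R]==>y:[R]==>h (x +[R]y)=h x +[S]h y"
  and "h 1[R]=1[S]"
 shows "h : rhom R S" using assms by (rule ring_hom_memI)

lemma rh_ah: "h : rhom R S==>h : ahom R S" by (auto simp: ring_hom_def hom_def)

lemma rh_pow:
 assumes "h : rhom R S" "monoid R" "x:[R]" shows "h (x [^][R] (n::nat))=h x [^][S] n" by (induction n) (use assms in \<open>simp_all add: rh_one rh_mul monoid.nat_pow_closed\<close>)

context strict_cdga
begin

sublocale gr: abelian_group "gr A i" for i by (rule gr_group)

lemma gr_pair: "gpair (gr A i) (gr A j)" by unfold_locales
lemma lmul_hom: "x:[gr A i]==>gmul A i j x : ahom (gr A j) (gr A (i + j))" by (rule ahI) (auto simp: gmul_closed distrib_r)
lemma rmul_hom: "y:[gr A j]==>(%x. gmul A i j x y) : ahom (gr A i) (gr A (i + j))" by (rule ahI) (auto simp: gmul_closed distrib_l)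

lemmas gmul_0_r = gpair.ah_0[OF gr_pair lmul_hom]
lemmas gmul_0_l = gpair.ah_0[OF gr_pair rmul_hom]
lemmas gmul_neg_r = gpair.ah_neg[OF gr_pair lmul_hom]
lemmas gmul_neg_l = gpair.ah_neg[OF gr_pair rmul_hom]
lemmas gmul_sub_r = gpair.ah_sub[OF gr_pair lmul_hom]
lemmas gmul_sub_l = gpair.ah_sub[OF gr_pair rmul_hom]
lemmas gmul_nm_r = gpair.ah_nm[OF gr_pair lmul_hom]
lemmas gmul_nm_l = gpair.ah_nm[OF gr_pair rmul_hom]
lemmas dif_0 = gpair.ah_0[OF gr_pair dif_hom]
lemmas dif_neg = gpair.ah_neg[OF gr_pair dif_hom]
lemmas dif_sub = gpair.ah_sub[OF gr_pair dif_hom]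
lemmas dif_nm = gpair.ah_nm[OF gr_pair dif_hom]
lemmas dif_closed = ah_cl[OF dif_hom]
lemmas dif_add = ah_add[OF dif_hom]

lemma gsign_closed: "x:[gr A i]==>gsign n (gr A i) x:[gr A i]" by (simp add: gsign_def)
lemma gone_r: "x:[gr A i]==>gmul A i 0 x (gone A)=x" using gcomm[of x i "gone A" 0] by (simp add: gone_closed gone_l gsign_def)

lemma dif_gone: "dif A 0 (gone A)=0[gr A 1]"
proof -
 have c: "dif A 0 (gone A):[gr A 1]" using dif_closed[OF gone_closed] by simp
 have "dif A 0 (gone A)=dif A 0 (gone A) +[gr A 1]dif A 0 (gone A)" using leibniz[OF gone_closed gone_closed] c by (simp add: gone_l gone_r gone_closed gsign_def)
 thus ?thesis using c gr.add.l_cancel_one' by blast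
qed

lemma deg0_cring: "cring (deg0 A)"
proof (rule cringI)
 show "abelian_group (deg0 A)" using gr.a_comm_group[of 0] gr.abelian_monoid_axioms[of 0] by (simp add: abelian_group_def abelian_group_axioms_def abelian_monoid_def add_mon_deg0)
 show "Group.comm_monoid (deg0 A)"
 proof (rule comm_monoidI)
  fix x y assume c: "x:[deg0 A]" "y:[deg0 A]"
  show "x *[deg0 A]y=y *[deg0 A]x" using gcomm[of x 0 y 0] c by (simp add: gsign_def)
 qed (use gmul_closed[of _ 0 _ 0] gone_closed assoc[of _ 0 _ 0 _ 0] gone_l[of _ 0] in simp_all)
qed (use distrib_l[of _ 0 _ _ 0] in simp_all)

sublocale deg0: cring "deg0 A" by (rule deg0_cring)

lemma idl_flip:
 assumes I: "asub I (gr A (i + j))" and x: "x:[gr A i]" and y: "y:[gr A j]"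
  and "gmul A j i y x : I"
 shows "gmul A i j x y : I" using gcomm[OF x y] assms(4) additive_subgroup.a_inv_closed[OF I] by (simp add: gsign_def)

lemma dif_pow:
 assumes x: "x:[gr A 0]"
 shows "dif A 0 (x [^][deg0 A] Suc n)=(Suc n) .[gr A 1] gmul A 0 1 (x [^][deg0 A] n) (dif A 0 x)"
proof (induction n)
 case 0
 have "dif A 0 x:[gr A 1]" using dif_closed[OF x] by simp
 thus ?case using x deg0.l_one[of x] gone_l[of _ 1] gone_closed by simp
next
 case (Suc n)
 let ?y = "x [^][deg0 A] Suc n" and ?z = "x [^][deg0 A] n"
 have p: "x [^][deg0 A] m:[gr A 0]" for m :: nat using deg0.nat_pow_closed[of x m] x by simp
 have c: "?y:[gr A 0]" "?z:[gr A 0]" "dif A 0 x:[gr A 1]" by (rule p, rule p, use dif_closed[OF x] in simp)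
 hence d: "gmul A 0 1 ?z (dif A 0 x):[gr A 1]" "gmul A 0 1 ?y (dif A 0 x):[gr A 1]" using gmul_closed[of _ 0 _ 1] by auto
 have "dif A 0 (x [^][deg0 A] Suc (Suc n))=dif A 0 (gmul A 0 0 ?y x)" by simp
 also have "\<dots>=gmul A 1 0 (dif A 0 ?y) x +[gr A 1]gmul A 0 1 ?y (dif A 0 x)" using leibniz[OF c(1) x] by (simp add: gsign_def)
 also have "gmul A 1 0 (dif A 0 ?y) x=(Suc n) .[gr A 1] gmul A 1 0 (gmul A 0 1 ?z (dif A 0 x)) x" using gmul_nm_l[OF x, of _ 1] d by (simp only: Suc.IH add_0_right)
 also have "gmul A 1 0 (gmul A 0 1 ?z (dif A 0 x)) x=gmul A 0 1 ?z (gmul A 0 1 x (dif A 0 x))" using assoc[OF c(2,3) x] gcomm[OF c(3) x] by (simp add: gsign_def)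
 also have "\<dots>=gmul A 0 1 ?y (dif A 0 x)" using assoc[OF c(2) x c(3)] by simp
 finally show ?case using d by (simp only: gr.nm_Suc)
qed

end

lemma frob_liftD:
 assumes "frobenius_lift p A F" "x:[A]"
 obtains y where "y:[A]" "F x -[A]x [^][A] p=p .[A] y" using assms by (auto simp: frobenius_lift_def mults_def)

text \<open>Filtrations by differential graded ideals. Two instances matter: powers of
  \<open>p\<close> on the log de Rham complex, and \<open>V^r + d V^r\<close> on a saturated
  algebra.\<close>

locale cfil = strict_cdga R A
 for R :: "('r, 'y) ring_scheme" and A :: "('a, 'r, 'z) cdga_scheme" +
 fixes Fil :: "nat => nat => 'a set"
 assumes sub: "asub (Fil i r) (gr A i)"
  and decr: "Fil i (Suc r) <= Fil i r"
  and ideal: "x:[gr A i]==>y : Fil j r==>gmul A i j x y : Fil (i + j) r"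
  and dif_fil: "x : Fil i r==>dif A i x : Fil (Suc i) r"
begin

sublocale fil: filg "gr A i" "Fil i" for i by (intro filg.intro filg_axioms.intro gr_group) (simp_all add: sub decr)

lemma idl_l: assumes "x : Fil i r" "y:[gr A j]" shows "gmul A i j x y : Fil (i + j) r" by (rule idl_flip) (use assms sub ideal[OF assms(2,1)] fil.Fil_car[OF assms(1)] in \<open>auto simp: add.commute\<close>)

abbreviation "C \<equiv> cdga_lim A Fil"
abbreviation "coh i \<equiv> chr (gr A i) (Fil i)"
abbreviation "Lim i \<equiv> lim_of (gr A i) (Fil i)"

lemma gr_lim [simp]: "gr C i=lim_ring (gr A i) (Fil i)" by (simp add: cdga_lim_def)
lemma Lim_cl: "coh i m==>Lim i m:[gr C i]" by (simp add: fil.lim_of_carrier)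

lemma gmul_cg:
 assumes "x:[gr A i]" "x':[gr A i]" "y:[gr A j]" "y':[gr A j]"
  and "x' -[gr A i]x : Fil i r" "y' -[gr A j]y : Fil j r"
 shows "gmul A i j x' y' -[gr A (i + j)]gmul A i j x y : Fil (i + j) r"
proof (rule gr.sub_sub_tr[OF sub, where y = "gmul A i j x' y"])
 show "gmul A i j x' y' -[gr A (i + j)]gmul A i j x' y : Fil (i + j) r" using ideal[OF assms(2,6)] assms by (simp add: gmul_sub_r)
 show "gmul A i j x' y -[gr A (i + j)]gmul A i j x y : Fil (i + j) r" using idl_l[OF assms(5,3)] assms by (simp add: gmul_sub_l)
qed (use assms gmul_closed in auto)

lemma coh_gmul: assumes "coh i m" "coh j n" shows "coh (i + j) (%r. gmul A i j (m r) (n r))" using assms gmul_cg by (simp add: chr_def gmul_closed)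

lemma gmul_Lim:
 assumes "coh i m" "coh j n"
 shows "gmul C i j (Lim i m) (Lim j n)=Lim (i + j) (%r. gmul A i j (m r) (n r))" unfolding cdga_lim_def cdga.simps lim_of_def
proof (rule ext)
 fix r
 note c = fil.coh_car[OF assms(1), of r] fil.coh_car[OF assms(2), of r]
 show "coset_map2 (gr A (i + j)) (Fil (i + j) r) (gmul A i j) (Fil i r +>[gr A i] m r) (Fil j r +>[gr A j] n r)
  = Fil (i + j) r +>[gr A (i + j)] gmul A i j (m r) (n r)"
 proof (rule cos_map2_cos[OF gr_group sub c(1) gr_group sub c(2)])
  fix z w assume z: "z:[gr A i]" "z -[gr A i]m r : Fil i r"
   and w: "w:[gr A j]" "w -[gr A j]n r : Fil j r"
  show "Fil (i + j) r +>[gr A (i + j)] gmul A i j z w=Fil (i + j) r +>[gr A (i + j)] gmul A i j (m r) (n r)" by (rule gr.cos_eqI[OF sub gmul_closed[OF z(1) w(1)] gmul_closed[OF c] gmul_cg[OF c(1) z(1) c(2) w(1) z(2) w(2)]])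
 qed
qed

lemma coh_dif: assumes "coh i m" shows "coh (Suc i) (%r. dif A i (m r))" using assms dif_fil by (auto simp: chr_def dif_closed simp flip: dif_sub)

lemma dif_Lim: assumes "coh i m" shows "dif C i (Lim i m)=Lim (Suc i) (%r. dif A i (m r))" unfolding cdga_lim_def cdga.simps lim_of_def
proof (rule ext)
 fix r
 note c = fil.coh_car[OF assms(1), of r]
 show "coset_map (gr A (Suc i)) (Fil (Suc i) r) (dif A i) (Fil i r +>[gr A i] m r)
  = Fil (Suc i) r +>[gr A (Suc i)] dif A i (m r)"
 proof (rule gr.cos_map_cos[OF sub c(1)])
  fix z assume z: "z:[gr A i]" "z -[gr A i]m r : Fil i r"
  show "Fil (Suc i) r +>[gr A (Suc i)] dif A i z=Fil (Suc i) r +>[gr A (Suc i)] dif A i (m r)" using dif_fil[OF z(2)] by (intro gr.cos_eqI[OF sub dif_closed[OF z(1)] dif_closed[OF c]]) (simp add: dif_sub z c)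
 qed
qed

lemma gsign_Lim: "coh i m==>gsign n (gr C i) (Lim i m)=Lim i (%r. gsign n (gr A i) (m r))" by (cases "even n") (simp_all add: gsign_def fil.lim_neg)
lemma gone_lim: "gone C=Lim 0 (%_. gone A)" by (simp add: cdga_lim_def fil.to_lim_eq)
lemma rmap_lim: "rmap C r=Lim 0 (%_. rmap A r)" by (simp add: cdga_lim_def fil.to_lim_eq)
lemma coh_const: "x:[gr A i]==>coh i (%_. x)" by (rule fil.chr_const)

lemma coh_cs:
 assumes "x:[gr C i]" obtains m where "coh i m" "x=Lim i m" "!!r. m r:[gr A i]" using fil.lim_cs[of x i] assms fil.coh_car by auto

lemma rmap_closed: "r:[R]==>rmap A r:[gr A 0]" using rh_cl[OF rmap_hom] by simp

text \<open>Every operation of the completion is computed termwise on coherent sequences, so each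
  axiom is the corresponding axiom of \<open>A\<close> at every level.\<close>

lemma lim_strict_dg: "strict_cdga R C"
proof (unfold strict_cdga_def, intro conjI allI impI)
 fix i show "abelian_group (gr C i)" by (simp add: fil.lim_grp)
next
 fix x i y j assume "x:[gr C i]" "y:[gr C j]"
 then obtain m n where mn: "coh i m" "x=Lim i m" "coh j n" "y=Lim j n" by (metis coh_cs)
 thus "gmul C i j x y:[gr C (i + j)]" unfolding mn(2,4) gmul_Lim[OF mn(1,3)] by (intro Lim_cl coh_gmul)
next
 show "gone C:[gr C 0]" unfolding gone_lim by (intro Lim_cl coh_const gone_closed)
next
 fix x i x' y j assume "x:[gr C i]" "x':[gr C i]" "y:[gr C j]"
 then obtain m m' n where mn: "coh i m" "x=Lim i m" "coh i m'" "x'=Lim i m'" "coh j n" "y=Lim j n" by (metis coh_cs)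
 note c = fil.coh_car[OF mn(1)] fil.coh_car[OF mn(3)] fil.coh_car[OF mn(5)]
 have s: "x +[gr C i]x'=Lim i (%r. m r +[gr A i]m' r)" by (simp add: mn fil.lim_add c)
 show "gmul C i j (x +[gr C i]x') y=gmul C i j x y +[gr C (i + j)]gmul C i j x' y" unfolding s unfolding mn(2,4,6) gmul_Lim[OF mn(1,5)] gmul_Lim[OF mn(3,5)]
   gmul_Lim[OF fil.coh_add[OF mn(1,3)] mn(5)] by (simp add: fil.lim_add c gmul_closed distrib_l)
next
 fix x i y j y' assume "x:[gr C i]" "y:[gr C j]" "y':[gr C j]"
 then obtain m n n' where mn: "coh i m" "x=Lim i m" "coh j n" "y=Lim j n" "coh j n'" "y'=Lim j n'" by (metis coh_cs)
 note c = fil.coh_car[OF mn(1)] fil.coh_car[OF mn(3)] fil.coh_car[OF mn(5)]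
 have s: "y +[gr C j]y'=Lim j (%r. n r +[gr A j]n' r)" by (simp add: mn fil.lim_add c)
 show "gmul C i j x (y +[gr C j]y')=gmul C i j x y +[gr C (i + j)]gmul C i j x y'" unfolding s unfolding mn(2,4,6) gmul_Lim[OF mn(1,3)] gmul_Lim[OF mn(1,5)]
   gmul_Lim[OF mn(1) fil.coh_add[OF mn(3,5)]] by (simp add: fil.lim_add c gmul_closed distrib_r)
next
 fix x i y j z l assume "x:[gr C i]" "y:[gr C j]" "z:[gr C l]"
 then obtain m n k where mn: "coh i m" "x=Lim i m" "coh j n" "y=Lim j n" "coh l k" "z=Lim l k" by (metis coh_cs)
 note c = fil.coh_car[OF mn(1)] fil.coh_car[OF mn(3)] fil.coh_car[OF mn(5)]
 show "gmul C (i + j) l (gmul C i j x y) z=gmul C i (j + l) x (gmul C j l y z)" unfolding mn(2,4,6) gmul_Lim[OF mn(1,3)] gmul_Lim[OF mn(3,5)] gmul_Lim[OF coh_gmul[OF mn(1,3)] mn(5)]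
   gmul_Lim[OF mn(1) coh_gmul[OF mn(3,5)]] by (simp add: assoc c add.assoc)
next
 fix x i assume "x:[gr C i]"
 then obtain m where m: "coh i m" "x=Lim i m" by (metis coh_cs)
 show "gmul C 0 i (gone C) x=x" unfolding m gone_lim gmul_Lim[OF coh_const[OF gone_closed] m(1)] by (simp add: gone_l fil.coh_car[OF m(1)])
next
 fix x i y j assume "x:[gr C i]" "y:[gr C j]"
 then obtain m n where mn: "coh i m" "x=Lim i m" "coh j n" "y=Lim j n" by (metis coh_cs)
 note c = fil.coh_car[OF mn(1)] fil.coh_car[OF mn(3)]
 have e: "Lim (j + i)=Lim (i + j)" "coh (j + i)=coh (i + j)" by (simp_all add: add.commute)
 show "gmul C i j x y=gsign (i * j) (gr C (i + j)) (gmul C j i y x)" unfolding mn(2,4) gmul_Lim[OF mn(1,3)] gmul_Lim[OF mn(3,1)] e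
   gsign_Lim[OF coh_gmul[OF mn(3,1), unfolded e]] by (simp add: gcomm[OF c, symmetric])
next
 fix i x assume "odd (i::nat)" "x:[gr C i]"
 then obtain m where m: "coh i m" "x=Lim i m" by (metis coh_cs)
 show "gmul C i i x x=0[gr C (i + i)]" unfolding m gmul_Lim[OF m(1,1)] using odd_square[OF \<open>odd i\<close> fil.coh_car[OF m(1)]] by (simp add: fil.lim_0)
next
 fix i show "dif C i : ahom (gr C i) (gr C (Suc i))"
 proof (rule ahI)
  fix x assume "x:[gr C i]"
  then obtain m where m: "coh i m" "x=Lim i m" by (metis coh_cs)
  thus "dif C i x:[gr C (Suc i)]" using dif_Lim[OF m(1)] Lim_cl[OF coh_dif[OF m(1)]] by simp
  fix y assume "y:[gr C i]"
  then obtain n where n: "coh i n" "y=Lim i n" by (metis coh_cs)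
  note c = fil.coh_car[OF m(1)] fil.coh_car[OF n(1)]
  have s: "x +[gr C i]y=Lim i (%r. m r +[gr A i]n r)" by (simp add: m n fil.lim_add c)
  show "dif C i (x +[gr C i]y)=dif C i x +[gr C (Suc i)]dif C i y" unfolding s unfolding m n dif_Lim[OF m(1)] dif_Lim[OF n(1)] dif_Lim[OF fil.coh_add[OF m(1) n(1)]] by (simp add: fil.lim_add c dif_closed dif_add)
 qed
next
 fix x i assume "x:[gr C i]"
 then obtain m where m: "coh i m" "x=Lim i m" by (metis coh_cs)
 show "dif C (Suc i) (dif C i x)=0[gr C (Suc (Suc i))]" unfolding m dif_Lim[OF m(1)] dif_Lim[OF coh_dif[OF m(1)]] by (simp add: dif_dif fil.coh_car[OF m(1)] fil.lim_0)
next
 fix x i y j assume "x:[gr C i]" "y:[gr C j]"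
 then obtain m n where mn: "coh i m" "x=Lim i m" "coh j n" "y=Lim j n" by (metis coh_cs)
 note c = fil.coh_car[OF mn(1)] fil.coh_car[OF mn(3)]
 have e: "Lim (i + Suc j)=Lim (Suc (i + j))" "coh (i + Suc j)=coh (Suc (i + j))"
  "Lim (Suc i + j)=Lim (Suc (i + j))" "coh (Suc i + j)=coh (Suc (i + j))" by simp_all
 have g: "gmul A i (Suc j) (m r) (dif A j (n r)):[gr A (Suc (i + j))]"
    "gmul A (Suc i) j (dif A i (m r)) (n r):[gr A (Suc (i + j))]" for r using gmul_closed[OF c(1) dif_closed[OF c(2)]] gmul_closed[OF dif_closed[OF c(1)] c(2)] by simp_all
 show "dif C (i + j) (gmul C i j x y)=gmul C (Suc i) j (dif C i x) y
    +[gr C (Suc (i + j))]gsign i (gr C (Suc (i + j))) (gmul C i (Suc j) x (dif C j y))" unfolding mn(2,4) gmul_Lim[OF mn(1,3)] dif_Lim[OF mn(1)] dif_Lim[OF mn(3)] dif_Lim[OF coh_gmul[OF mn(1,3)]]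
   gmul_Lim[OF mn(1) coh_dif[OF mn(3)]] gmul_Lim[OF coh_dif[OF mn(1)] mn(3)] e
   gsign_Lim[OF coh_gmul[OF mn(1) coh_dif[OF mn(3)], unfolded e]] by (simp add: leibniz[OF c] fil.lim_add g gsign_closed)
next
 have r: "rhom R (deg0 A)=rhom R (deg0 A)" by simp
 note rh = rh_cl[OF rmap_hom, simplified] rh_mul[OF rmap_hom, simplified]
  rh_add[OF rmap_hom, simplified] rh_one[OF rmap_hom, simplified]
 show "rmap C : rhom R (deg0 C)"
 proof (rule rhI)
  fix x assume x: "x:[R]"
  show "rmap C x:[deg0 C]" unfolding rmap_lim using Lim_cl[OF coh_const[OF rh(1)[OF x]]] by simp
  fix y assume y: "y:[R]"
  note g = gmul_Lim[OF coh_const[OF rh(1)[OF x]] coh_const[OF rh(1)[OF y]]]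
  show "rmap C (x *[R]y)=rmap C x *[deg0 C]rmap C y" using g by (simp add: rmap_lim rh x y)
  show "rmap C (x +[R]y)=rmap C x +[deg0 C]rmap C y" by (simp add: rmap_lim rh x y fil.lim_add)
 next
  show "rmap C 1[R]=1[deg0 C]" by (simp add: rmap_lim gone_lim rh)
 qed
next
 fix r assume r: "r:[R]"
 show "dif C 0 (rmap C r)=0[gr C 1]" unfolding rmap_lim dif_Lim[OF coh_const[OF rmap_closed[OF r]]] by (simp add: dif_rmap[OF r] fil.lim_0)
qed

sublocale lim: strict_cdga R C by (rule lim_strict_dg)

abbreviation "\<tau> i \<equiv> to_lim (gr A i) (Fil i)"

lemma tau_hom: "\<tau> i : ahom (gr A i) (gr C i)" using fil.to_lim_hom by simp

lemma tau_gmul: "x:[gr A i]==>y:[gr A j] ==>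
  \<tau> (i + j) (gmul A i j x y)=gmul C i j (\<tau> i x) (\<tau> j y)" unfolding fil.to_lim_eq by (simp add: gmul_Lim coh_const)

lemma tau_gone: "\<tau> 0 (gone A)=gone C" by (simp add: gone_lim fil.to_lim_eq)
lemma tau_dif: "x:[gr A i]==>\<tau> (Suc i) (dif A i x)=dif C i (\<tau> i x)" unfolding fil.to_lim_eq by (simp add: dif_Lim coh_const)
lemma tau_rmap: "\<tau> 0 (rmap A r)=rmap C r" by (simp add: rmap_lim fil.to_lim_eq)
lemma tau_gr: "graded_ring_hom A C \<tau>" unfolding grh_def using tau_hom tau_gmul tau_gone by blast

end

lemma (in strict_cdga) pft: "cfil R A (%i. p_fil p (gr A i))"
proof (intro cfil.intro cfil_axioms.intro strict_cdga_axioms)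
 fix i r j x y assume x: "x:[gr A i]" and "y : mults (p ^ r) (gr A j)"
 thus "gmul A i j x y : mults (p ^ r) (gr A (i + j))" using gpair.ah_muls[OF gr_pair lmul_hom[OF x]] by blast
next
 fix x i r assume "x : mults (p ^ r) (gr A i)"
 thus "dif A i x : mults (p ^ r) (gr A (Suc i))" using gpair.ah_muls[OF gr_pair dif_hom] by blast
qed (simp_all add: gr.muls_sub gr.muls_dvd)

section \<open>The log de Rham complex\<close>

lemma frag_extend_add_fun: "frag_extend (%g. f g + h g) x=frag_extend f x + frag_extend h x" by (simp add: frag_extend_def frag_cmul_distrib2 sum.distrib)
lemma frag_cmul_diff_right: "frag_cmul c (a - b)=frag_cmul c a - frag_cmul c b" using frag_cmul_distrib2[of c "a - b" b] by (simp add: algebra_simps)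
lemma frag_extend_diff_fun: "frag_extend (%g. f g - h g) x=frag_extend f x - frag_extend h x" by (simp add: frag_extend_def frag_cmul_diff_right sum_subtractf)
lemma frag_extend_0_fun: "frag_extend (%g. 0) x=0" by (simp add: frag_extend_def)

text \<open>The homogeneous relations of degree \<open>e\<close> that generate \<^const>\<open>form_rel\<close> as a two-sided ideal.\<close>

inductive brel ::
 "('s, 'n, 'y) prelog_scheme => ('a, 'l, 's, 'n, 'z) prelog_alg_scheme => nat => ('a, 'l) form => bool"
 for S A where
  b_coeff: "[|a:[pr A]; b:[pr A]|] ==>
   brel S A 0 (frg (a +[pr A]b, []) - (frg (a, []) + frg (b, [])))"
 | b_d_add: "[|b:[pr A]; c:[pr A]|] ==>
   brel S A 1 (frg (1[pr A], [Dsym (b +[pr A]c)])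
    - (frg (1[pr A], [Dsym b]) + frg (1[pr A], [Dsym c])))"
 | b_d_mult: "[|b:[pr A]; c:[pr A]|] ==>
   brel S A 1 (frg (1[pr A], [Dsym (b *[pr A]c)])
    - (frg (b, [Dsym c]) + frg (c, [Dsym b])))"
 | b_d_base: "s:[pr S]==>brel S A 1 (frg (1[pr A], [Dsym (rstr A s)]))"
 | b_dlog_mult: "[|l:[pmon A]; m:[pmon A]|] ==>
   brel S A 1 (frg (1[pr A], [Lsym (l *[pmon A]m)])
    - (frg (1[pr A], [Lsym l]) + frg (1[pr A], [Lsym m])))"
 | b_dlog_base: "n:[pmon S]==>brel S A 1 (frg (1[pr A], [Lsym (nstr A n)]))"
 | b_log: "l:[pmon A] ==>
   brel S A 1 (frg (1[pr A], [Dsym (palpha A l)]) - frg (palpha A l, [Lsym l]))"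
 | b_square: "s : dsyms A==>brel S A 2 (frg (1[pr A], [s, s]))"
 | b_swap: "[|s : dsyms A; t : dsyms A|] ==>
   brel S A 2 (frg (1[pr A], [s, t]) + frg (1[pr A], [t, s]))"

definition fsgn :: "nat => 'a::ab_group_add => 'a" where
 "fsgn n x=(if even n then x else - x)"

lemma fsgn_s [simp]: "fsgn 0 x=x" "fsgn (Suc n) x=- fsgn n x" "fsgn n 0=0"
 "fsgn m (fsgn n x)=fsgn (m + n) x" "fsgn n (- x)=- fsgn n x" by (auto simp: fsgn_def)

lemma fsgn_diff: "fsgn n (x - y)=fsgn n x - fsgn n y" by (auto simp: fsgn_def)

locale prelog_algebra =
 fixes S :: "('s, 'n, 'y) prelog_scheme" and A :: "('a, 'l, 's, 'n, 'z) prelog_alg_scheme"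
 assumes ring_A: "cring (pr A)" and mon_A: "Group.comm_monoid (pmon A)"
  and al_A: "palpha A : monoid_maps (pmon A) (pr A)"
  and rstr_A: "rstr A : rhom (pr S) (pr A)"
  and nstr_A: "nstr A : monoid_maps (pmon S) (pmon A)"
  and one_S: "1[pr S]:[pr S]"
begin

sublocale K: cring "pr A" by (rule ring_A)
sublocale M: Group.comm_monoid "pmon A" by (rule mon_A)

abbreviation star (infixl "**" 70) where "x ** y \<equiv> form_mult A x y"
abbreviation "words i \<equiv> {w. length w=i & set w <= dsyms A}"
abbreviation "FF i \<equiv> carrier (free_forms A i)"
abbreviation "rel i \<equiv> form_rel S A i"
abbreviation "om \<equiv> log_de_rham S A"

lemma al_cl [simp]: "l:[pmon A]==>palpha A l:[pr A]" using al_A by (auto simp: mm_def hom_def)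
lemma rstr_cl [simp]: "s:[pr S]==>rstr A s:[pr A]" using rstr_A by (rule rh_cl)
lemma nstr_cl [simp]: "n:[pmon S]==>nstr A n:[pmon A]" using nstr_A by (auto simp: mm_def hom_def)

lemma dsyms_s [simp]:
 "Dsym a : dsyms A \<longleftrightarrow> a:[pr A]" "Lsym l : dsyms A \<longleftrightarrow> l:[pmon A]" by (auto simp: dsyms_def)

lemma FF_0 [simp]: "0 : FF i"
 and FF_of: "frg (a, w) : FF i \<longleftrightarrow> a:[pr A] & w : words i" by (auto simp: free_forms_def keys_frag_of)

lemma FF_diff: assumes "x : FF i" "y : FF i" shows "x - y : FF i" using assms keys_diff[of x y] unfolding free_forms_def by simp blast
lemma FF_add: assumes "x : FF i" "y : FF i" shows "x + y : FF i" using assms keys_add[of x y] unfolding free_forms_def by simp blast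
lemma FF_sub: assumes "x : FF i" shows "- x : FF i" using FF_diff[OF FF_0 assms] by simp

lemma FF_ind [consumes 1, case_names zero of diff]:
 assumes "x : FF i" "P 0"
  and "!!a w. a:[pr A]==>length w=i==>set w <= dsyms A==>P (frg (a, w))"
  and "!!x y. x : FF i==>y : FF i==>P x==>P y==>P (x - y)"
 shows "P x"
proof -
 have "Poly_Mapping.keys x <= carrier (pr A) \<times> words i" using assms(1) by (simp add: free_forms_def)
 hence "x : FF i & P x" by (rule frag_induction) (use assms(2-4) in \<open>auto simp: FF_of FF_diff\<close>)
 thus ?thesis ..
qed

lemma free_forms_s [simp]: "0[free_forms A i]=0" "x +[free_forms A i]y=x + y" by (simp_all add: free_forms_def)
lemma FF_grp: "abelian_group (free_forms A i)" by (rule abelian_groupI) (auto simp: FF_add algebra_simps intro!: bexI[of _ "- _"] FF_sub)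

sublocale FF: abelian_group "free_forms A i" for i by (rule FF_grp)

lemma FF_a_inv [simp]: "x : FF i==>-[free_forms A i] x=- x" by (rule FF.minus_equality) (auto simp: FF_sub)
lemma FF_a_sub [simp]: "x : FF i==>y : FF i==>x -[free_forms A i]y=x - y" by (simp add: FF.minus_eq)

section \<open>The concatenation product of forms and the ideal of relations\<close>

lemma star_of: "frg (a, w) ** frg (b, v)=frg (a *[pr A]b, w @ v)" by (simp add: form_mult_def)

lemma star_add_l: "(x + y) ** z=x ** z + y ** z"
 and star_diff_l: "(x - y) ** z=x ** z - y ** z"
 and star_zero_l [simp]: "0 ** z=0"
 and star_neg_l: "(- x) ** z=- (x ** z)" by (simp_all add: form_mult_def frag_extend_add frag_extend_diff frag_extend_minus)

lemma star_diff_r: "x ** (y - z)=x ** y - x ** z"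
 and star_add_r: "x ** (y + z)=x ** y + x ** z"
 and star_zero_r [simp]: "x ** 0=0" by (simp_all add: form_mult_def frag_extend_diff frag_extend_add split_def frag_extend_0_fun)
  (simp_all add: frag_extend_diff_fun frag_extend_add_fun)

lemma star_neg_r: "x ** (- z)=- (x ** z)" using star_diff_r[of x 0 z] by simp

lemmas star_lin = star_of star_add_l star_diff_l star_diff_r star_add_r star_neg_l star_neg_r

lemma star_cl: assumes "x : FF i" "y : FF j" shows "x ** y : FF (i + j)" using assms(1)
proof (induction rule: FF_ind)
 case (of a w)
 note aw = this
 from assms(2) show ?case by (induction rule: FF_ind) (use aw in \<open>auto simp: star_lin FF_of FF_diff\<close>)
qed (auto simp: star_lin FF_diff)

lemma star_as: assumes "x : FF i" "y : FF j" "z : FF k" shows "x ** y ** z=x ** (y ** z)" using assms(1)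
proof (induction rule: FF_ind)
 case (of a w)
 note aw = this
 from assms(2) show ?case
 proof (induction rule: FF_ind)
  case (of b v)
  from assms(3) show ?case by (induction rule: FF_ind) (use aw of in \<open>auto simp: star_lin K.m_assoc\<close>)
 qed (auto simp: star_lin)
qed (auto simp: star_lin)

lemma star_one: "x : FF i==>frg (1[pr A], []) ** x=x" by (induction rule: FF_ind) (auto simp: star_lin)

lemma star_scalar_cm:
 "x : FF i==>a:[pr A]==>x ** frg (a, [])=frg (a, []) ** x" by (induction rule: FF_ind) (auto simp: star_lin K.m_comm)

lemma brel_cl: "brel S A e x==>x : FF e" by (induction rule: brel.induct) (auto intro!: FF_diff FF_add simp: FF_of)

text \<open>The relations are the two-sided ideal generated by \<open>brel\<close>, put as an
  induction principle: a map compatible with products, possibly up to sign, has to be tested on the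
  nine homogeneous relations and not on their translates by words.\<close>

lemma rel_ind [consumes 1, case_names zero diff gen]:
 assumes "x : rel i" "P 0" "!!x y. x : rel i==>y : rel i==>P x==>P y==>P (x - y)"
  and gen: "!!a u v e x. a:[pr A]==>set u <= dsyms A==>set v <= dsyms A ==>
   length u + e + length v=i==>brel S A e x ==>
   P (frg (a, u) ** x ** frg (1[pr A], v))"
 shows "P x" using assms(1)
proof (induction rule: form_rel.induct)
 case (rel_coeff a b w)
 show ?case using gen[OF _ _ _ _ b_coeff[of a A b S], of "1[pr A]" "[]" w] rel_coeff by (simp add: star_lin)
next
 case (rel_d_add a b c u v)
 show ?case using gen[OF _ _ _ _ b_d_add[of b A c S], of a u v] rel_d_add by (simp add: star_lin)
next
 case (rel_d_mult a b c u v)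
 show ?case using gen[OF _ _ _ _ b_d_mult[of b A c S], of a u v] rel_d_mult by (simp add: star_lin)
next
 case (rel_d_base a s u v)
 show ?case using gen[OF _ _ _ _ b_d_base[of s S A], of a u v] rel_d_base by (simp add: star_lin)
next
 case (rel_dlog_mult a l m u v)
 show ?case using gen[OF _ _ _ _ b_dlog_mult[of l A m S], of a u v] rel_dlog_mult by (simp add: star_lin)
next
 case (rel_dlog_base a n u v)
 show ?case using gen[OF _ _ _ _ b_dlog_base[of n S A], of a u v] rel_dlog_base by (simp add: star_lin)
next
 case (rel_log a l u v)
 show ?case using gen[OF _ _ _ _ b_log[of l A S], of a u v] rel_log by (simp add: star_lin)
next
 case (rel_square a s u v)
 show ?case using gen[OF _ _ _ _ b_square[of s A S], of a u v] rel_square by (simp add: star_lin)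
next
 case (rel_swap a s t u v)
 show ?case using gen[OF _ _ _ _ b_swap[of s A t S], of a u v] rel_swap by (simp add: star_lin)
qed (use assms in auto)

lemma rel_gen:
 assumes "brel S A e x" "a:[pr A]" "set u <= dsyms A" "set v <= dsyms A"
  "length u + e + length v=i"
 shows "frg (a, u) ** x ** frg (1[pr A], v) : rel i" using assms(1)
proof (cases rule: brel.cases)
 case (b_coeff b c)
 thus ?thesis using rel_coeff[of "a *[pr A]b" A "a *[pr A]c" "u @ v" i S] assms by (simp add: star_lin K.r_distr)
next
 case (b_d_add b c)
 thus ?thesis using rel_d_add[of a A b c u v i S] assms by (simp add: star_lin)
next
 case (b_d_mult b c)
 thus ?thesis using rel_d_mult[of a A b c u v i S] assms by (simp add: star_lin)
next
 case (b_d_base s)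
 thus ?thesis using rel_d_base[of a A s S u v i] assms by (simp add: star_lin)
next
 case (b_dlog_mult l m)
 thus ?thesis using rel_dlog_mult[of a A l m u v i S] assms by (simp add: star_lin)
next
 case (b_dlog_base n)
 thus ?thesis using rel_dlog_base[of a A n S u v i] assms by (simp add: star_lin)
next
 case (b_log l)
 thus ?thesis using rel_log[of a A l u v i S] assms by (simp add: star_lin)
next
 case (b_square s)
 thus ?thesis using rel_square[of a A s u v i S] assms by (simp add: star_lin)
next
 case (b_swap s t)
 thus ?thesis using rel_swap[of a A s t u v i S] assms by (simp add: star_lin)
qed

lemma brel_rel: assumes "brel S A e x" shows "x : rel e"
proof -
 have "frg (1[pr A], []) ** x ** frg (1[pr A], [])=x" using brel_cl[OF assms] star_scalar_cm[OF brel_cl[OF assms]] by (simp add: star_one)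
 thus ?thesis using rel_gen[OF assms, of "1[pr A]" "[]" "[]"] by simp
qed

lemma rel_FF: "x : rel i==>x : FF i"
proof (induction rule: rel_ind)
 case (gen a u v e x)
 thus ?case using star_cl[OF star_cl[OF _ brel_cl[OF gen(5)]], of "frg (a, u)" "length u"
    "frg (1[pr A], v)" "length v"] by (simp add: FF_of)
qed (auto simp: FF_diff)

lemma rel_neg: "x : rel i==>- x : rel i" using rel_diff[OF rel_zero, of x S A i] by simp
lemma rel_add: "x : rel i==>y : rel i==>x + y : rel i" using rel_diff[OF _ rel_neg, of x i y] by simp
lemma rel_fsgn: "x : rel i==>fsgn n x : rel i" by (simp add: fsgn_def rel_neg)
lemma rel_sub: "asub (rel i) (free_forms A i)" by (rule FF.subgroupI) (auto simp: rel_FF form_rel.rel_zero form_rel.rel_diff)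

lemma rel_idl_l: assumes "x : FF i" "y : rel j" shows "x ** y : rel (i + j)" using assms(1)
proof (induction rule: FF_ind)
 case (of b w)
 note bw = this
 have B: "frg (b, w) : FF i" using of by (simp add: FF_of)
 from assms(2) show ?case
 proof (induction rule: rel_ind)
  case (gen a u v e x)
  have U: "frg (a, u) : FF (length u)" "frg (1[pr A], v) : FF (length v)" using gen by (auto simp: FF_of)
  note X = brel_cl[OF gen(5)]
  have "frg (b, w) ** (frg (a, u) ** x ** frg (1[pr A], v)) =
    frg (b *[pr A]a, w @ u) ** x ** frg (1[pr A], v)" using star_as[OF B star_cl[OF U(1) X] U(2)] star_as[OF B U(1) X] by (simp add: star_of)
  thus ?case using rel_gen[OF gen(5), of "b *[pr A]a" "w @ u" v "i + j"] gen bw by simp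
 qed (auto simp: star_lin form_rel.rel_zero form_rel.rel_diff)
qed (auto simp: star_lin form_rel.rel_zero form_rel.rel_diff)

text \<open>A generator carries its coefficient on the far left, so the coefficient \<open>b\<close>
  of the right factor has to travel through \<open>x\<close> and \<open>u\<close>; this uses that
  the coefficient ring is commutative.\<close>

lemma rel_idl_r: assumes "x : rel i" "y : FF j" shows "x ** y : rel (i + j)" using assms(2)
proof (induction rule: FF_ind)
 case (of b w)
 note bw = this
 have B: "frg (b, []) : FF 0" "frg (1[pr A], w) : FF j" "frg (b, w) : FF j" using of by (auto simp: FF_of)
 have Bw: "frg (b, w)=frg (b, []) ** frg (1[pr A], w)" using of by (simp add: star_of)
 from assms(1) show ?case
 proof (induction rule: rel_ind)
  case (gen a u v e x)
  have U: "frg (a, u) : FF (length u)" "frg (1[pr A], v) : FF (length v)" using gen by (auto simp: FF_of)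
  note X = brel_cl[OF gen(5)]
  note UX = star_cl[OF U(1) X]
  have "frg (a, u) ** x ** frg (1[pr A], v) ** frg (b, w)
    = frg (a, u) ** x ** (frg (b, v @ w))" using star_as[OF UX U(2) B(3)] bw gen by (simp add: star_of)
  also have "frg (b, v @ w)=frg (b, []) ** frg (1[pr A], v @ w)" using bw by (simp add: star_of)
  also have "frg (a, u) ** x ** (frg (b, []) ** frg (1[pr A], v @ w)) =
    frg (a, u) ** x ** frg (b, []) ** frg (1[pr A], v @ w)" using bw gen by (subst star_as[OF UX B(1), of _ "length (v @ w)"]) (auto simp: FF_of)
  also have "frg (a, u) ** x ** frg (b, [])=frg (b *[pr A]a, u) ** x" using star_scalar_cm[OF UX bw(1)] star_as[OF B(1) U(1) X] by (simp add: star_of)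
  finally show ?case using rel_gen[OF gen(5), of "b *[pr A]a" u "v @ w" "i + j"] gen bw by simp
 qed (auto simp: star_lin form_rel.rel_zero form_rel.rel_diff)
qed (auto simp: star_lin form_rel.rel_zero form_rel.rel_diff)

lemma rel_tr: "x - y : rel i==>y - z : rel i==>x - z : rel i" using rel_add[of "x - y" i "y - z"] by simp

text \<open>One application of \<open>rel_swap\<close> for each letter of \<open>v\<close>, each
  contributing a sign. Graded commutativity, the Leibniz rule and the vanishing of odd squares are
  read off from this.\<close>

lemma move_sym:
 assumes "a:[pr A]" "set u <= dsyms A" "s : dsyms A" "set v <= dsyms A" "set r <= dsyms A"
  "length u + Suc (length v) + length r=i"
 shows "frg (a, u @ s # v @ r) - fsgn (length v) (frg (a, u @ v @ s # r)) : rel i" using assms(2,4,6)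
proof (induction v arbitrary: u)
 case Nil thus ?case by (simp add: form_rel.rel_zero)
next
 case (Cons t v)
 have 1: "frg (a, u @ s # t # v @ r) - (- frg (a, u @ t # s # v @ r)) : rel i" using rel_swap[of a A s t u "v @ r" i S] Cons assms by simp
 have "frg (a, u @ t # s # v @ r) - fsgn (length v) (frg (a, u @ t # v @ s # r)) : rel i" using Cons.IH[of "u @ [t]"] Cons.prems by simp
 from rel_neg[OF this]
 have 2: "(- frg (a, u @ t # s # v @ r)) - fsgn (length (t # v)) (frg (a, u @ (t # v) @ s # r)) : rel i" by simp
 show ?case using rel_tr[OF 1 2] by simp
qed

lemma move_word:
 assumes "a:[pr A]" "set u <= dsyms A" "set w <= dsyms A" "set v <= dsyms A"
  "length u + length w + length v=i"
 shows "frg (a, u @ w @ v) - fsgn (length w * length v) (frg (a, u @ v @ w)) : rel i" using assms(2,3,5)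
proof (induction w arbitrary: u)
 case Nil thus ?case by (simp add: form_rel.rel_zero)
next
 case (Cons s w)
 have 1: "frg (a, u @ (s # w) @ v) - fsgn (length w * length v) (frg (a, u @ s # v @ w)) : rel i" using Cons.IH[of "u @ [s]"] Cons.prems by simp
 have "frg (a, u @ s # v @ w) - fsgn (length v) (frg (a, u @ v @ s # w)) : rel i" using move_sym[of a u s v w i] Cons assms by simp
 from rel_fsgn[OF this, of "length w * length v"]
 have 2: "fsgn (length w * length v) (frg (a, u @ s # v @ w))
   - fsgn (length (s # w) * length v) (frg (a, u @ v @ s # w)) : rel i" by (simp add: fsgn_diff add.commute)
 show ?case using rel_tr[OF 1 2] by simp
qed

lemma star_cm:
 assumes "x : FF i" "y : FF j" shows "x ** y - fsgn (i * j) (y ** x) : rel (i + j)" using assms(1)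
proof (induction rule: FF_ind)
 case (of a w)
 note aw = this
 from assms(2) show ?case
 proof (induction rule: FF_ind)
  case (of b v)
  show ?case using move_word[of "a *[pr A]b" "[]" w v "i + j"] aw of by (simp add: star_of K.m_comm)
 next
  case (diff x y)
  show ?case using rel_diff[OF diff(3,4)] by (simp add: star_lin fsgn_diff algebra_simps)
 qed (auto simp: form_rel.rel_zero)
next
 case (diff x y)
 show ?case using rel_diff[OF diff(3,4)] by (simp add: star_lin fsgn_diff algebra_simps)
qed (auto simp: form_rel.rel_zero)

text \<open>For a single word \<open>s # w'\<close> of odd length the tail has even length, so the
  second \<open>s\<close> moves next to the first without a sign, and a doubled letter is a
  relation. For differences of forms the cross terms cancel by graded commutativity.\<close>

lemma star_square:
 assumes "odd i" "x : FF i" shows "x ** x : rel (i + i)" using assms(2)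
proof (induction rule: FF_ind)
 case (of a w)
 obtain s w' where w: "w=s # w'" using of assms(1) by (cases w) auto
 have "frg (a *[pr A]a, [s] @ w' @ ([s] @ w'))
   - fsgn (length w') (frg (a *[pr A]a, [s] @ [s] @ w' @ w')) : rel (i + i)"
 proof -
  have *: "frg (a *[pr A]a, [s] @ s # w' @ w') - fsgn (length w') (frg (a *[pr A]a, [s] @ w' @ s # w')) : rel (i + i)" by (rule move_sym) (use of w in auto)
  have "even (length w')" using assms(1) of w by auto
  thus ?thesis using rel_neg[OF *] by (simp add: fsgn_def)
 qed
 moreover have "fsgn (length w') (frg (a *[pr A]a, [s] @ [s] @ w' @ w')) : rel (i + i)" using rel_square[of "a *[pr A]a" A s "[]" "w' @ w'" "i + i" S] of w by (intro rel_fsgn) auto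
 ultimately show ?case using rel_add by (fastforce simp: star_of w)
next
 case (diff x y)
 have "x ** y + y ** x : rel (i + i)" using star_cm[OF diff(1,2)] assms(1) by (simp add: fsgn_def)
 hence "x ** x + y ** y - (x ** y + y ** x) : rel (i + i)" using rel_add[OF diff(3,4)] form_rel.rel_diff by blast
 thus ?case by (simp add: star_lin algebra_simps)
qed (auto simp: form_rel.rel_zero)

section \<open>The differential on words\<close>

lemma fdif_of [simp]: "form_dif A (frg (a, w))=frg (1[pr A], Dsym a # w)" by (simp add: form_dif_def)

lemma fdif_lin: "form_dif A (x - y)=form_dif A x - form_dif A y" "form_dif A (x + y)=form_dif A x + form_dif A y"
 "form_dif A 0=0" "form_dif A (- x)=- form_dif A x" by (simp_all add: form_dif_def frag_extend_diff frag_extend_add frag_extend_minus)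

lemma fdif_cl: "x : FF i==>form_dif A x : FF (Suc i)" by (induction rule: FF_ind) (auto simp: fdif_lin FF_diff FF_of)

lemma fdif_leibniz:
 assumes "x : FF i" "y : FF j"
 shows "form_dif A (x ** y) - (form_dif A x ** y + fsgn i (x ** form_dif A y)) : rel (Suc (i + j))" using assms(1)
proof (induction rule: FF_ind)
 case (of a w)
 note aw = this
 from assms(2) show ?case
 proof (induction rule: FF_ind)
  case (of b v)
  have 1: "frg (1[pr A], Dsym (a *[pr A]b) # w @ v)
    - (frg (a, Dsym b # w @ v) + frg (b, Dsym a # w @ v)) : rel (Suc (i + j))" using rel_d_mult[of "1[pr A]" A a b "[]" "w @ v" "Suc (i + j)" S] aw of by simp
  have 2: "frg (a, Dsym b # w @ v) - fsgn i (frg (a, w @ Dsym b # v)) : rel (Suc (i + j))" using move_sym[of a "[]" "Dsym b" w v "Suc (i + j)"] aw of by simp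
  show ?case using rel_add[OF 1 2] aw of by (simp add: star_of algebra_simps)
 next
  case (diff x y)
  show ?case using rel_diff[OF diff(3,4)] by (simp add: star_lin fsgn_diff fdif_lin algebra_simps)
 qed (auto simp: form_rel.rel_zero fdif_lin)
next
 case (diff x y)
 show ?case using rel_diff[OF diff(3,4)] by (simp add: star_lin fsgn_diff fdif_lin algebra_simps)
qed (auto simp: form_rel.rel_zero fdif_lin)

text \<open>The unit comes from the base, so \<open>d 1\<close> is a base relation. It matters
  because differentiating a word with coefficient 1 inserts the letter \<open>Dsym 1\<close>: this
  kills \<open>d d\<close> and the differentials of most relations.\<close>

lemma d_one: "frg (1[pr A], [Dsym 1[pr A]]) : rel 1" using brel_rel[OF b_d_base[of "1[pr S]" S A]] one_S rh_one[OF rstr_A] by simp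
lemma d_one_star: assumes "x : FF i" shows "frg (1[pr A], [Dsym 1[pr A]]) ** x : rel (Suc i)" using rel_idl_r[OF d_one assms] by simp

lemma fdif_brel: assumes "brel S A e x" shows "form_dif A x : rel (Suc e)" using assms
proof (cases rule: brel.cases)
 case (b_coeff a b)
 thus ?thesis using brel_rel[OF b_d_add[of a A b S]] by (simp add: fdif_lin)
next
 case (b_d_mult b c)
 have 1: "frg (1[pr A], [Dsym 1[pr A], Dsym (b *[pr A]c)]) : rel 2" using d_one_star[of "frg (1[pr A], [Dsym (b *[pr A]c)])" 1] b_d_mult by (simp add: star_of FF_of numeral_2_eq_2)
 show ?thesis using rel_diff[OF 1 brel_rel[OF b_swap[of "Dsym b" A "Dsym c" S]]] b_d_mult by (simp add: fdif_lin numeral_2_eq_2)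
next
 case (b_log l)
 have 1: "frg (1[pr A], [Dsym 1[pr A], Dsym (palpha A l)]) : rel 2" using d_one_star[of "frg (1[pr A], [Dsym (palpha A l)])" 1] b_log by (simp add: star_of FF_of numeral_2_eq_2)
 \<comment> \<open>\<open>d alpha(l) dlog l = alpha(l) dlog l dlog l\<close>, and the doubled letter
   is zero.\<close>
 have 2: "frg (1[pr A], [Dsym (palpha A l), Lsym l]) - frg (palpha A l, [Lsym l, Lsym l]) : rel 2" using form_rel.rel_log[of "1[pr A]" A l "[]" "[Lsym l]" 2 S] b_log by simp
 have 3: "frg (palpha A l, [Lsym l, Lsym l]) : rel 2" using form_rel.rel_square[of "palpha A l" A "Lsym l" "[]" "[]" 2 S] b_log by simp
 show ?thesis using rel_diff[OF 1 rel_add[OF 2 3]] b_log by (simp add: fdif_lin numeral_2_eq_2)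
next
 case (b_d_add b c)
 show ?thesis using d_one_star[OF brel_cl[OF assms]] b_d_add by (simp add: fdif_lin star_lin)
next
 case (b_d_base s)
 show ?thesis using d_one_star[OF brel_cl[OF assms]] b_d_base by (simp add: fdif_lin star_lin)
next
 case (b_dlog_mult l m)
 show ?thesis using d_one_star[OF brel_cl[OF assms]] b_dlog_mult by (simp add: fdif_lin star_lin)
next
 case (b_dlog_base n)
 show ?thesis using d_one_star[OF brel_cl[OF assms]] b_dlog_base by (simp add: fdif_lin star_lin)
next
 case (b_square s)
 show ?thesis using d_one_star[OF brel_cl[OF assms]] b_square by (simp add: fdif_lin star_lin)
next
 case (b_swap s t)
 show ?thesis using d_one_star[OF brel_cl[OF assms]] b_swap by (simp add: fdif_lin star_lin)
qed

lemma fdif_rel: "x : rel i==>form_dif A x : rel (Suc i)"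
proof (induction rule: rel_ind)
 case (gen a u v e x)
 let ?U = "frg (a, u)" and ?V = "frg (1[pr A], v)"
 have U: "?U : FF (length u)" "?V : FF (length v)" using gen by (auto simp: FF_of)
 note X = brel_cl[OF gen(5)] and x = brel_rel[OF gen(5)]
 have i: "length u + e + length v=i" by fact
 have a: "form_dif A (?U ** x) ** ?V + fsgn (length u + e) (?U ** x ** form_dif A ?V) : rel (Suc i)"
 proof (rule rel_add)
  have "form_dif A (?U ** x) : rel (Suc (length u + e))"
  proof -
   have "form_dif A ?U ** x + fsgn (length u) (?U ** form_dif A x) : rel (Suc (length u + e))" using rel_idl_l[OF fdif_cl[OF U(1)] x] rel_idl_l[OF U(1) fdif_brel[OF gen(5)]] by (intro rel_add rel_fsgn) simp_all
   with fdif_leibniz[OF U(1) X] show ?thesis using rel_add by fastforce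
  qed
  from rel_idl_r[OF this U(2)] show "form_dif A (?U ** x) ** ?V : rel (Suc i)" using i by simp
  show "fsgn (length u + e) (?U ** x ** form_dif A ?V) : rel (Suc i)" using rel_idl_r[OF rel_idl_l[OF U(1) x] fdif_cl[OF U(2)]] i by (intro rel_fsgn) simp
 qed
 have b: "form_dif A (?U ** x ** ?V) - (form_dif A (?U ** x) ** ?V + fsgn (length u + e) (?U ** x ** form_dif A ?V)) : rel (Suc i)" using fdif_leibniz[OF star_cl[OF U(1) X] U(2)] i by simp
 show ?case using rel_add[OF b a] by simp
qed (auto simp: fdif_lin form_rel.rel_zero form_rel.rel_diff)

lemma fdif_dif: "x : FF i==>form_dif A (form_dif A x) : rel (Suc (Suc i))"
proof (induction rule: FF_ind)
 case (of a w)
 show ?case using d_one_star[of "frg (1[pr A], Dsym a # w)" "Suc i"] of by (simp add: star_of FF_of)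
qed (auto simp: fdif_lin form_rel.rel_zero form_rel.rel_diff)

section \<open>The log de Rham complex as a quotient\<close>

abbreviation "cl i x \<equiv> form_rel S A i +>[free_forms A i] x"

lemma fcl_cl: "form_class S A i g=cl i (frg g)" by (simp add: form_class_def)
lemma gr_om: "gr om i=free_forms A i Quot rel i" by (simp add: log_de_rham_def)
lemma om_car: "X:[gr om i] \<longleftrightarrow> (\<exists>x\<in>FF i. X=cl i x)" by (simp add: gr_om FF.quot_car)
lemma om_grp: "abelian_group (gr om i)" unfolding gr_om by (rule abelian_grp_quot[OF FF_grp rel_sub])
lemma cl_hom: "cl i : ahom (free_forms A i) (gr om i)" unfolding gr_om by (rule quot_hom[OF FF_grp rel_sub])
lemma cl_cl: "x : FF i==>cl i x:[gr om i]" by (rule ah_cl[OF cl_hom])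
lemma om_pair: "gpair (free_forms A i) (gr om i)" by (intro gpair.intro FF_grp om_grp)
lemma cl_add: "x : FF i==>y : FF i==>cl i x +[gr om i]cl i y=cl i (x + y)" using ah_add[OF cl_hom] by simp
lemma cl_neg: "x : FF i==>-[gr om i] cl i x=cl i (- x)" using gpair.ah_neg[OF om_pair cl_hom] by simp
lemma cl_diff: "x : FF i==>y : FF i==>cl i x -[gr om i]cl i y=cl i (x - y)" using gpair.ah_sub[OF om_pair cl_hom] by simp
lemma cl_0: "0[gr om i]=cl i 0" using gpair.ah_0[OF om_pair cl_hom] by simp
lemma cl_eq_iff: "x : FF i==>y : FF i==>cl i x=cl i y \<longleftrightarrow> x - y : rel i" using FF.cos_eq_iff[OF rel_sub] by simp

lemma gmul_cl:
 assumes "x : FF i" "y : FF j" shows "gmul om i j (cl i x) (cl j y)=cl (i + j) (x ** y)"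
proof -
 have "coset_map2 (free_forms A (i + j)) (rel (i + j)) (form_mult A) (cl i x) (cl j y)=cl (i + j) (x ** y)"
 proof (rule cos_map2_cos[OF FF_grp rel_sub assms(1) FF_grp rel_sub assms(2)])
  fix z w assume z: "z : FF i" "z -[free_forms A i]x : rel i" and w: "w : FF j" "w -[free_forms A j]y : rel j"
  have "z ** (w - y) + (z - x) ** y : rel (i + j)" using z w assms by (intro rel_add rel_idl_l rel_idl_r) simp_all
  thus "cl (i + j) (z ** w)=cl (i + j) (x ** y)" using z w assms by (subst cl_eq_iff) (auto simp: star_cl star_lin)
 qed
 thus ?thesis by (simp add: log_de_rham_def)
qed

lemma dif_cl: assumes "x : FF i" shows "dif om i (cl i x)=cl (Suc i) (form_dif A x)"
proof -
 have "coset_map (free_forms A (Suc i)) (rel (Suc i)) (form_dif A) (cl i x)=cl (Suc i) (form_dif A x)"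
 proof (rule FF.cos_map_cos[OF rel_sub assms])
  fix z assume z: "z : FF i" "z -[free_forms A i]x : rel i"
  hence "form_dif A (z - x) : rel (Suc i)" using assms by (intro fdif_rel) simp
  thus "cl (Suc i) (form_dif A z)=cl (Suc i) (form_dif A x)" using z assms by (subst cl_eq_iff) (auto simp: fdif_cl fdif_lin)
 qed
 thus ?thesis by (simp add: log_de_rham_def)
qed

lemma gone_cl: "gone om=cl 0 (frg (1[pr A], []))" by (simp add: log_de_rham_def fcl_cl)
lemma rmap_cl: "rmap om s=cl 0 (frg (rstr A s, []))" by (simp add: log_de_rham_def fcl_cl)
lemma gsign_cl: "x : FF i==>gsign n (gr om i) (cl i x)=cl i (fsgn n x)" by (cases "even n") (simp_all add: gsign_def fsgn_def cl_neg)
lemma fsgn_FF: "x : FF i==>fsgn n x : FF i" by (simp add: fsgn_def FF_sub)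

lemma rel_0_add:
 "a:[pr A]==>b:[pr A] ==>
  cl 0 (frg (a +[pr A]b, []))=cl 0 (frg (a, [])) +[gr om 0]cl 0 (frg (b, []))" using brel_rel[OF b_coeff[of a A b S]] by (simp add: cl_add FF_of cl_eq_iff FF_add)

lemma om_strict_dg: "strict_cdga (pr S) om"
proof (unfold strict_cdga_def, intro conjI allI impI)
 fix i show "abelian_group (gr om i)" by (rule om_grp)
next
 fix x i y j assume "x:[gr om i]" "y:[gr om j]"
 thus "gmul om i j x y:[gr om (i + j)]" by (auto simp: om_car gmul_cl star_cl)
next
 show "gone om:[gr om 0]" by (simp add: gone_cl cl_cl FF_of)
next
 fix x i x' y j assume "x:[gr om i]" "x':[gr om i]" "y:[gr om j]"
 thus "gmul om i j (x +[gr om i]x') y=gmul om i j x y +[gr om (i + j)]gmul om i j x' y" by (auto simp: om_car gmul_cl star_cl cl_add FF_add star_lin)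
next
 fix x i x' y j assume "x:[gr om i]" "x':[gr om j]" "y:[gr om j]"
 thus "gmul om i j x (x' +[gr om j]y)=gmul om i j x x' +[gr om (i + j)]gmul om i j x y" by (auto simp: om_car gmul_cl star_cl cl_add FF_add star_lin)
next
 fix x i y j z l assume "x:[gr om i]" "y:[gr om j]" "z:[gr om l]"
 then obtain a b c where "a : FF i" "x=cl i a" "b : FF j" "y=cl j b" "c : FF l" "z=cl l c" by (auto simp: om_car)
 thus "gmul om (i + j) l (gmul om i j x y) z=gmul om i (j + l) x (gmul om j l y z)" by (simp add: gmul_cl star_cl star_as add.assoc)
next
 fix x i assume "x:[gr om i]"
 then obtain a where a: "a : FF i" "x=cl i a" by (auto simp: om_car)
 have "frg (1[pr A], []) : FF 0" by (simp add: FF_of)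
 from gmul_cl[OF this a(1)] show "gmul om 0 i (gone om) x=x" using a by (simp add: gone_cl star_one)
next
 fix x i y j assume "x:[gr om i]" "y:[gr om j]"
 then obtain a b where a: "a : FF i" "x=cl i a" and b: "b : FF j" "y=cl j b" by (auto simp: om_car)
 have c: "b ** a : FF (i + j)" using star_cl[OF b(1) a(1)] by (simp add: add.commute)
 have "gmul om j i y x=cl (i + j) (b ** a)" using gmul_cl[OF b(1) a(1)] a b by (simp add: add.commute)
 thus "gmul om i j x y=gsign (i * j) (gr om (i + j)) (gmul om j i y x)" using a b c star_cm[OF a(1) b(1)] by (simp add: gmul_cl gsign_cl) (simp add: cl_eq_iff star_cl fsgn_FF)
next
 fix i x assume i: "odd (i::nat)" "x:[gr om i]"
 then obtain a where a: "a : FF i" "x=cl i a" by (auto simp: om_car)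
 thus "gmul om i i x x=0[gr om (i + i)]" using star_square[OF i(1) a(1)] by (simp add: gmul_cl cl_0 cl_eq_iff star_cl)
next
 fix i show "dif om i : ahom (gr om i) (gr om (Suc i))" by (rule ahI) (auto simp: om_car dif_cl cl_add FF_add fdif_cl fdif_lin)
next
 fix x i assume "x:[gr om i]"
 then obtain a where a: "a : FF i" "x=cl i a" by (auto simp: om_car)
 thus "dif om (Suc i) (dif om i x)=0[gr om (Suc (Suc i))]" using fdif_dif[OF a(1)] by (simp add: dif_cl fdif_cl cl_0 cl_eq_iff)
next
 fix x i y j assume "x:[gr om i]" "y:[gr om j]"
 then obtain a b where a: "a : FF i" "x=cl i a" and b: "b : FF j" "y=cl j b" by (auto simp: om_car)
 have c: "form_dif A a ** b : FF (Suc (i + j))" "a ** form_dif A b : FF (Suc (i + j))" using star_cl[OF a(1) fdif_cl[OF b(1)]] star_cl[OF fdif_cl[OF a(1)] b(1)] by simp_all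
 show "dif om (i + j) (gmul om i j x y)=gmul om (Suc i) j (dif om i x) y
    +[gr om (Suc (i + j))]gsign i (gr om (Suc (i + j))) (gmul om i (Suc j) x (dif om j y))" using gmul_cl[OF a(1) fdif_cl[OF b(1)]] gmul_cl[OF fdif_cl[OF a(1)] b(1)]
   fdif_leibniz[OF a(1) b(1)] c by (simp add: a b gmul_cl dif_cl star_cl gsign_cl)
   (simp add: a b cl_add cl_eq_iff fsgn_FF FF_add star_cl fdif_cl)
next
 show "rmap om : rhom (pr S) (deg0 om)"
 proof (rule rhI)
  fix x y assume xy: "x:[pr S]" "y:[pr S]"
  show "rmap om (x *[pr S]y)=rmap om x *[deg0 om]rmap om y" using xy gmul_cl[of "frg (rstr A x, [])" 0 "frg (rstr A y, [])" 0] by (simp add: rmap_cl FF_of star_of rh_mul[OF rstr_A])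
  show "rmap om (x +[pr S]y)=rmap om x +[deg0 om]rmap om y" using xy by (simp add: rmap_cl rel_0_add rh_add[OF rstr_A])
 qed (auto simp: rmap_cl gone_cl FF_of rh_one[OF rstr_A] intro: cl_cl)
next
 fix s assume s: "s:[pr S]"
 have "frg (rstr A s, []) : FF 0" using s by (simp add: FF_of)
 from dif_cl[OF this] show "dif om 0 (rmap om s)=0[gr om 1]" using brel_rel[OF b_d_base[OF s]] s by (simp add: rmap_cl cl_0 cl_eq_iff FF_of)
qed

sublocale omega: strict_cdga "pr S" om by (rule om_strict_dg)

lemma form_class_closed:
 "a:[pr A]==>w : words i==>form_class S A i (a, w):[gr om i]" by (simp add: fcl_cl cl_cl FF_of)

lemma fcl_mul:
 "a:[pr A]==>b:[pr A]==>w : words i==>v : words j ==>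
  gmul om i j (form_class S A i (a, w)) (form_class S A j (b, v))=form_class S A (i + j) (a *[pr A]b, w @ v)" by (simp add: fcl_cl gmul_cl FF_of star_of)

lemma fcl_dif:
 "a:[pr A]==>w : words i ==>
  dif om i (form_class S A i (a, w))=form_class S A (Suc i) (1[pr A], Dsym a # w)" by (simp add: fcl_cl dif_cl FF_of)

lemma om_hom_eqI:
 assumes "abelian_group G" and h: "h : ahom (gr om i) G" and k: "k : ahom (gr om i) G"
  and eq: "!!a w. a:[pr A]==>w : words i==>h (form_class S A i (a, w))=k (form_class S A i (a, w))"
  and "x:[gr om i]"
 shows "h x=k x"
proof -
 interpret G: abelian_group G by fact
 interpret gpair "gr om i" G by (intro gpair.intro om_grp assms(1))
 obtain a where a: "a : FF i" "x=cl i a" using assms(5) by (auto simp: om_car)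
 from a(1) have "h (cl i a)=k (cl i a)"
 proof (induction rule: FF_ind)
  case zero
  thus ?case using ah_0[OF h] ah_0[OF k] by (simp add: cl_0)
 next
  case (of a w)
  thus ?case using eq by (simp add: fcl_cl)
 next
  case (diff x y)
  thus ?case using ah_sub[OF h] ah_sub[OF k] by (simp add: cl_cl flip: cl_diff)
 qed
 thus ?thesis by (simp add: a)
qed

end

text \<open>A log derivation from \<open>A\<close> to degree one of a graded-commutative algebra \<open>E\<close> along a ring
 map \<open>f\<close>. The map \<open>D\<close> is not required to be the differential of \<open>E\<close> composed with \<open>f\<close>.\<close>

locale log_derivation = prelog_algebra S A + E: strict_cdga RE E
 for S :: "('s, 'n, 'y) prelog_scheme" and A :: "('a, 'l, 's, 'n, 'z) prelog_alg_scheme"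
  and RE :: "('r, 'w) ring_scheme" and E :: "('e, 'r, 'v) cdga_scheme" +
 fixes f :: "'a => 'e" and D :: "'a => 'e" and \<delta> :: "'l => 'e"
 assumes f: "f : rhom (pr A) (deg0 E)"
  and D_cl: "a:[pr A]==>D a:[gr E 1]"
  and D_add: "[|a:[pr A]; b:[pr A]|]==>D (a +[pr A]b)=D a +[gr E 1]D b"
  and D_mul: "[|a:[pr A]; b:[pr A]|] ==>
   D (a *[pr A]b)=gmul E 0 1 (f a) (D b) +[gr E 1]gmul E 0 1 (f b) (D a)"
  and D_base: "s:[pr S]==>D (rstr A s)=0[gr E 1]"
  and delta_cl: "l:[pmon A]==>\<delta> l:[gr E 1]"
  and delta_mul: "[|l:[pmon A]; m:[pmon A]|]==>\<delta> (l *[pmon A]m)=\<delta> l +[gr E 1]\<delta> m"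
  and delta_base: "n:[pmon S]==>\<delta> (nstr A n)=0[gr E 1]"
  and D_log: "l:[pmon A]==>D (palpha A l)=gmul E 0 1 (f (palpha A l)) (\<delta> l)"
begin

fun sym_val :: "('a, 'l) dsym => 'e" where
 "sym_val (Dsym a)=D a"
| "sym_val (Lsym l)=\<delta> l"

fun wv :: "('a, 'l) dsym list => 'e" where
 "wv []=gone E"
| "wv (s # w)=gmul E 1 (length w) (sym_val s) (wv w)"

definition gen_val :: "'a \<times> ('a, 'l) dsym list => 'e" where
 "gen_val=(%(a, w). gmul E 0 (length w) (f a) (wv w))"

lemma f_closed [simp]: "a:[pr A]==>f a:[gr E 0]" using rh_cl[OF f] by simp
lemma f_mul: "a:[pr A]==>b:[pr A]==>f (a *[pr A]b)=gmul E 0 0 (f a) (f b)" using rh_mul[OF f] by simp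
lemma f_one: "f 1[pr A]=gone E" using rh_one[OF f] by simp
lemma f_add: "a:[pr A]==>b:[pr A]==>f (a +[pr A]b)=f a +[gr E 0]f b" using rh_add[OF f] by simp
lemma sym_val_cl: "s : dsyms A==>sym_val s:[gr E 1]" by (cases s) (simp_all add: D_cl delta_cl del: One_nat_def)

lemma wval_cl: "set w <= dsyms A==>wv w:[gr E (length w)]"
proof (induction w)
 case Nil thus ?case by (simp add: E.gone_closed)
next
 case (Cons s w)
 thus ?case using E.gmul_closed[OF sym_val_cl, of s "wv w" "length w"] by simp
qed

lemma wval_append:
 "set u <= dsyms A==>set v <= dsyms A ==>
  wv (u @ v)=gmul E (length u) (length v) (wv u) (wv v)"
proof (induction u)
 case Nil thus ?case by (simp add: E.gone_l wval_cl)
next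
 case (Cons s u)
 thus ?case using E.assoc[OF sym_val_cl wval_cl wval_cl, of s u v] by simp
qed

lemma gen_val_cl: "a:[pr A]==>set w <= dsyms A==>gen_val (a, w):[gr E (length w)]" using E.gmul_closed[OF f_closed wval_cl] by (simp add: gen_val_def)

lemma scalar_cm:
 assumes "x:[gr E i]" "a:[gr E 0]" shows "gmul E i 0 x a=gmul E 0 i a x" using E.gcomm[OF assms] by (simp add: gsign_def)

lemma gen_val_mul:
 assumes "a:[pr A]" "b:[pr A]" "set w <= dsyms A" "set v <= dsyms A"
 shows "gen_val (a *[pr A]b, w @ v)=gmul E (length w) (length v) (gen_val (a, w)) (gen_val (b, v))"
proof -
 let ?i = "length w" and ?j = "length v"
 note W = wval_cl[OF assms(3)] and V = wval_cl[OF assms(4)]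
 note a = f_closed[OF assms(1)] and b = f_closed[OF assms(2)]
 have "gmul E ?i ?j (gmul E 0 ?i (f a) (wv w)) (gmul E 0 ?j (f b) (wv v))
  = gmul E 0 (?i + ?j) (f a) (gmul E ?i ?j (wv w) (gmul E 0 ?j (f b) (wv v)))" using E.assoc[OF a W E.gmul_closed[OF b V]] by simp
 also have "gmul E ?i ?j (wv w) (gmul E 0 ?j (f b) (wv v)) =
   gmul E ?i ?j (gmul E ?i 0 (wv w) (f b)) (wv v)" using E.assoc[OF W b V] by simp
 also have "\<dots>=gmul E 0 (?i + ?j) (f b) (gmul E ?i ?j (wv w) (wv v))" using E.assoc[OF b W V] scalar_cm[OF W b] by simp
 also have "gmul E 0 (?i + ?j) (f a) \<dots>=gmul E 0 (?i + ?j) (gmul E 0 0 (f a) (f b)) (wv (w @ v))" using E.assoc[OF a b E.gmul_closed[OF W V]] assms by (simp add: wval_append)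
 finally show ?thesis using assms by (simp add: gen_val_def f_mul)
qed

text \<open>An additive extension of \<open>gen_val\<close> supplied by the universal property of
  the free abelian group; afterwards only additivity and the values on generators enter.\<close>

definition form_val :: "nat => ('a, 'l) form => 'e" where
 "form_val i=(SOME h. h : hom (free_Abelian_group (carrier (pr A) \<times> words i)) (add_monoid (gr E i)) &
   (\<forall>g\<in>carrier (pr A) \<times> words i. h (frg g)=gen_val g))"

lemma form_val: "form_val i : ahom (free_forms A i) (gr E i) &
 (\<forall>a w. a:[pr A] --> w : words i --> form_val i (frg (a, w))=gen_val (a, w))"
proof -
 let ?S = "carrier (pr A) \<times> words i"
 have "gen_val g:[gr E i]" if "g : ?S" for g using that gen_val_cl[of "fst g" "snd g"] by (simp add: mem_Times_iff)
 hence im: "gen_val ` ?S <= carrier (add_monoid (gr E i))" by (simp add: image_subset_iff)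
 obtain h where "h : hom (free_Abelian_group ?S) (add_monoid (gr E i))" "!!g. g : ?S==>h (frg g)=gen_val g" by (rule comm_group.free_Abelian_group_universal[OF E.gr.a_comm_group[of i] im]) blast
 hence *: "\<exists>h. h : hom (free_Abelian_group ?S) (add_monoid (gr E i)) & (\<forall>g\<in>?S. h (frg g)=gen_val g)" by blast
 have e: "ahom (free_forms A i) (gr E i)=hom (free_Abelian_group ?S) (add_monoid (gr E i))" by (auto simp: hom_def free_forms_def)
 show ?thesis unfolding e using someI_ex[OF *] unfolding form_val_def[symmetric] by simp
qed

lemma fval_of: "a:[pr A]==>w : words i==>form_val i (frg (a, w))=gen_val (a, w)" using form_val by blast
lemma fval_hom: "form_val i : ahom (free_forms A i) (gr E i)" using form_val by blast
lemma E_pair: "gpair (free_forms A i) (gr E j)" by unfold_locales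
lemma fval_0: "form_val i 0=0[gr E i]" using gpair.ah_0[OF E_pair fval_hom] by simp
lemma fval_add: "x : FF i==>y : FF i==>form_val i (x + y)=form_val i x +[gr E i]form_val i y" using ah_add[OF fval_hom] by simp
lemma fval_diff: "x : FF i==>y : FF i==>form_val i (x - y)=form_val i x -[gr E i]form_val i y" using gpair.ah_sub[OF E_pair fval_hom] by simp
lemma fval_cl: "x : FF i==>form_val i x:[gr E i]" by (rule ah_cl[OF fval_hom])

lemma fval_star:
 assumes "x : FF i" "y : FF j"
 shows "form_val (i + j) (x ** y)=gmul E i j (form_val i x) (form_val j y)" using assms(1)
proof (induction rule: FF_ind)
 case zero
 thus ?case by (simp add: fval_0 E.gmul_0_l fval_cl assms(2))
next
 case (diff x x')
 thus ?case by (simp add: star_diff_l fval_diff star_cl assms(2) fval_cl E.gmul_sub_l)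
next
 case (of a w)
 note aw = this
 hence F: "frg (a, w) : FF i" by (simp add: FF_of)
 from assms(2) show ?case
 proof (induction rule: FF_ind)
  case zero
  thus ?case using F by (simp add: fval_0 E.gmul_0_r fval_cl)
 next
  case (diff x x')
  thus ?case using F by (simp add: star_diff_r fval_diff star_cl fval_cl E.gmul_sub_r)
 next
  case (of b v)
  show ?case using gen_val_mul[of a b w v] aw of by (simp add: star_of fval_of)
 qed
qed

lemma wval_sym: "s : dsyms A==>wv [s]=sym_val s" using E.gone_r[OF sym_val_cl] by simp
lemma gen_val_one: "set w <= dsyms A==>gen_val (1[pr A], w)=wv w" by (simp add: gen_val_def f_one E.gone_l wval_cl)
lemma gen_val_sym: "s : dsyms A==>gen_val (a, [s])=gmul E 0 1 (f a) (sym_val s)" by (simp add: gen_val_def wval_sym del: wv.simps)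

lemma fval_brel: assumes "brel S A e x" shows "form_val e x=0[gr E e]" using assms
proof (cases rule: brel.cases)
 case (b_coeff a b)
 thus ?thesis by (simp add: fval_diff fval_add FF_of FF_add fval_of gen_val_def f_add E.gone_r)
next
 case (b_d_add b c)
 thus ?thesis by (simp add: fval_diff fval_add FF_of FF_add fval_of gen_val_one wval_sym D_add D_cl
   del: wv.simps One_nat_def)
next
 case (b_d_mult b c)
 have "gmul E 0 1 (f b) (D c):[gr E 1]" "gmul E 0 1 (f c) (D b):[gr E 1]" using E.gmul_closed[OF f_closed D_cl, of b c] E.gmul_closed[OF f_closed D_cl, of c b] b_d_mult by simp_all
 thus ?thesis using b_d_mult by (simp add: fval_diff fval_add FF_of FF_add fval_of gen_val_one wval_sym gen_val_sym D_mul f_one E.gone_l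
   del: wv.simps One_nat_def)
next
 case (b_d_base s)
 thus ?thesis by (simp add: fval_of gen_val_one wval_sym D_base del: wv.simps One_nat_def)
next
 case (b_dlog_mult l m)
 thus ?thesis by (simp add: fval_diff fval_add FF_of FF_add fval_of gen_val_one wval_sym delta_mul delta_cl
   del: wv.simps One_nat_def)
next
 case (b_dlog_base n)
 thus ?thesis by (simp add: fval_of gen_val_one wval_sym delta_base del: wv.simps One_nat_def)
next
 case (b_log l)
 have "gmul E 0 1 (f (palpha A l)) (\<delta> l):[gr E 1]" using E.gmul_closed[OF f_closed delta_cl, of "palpha A l" l] b_log by simp
 thus ?thesis using b_log by (simp add: fval_diff FF_of fval_of gen_val_one wval_sym gen_val_sym D_log f_one E.gone_l
   del: wv.simps One_nat_def)
next
 case (b_square s)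
 have "gen_val (1[pr A], [s, s])=gmul E 1 1 (sym_val s) (sym_val s)" using b_square by (simp add: gen_val_one E.gone_r[OF sym_val_cl, simplified])
 thus ?thesis using b_square E.odd_square[of 1 "sym_val s"] sym_val_cl by (simp add: fval_of numeral_2_eq_2)
next
 case (b_swap s t)
 have *: "gen_val (1[pr A], [s, t])=gmul E 1 1 (sym_val s) (sym_val t)"
  "gen_val (1[pr A], [t, s])=gmul E 1 1 (sym_val t) (sym_val s)" using b_swap by (simp_all add: gen_val_one E.gone_r[OF sym_val_cl, simplified])
 have "gmul E 1 1 (sym_val t) (sym_val s):[gr E 2]" using E.gmul_closed[OF sym_val_cl sym_val_cl] b_swap by (metis one_add_one)
 thus ?thesis using b_swap E.gcomm[of "sym_val s" 1 "sym_val t" 1] sym_val_cl by (simp add: fval_add FF_of fval_of * gsign_def E.gr.l_neg del: One_nat_def) 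
qed

lemma fval_rel: "x : rel i==>form_val i x=0[gr E i]"
proof (induction rule: rel_ind)
 case (gen a u v e x)
 have U: "frg (a, u) : FF (length u)" "frg (1[pr A], v) : FF (length v)" using gen by (auto simp: FF_of)
 note X = brel_cl[OF gen(5)]
 show ?case using fval_star[OF star_cl[OF U(1) X] U(2)] fval_star[OF U(1) X] gen(4) by (simp add: fval_brel[OF gen(5)] E.gmul_0_r E.gmul_0_l fval_cl U)
qed (auto simp: fval_0 fval_diff rel_FF)

text \<open>Evaluation at an arbitrarily chosen representative, legitimate because
  \<open>form_val\<close> kills the relations (\<open>fval_rel\<close>).\<close>

definition omega_val :: "nat => ('a, 'l) form set => 'e" where
 "omega_val i X=form_val i (SOME x. x : X)"

lemma om_val_cl: assumes "x : FF i" shows "omega_val i (cl i x)=form_val i x"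
proof -
 have "(SOME y. y : cl i x) : cl i x" using FF.cos_self[OF rel_sub assms] by (rule someI)
 hence "(SOME y. y : cl i x) : FF i" "(SOME y. y : cl i x) - x : rel i" using assms by (auto simp: FF.cos_mem[OF rel_sub assms])
 thus ?thesis using fval_rel[of "(SOME y. y : cl i x) - x" i] assms by (simp add: omega_val_def fval_diff E.gr.sub_0_iff fval_cl)
qed

lemma om_val_gr: "graded_ring_hom om E omega_val" unfolding grh_def
proof (intro conjI allI ballI)
 fix i show "omega_val i : ahom (gr om i) (gr E i)" by (rule ahI) (auto simp: om_car om_val_cl fval_cl cl_add FF_add fval_add)
next
 fix i j x y assume "x:[gr om i]" "y:[gr om j]"
 thus "omega_val (i + j) (gmul om i j x y)=gmul E i j (omega_val i x) (omega_val j y)" by (auto simp: om_car gmul_cl om_val_cl star_cl fval_star)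
next
 show "omega_val 0 (gone om)=gone E" by (simp add: gone_cl om_val_cl FF_of fval_of gen_val_one)
qed

lemma om_val_0: "a:[pr A]==>omega_val 0 (form_class S A 0 (a, []))=f a" by (simp add: fcl_cl om_val_cl FF_of fval_of gen_val_def E.gone_r)
lemma om_val_1: "s : dsyms A==>omega_val 1 (form_class S A 1 (1[pr A], [s]))=sym_val s" using E.gone_r[OF sym_val_cl, of s] by (simp add: fcl_cl om_val_cl FF_of fval_of gen_val_one)

end

section \<open>Saturation\<close>

context dieudonne_algebra
begin

abbreviation "F i \<equiv> frob A i"

lemma F_hom: "F i : ahom (gr A i) (gr A i)" using frob_hom by (simp add: grh_def)

lemmas F_cl = ah_cl[OF F_hom]
lemmas F_add = ah_add[OF F_hom]
lemmas F_0 = gpair.ah_0[OF gr_pair F_hom]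
lemmas F_neg = gpair.ah_neg[OF gr_pair F_hom]
lemmas F_sub = gpair.ah_sub[OF gr_pair F_hom]
lemmas F_nm = gpair.ah_nm[OF gr_pair F_hom]

lemma F_gmul: "x:[gr A i]==>y:[gr A j] ==>
  F (i + j) (gmul A i j x y)=gmul A i j (F i x) (F j y)" using frob_hom by (simp add: grh_def)

lemma F_gone: "F 0 (gone A)=gone A" using frob_hom by (simp add: grh_def)
lemma F_rh: "F 0 : rhom (deg0 A) (deg0 A)" using frob_lift by (simp add: frobenius_lift_def)

lemma F_pow_hom: "(F i ^^ k) : ahom (gr A i) (gr A i)"
proof (induction k)
 case 0 thus ?case by (intro ahI) auto
next
 case (Suc k) thus ?case using ah_comp[OF Suc F_hom] by (simp add: comp_def)
qed

lemmas F_pow_cl = ah_cl[OF F_pow_hom]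
lemmas F_pow_nm = gpair.ah_nm[OF gr_pair F_pow_hom]
lemmas F_pow_0 = gpair.ah_0[OF gr_pair F_pow_hom]

lemma F_pow_gmul: "x:[gr A i]==>y:[gr A j] ==>
  (F (i + j) ^^ k) (gmul A i j x y)=gmul A i j ((F i ^^ k) x) ((F j ^^ k) y)" by (induction k) (simp_all add: F_gmul F_pow_cl)

lemma dif_F_pow: "x:[gr A i] ==>
  dif A i ((F i ^^ k) x)=(p ^ k) .[gr A (Suc i)] (F (Suc i) ^^ k) (dif A i x)"
proof (induction k)
 case (Suc k)
 thus ?case by (simp add: dif_frob F_pow_cl dif_closed F_nm gr.nm_nm F_cl)
qed (simp add: dif_closed)

end

locale tfd = dieudonne_algebra R A p FR
 for R :: "('r, 'y) ring_scheme" and A :: "('a, 'r, 'z) dieu_scheme" and p FR +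
 assumes tf: "dieu_torsion_free p A" and p_pos: "0 < p"
begin

lemma tf_gr: "torsion_free p (gr A i)" using tf by (simp add: dieu_torsion_free_def)
lemma tf_pow: "torsion_free (p ^ n) (gr A i)" by (rule gr.tf_power[OF tf_gr])

lemma nm_eqD:
 "x:[gr A i]==>y:[gr A i] ==>
  (p ^ n) .[gr A i] x=(p ^ n) .[gr A i] y==>x=y" by (rule gr.nm_inj[OF tf_pow])

abbreviation "St i n \<equiv> sat_stage p A i n"
abbreviation "cs i n y \<equiv> sat_class p A i (n, y)"
abbreviation "T \<equiv> saturation p A"

section \<open>Stages of the colimit and their classes\<close>

lemma St_cl: "y : St i n==>y:[gr A i]" by (simp add: sat_stage_def)
lemma St_iff: "y : St i n \<longleftrightarrow> y:[gr A i] & dif A i y : mults (p ^ n) (gr A (Suc i))" by (simp add: sat_stage_def)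
lemma St_sub: "asub (St i n) (gr A i)" unfolding sat_stage_def by (rule gpair.ah_kernel[OF gr_pair dif_hom gr.muls_sub])
lemma St_0: "y:[gr A i]==>y : St i 0" using gr.muls_mem[of "dif A i y" "Suc i" "p ^ 0"] dif_closed by (simp add: St_iff)
lemma St_Suc: "y : St i (Suc n)==>y : St i n" using gr.muls_dvd[of "p ^ n" "p ^ Suc n" "Suc i"] by (auto simp: St_iff)
lemma St_F: "y : St i n==>F i y : St i (Suc n)" using gr.muls_nm[OF gpair.ah_muls[OF gr_pair F_hom]] by (simp add: St_iff F_cl dif_frob)
lemma St_F': "y : St i n==>F i y : St i n" using St_F St_Suc by blast
lemma St_F_pow: "y : St i n==>(F i ^^ k) y : St i (n + k)" by (induction k) (simp_all add: St_F)
lemma F_pow_diff: "a <= b==>b <= t==>(F i ^^ (t - b)) ((F i ^^ (b - a)) y)=(F i ^^ (t - a)) y" using funpow_add[of "t - b" "b - a" "F i"] by (simp add: fun_eq_iff)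

lemma cls_mem: "(m, z) : cs i n y \<longleftrightarrow>
  z : St i m & (\<exists>t \<ge> max m n. (F i ^^ (t - n)) y=(F i ^^ (t - m)) z)" by (simp add: sat_class_def)

lemma cls_self: "y : St i n==>(n, y) : cs i n y" by (auto simp: cls_mem)

text \<open>Two representatives that meet at stage \<open>t\<close> can be compared with any third
  one at the larger of the two stages involved. Using this in both directions gives equality of
  classes.\<close>

lemma cls_le:
 assumes "n <= t" "m <= t" "(F i ^^ (t - n)) y=(F i ^^ (t - m)) z" shows "cs i n y <= cs i m z"
proof clarify
 fix l w assume "(l, w) : cs i n y"
 then obtain s where s: "w : St i l" "max l n <= s" "(F i ^^ (s - n)) y=(F i ^^ (s - l)) w" by (auto simp: cls_mem)
 let ?q = "max s t"
 have "(F i ^^ (?q - m)) z=(F i ^^ (?q - t)) ((F i ^^ (t - n)) y)" using assms F_pow_diff[of m t ?q i z] by simp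
 also have "\<dots>=(F i ^^ (?q - s)) ((F i ^^ (s - n)) y)" using F_pow_diff[of n t ?q i y] F_pow_diff[of n s ?q i y] assms s by simp
 also have "\<dots>=(F i ^^ (?q - l)) w" using F_pow_diff[of l s ?q i w] s by simp
 finally show "(l, w) : cs i m z" using s assms(2) by (auto simp: cls_mem intro!: exI[of _ ?q])
qed

lemma cls_eqI:
 assumes "n <= t" "m <= t" "(F i ^^ (t - n)) y=(F i ^^ (t - m)) z" shows "cs i n y=cs i m z" using cls_le[OF assms] cls_le[OF assms(2,1) assms(3)[symmetric]] by blast

lemma cls_shift: "cs i (n + k) ((F i ^^ k) y)=cs i n y" by (rule cls_eqI[of _ "n + k"]) simp_all

lemma cls_eq_iff:
 assumes "x : St i n" "y : St i n" shows "cs i n x=cs i n y \<longleftrightarrow> (\<exists>k. (F i ^^ k) x=(F i ^^ k) y)"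
proof
 assume "cs i n x=cs i n y"
 hence "(n, x) : cs i n y" using cls_self[OF assms(1)] by simp
 then obtain t where "t \<ge> n" "(F i ^^ (t - n)) y=(F i ^^ (t - n)) x" by (auto simp: cls_mem)
 thus "\<exists>k. (F i ^^ k) x=(F i ^^ k) y" by metis
next
 assume "\<exists>k. (F i ^^ k) x=(F i ^^ k) y"
 then obtain k where "(F i ^^ k) x=(F i ^^ k) y" by blast
 thus "cs i n x=cs i n y" using cls_eqI[of n "n + k" n i x y] by simp
qed

text \<open>An operation defined stage by stage descends to the colimit as soon as it commutes with
  the transition map \<open>F\<close>: any two pairs of representatives become equal at a common
  later stage. The union in the definition of the saturation then collapses.\<close>

lemma cls_binop:
 assumes x: "x : St i n" and y: "y : St j n"
  and g: "!!m x y. x : St i m==>y : St j m==>F l (g m x y)=g (Suc m) (F i x) (F j y)"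
 shows "\<Union>{cs l m (g m z w) | m z w. (m, z) : cs i n x & (m, w) : cs j n y}=cs l n (g n x y)"
proof -
 have g': "(F l ^^ k) (g m x y)=g (m + k) ((F i ^^ k) x) ((F j ^^ k) y)" if "x : St i m" "y : St j m" for k m x y using that by (induction k) (simp_all add: g St_F_pow)
 have "cs l m (g m z w)=cs l n (g n x y)" if zw: "(m, z) : cs i n x" "(m, w) : cs j n y" for m z w
 proof -
  obtain s where s: "max m n <= s" "(F i ^^ (s - n)) x=(F i ^^ (s - m)) z" "z : St i m" using zw by (auto simp: cls_mem)
  obtain t where t: "max m n <= t" "(F j ^^ (t - n)) y=(F j ^^ (t - m)) w" "w : St j m" using zw by (auto simp: cls_mem)
  let ?q = "max s t"
  have 1: "(F i ^^ (?q - n)) x=(F i ^^ (?q - m)) z" using F_pow_diff[of n s ?q i x] F_pow_diff[of m s ?q i z] s by simp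
  have 2: "(F j ^^ (?q - n)) y=(F j ^^ (?q - m)) w" using F_pow_diff[of n t ?q j y] F_pow_diff[of m t ?q j w] t by simp
  have "m <= ?q" "n <= ?q" using s t by auto
  thus ?thesis by (intro cls_eqI[of _ ?q]) (use s t 1 2 x y in \<open>simp_all add: g'\<close>)
 qed
 thus ?thesis using cls_self[OF x] cls_self[OF y] by blast
qed

lemma cls_unop:
 assumes x: "x : St i n" and g: "!!m x. x : St i m==>F l (g m x)=g (Suc m) (F i x)"
 shows "\<Union>{cs l m (g m z) | m z. (m, z) : cs i n x}=cs l n (g n x)"
proof -
 have "\<Union>{cs l m (g m z) | m z. (m, z) : cs i n x}
   = \<Union>{cs l m ((%m z w. g m z) m z w) | m z w. (m, z) : cs i n x & (m, w) : cs i n x}" by blast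
 also have "\<dots>=cs l n (g n x)" by (rule cls_binop[OF x x, of l "%m z w. g m z"]) (rule g)
 finally show ?thesis .
qed

text \<open>The differential \<open>p^(-n) d\<close> of the \<open>n\<close>-th stage. The quotient
  exists by the definition of the stage and is unique because the algebra is torsion free.\<close>

definition dv :: "nat => nat => 'a => 'a" where
 "dv i n y=(THE z. z:[gr A (Suc i)] & (p ^ n) .[gr A (Suc i)] z=dif A i y)"

lemma dv_eqI:
 "z:[gr A (Suc i)]==>(p ^ n) .[gr A (Suc i)] z=dif A i y==>dv i n y=z" unfolding dv_def by (rule the_equality) (blast, metis nm_eqD)

lemma dv: assumes "y : St i n"
 shows "dv i n y:[gr A (Suc i)]" "(p ^ n) .[gr A (Suc i)] dv i n y=dif A i y"
proof -
 obtain z where "z:[gr A (Suc i)]" "(p ^ n) .[gr A (Suc i)] z=dif A i y" using assms by (auto simp: St_iff mults_def)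
 thus "dv i n y:[gr A (Suc i)]" "(p ^ n) .[gr A (Suc i)] dv i n y=dif A i y" using dv_eqI by metis+
qed

lemma dif_dv: assumes "y : St i n" shows "dif A (Suc i) (dv i n y)=0[gr A (Suc (Suc i))]"
proof (rule nm_eqD[of _ _ _ n])
 show "(p ^ n) .[gr A (Suc (Suc i))] dif A (Suc i) (dv i n y)=(p ^ n) .[gr A (Suc (Suc i))] 0[gr A (Suc (Suc i))]" using dv[OF assms] by (simp add: dif_dif St_cl[OF assms] flip: dif_nm)
qed (simp_all add: dif_closed dv[OF assms])

text \<open>\<open>p^(-n) d y\<close> is closed, hence it lies in every stage and not only in the
  \<open>n\<close>-th.\<close>

lemma dv_St: assumes "y : St i n" shows "dv i n y : St (Suc i) m" using gr.muls_sub[THEN sub_zero] dif_dv[OF assms] dv[OF assms] by (simp add: St_iff)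

lemma dv_F: assumes "y : St i n" shows "F (Suc i) (dv i n y)=dv i (Suc n) (F i y)"
proof (rule dv_eqI[symmetric])
 show "(p ^ Suc n) .[gr A (Suc i)] F (Suc i) (dv i n y)=dif A i (F i y)" using dv(1)[OF assms] St_cl[OF assms] by (simp add: dif_frob F_nm F_cl gr.nm_nm flip: dv(2)[OF assms])
qed (simp add: F_cl dv[OF assms])

lemma St_gmul: assumes x: "x : St i n" and y: "y : St j n" shows "gmul A i j x y : St (i + j) n"
  and "dv (i + j) n (gmul A i j x y)=gmul A (Suc i) j (dv i n x) y
   +[gr A (Suc (i + j))]gsign i (gr A (Suc (i + j))) (gmul A i (Suc j) x (dv j n y))"
proof -
 note c = St_cl[OF x] St_cl[OF y] dv[OF x] dv[OF y]
 let ?z = "gmul A (Suc i) j (dv i n x) y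
   +[gr A (Suc (i + j))]gsign i (gr A (Suc (i + j))) (gmul A i (Suc j) x (dv j n y))"
 have g: "gmul A (Suc i) j (dv i n x) y:[gr A (Suc (i + j))]" "gmul A i (Suc j) x (dv j n y):[gr A (Suc (i + j))]" using gmul_closed[OF c(3) c(2)] gmul_closed[OF c(1) c(5)] by simp_all
 have z: "?z:[gr A (Suc (i + j))]" using g by (simp add: gsign_closed)
 have *: "(p ^ n) .[gr A (Suc (i + j))] ?z=dif A (i + j) (gmul A i j x y)" using gmul_nm_l[OF c(2,3), of "p ^ n"] gmul_nm_r[OF c(1,5), of "p ^ n"] c(1,2) g unfolding c(4,6) by (simp add: leibniz gr.nm_dist gsign_closed) (simp add: gsign_def gr.nm_neg)
 thus "gmul A i j x y : St (i + j) n" using gr.muls_mem[OF z, of "p ^ n"] c by (simp add: St_iff gmul_closed)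
 show "dv (i + j) n (gmul A i j x y)=?z" by (rule dv_eqI[OF z *])
qed

lemma sat_car: "X:[gr T i] \<longleftrightarrow> (\<exists>n y. y : St i n & X=cs i n y)" by (auto simp: saturation_def sat_gr_def)
lemma cs_cl: "y : St i n==>cs i n y:[gr T i]" by (auto simp: sat_car)

text \<open>Moving along the transition maps represents a class at every later stage, so finitely
  many classes have representatives at a common stage.\<close>

lemma sat_raise:
 assumes "X:[gr T i]" obtains m where "!!n. m <= n==>\<exists>y. y : St i n & X=cs i n y"
proof -
 obtain m y where my: "y : St i m" "X=cs i m y" using assms by (auto simp: sat_car)
 have "\<exists>z. z : St i n & X=cs i n z" if "m <= n" for n using St_F_pow[OF my(1), of "n - m"] cls_shift[of i m "n - m" y] my that by auto
 thus ?thesis using that by blast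
qed

lemma sat_reps2:
 assumes "X:[gr T i]" "Y:[gr T j]"
 obtains n x y where "x : St i n" "X=cs i n x" "y : St j n" "Y=cs j n y"
proof -
 obtain m where m: "!!n. m <= n==>\<exists>y. y : St i n & X=cs i n y" using sat_raise[OF assms(1)] by blast
 obtain l where l: "!!n. l <= n==>\<exists>y. y : St j n & Y=cs j n y" using sat_raise[OF assms(2)] by blast
 show ?thesis using m[of "max m l"] l[of "max m l"] that by auto
qed

lemma sat_reps3:
 assumes "X:[gr T i]" "Y:[gr T j]" "Z:[gr T k]"
 obtains n x y z where "x : St i n" "X=cs i n x" "y : St j n" "Y=cs j n y" "z : St k n" "Z=cs k n z"
proof -
 obtain m where m: "!!n. m <= n==>\<exists>y. y : St i n & X=cs i n y" using sat_raise[OF assms(1)] by blast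
 obtain l where l: "!!n. l <= n==>\<exists>y. y : St j n & Y=cs j n y" using sat_raise[OF assms(2)] by blast
 obtain h where h: "!!n. h <= n==>\<exists>y. y : St k n & Z=cs k n y" using sat_raise[OF assms(3)] by blast
 let ?n = "max m (max l h)"
 have "m <= ?n" "l <= ?n" "h <= ?n" by auto
 thus ?thesis using m[of ?n] l[of ?n] h[of ?n] that by metis
qed

lemma St_add: "x : St i n==>y : St i n==>x +[gr A i]y : St i n" using St_sub by (rule sub_plus)
lemma St_neg: "x : St i n==>-[gr A i] x : St i n" by (rule additive_subgroup.a_inv_closed[OF St_sub])
lemma St_zero: "0[gr A i] : St i n" by (rule sub_zero[OF St_sub])

lemma cs_add: assumes "x : St i n" "y : St i n"
 shows "cs i n x +[gr T i]cs i n y=cs i n (x +[gr A i]y)" using cls_binop[OF assms, of i "%m x y. x +[gr A i]y"] by (simp add: saturation_def sat_gr_def F_add St_cl)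

lemma cs_0: "cs i n 0[gr A i]=0[gr T i]" using cls_shift[of i 0 n "0[gr A i]"] by (simp add: saturation_def sat_gr_def F_pow_0)

lemma cs_gmul: assumes "x : St i n" "y : St j n"
 shows "gmul T i j (cs i n x) (cs j n y)=cs (i + j) n (gmul A i j x y)" using cls_binop[OF assms, of "i + j" "%m. gmul A i j"] by (simp add: saturation_def F_gmul St_cl)

lemma cs_dif: assumes "x : St i n" shows "dif T i (cs i n x)=cs (Suc i) n (dv i n x)" using cls_unop[OF assms, of "Suc i" "dv i"] dv_F by (simp add: saturation_def dv_def)
lemma cs_frob: assumes "x : St i n" shows "frob T i (cs i n x)=cs i n (F i x)" using cls_unop[OF assms, of i "%m. F i"] by (simp add: saturation_def)

lemma cs_gone: "gone T=cs 0 n (gone A)"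
proof -
 have "(F 0 ^^ n) (gone A)=gone A" by (induction n) (simp_all add: F_gone)
 thus ?thesis using cls_shift[of 0 0 n "gone A"] by (simp add: saturation_def)
qed

lemma St_gone: "gone A : St 0 n" using gr.muls_sub[THEN sub_zero] by (simp add: St_iff gone_closed dif_gone)

lemma sat_grp: "abelian_group (gr T i)"
proof (rule abelian_groupI)
 fix x assume x: "x:[gr T i]"
 fix y assume y: "y:[gr T i]"
 obtain n a b where "a : St i n" "x=cs i n a" "b : St i n" "y=cs i n b" by (rule sat_reps2[OF x y])
 thus "x +[gr T i]y:[gr T i]" "x +[gr T i]y=y +[gr T i]x" by (simp_all add: cs_add cs_cl St_add gr.a_comm St_cl)
 fix z assume z: "z:[gr T i]"
 obtain n a b c where "a : St i n" "x=cs i n a" "b : St i n" "y=cs i n b" "c : St i n" "z=cs i n c" by (rule sat_reps3[OF x y z])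
 thus "x +[gr T i]y +[gr T i]z=x +[gr T i](y +[gr T i]z)" by (simp add: cs_add St_add gr.a_assoc St_cl)
next
 show "0[gr T i]:[gr T i]" using cs_cl[OF St_zero, of i 0] by (simp add: cs_0)
next
 fix x assume "x:[gr T i]"
 then obtain n a where a: "a : St i n" "x=cs i n a" by (auto simp: sat_car)
 show "0[gr T i] +[gr T i]x=x" using cs_add[OF St_zero a(1)] a by (simp add: cs_0 St_cl)
 have "cs i n (-[gr A i] a) +[gr T i]x=0[gr T i]" using a by (simp add: cs_add St_neg gr.l_neg St_cl cs_0)
 thus "\<exists>y\<in>carrier (gr T i). y +[gr T i]x=0[gr T i]" using cs_cl[OF St_neg[OF a(1)]] by blast
qed

lemma cs_neg: assumes "x : St i n" shows "-[gr T i] cs i n x=cs i n (-[gr A i] x)"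
proof -
 interpret T: abelian_group "gr T i" by (rule sat_grp)
 show ?thesis by (rule T.minus_equality) (simp_all add: assms cs_add St_neg gr.l_neg St_cl[OF assms] cs_0 cs_cl)
qed

lemma cs_sub: "x : St i n==>y : St i n==>cs i n x -[gr T i]cs i n y=cs i n (x -[gr A i]y)" using abelian_group.minus_eq[OF sat_grp] by (simp add: gr.minus_eq cs_neg cs_add St_neg)

lemma cs_nm: assumes "x : St i n" shows "k .[gr T i] cs i n x=cs i n ((k::nat) .[gr A i] x)"
proof -
 interpret T: abelian_group "gr T i" by (rule sat_grp)
 show ?thesis by (induction k) (simp_all add: cs_0 T.nm_Suc gr.nm_Suc cs_add assms gr.sub_nm St_sub)
qed

lemma cs_gsign: "x : St i n==>gsign k (gr T i) (cs i n x)=cs i n (gsign k (gr A i) x)" by (cases "even k") (simp_all add: gsign_def cs_neg)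
lemma St_gsign: "x : St i n==>gsign k (gr A i) x : St i n" by (simp add: gsign_def St_neg)
lemma rmap_closed: "r:[R]==>rmap A r:[gr A 0]" using rh_cl[OF rmap_hom] by simp
lemma cs_rmap: "rmap T r=cs 0 0 (rmap A r)" by (simp add: saturation_def)

lemma dv_add: assumes "x : St i n" "y : St i n"
 shows "dv i n (x +[gr A i]y)=dv i n x +[gr A (Suc i)]dv i n y" by (rule dv_eqI) (simp_all add: dv[OF assms(1)] dv[OF assms(2)] gr.nm_dist dif_add St_cl[OF assms(1)]
   St_cl[OF assms(2)])

lemma dv_0: "dif A i x=0[gr A (Suc i)]==>dv i n x=0[gr A (Suc i)]" by (rule dv_eqI) simp_all

section \<open>The saturation is a saturated Dieudonne algebra\<close>

lemma sat_strict_dg: "strict_cdga R T"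
proof (unfold strict_cdga_def, intro conjI allI impI)
 fix i show "abelian_group (gr T i)" by (rule sat_grp)
next
 fix x i y j assume "x:[gr T i]" "y:[gr T j]"
 then obtain n a b where "a : St i n" "x=cs i n a" "b : St j n" "y=cs j n b" by (rule sat_reps2)
 thus "gmul T i j x y:[gr T (i + j)]" by (simp add: cs_gmul cs_cl St_gmul)
next
 show "gone T:[gr T 0]" using cs_cl[OF St_gone] by (simp add: cs_gone[of 0])
next
 fix x i x' y j assume "x:[gr T i]" "x':[gr T i]" "y:[gr T j]"
 then obtain n a a' b where "a : St i n" "x=cs i n a" "a' : St i n" "x'=cs i n a'" "b : St j n" "y=cs j n b" by (rule sat_reps3)
 thus "gmul T i j (x +[gr T i]x') y=gmul T i j x y +[gr T (i + j)]gmul T i j x' y" by (simp add: cs_gmul cs_add St_gmul(1) St_add distrib_l St_cl)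
next
 fix x i y y' j assume "x:[gr T i]" "y:[gr T j]" "y':[gr T j]"
 then obtain n a a' b where "a : St i n" "x=cs i n a" "a' : St j n" "y=cs j n a'" "b : St j n" "y'=cs j n b" by (rule sat_reps3)
 thus "gmul T i j x (y +[gr T j]y')=gmul T i j x y +[gr T (i + j)]gmul T i j x y'" by (simp add: cs_gmul cs_add St_gmul(1) St_add distrib_r St_cl)
next
 fix x i y j z l assume "x:[gr T i]" "y:[gr T j]" "z:[gr T l]"
 then obtain n a b c where "a : St i n" "x=cs i n a" "b : St j n" "y=cs j n b" "c : St l n" "z=cs l n c" by (rule sat_reps3)
 thus "gmul T (i + j) l (gmul T i j x y) z=gmul T i (j + l) x (gmul T j l y z)" by (simp add: cs_gmul St_gmul(1) assoc St_cl add.assoc)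
next
 fix x i assume "x:[gr T i]"
 then obtain n a where a: "a : St i n" "x=cs i n a" by (auto simp: sat_car)
 thus "gmul T 0 i (gone T) x=x" using cs_gmul[OF St_gone a(1)] by (simp add: cs_gone[of n] gone_l St_cl)
next
 fix x i y j assume "x:[gr T i]" "y:[gr T j]"
 then obtain n a b where *: "a : St i n" "x=cs i n a" "b : St j n" "y=cs j n b" by (rule sat_reps2)
 have c: "gmul A j i b a : St (i + j) n" using St_gmul(1)[OF *(3,1)] by (simp add: add.commute)
 have "gmul T j i y x=cs (i + j) n (gmul A j i b a)" using cs_gmul[OF *(3,1)] * by (simp add: add.commute)
 thus "gmul T i j x y=gsign (i * j) (gr T (i + j)) (gmul T j i y x)" using * cs_gsign[OF c] gcomm[OF St_cl[OF *(1)] St_cl[OF *(3)]] by (simp add: cs_gmul)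
next
 fix i x assume i: "odd (i::nat)" "x:[gr T i]"
 then obtain n a where "a : St i n" "x=cs i n a" by (auto simp: sat_car)
 thus "gmul T i i x x=0[gr T (i + i)]" using i(1) by (simp add: cs_gmul odd_square St_cl cs_0)
next
 fix i show "dif T i : ahom (gr T i) (gr T (Suc i))"
 proof (rule ahI)
  fix x assume x: "x:[gr T i]"
  then obtain n a where "a : St i n" "x=cs i n a" by (auto simp: sat_car)
  thus "dif T i x:[gr T (Suc i)]" using cs_cl[OF dv_St] by (simp add: cs_dif)
  fix y assume "y:[gr T i]"
  then obtain n a b where "a : St i n" "x=cs i n a" "b : St i n" "y=cs i n b" by (rule sat_reps2[OF x])
  thus "dif T i (x +[gr T i]y)=dif T i x +[gr T (Suc i)]dif T i y" by (simp add: cs_dif cs_add St_add dv_St dv_add)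
 qed
next
 fix x i assume "x:[gr T i]"
 then obtain n a where "a : St i n" "x=cs i n a" by (auto simp: sat_car)
 thus "dif T (Suc i) (dif T i x)=0[gr T (Suc (Suc i))]" by (simp add: cs_dif dv_St dv_0 dif_dv cs_0)
next
 fix x i y j assume "x:[gr T i]" "y:[gr T j]"
 then obtain n a b where *: "a : St i n" "x=cs i n a" "b : St j n" "y=cs j n b" by (rule sat_reps2)
 note da = dv_St[OF *(1), of n] and db = dv_St[OF *(3), of n]
 have e: "gmul A (Suc i) j (dv i n a) b : St (Suc (i + j)) n" "gmul A i (Suc j) a (dv j n b) : St (Suc (i + j)) n" using St_gmul(1)[OF da *(3)] St_gmul(1)[OF *(1) db] by simp_all
 show "dif T (i + j) (gmul T i j x y)=gmul T (Suc i) j (dif T i x) y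
    +[gr T (Suc (i + j))]gsign i (gr T (Suc (i + j))) (gmul T i (Suc j) x (dif T j y))" using * e cs_gmul[OF da *(3)] cs_gmul[OF *(1) db] by (simp add: cs_gmul cs_dif St_gmul cs_gsign cs_add St_gsign)
next
 note rh = rh_mul[OF rmap_hom, simplified] rh_add[OF rmap_hom, simplified] rh_one[OF rmap_hom, simplified]
 show "rmap T : rhom R (deg0 T)"
 proof (rule rhI)
  fix x y assume "x:[R]" "y:[R]"
  thus "rmap T (x *[R]y)=rmap T x *[deg0 T]rmap T y" "rmap T (x +[R]y)=rmap T x +[deg0 T]rmap T y" using cs_gmul[of "rmap A x" 0 0 "rmap A y" 0] by (simp_all add: cs_rmap rh cs_add St_0 rmap_closed)
 qed (auto simp: cs_rmap cs_gone[of 0] rh intro: cs_cl St_0 rmap_closed)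
next
 fix r assume "r:[R]"
 thus "dif T 0 (rmap T r)=0[gr T 1]" by (simp add: cs_rmap cs_dif St_0 rmap_closed dv_0 dif_rmap cs_0)
qed

sublocale T: strict_cdga R T by (rule sat_strict_dg)

lemma St_pow:
 fixes k :: nat
 assumes "y : St 0 n"
 shows "y [^][deg0 A] k : St 0 n & cs 0 n y [^][deg0 T] k=cs 0 n (y [^][deg0 A] k)"
proof (induction k)
 case 0 thus ?case by (simp add: St_gone cs_gone)
next
 case (Suc k)
 thus ?case using St_gmul(1)[of _ 0 n y 0] cs_gmul[of _ 0 n y 0] assms by simp
qed

lemma sat_dieu: "dieudonne_algebra R T p FR"
proof (intro dieudonne_algebra.intro dieudonne_algebra_axioms.intro sat_strict_dg)
 have ring: "frob T 0 (gmul T 0 0 x y)=gmul T 0 0 (frob T 0 x) (frob T 0 y)"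
  if xy: "x:[gr T 0]" "y:[gr T 0]" for x y
 proof -
  obtain n a b where "a : St 0 n" "x=cs 0 n a" "b : St 0 n" "y=cs 0 n b" by (rule sat_reps2[OF xy])
  thus ?thesis using cs_gmul[of _ 0 n _ 0] St_gmul(1)[of a 0 n b 0] F_gmul[of a 0 b 0] by (simp add: cs_frob St_F' St_cl)
 qed
 have hom: "frob T i : ahom (gr T i) (gr T i)" for i
 proof (rule ahI)
  fix x assume x: "x:[gr T i]"
  then obtain n a where "a : St i n" "x=cs i n a" by (auto simp: sat_car)
  thus "frob T i x:[gr T i]" by (simp add: cs_frob cs_cl St_F')
  fix y assume "y:[gr T i]"
  then obtain n a b where "a : St i n" "x=cs i n a" "b : St i n" "y=cs i n b" by (rule sat_reps2[OF x])
  thus "frob T i (x +[gr T i]y)=frob T i x +[gr T i]frob T i y" by (simp add: cs_frob cs_add St_add St_F' F_add St_cl)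
 qed
 have one: "frob T 0 (gone T)=gone T" by (simp add: cs_gone[of 0] cs_frob St_gone F_gone)
 show "graded_ring_hom T T (frob T)" unfolding grh_def
 proof (intro conjI allI ballI hom one)
  fix i j x y assume "x:[gr T i]" "y:[gr T j]"
  then obtain n a b where "a : St i n" "x=cs i n a" "b : St j n" "y=cs j n b" by (rule sat_reps2)
  thus "frob T (i + j) (gmul T i j x y)=gmul T i j (frob T i x) (frob T j y)" by (simp add: cs_gmul St_gmul(1) cs_frob F_gmul St_cl St_F')
 qed
 show "frobenius_lift p (deg0 T) (frob T 0)" unfolding frobenius_lift_def
 proof (intro conjI ballI)
  show "frob T 0 : rhom (deg0 T) (deg0 T)" by (rule rhI) (use ring ah_cl[OF hom] ah_add[OF hom] one in simp_all)
  fix x assume "x:[deg0 T]"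
  then obtain n y where y: "y : St 0 n" "x=cs 0 n y" by (auto simp: sat_car)
  note c = St_cl[OF y(1)]
  let ?q = "y [^][deg0 A] p" and ?r = "y [^][deg0 A] (p - 1)"
  have q: "?q : St 0 n" and r: "?r : St 0 n" using St_pow[OF y(1)] by auto
  \<comment> \<open>The quotient \<open>w\<close> of \<open>F y - y^p\<close> by \<open>p\<close>
    has to lie in stage \<open>n\<close> again. Cancelling \<open>p\<close> in the differential of
    this equation gives \<open>d w = F(d y) - y^(p-1) d y\<close>, and both terms are divisible by
    \<open>p^n\<close> because \<open>d y\<close> is.\<close>
  obtain w where w: "w:[gr A 0]" "F 0 y -[gr A 0]?q=p .[gr A 0] w" using frob_liftD[OF frob_lift, of y] c by auto
  have d: "dif A 0 y:[gr A 1]" "dif A 0 w:[gr A 1]" using dif_closed c w by simp_all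
  have g: "gmul A 0 1 ?r (dif A 0 y):[gr A 1]" using gmul_closed[OF St_cl[OF r] d(1)] by simp
  have dq: "dif A 0 ?q=p .[gr A 1] gmul A 0 1 ?r (dif A 0 y)" using dif_pow[OF c, of "p - 1"] p_pos by simp
  have "p .[gr A 1] dif A 0 w=dif A 0 (F 0 y -[gr A 0]?q)" using w by (simp add: dif_nm)
  also have "\<dots>=p .[gr A 1] (F 1 (dif A 0 y) -[gr A 1]gmul A 0 1 ?r (dif A 0 y))" using dif_frob[OF c] d g F_cl[OF d(1)] by (simp add: dif_sub F_cl c St_cl[OF q] dq gr.nm_sub)
  finally have "dif A 0 w=F 1 (dif A 0 y) -[gr A 1]gmul A 0 1 ?r (dif A 0 y)" using gr.nm_inj[OF tf_gr d(2)] F_cl[OF d(1)] g by simp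
  moreover have "F 1 (dif A 0 y) : mults (p ^ n) (gr A 1)" "gmul A 0 1 ?r (dif A 0 y) : mults (p ^ n) (gr A 1)" using gpair.ah_muls[OF gr_pair F_hom, of _ "p ^ n" 1] y(1)
    gpair.ah_muls[OF gr_pair lmul_hom[OF St_cl[OF r]], of _ "p ^ n" 1] by (simp_all add: St_iff)
  ultimately have "w : St 0 n" using w(1) gr.sub_sub[OF gr.muls_sub] by (simp add: St_iff)
  hence "frob T 0 x -[gr T 0]x [^][deg0 T] p=p .[gr T 0] cs 0 n w" using y w St_pow[OF y(1), of p] by (simp add: cs_frob cs_sub St_F' cs_nm)
  thus "frob T 0 x -[deg0 T]x [^][deg0 T] p : mults p (deg0 T)" using cs_cl[OF \<open>w : St 0 n\<close>] by (auto simp: mults_def)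
 qed
next
 fix x i assume "x:[gr T i]"
 then obtain n y where y: "y : St i n" "x=cs i n y" by (auto simp: sat_car)
 have "dv i n (F i y)=p .[gr A (Suc i)] F (Suc i) (dv i n y)"
 proof (rule dv_eqI)
  show "(p ^ n) .[gr A (Suc i)] (p .[gr A (Suc i)] F (Suc i) (dv i n y))=dif A i (F i y)" using dif_frob[OF St_cl[OF y(1)]] dv(1)[OF y(1)] by (simp add: F_nm gr.nm_nm F_cl mult.commute flip: dv(2)[OF y(1)])
 qed (simp add: F_cl dv y)
 thus "dif T i (frob T i x)=p .[gr T (Suc i)] frob T (Suc i) (dif T i x)" using y by (simp add: cs_frob cs_dif St_F' dv_St cs_nm)
next
 fix r assume "r:[R]"
 thus "frob T 0 (rmap T r)=rmap T (FR r)" by (simp add: cs_rmap cs_frob St_0 rmap_closed frob_rmap)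
qed

lemma sat_tf: "dieu_torsion_free p T" unfolding dieu_torsion_free_def torsion_free_def
proof (intro allI ballI impI)
 fix i x assume "x:[gr T i]" and z: "p .[gr T i] x=0[gr T i]"
 then obtain n y where y: "y : St i n" "x=cs i n y" by (auto simp: sat_car)
 have "cs i n (p .[gr A i] y)=cs i n 0[gr A i]" using z y by (simp add: cs_nm cs_0)
 then obtain k where "(F i ^^ k) (p .[gr A i] y)=(F i ^^ k) 0[gr A i]" using y by (auto simp: cls_eq_iff St_zero gr.sub_nm St_sub)
 hence "p .[gr A i] (F i ^^ k) y=0[gr A i]" using y by (simp add: F_pow_nm F_pow_0 St_cl)
 hence "(F i ^^ k) y=0[gr A i]" using tf_gr F_pow_cl[OF St_cl[OF y(1)]] by (simp add: torsion_free_def)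
 thus "x=0[gr T i]" using cls_eq_iff[OF y(1) St_zero] y by (auto simp: F_pow_0 cs_0)
qed

text \<open>An element \<open>y\<close> of stage \<open>m + 1\<close>, read at stage
  \<open>m\<close>, is \<open>F\<close> of the same \<open>y\<close> read at stage
  \<open>m + 1\<close>. So a class has an \<open>F\<close>-root once some representative lies one
  stage deeper, and this is what divisibility of its differential by \<open>p\<close> says after
  enough transition maps.\<close>

lemma sat_saturated: "saturated p T" unfolding saturated_def
proof (intro conjI allI sat_tf)
 interpret D: dieudonne_algebra R T p FR by (rule sat_dieu)
 fix i
 show "bij_betw (frob T i) (carrier (gr T i)) {x : carrier (gr T i). dif T i x : mults p (gr T (Suc i))}"
 proof (rule bij_betwI')
  fix x y assume "x:[gr T i]" "y:[gr T i]"
  then obtain n a b where ab: "a : St i n" "x=cs i n a" "b : St i n" "y=cs i n b" by (rule sat_reps2)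
  have "(\<exists>k. (F i ^^ k) a=(F i ^^ k) b) \<longleftrightarrow> (\<exists>k. (F i ^^ k) (F i a)=(F i ^^ k) (F i b))" by (metis funpow.simps(2) funpow_swap1 comp_apply)
  thus "frob T i x=frob T i y \<longleftrightarrow> x=y" using ab by (simp add: cs_frob cls_eq_iff St_F')
 next
  fix x assume "x:[gr T i]"
  thus "frob T i x : {x : carrier (gr T i). dif T i x : mults p (gr T (Suc i))}" by (auto simp: D.F_cl dif_frob D.dif_frob T.gr.muls_mem T.dif_closed)
 next
  fix x assume "x : {x : carrier (gr T i). dif T i x : mults p (gr T (Suc i))}"
  hence x: "x:[gr T i]" and "dif T i x : mults p (gr T (Suc i))" by auto
  then obtain w where w: "w:[gr T (Suc i)]" "dif T i x=p .[gr T (Suc i)] w" by (auto simp: mults_def)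
  obtain n y v where y: "y : St i n" "x=cs i n y" and v: "v : St (Suc i) n" "w=cs (Suc i) n v" by (rule sat_reps2[OF x w(1)])
  have "cs (Suc i) n (dv i n y)=cs (Suc i) n (p .[gr A (Suc i)] v)" using w y v by (simp add: cs_dif cs_nm)
  then obtain k where k: "(F (Suc i) ^^ k) (dv i n y)=(F (Suc i) ^^ k) (p .[gr A (Suc i)] v)" using y v by (auto simp: cls_eq_iff dv_St gr.sub_nm St_sub)
  let ?y = "(F i ^^ k) y" and ?v = "(F (Suc i) ^^ k) v"
  note c = St_cl[OF v(1)] St_cl[OF y(1)]
  have "dif A i ?y=(p ^ k) .[gr A (Suc i)] (F (Suc i) ^^ k) (dif A i y)" by (rule dif_F_pow[OF c(2)])
  also have "\<dots>=(p ^ k * p ^ n) .[gr A (Suc i)] (F (Suc i) ^^ k) (dv i n y)" using dv(1)[OF y(1)] by (simp add: F_pow_nm gr.nm_nm F_pow_cl flip: dv(2)[OF y(1)])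
  also have "\<dots>=(p ^ Suc (n + k)) .[gr A (Suc i)] ?v" using k c by (simp add: F_pow_nm gr.nm_nm F_pow_cl power_add mult_ac)
  finally have s: "?y : St i (Suc (n + k))" using c by (simp add: St_iff F_pow_cl gr.muls_mem)
  have "x=cs i (n + k) ?y" using y cls_shift by simp
  also have "\<dots>=frob T i (cs i (Suc (n + k)) ?y)" using cls_shift[of i "n + k" 1 ?y] by (simp add: cs_frob[OF s])
  finally show "\<exists>z\<in>carrier (gr T i). x=frob T i z" using cs_cl[OF s] by blast
 qed
qed

lemma sat_unit: "dieu_hom R A T (%i. cs i 0)" unfolding dieu_hom_def grh_def
proof (intro conjI allI ballI)
 fix i show "cs i 0 : ahom (gr A i) (gr T i)" by (rule ahI) (simp_all add: cs_cl St_0 cs_add)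
next
 fix i x assume x: "x:[gr A i]"
 have "dv i 0 x=dif A i x" by (rule dv_eqI) (simp_all add: dif_closed x)
 thus "cs (Suc i) 0 (dif A i x)=dif T i (cs i 0 x)" using x by (simp add: cs_dif St_0)
qed (simp_all add: cs_gmul St_0 cs_gone[of 0] cs_rmap cs_frob)

end

lemma ah_id: "(%x. x) : ahom G G" by (simp add: hom_def)

context abelian_group
begin

lemma add_diff_l: "x:[G]==>y:[G]==>(x \<oplus> y) \<ominus> x=y" by algebra
lemma diff_add: "x:[G]==>y:[G]==>(x \<ominus> y) \<oplus> y=x" by algebra
lemma diff_diff_self: "x:[G]==>y:[G]==>x \<ominus> (x \<ominus> y)=y" by algebra
lemma add3_diff_l: "x:[G]==>y:[G]==>z:[G]==>(x \<oplus> y \<oplus> z) \<ominus> x=y \<oplus> z" by algebra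
lemma add3_diff_m: "x:[G]==>y:[G]==>z:[G]==>(x \<oplus> y \<oplus> z) \<ominus> y=z \<oplus> x" by algebra
lemma diff_swap: "x:[G]==>y:[G]==>z:[G]==>w:[G] ==>
  (x \<ominus> y) \<ominus> (z \<ominus> w)=(x \<ominus> z) \<ominus> (y \<ominus> w)" by algebra
lemma add_0_neg:
 assumes "x:[G]" "y:[G]" "x \<oplus> y=\<zero>" shows "y=\<ominus> x"
proof -
 have "y=(x \<oplus> y) \<ominus> x" using assms(1,2) by algebra
 thus ?thesis using assms by (simp add: minus_eq)
qed

end

section \<open>The binomial theorem modulo p\<close>

context cring
begin

lemma nm_m_l: "x:[R]==>y:[R]==>[(n::nat)] \<cdot> x \<otimes> y=[n] \<cdot> (x \<otimes> y)" by (induction n) (simp_all add: nm_Suc l_distr)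
lemma nm_m_r: "x:[R]==>y:[R]==>x \<otimes> [(n::nat)] \<cdot> y=[n] \<cdot> (x \<otimes> y)" by (induction n) (simp_all add: nm_Suc r_distr)

lemma binomial:
 assumes x: "x:[R]" and y: "y:[R]"
 shows "(x \<oplus> y) [^] n=(\<Oplus>k\<in>{..n}. [(n choose k)] \<cdot> (x [^] k \<otimes> y [^] (n - k)))"
proof (induction n)
 case 0 thus ?case by simp
next
 case (Suc n)
 let ?t = "%n k. x [^] k \<otimes> y [^] (n - k)"
 have t: "?t n k:[R]" for n k :: nat using x y by simp
 have "(x \<oplus> y) [^] Suc n=(x \<oplus> y) [^] n \<otimes> x \<oplus> (x \<oplus> y) [^] n \<otimes> y" using x y by (simp add: r_distr)
 also have "(x \<oplus> y) [^] n \<otimes> x=(\<Oplus>k\<in>{..n}. [(n choose k)] \<cdot> (x [^] Suc k \<otimes> y [^] (n - k)))" unfolding Suc.IH using x y t by (subst finsum_ldistr) (auto intro!: finsum_cong' simp: nm_m_l nm_m_r m_ac)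
 also have "(x \<oplus> y) [^] n \<otimes> y=(\<Oplus>k\<in>{..n}. [(n choose k)] \<cdot> ?t (Suc n) k)" unfolding Suc.IH using x y t by (subst finsum_ldistr) (auto intro!: finsum_cong' simp: nm_m_l m_assoc Suc_diff_le)
 also have "\<dots>=(\<Oplus>k\<in>{..Suc n}. [(n choose k)] \<cdot> ?t (Suc n) k)" using t x y by (subst finsum_Suc) (auto simp: binomial_eq_0 simp del: nat_pow_Suc)
 also have "\<dots>=(\<Oplus>k\<in>{..n}. [(n choose Suc k)] \<cdot> (x [^] Suc k \<otimes> y [^] (n - k))) \<oplus> y [^] Suc n" using t x y by (subst finsum_Suc2) (auto simp del: nat_pow_Suc)
 also have "(\<Oplus>k\<in>{..n}. [(n choose k)] \<cdot> (x [^] Suc k \<otimes> y [^] (n - k))) \<oplus> \<dots> =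
   (\<Oplus>k\<in>{..n}. [(n choose k)] \<cdot> (x [^] Suc k \<otimes> y [^] (n - k)) \<oplus> [(n choose Suc k)] \<cdot> (x [^] Suc k \<otimes> y [^] (n - k))) \<oplus> y [^] Suc n" using x y by (subst finsum_addf) (auto simp: a_assoc Pi_iff simp del: nat_pow_Suc)
 also have "\<dots>=(\<Oplus>k\<in>{..n}. [(Suc n choose Suc k)] \<cdot> (x [^] Suc k \<otimes> y [^] (n - k))) \<oplus> y [^] Suc n" using x y by (simp add: nm_add del: nat_pow_Suc)
 also have "\<dots>=(\<Oplus>k\<in>{..Suc n}. [(Suc n choose k)] \<cdot> ?t (Suc n) k)" using t x y by (subst finsum_Suc2) (auto simp del: nat_pow_Suc binomial_Suc_Suc)
 finally show ?case .
qed

lemma finsum_subgroup: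
 assumes "asub H R" "!!k. k <= n==>f k : H"
 shows "(\<Oplus>k\<in>{..n::nat}. f k) : H"
proof -
 have c: "f k:[R]" if "k <= n" for k using assms that sub_car by blast
 have "(\<Oplus>k\<in>{..m}. f k) : H" if "m <= n" for m using that
 proof (induction m)
  case 0 thus ?case using assms(2)[of 0] c by (subst finsum_0) auto
 next
  case (Suc m)
  thus ?case using assms c by (subst finsum_Suc) (auto intro: sub_plus)
 qed
 thus ?thesis by simp
qed

text \<open>The middle binomial coefficients are divisible by \<open>p\<close>, and every middle
  term contains a factor \<open>s\<close>. Keeping that factor in the error term is the point: for
  \<open>s\<close> in an ideal the error is \<open>p\<close> times an element of the ideal.\<close>

lemma prime_binomial:
 assumes p: "prime (p::nat)" and x: "x:[R]" and s: "s:[R]"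
 obtains z where "z:[R]" "(x \<oplus> s) [^] p=x [^] p \<oplus> s [^] p \<oplus> [p] \<cdot> (s \<otimes> z)"
proof -
 \<comment> \<open>With \<open>p = q + 2\<close> the middle indices are exactly the
   \<open>Suc k\<close> with \<open>k <= q\<close>.\<close>
 obtain q where q: "p=Suc (Suc q)" using prime_ge_2_nat[OF p] by (metis add_2_eq_Suc le_Suc_ex)
 let ?f = "%k. [(p choose k)] \<cdot> (x [^] k \<otimes> s [^] (p - k))"
 let ?H = "(%z. [p] \<cdot> (s \<otimes> z)) ` carrier R"
 have fc: "?f k:[R]" for k using x s by simp
 have "(%z. [p] \<cdot> (s \<otimes> z)) : ahom R R" using s by (intro ahI) (auto simp: r_distr nm_dist)
 moreover have "asub (carrier R) R" by (rule subgroupI) auto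
 moreover have "gpair R R" by unfold_locales
 ultimately have H: "asub ?H R" using gpair.ah_img by blast
 have "(\<Oplus>k\<in>{..q}. ?f (Suc k)) : ?H"
 proof (rule finsum_subgroup[OF H])
  fix k assume k: "k <= q"
  have "p dvd (p choose Suc k)" by (rule dvd_choose_prime) (use k q p in auto)
  then obtain c where c: "p choose Suc k=p * c" by blast
  have e: "p - Suc k=Suc (q - k)" using k q by simp
  have "?f (Suc k)=[p] \<cdot> (s \<otimes> ([c] \<cdot> (x [^] Suc k \<otimes> s [^] (q - k))))" using x s unfolding c e by (simp add: nm_m_r m_ac flip: nm_nm)
  thus "?f (Suc k) : ?H" using x s by (auto intro!: image_eqI)
 qed
 then obtain z where z: "z:[R]" "(\<Oplus>k\<in>{..q}. ?f (Suc k))=[p] \<cdot> (s \<otimes> z)" by blast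
 have "?f : {..n} \<rightarrow> carrier R" for n :: nat using fc by blast
 hence "(\<Oplus>k\<in>{..Suc (Suc q)}. ?f k)=?f (Suc (Suc q)) \<oplus> ((\<Oplus>k\<in>{..q}. ?f (Suc k)) \<oplus> ?f 0)" using finsum_Suc[of ?f "Suc q"] finsum_Suc2[of ?f q] by presburger
 hence "(x \<oplus> s) [^] p=?f p \<oplus> ((\<Oplus>k\<in>{..q}. ?f (Suc k)) \<oplus> ?f 0)" using binomial[OF x s, of p] q by metis
 also have "\<dots>=x [^] p \<oplus> s [^] p \<oplus> [p] \<cdot> (s \<otimes> z)" unfolding z(2) using x s z(1) by (simp add: a_ac)
 finally show ?thesis using that z(1) by blast
qed

end

section \<open>Saturated Dieudonne algebras\<close>

locale satd = tfd R A p FR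
 for R :: "('r, 'y) ring_scheme" and A :: "('a, 'r, 'z) dieu_scheme" and p FR +
 assumes sat: "saturated p A" and prime_p: "prime p"
begin

section \<open>The Verschiebung\<close>

abbreviation "V i \<equiv> ver p A i"

lemma F_inj: "x:[gr A i]==>y:[gr A i]==>F i x=F i y==>x=y" using sat by (auto simp: saturated_def bij_betw_def inj_on_def)

lemma F_sj:
 assumes "x:[gr A i]" "dif A i x : mults p (gr A (Suc i))"
 obtains y where "y:[gr A i]" "x=F i y"
proof -
 have "x : F i ` carrier (gr A i)" using sat assms unfolding saturated_def bij_betw_def by blast
 thus ?thesis using that by blast
qed

lemma V_eqI: "y:[gr A i]==>F i y=p .[gr A i] x==>V i x=y" unfolding ver_def by (rule the_equality) (blast, metis F_inj)

lemma V: assumes "x:[gr A i]"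
 shows V_cl: "V i x:[gr A i]" and F_V: "F i (V i x)=p .[gr A i] x"
proof -
 have "dif A i (p .[gr A i] x) : mults p (gr A (Suc i))" using assms by (simp add: dif_nm gr.muls_mem dif_closed)
 then obtain y where "y:[gr A i]" "p .[gr A i] x=F i y" using F_sj assms by blast
 thus "V i x:[gr A i]" "F i (V i x)=p .[gr A i] x" using V_eqI by metis+
qed

lemma V_F: "x:[gr A i]==>V i (F i x)=p .[gr A i] x" by (rule V_eqI) (simp_all add: F_nm)

lemma V_hom: "V i : ahom (gr A i) (gr A i)"
proof (rule ahI)
 fix x y assume "x:[gr A i]" "y:[gr A i]"
 thus "V i (x +[gr A i]y)=V i x +[gr A i]V i y" by (intro V_eqI) (simp_all add: F_add V_cl F_V gr.nm_dist)
qed (rule V_cl)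

lemma V_pow_hom: "(V i ^^ k) : ahom (gr A i) (gr A i)"
proof (induction k)
 case 0 thus ?case by (intro ahI) auto
next
 case (Suc k) thus ?case using ah_comp[OF Suc V_hom] by (simp add: comp_def)
qed

lemmas V_pow_cl = ah_cl[OF V_pow_hom]
lemmas V_pow_add = ah_add[OF V_pow_hom]
lemmas V_pow_nm = gpair.ah_nm[OF gr_pair V_pow_hom]
lemmas V_pow_0 = gpair.ah_0[OF gr_pair V_pow_hom]
lemmas V_nm = gpair.ah_nm[OF gr_pair V_hom]

lemma F_dV: assumes "x:[gr A i]" shows "F (Suc i) (dif A i (V i x))=dif A i x"
proof (rule gr.nm_inj[OF tf_gr])
 show "p .[gr A (Suc i)] F (Suc i) (dif A i (V i x))=p .[gr A (Suc i)] dif A i x" using assms by (simp add: V_cl F_V dif_nm flip: dif_frob)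
qed (use assms in \<open>simp_all add: F_cl dif_closed V_cl\<close>)

lemma V_dif: assumes "x:[gr A i]" shows "V (Suc i) (dif A i x)=p .[gr A (Suc i)] dif A i (V i x)" by (rule V_eqI) (use assms in \<open>simp_all add: dif_closed V_cl F_nm F_dV\<close>)
lemma F_V_pow: "x:[gr A i]==>(F i ^^ k) ((V i ^^ k) x)=(p ^ k) .[gr A i] x" by (induction k) (simp_all add: funpow_swap1[of "F i"] F_V V_pow_cl F_pow_nm gr.nm_nm)
lemma V_F_pow: "x:[gr A i]==>(V i ^^ k) ((F i ^^ k) x)=(p ^ k) .[gr A i] x" by (induction k) (simp_all add: funpow_swap1[of "V i"] V_F F_pow_cl V_pow_nm gr.nm_nm)
lemma F_dV_pow: "x:[gr A i]==>(F (Suc i) ^^ k) (dif A i ((V i ^^ k) x))=dif A i x" by (induction k) (simp_all add: funpow_swap1[of "F (Suc i)"] F_dV V_pow_cl)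
lemma F_inj_pow: "x:[gr A i]==>y:[gr A i]==>(F i ^^ k) x=(F i ^^ k) y==>x=y" by (induction k) (auto dest!: F_inj[rotated 2] simp: F_pow_cl)

text \<open>The projection formula. Both sides agree after applying the injective map
  \<open>F^k\<close>, since \<open>F^k V^k = p^k\<close>.\<close>

lemma gmul_V:
 assumes x: "x:[gr A i]" and y: "y:[gr A j]"
 shows "gmul A i j x ((V j ^^ k) y)=(V (i + j) ^^ k) (gmul A i j ((F i ^^ k) x) y)"
proof (rule F_inj_pow[of _ _ _ k])
 have "(F (i + j) ^^ k) (gmul A i j x ((V j ^^ k) y))=gmul A i j ((F i ^^ k) x) ((p ^ k) .[gr A j] y)" using x y by (simp add: F_pow_gmul V_pow_cl F_V_pow)
 also have "\<dots>=(F (i + j) ^^ k) ((V (i + j) ^^ k) (gmul A i j ((F i ^^ k) x) y))" using x y by (simp add: F_V_pow gmul_closed F_pow_cl gmul_nm_r)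
 finally show "(F (i + j) ^^ k) (gmul A i j x ((V j ^^ k) y))=(F (i + j) ^^ k) ((V (i + j) ^^ k) (gmul A i j ((F i ^^ k) x) y))" .
qed (use x y in \<open>simp_all add: gmul_closed V_pow_cl F_pow_cl\<close>)

section \<open>The filtration \<open>V^r + d V^r\<close>\<close>

abbreviation "VF i r \<equiv> V_fil p A i r"

definition dV_img :: "nat => nat => 'a set" where
 "dV_img i r=(case i of 0 => {0[gr A 0]}
   | Suc j => (%x. dif A j ((V j ^^ r) x)) ` carrier (gr A j))"

lemma car_sub: "asub (carrier (gr A i)) (gr A i)" by (rule gr.subgroupI) auto

lemma dV_img_sub: "asub (dV_img i r) (gr A i)"
proof (cases i)
 case 0
 show ?thesis unfolding 0 by (rule gr.subgroupI) (auto simp: dV_img_def)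
next
 case (Suc j)
 show ?thesis using gpair.ah_img[OF gr_pair ah_comp[OF V_pow_hom dif_hom] car_sub] by (simp add: dV_img_def Suc)
qed

lemma VF_eq: "VF i r=(V i ^^ r) ` carrier (gr A i) <+>[gr A i] dV_img i r" by (simp add: V_fil_def dV_img_def)
lemma VF_sub: "asub (VF i r) (gr A i)" unfolding VF_eq by (rule gr.add_additive_subgroups[OF gpair.ah_img[OF gr_pair V_pow_hom car_sub] dV_img_sub])
lemma VF_iff: "x : VF i r \<longleftrightarrow> (\<exists>a\<in>carrier (gr A i). \<exists>w\<in>dV_img i r. x=(V i ^^ r) a +[gr A i]w)" by (auto simp: VF_eq set_add_def')
lemma VF_car: "x : VF i r==>x:[gr A i]" using gr.sub_car[OF _ VF_sub] .
lemma VF_add: "x : VF i r==>y : VF i r==>x +[gr A i]y : VF i r" using VF_sub by (rule sub_plus)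
lemma dV_img_cl: "w : dV_img i r==>w:[gr A i]" using gr.sub_car[OF _ dV_img_sub] .
lemma dif_dV_img: "w : dV_img i r==>dif A i w=0[gr A (Suc i)]" by (cases i) (auto simp: dV_img_def dif_0 dif_dif V_pow_cl)

lemma VF_V: "a:[gr A i]==>(V i ^^ r) a : VF i r" unfolding VF_iff by (rule bexI[of _ a], rule bexI[of _ "0[gr A i]"])
  (simp_all add: V_pow_cl sub_zero[OF dV_img_sub])

lemma VF_W: "w : dV_img i r==>w : VF i r" unfolding VF_iff by (rule bexI[of _ "0[gr A i]"], rule bexI[of _ w]) (simp_all add: V_pow_0 dV_img_cl)
lemma VF_dV: "a:[gr A i]==>dif A i ((V i ^^ r) a) : VF (Suc i) r" by (rule VF_W) (simp add: dV_img_def)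

text \<open>Reduces statements about the filtration to its two kinds of generators. Those of the
  second kind are absent in degree 0, which the premise \<open>i = Suc j\<close> records.\<close>

lemma VF_ind:
 assumes x: "x : VF i r" and H: "asub H G" and h: "h : ahom (gr A i) G"
  and 1: "!!a. a:[gr A i]==>h ((V i ^^ r) a) : H"
  and 2: "!!j b. i=Suc j==>b:[gr A j]==>h (dif A j ((V j ^^ r) b)) : H"
  and G: "abelian_group G"
 shows "h x : H"
proof -
 interpret G: abelian_group G by fact
 interpret gpair "gr A i" G by unfold_locales
 obtain a w where a: "a:[gr A i]" "w : dV_img i r" "x=(V i ^^ r) a +[gr A i]w" using x by (auto simp: VF_iff)
 have "h w : H" using a(2) 2 ah_0[OF h] sub_zero[OF H] by (cases i) (auto simp: dV_img_def)
 thus ?thesis using 1[OF a(1)] a ah_add[OF h] sub_plus[OF H] by (simp add: V_pow_cl dV_img_cl)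
qed

lemma VF_F: assumes "x : VF i (Suc r)" shows "F i x : VF i r"
proof (rule VF_ind[OF assms VF_sub F_hom])
 fix a assume a: "a:[gr A i]"
 show "F i ((V i ^^ Suc r) a) : VF i r" using a gr.sub_nm[OF VF_sub VF_V[OF a]] by (simp add: F_V V_pow_cl)
next
 fix j b assume b: "i=Suc j" "b:[gr A j]"
 thus "F i (dif A j ((V j ^^ Suc r) b)) : VF i r" by (simp add: F_dV V_pow_cl VF_dV)
qed (rule gr_group)

lemma VF_Ver: assumes "x : VF i r" shows "V i x : VF i (Suc r)"
proof (rule VF_ind[OF assms VF_sub V_hom])
 fix a assume a: "a:[gr A i]"
 show "V i ((V i ^^ r) a) : VF i (Suc r)" using VF_V[OF a, of "Suc r"] by simp
next
 fix j b assume b: "i=Suc j" "b:[gr A j]"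
 thus "V i (dif A j ((V j ^^ r) b)) : VF i (Suc r)" using VF_dV[OF b(2), of "Suc r"] by (simp add: V_dif V_pow_cl gr.sub_nm[OF VF_sub])
qed (rule gr_group)

lemma VF_Suc: "VF i (Suc r) <= VF i r"
proof
 fix x assume x: "x : VF i (Suc r)"
 have "(%x. x) x : VF i r"
 proof (rule VF_ind[OF x VF_sub ah_id])
  fix a assume a: "a:[gr A i]"
  show "(V i ^^ Suc r) a : VF i r" using VF_V[OF V_cl[OF a], of r] by (simp add: funpow_swap1)
 next
  fix j b assume b: "i=Suc j" "b:[gr A j]"
  thus "dif A j ((V j ^^ Suc r) b) : VF i r" using VF_dV[OF V_cl[OF b(2)], of r] by (simp add: funpow_swap1)
 qed (rule gr_group)
 thus "x : VF i r" .
qed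

text \<open>On \<open>V^r a\<close> this is the projection formula. On \<open>d V^r b\<close> the
  Leibniz rule for \<open>x V^r b\<close> is solved for the wanted product:
  \<open>d (x V^r b)\<close> and \<open>dx V^r b\<close> are again covered by the projection
  formula.\<close>

lemma VF_idl: assumes x: "x:[gr A i]" and y: "y : VF j r" shows "gmul A i j x y : VF (i + j) r"
proof (rule VF_ind[OF y VF_sub lmul_hom[OF x]])
 fix a assume "a:[gr A j]"
 thus "gmul A i j x ((V j ^^ r) a) : VF (i + j) r" using x by (simp add: gmul_V VF_V gmul_closed F_pow_cl)
next
 fix l b assume l: "j=Suc l" and b: "b:[gr A l]"
 let ?v = "(V l ^^ r) b"
 have v: "?v:[gr A l]" using b by (rule V_pow_cl)
 have c: "gmul A (Suc i) l (dif A i x) ?v:[gr A (Suc (i + l))]"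
  "gmul A i (Suc l) x (dif A l ?v):[gr A (Suc (i + l))]" "dif A (i + l) (gmul A i l x ?v):[gr A (Suc (i + l))]" using gmul_closed[OF dif_closed[OF x] v] gmul_closed[OF x dif_closed[OF v]] dif_closed[OF gmul_closed[OF x v]] by simp_all
 have 1: "dif A (i + l) (gmul A i l x ?v) : VF (Suc (i + l)) r" using x b by (simp add: gmul_V VF_dV gmul_closed F_pow_cl)
 have 2: "gmul A (Suc i) l (dif A i x) ?v : VF (Suc (i + l)) r" using gmul_V[OF dif_closed[OF x] b, of r] VF_V[OF gmul_closed[OF F_pow_cl[OF dif_closed[OF x]] b], of r r] by simp
 let ?g = "gmul A i (Suc l) x (dif A l ?v)"
 have "gsign i (gr A (Suc (i + l))) ?g =
   dif A (i + l) (gmul A i l x ?v) -[gr A (Suc (i + l))]gmul A (Suc i) l (dif A i x) ?v"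
 proof -
  have g: "gsign i (gr A (Suc (i + l))) ?g:[gr A (Suc (i + l))]" using c by (simp add: gsign_closed)
  show ?thesis unfolding leibniz[OF x v] using gr.add_diff_l[OF c(1) g] by simp
 qed
 hence "gsign i (gr A (Suc (i + l))) ?g : VF (Suc (i + l)) r" using gr.sub_sub[OF VF_sub 1 2] by simp
 hence "?g : VF (Suc (i + l)) r" using additive_subgroup.a_inv_closed[OF VF_sub[of "Suc (i + l)" r], of "-[gr A (Suc (i + l))] ?g"]
   gr.minus_minus[OF c(2)] by (simp add: gsign_def split: if_splits)
 thus "gmul A i j x (dif A l ((V l ^^ r) b)) : VF (i + j) r" by (simp add: l)
qed (rule gr_group)

lemma VF_dif: assumes "x : VF i r" shows "dif A i x : VF (Suc i) r"
proof (rule VF_ind[OF assms VF_sub dif_hom])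
 fix j b assume b: "i=Suc j" "b:[gr A j]"
 thus "dif A i (dif A j ((V j ^^ r) b)) : VF (Suc i) r" by (simp add: dif_dif V_pow_cl sub_zero[OF VF_sub])
qed (auto intro: VF_dV gr_group)

lemma VF_filt: "cfil R A (V_fil p A)" by (intro cfil.intro cfil_axioms.intro strict_cdga_axioms)
  (simp_all add: VF_sub VF_Suc VF_idl VF_dif)

lemma p_VF: "x : mults (p ^ r) (gr A i)==>x : VF i r" using VF_V[of _ i r] by (auto simp: mults_def F_pow_cl simp flip: V_F_pow)

text \<open>Since \<open>F^(r+1) d V^(r+1) a = d a\<close>, the hypothesis makes \<open>d a\<close>
  divisible by \<open>p\<close>. Saturation then gives \<open>a = F a'\<close>, and
  \<open>V F = p\<close> frees one factor.\<close>

lemma V_div: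
 assumes a: "a:[gr A i]" and d: "dif A i ((V i ^^ Suc r) a) : mults p (gr A (Suc i))"
 obtains a' where "a':[gr A i]" "(V i ^^ Suc r) a=p .[gr A i] (V i ^^ r) a'"
proof -
 have "dif A i a : mults p (gr A (Suc i))" using gpair.ah_muls[OF gr_pair F_pow_hom d] F_dV_pow[OF a, of "Suc r"] by metis
 then obtain a' where "a':[gr A i]" "a=F i a'" using F_sj a by blast
 hence "(V i ^^ Suc r) a=p .[gr A i] (V i ^^ r) a'" by (simp add: funpow_swap1 V_F V_pow_nm)
 thus ?thesis using that \<open>a':[gr A i]\<close> by blast
qed

text \<open>In \<open>p x = V^(r+1) a + w\<close> the part \<open>w\<close> is closed, so
  \<open>d V^(r+1) a\<close> is divisible by \<open>p\<close> and \<open>V_div\<close> extracts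
  \<open>p\<close> from the first summand. What remains shows that \<open>w\<close> is divisible by
  \<open>p\<close>; in positive degree \<open>w = d V^(r+1) b\<close> and \<open>V_div\<close>
  applies to \<open>b\<close> as well, in degree 0 it is zero. The torsion-freeness of the
  strictification comes from here.\<close>

lemma p_div:
 assumes x: "x:[gr A i]" and px: "p .[gr A i] x : VF i (Suc r)"
 shows "x : VF i r"
proof -
 obtain a w where a: "a:[gr A i]" and w: "w : dV_img i (Suc r)"
  and e: "p .[gr A i] x=(V i ^^ Suc r) a +[gr A i]w" using px by (auto simp: VF_iff simp del: funpow.simps)
 note c = V_pow_cl[OF a, of "Suc r"] dV_img_cl[OF w]
 have "dif A i (p .[gr A i] x)=dif A i ((V i ^^ Suc r) a)" unfolding e using c dif_dV_img[OF w] dif_closed[OF c(1)] by (simp add: dif_add del: funpow.simps)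
 hence "dif A i ((V i ^^ Suc r) a) : mults p (gr A (Suc i))" using x by (metis dif_nm gr.muls_mem dif_closed)
 then obtain a' where a': "a':[gr A i]" "(V i ^^ Suc r) a=p .[gr A i] (V i ^^ r) a'" using V_div[OF a] by blast
 let ?y = "x -[gr A i](V i ^^ r) a'"
 have y: "?y:[gr A i]" "p .[gr A i] ?y=w"
 proof -
  have v: "(V i ^^ r) a':[gr A i]" using a'(1) by (rule V_pow_cl)
  thus "?y:[gr A i]" using x by simp
  have "p .[gr A i] ?y=p .[gr A i] (V i ^^ r) a' +[gr A i]w -[gr A i]p .[gr A i] (V i ^^ r) a'" using x v e a' by (simp add: gr.nm_sub)
  also have "\<dots>=w" by (rule gr.add_diff_l[OF gr.nm_cl[OF v] c(2)])
  finally show "p .[gr A i] ?y=w" .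
 qed
 have "?y : VF i r"
 proof (cases i)
  case 0
  hence "?y=0[gr A i]" using w y tf_gr[of i] by (simp add: dV_img_def torsion_free_def)
  thus ?thesis by (simp add: sub_zero[OF VF_sub])
 next
  case (Suc j)
  then obtain b where b: "b:[gr A j]" "w=dif A j ((V j ^^ Suc r) b)" using w by (auto simp: dV_img_def)
  have "dif A j ((V j ^^ Suc r) b) : mults p (gr A (Suc j))" using y b Suc gr.muls_mem by metis
  then obtain b' where b': "b':[gr A j]" "(V j ^^ Suc r) b=p .[gr A j] (V j ^^ r) b'" using V_div[OF b(1)] by blast
  have "p .[gr A i] ?y=p .[gr A i] dif A j ((V j ^^ r) b')" using y b b' Suc by (simp add: dif_nm V_pow_cl)
  hence "?y=dif A j ((V j ^^ r) b')" using gr.nm_inj[OF tf_gr] y b' Suc by (metis V_pow_cl dif_closed)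
  thus ?thesis using b' Suc VF_dV by simp
 qed
 moreover have "x=(V i ^^ r) a' +[gr A i]?y" using x V_pow_cl[OF a'(1)] by (simp add: gr.add_minus_cancel)
 ultimately show ?thesis using VF_add[OF VF_V[OF a'(1)]] by metis
qed

text \<open>Apply \<open>V\<close>: the element \<open>V F z = p z\<close> is one step deeper, and
  \<open>p_div\<close> gives the step back.\<close>

lemma F_div:
 assumes "z:[gr A i]" "F i z : VF i r" shows "z : VF i r" using VF_Ver[OF assms(2)] by (simp add: V_F assms(1) p_div)

text \<open>Surjectivity of \<open>F\<close> on the strictification, at a finite level. After
  subtracting \<open>V^(r+1) b\<close> from \<open>m\<close> the error in \<open>d m = p n\<close>
  is \<open>V^(r+1) a\<close>. Applying \<open>d\<close> again shows that its differential is
  divisible by \<open>p\<close>, so \<open>V_div\<close> turns the error into a multiple of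
  \<open>p\<close>, and saturation provides the root \<open>z\<close>.\<close>

lemma dif_div:
 assumes m: "m:[gr A i]" and n: "n:[gr A (Suc i)]"
  and v: "dif A i m -[gr A (Suc i)]p .[gr A (Suc i)] n : VF (Suc i) (Suc r)"
 obtains z where "z:[gr A i]" "m -[gr A i]F i z : VF i (Suc r)"
proof -
 obtain a b where a: "a:[gr A (Suc i)]" and b: "b:[gr A i]"
  and e: "dif A i m -[gr A (Suc i)]p .[gr A (Suc i)] n=(V (Suc i) ^^ Suc r) a +[gr A (Suc i)]dif A i ((V i ^^ Suc r) b)" using v by (auto simp: VF_iff dV_img_def simp del: funpow.simps)
 let ?a = "(V (Suc i) ^^ Suc r) a" and ?b = "(V i ^^ Suc r) b" and ?n = "p .[gr A (Suc i)] n"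
 have c: "?a:[gr A (Suc i)]" "?b:[gr A i]" "?n:[gr A (Suc i)]" "dif A i m:[gr A (Suc i)]"
  "dif A i ?b:[gr A (Suc i)]" using n by (simp_all add: a b V_pow_cl dif_closed m del: funpow.simps)
 have mb: "m -[gr A i]?b:[gr A i]" using m c by (simp del: funpow.simps)
 have "dif A i (m -[gr A i]?b)=dif A i m -[gr A (Suc i)]dif A i ?b" by (rule dif_sub[OF m c(2)])
 also have "\<dots>=((dif A i m -[gr A (Suc i)]?n) +[gr A (Suc i)]?n) -[gr A (Suc i)]dif A i ?b" by (simp only: gr.diff_add[OF c(4,3)])
 also have "\<dots>=?n +[gr A (Suc i)]?a" unfolding e by (rule gr.add3_diff_m[OF c(1,5,3)])
 finally have d: "dif A i (m -[gr A i]?b)=?n +[gr A (Suc i)]?a" .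
 have "dif A (Suc i) ?n +[gr A (Suc (Suc i))]dif A (Suc i) ?a=0[gr A (Suc (Suc i))]" using dif_dif[OF mb] unfolding d dif_add[OF c(3,1)] .
 moreover have "dif A (Suc i) ?n=p .[gr A (Suc (Suc i))] dif A (Suc i) n" by (rule dif_nm[OF n])
 ultimately have "dif A (Suc i) ?a=-[gr A (Suc (Suc i))](p .[gr A (Suc (Suc i))] dif A (Suc i) n)" using gr.add_0_neg[OF dif_closed[OF c(3)] dif_closed[OF c(1)]] by simp
 hence "dif A (Suc i) ?a : mults p (gr A (Suc (Suc i)))" using gr.muls_mem[OF dif_closed[OF n], of p] additive_subgroup.a_inv_closed[OF gr.muls_sub] by metis
 then obtain a' where a': "a':[gr A (Suc i)]" "?a=p .[gr A (Suc i)] (V (Suc i) ^^ r) a'" using V_div[OF a] by blast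
 have "dif A i (m -[gr A i]?b) : mults p (gr A (Suc i))" unfolding d a'(2) using gr.muls_mem[OF n, of p] gr.muls_mem[OF V_pow_cl[OF a'(1)], of p] by (intro sub_plus[OF gr.muls_sub])
 then obtain z where z: "z:[gr A i]" "m -[gr A i]?b=F i z" using F_sj mb by blast
 have "m -[gr A i](m -[gr A i]?b)=?b" by (rule gr.diff_diff_self[OF m c(2)])
 hence "m -[gr A i]F i z : VF i (Suc r)" using z VF_V[OF b, of "Suc r"] by metis
 thus ?thesis using that z(1) by blast
qed

section \<open>First-order expansion of \<open>(F m - m^p) / p\<close>\<close>

lemma VF0: "VF 0 r=(V 0 ^^ r) ` carrier (gr A 0)"
proof (intro equalityI subsetI)
 fix x assume "x : VF 0 r"
 thus "x : (V 0 ^^ r) ` carrier (gr A 0)" by (auto simp: VF_iff dV_img_def V_pow_cl)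
qed (auto intro: VF_V)


text \<open>Already the square gains a factor: for \<open>s = V^(r+1) a\<close> the projection
  formula gives \<open>s s = p^(r+1) V^(r+1) (a a)\<close>, of which one \<open>p\<close> is split
  off, and \<open>p >= 2\<close> leaves a square inside \<open>s^p\<close>.\<close>

lemma VF_pow:
 assumes "s : VF 0 (Suc r)"
 obtains e where "e : VF 0 (Suc r)" "s [^][deg0 A] p=p .[gr A 0] e"
proof -
 obtain a where a: "a:[gr A 0]" "s=(V 0 ^^ Suc r) a" using assms unfolding VF0 by blast
 let ?V = "V 0 ^^ Suc r"
 have s: "s:[gr A 0]" using assms by (rule VF_car)
 have aa: "gmul A 0 0 a a:[gr A 0]" using gmul_closed[OF a(1,1)] by simp
 have "gmul A 0 0 s s=?V (gmul A 0 0 ((p ^ Suc r) .[gr A 0] a) a)" using gmul_V[OF s a(1), of "Suc r"] F_V_pow[OF a(1), of "Suc r"] unfolding a(2) by simp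
 also have "\<dots>=p .[gr A 0] ((p ^ r) .[gr A 0] ?V (gmul A 0 0 a a))" using gmul_nm_l[OF a(1), of a 0 "p ^ Suc r"] a(1) aa by (simp add: V_pow_nm gr.nm_nm V_pow_cl del: funpow.simps)
 finally have ss: "gmul A 0 0 s s=p .[gr A 0] ((p ^ r) .[gr A 0] ?V (gmul A 0 0 a a))" .
 let ?u = "(p ^ r) .[gr A 0] ?V (gmul A 0 0 a a)"
 have u: "?u : VF 0 (Suc r)" by (rule gr.sub_nm[OF VF_sub VF_V[OF aa]])
 obtain q where q: "p=Suc (Suc q)" using prime_ge_2_nat[OF prime_p] by (metis add_2_eq_Suc le_Suc_ex)
 have sq: "s [^][deg0 A] q:[gr A 0]" using deg0.nat_pow_closed[of s q] s by simp
 have "s [^][deg0 A] p=gmul A 0 0 (s [^][deg0 A] q) (gmul A 0 0 s s)" using assoc[OF sq s s] by (simp add: q)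
 also have "\<dots>=p .[gr A 0] gmul A 0 0 (s [^][deg0 A] q) ?u" unfolding ss using gmul_nm_r[OF sq, of _ 0 p] VF_car[OF u] by simp
 finally show ?thesis using that VF_idl[OF sq u] by simp
qed

text \<open>Linearisation of \<open>(F m - m^p) / p\<close>, whose values at \<open>m\<close> and
  \<open>m'\<close> are \<open>w\<close> and \<open>w'\<close>. For
  \<open>m' = m + V^(r+1) a\<close> the Frobenius contributes \<open>V^r a\<close>, because
  \<open>F V = p\<close>, while by \<open>prime_binomial\<close> and \<open>VF_pow\<close> the
  \<open>p\<close>-th powers contribute only terms one step deeper in the filtration. Existence and
  uniqueness of Teichmueller lifts rest on this.\<close>

lemma theta_expand:
 assumes m: "m:[gr A 0]" and m': "m':[gr A 0]" and d: "m' -[gr A 0]m : VF 0 (Suc r)"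
  and w: "w:[gr A 0]" "F 0 m -[gr A 0]m [^][deg0 A] p=p .[gr A 0] w"
  and w': "w':[gr A 0]" "F 0 m' -[gr A 0]m' [^][deg0 A] p=p .[gr A 0] w'"
 obtains a where "a:[gr A 0]" "m' -[gr A 0]m=(V 0 ^^ Suc r) a"
  "(V 0 ^^ r) a -[gr A 0](w' -[gr A 0]w) : VF 0 (Suc r)"
proof -
 let ?s = "m' -[gr A 0]m"
 have s: "?s:[gr A 0]" using m m' by simp
 obtain a where a: "a:[gr A 0]" "?s=(V 0 ^^ Suc r) a" using d unfolding VF0 by blast
 obtain z where z: "z:[gr A 0]" "(m +[gr A 0]?s) [^][deg0 A] p =
   m [^][deg0 A] p +[gr A 0]?s [^][deg0 A] p +[gr A 0]p .[gr A 0] gmul A 0 0 ?s z" using deg0.prime_binomial[OF prime_p, of m ?s] m s by auto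
 obtain e where e: "e : VF 0 (Suc r)" "?s [^][deg0 A] p=p .[gr A 0] e" using VF_pow[OF d] by blast
 have zs: "gmul A 0 0 ?s z : VF 0 (Suc r)" using cfil.idl_l[OF VF_filt d z(1)] by simp
 have ms: "m +[gr A 0]?s=m'" using m m' by (simp add: gr.add_minus_cancel)
 let ?v = "(V 0 ^^ r) a"
 have v: "?v:[gr A 0]" using a(1) by (rule V_pow_cl)
 have Fs: "F 0 m' -[gr A 0]F 0 m=p .[gr A 0] ?v" using a by (simp add: m m' F_V V_pow_cl flip: F_sub)
 note c = VF_car[OF e(1)] VF_car[OF zs]
 have mp: "m [^][deg0 A] p:[gr A 0]" "m' [^][deg0 A] p:[gr A 0]" using deg0.nat_pow_closed[of _ p] m m' by auto
 have FF: "F 0 m:[gr A 0]" "F 0 m':[gr A 0]" using m m' by (simp_all add: F_cl)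
 have pe: "m' [^][deg0 A] p -[gr A 0]m [^][deg0 A] p=p .[gr A 0] (e +[gr A 0]gmul A 0 0 ?s z)"
 proof -
  have pc: "p .[gr A 0] e:[gr A 0]" "p .[gr A 0] gmul A 0 0 ?s z:[gr A 0]" using c by auto
  have "m' [^][deg0 A] p=m [^][deg0 A] p +[gr A 0]p .[gr A 0] e +[gr A 0]p .[gr A 0] gmul A 0 0 ?s z" using z(2) unfolding ms e(2) .
  also have "\<dots> -[gr A 0]m [^][deg0 A] p=p .[gr A 0] e +[gr A 0]p .[gr A 0] gmul A 0 0 ?s z" by (rule gr.add3_diff_l[OF mp(1) pc])
  finally show ?thesis using c by (simp add: gr.nm_dist)
 qed
 have "p .[gr A 0] (w' -[gr A 0]w)=(F 0 m' -[gr A 0]m' [^][deg0 A] p) -[gr A 0](F 0 m -[gr A 0]m [^][deg0 A] p)" using w w' by (simp add: gr.nm_sub)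
 also have "\<dots>=(F 0 m' -[gr A 0]F 0 m) -[gr A 0](m' [^][deg0 A] p -[gr A 0]m [^][deg0 A] p)" by (rule gr.diff_swap[OF FF(2) mp(2) FF(1) mp(1)])
 also have "\<dots>=p .[gr A 0] (?v -[gr A 0](e +[gr A 0]gmul A 0 0 ?s z))" unfolding Fs pe using v c by (simp add: gr.nm_sub)
 finally have "w' -[gr A 0]w=?v -[gr A 0](e +[gr A 0]gmul A 0 0 ?s z)" by (rule gr.nm_inj[OF tf_gr, rotated 2]) (use w w' v c in simp_all)
 hence "?v -[gr A 0](w' -[gr A 0]w)=e +[gr A 0]gmul A 0 0 ?s z" using v c by (simp add: gr.diff_diff_self)
 thus ?thesis using that[OF a] VF_add[OF e(1) zs] by simp
qed

lemma theta_cg: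
 assumes m: "m:[gr A 0]" and m': "m':[gr A 0]" and d: "m' -[gr A 0]m : VF 0 (Suc r)"
  and w: "w:[gr A 0]" "F 0 m -[gr A 0]m [^][deg0 A] p=p .[gr A 0] w"
  and w': "w':[gr A 0]" "F 0 m' -[gr A 0]m' [^][deg0 A] p=p .[gr A 0] w'"
 shows "w' -[gr A 0]w : VF 0 r"
proof -
 obtain a where a: "a:[gr A 0]" "(V 0 ^^ r) a -[gr A 0](w' -[gr A 0]w) : VF 0 (Suc r)" using theta_expand[OF assms] by blast
 hence "(V 0 ^^ r) a -[gr A 0](w' -[gr A 0]w) : VF 0 r" using VF_Suc by blast
 thus ?thesis using gr.sub_mem_cg[OF VF_sub V_pow_cl[OF a(1)] gr.minus_closed[OF w'(1) w(1)]] VF_V[OF a(1), of r] by blast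
qed

end

section \<open>Strictification\<close>

lemma strict_dg_cg:
 assumes "gr A'=gr A" "gmul A'=gmul A" "gone A'=gone A" "dif A'=dif A" "rmap A'=rmap A"
 shows "strict_cdga R A' \<longleftrightarrow> strict_cdga R A" by (simp add: strict_cdga_def assms deg0_def)

context satd
begin

sublocale fl: cfil R A "V_fil p A" by (rule VF_filt)

abbreviation "W \<equiv> strictification p A"

lemma W_s [simp]:
 "gr W=gr fl.C" "gmul W=gmul fl.C" "gone W=gone fl.C" "dif W=dif fl.C" "rmap W=rmap fl.C" by (simp_all add: strictification_def cdga.extend_def cdga_lim_def)

lemma W_strict_dg: "strict_cdga R W" using fl.lim_strict_dg strict_dg_cg[of W fl.C R] by simp
lemma coh_F: assumes "fl.coh i m" shows "fl.coh i (%r. F i (m (Suc r)))" using assms VF_F by (auto simp: chr_def F_cl simp flip: F_sub)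

text \<open>\<open>F\<close> lowers the V-filtration by one, so level \<open>r\<close> of the image
  is computed from level \<open>Suc r\<close>.\<close>

lemma frob_Lim: assumes "fl.coh i m" shows "frob W i (fl.Lim i m)=fl.Lim i (%r. F i (m (Suc r)))"
proof -
 have "coset_map (gr A i) (VF i r) (frob A i) (VF i (Suc r) +>[gr A i] m (Suc r))=VF i r +>[gr A i] F i (m (Suc r))" for r
 proof (rule gr.cos_map_cos[OF VF_sub])
  show c: "m (Suc r):[gr A i]" by (rule fl.fil.coh_car[OF assms])
  fix z assume z: "z:[gr A i]" "z -[gr A i]m (Suc r) : VF i (Suc r)"
  show "VF i r +>[gr A i] F i z=VF i r +>[gr A i] F i (m (Suc r))" using VF_F[OF z(2)] z(1) c by (intro gr.cos_eqI[OF VF_sub]) (simp_all add: F_cl F_sub)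
 qed
 thus ?thesis by (simp add: strictification_def cdga.extend_def dieu.fields_def lim_of_def)
qed

lemma coh_V: assumes "fl.coh i m" shows "fl.coh i (%r. (V i ^^ k) (m r))"
proof (induction k)
 case 0 thus ?case using assms by simp
next
 case (Suc k)
 have "V i x : VF i r" if "x : VF i r" for x r using VF_Ver[OF that] VF_Suc by blast
 with Suc show ?case by (auto simp: chr_def V_cl simp flip: gpair.ah_sub[OF gr_pair V_hom])
qed

lemma Lim_cs:
 assumes "x:[gr W i]" obtains m where "fl.coh i m" "x=fl.Lim i m" "!!r. m r:[gr A i]" using fl.coh_cs assms by auto

lemma frob_W_hom: "graded_ring_hom W W (frob W)" unfolding grh_def
proof (intro conjI allI ballI)
 fix i show "frob W i : ahom (gr W i) (gr W i)"
 proof (rule ahI)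
  fix x assume "x:[gr W i]"
  then obtain m where m: "fl.coh i m" "x=fl.Lim i m" "!!r. m r:[gr A i]" by (rule Lim_cs) blast
  thus "frob W i x:[gr W i]" using fl.Lim_cl[OF coh_F[OF m(1)]] by (simp add: frob_Lim)
  fix y assume "y:[gr W i]"
  then obtain n where n: "fl.coh i n" "y=fl.Lim i n" "!!r. n r:[gr A i]" by (rule Lim_cs) blast
  have "x +[gr W i]y=fl.Lim i (%r. m r +[gr A i]n r)" by (simp add: m n fl.fil.lim_add)
  thus "frob W i (x +[gr W i]y)=frob W i x +[gr W i]frob W i y" by (simp add: m n frob_Lim fl.fil.coh_add fl.fil.lim_add F_cl F_add)
 qed
next
 fix i j x y assume "x:[gr W i]" "y:[gr W j]"
 then obtain m n where m: "fl.coh i m" "x=fl.Lim i m" "!!r. m r:[gr A i]"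
  and n: "fl.coh j n" "y=fl.Lim j n" "!!r. n r:[gr A j]" by (metis Lim_cs)
 show "frob W (i + j) (gmul W i j x y)=gmul W i j (frob W i x) (frob W j y)" unfolding m(2) n(2) W_s fl.gmul_Lim[OF m(1) n(1)] frob_Lim[OF m(1)] frob_Lim[OF n(1)]
   frob_Lim[OF fl.coh_gmul[OF m(1) n(1)]] fl.gmul_Lim[OF coh_F[OF m(1)] coh_F[OF n(1)]] by (simp add: F_gmul m n)
next
 show "frob W 0 (gone W)=gone W" using frob_Lim[OF fl.coh_const[OF gone_closed]] by (simp add: fl.gone_lim F_gone)
qed

lemma W_tf: "dieu_torsion_free p W" unfolding dieu_torsion_free_def
proof
 fix i show "torsion_free p (gr W i)" using lim_tf[OF fl.fil.filg_axioms, of i p] p_div by simp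
qed

lemma Lim_nm: "fl.coh i m==>n .[gr W i] fl.Lim i m=fl.Lim i (%r. n .[gr A i] m r)" for n :: nat by (simp add: fl.fil.lim_nm)

lemma Lim_pow:
 assumes m: "fl.coh 0 m"
 shows "fl.Lim 0 m [^][deg0 W] (k::nat)=fl.Lim 0 (%r. m r [^][deg0 A] k) & fl.coh 0 (%r. m r [^][deg0 A] k)"
proof (induction k)
 case 0 thus ?case by (simp add: fl.gone_lim fl.coh_const gone_closed)
next
 case (Suc k)
 thus ?case using fl.gmul_Lim[of 0 _ 0 m] fl.coh_gmul[of 0 _ 0 m] m by simp
qed

lemma Lim_sub: "fl.coh i m==>fl.coh i n==>fl.Lim i m -[gr W i]fl.Lim i n=fl.Lim i (%r. m r -[gr A i]n r)" by (simp add: fl.fil.lim_sub)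

lemma Lim_eqI:
 "(!!r. m r:[gr A i])==>(!!r. n r:[gr A i])==>(!!r. m r -[gr A i]n r : VF i r) ==>
  fl.Lim i m=fl.Lim i n" by (simp add: fl.fil.lim_eq_iff)

lemma Lim_shift: assumes "fl.coh i m" shows "fl.Lim i (%r. m (Suc r))=fl.Lim i m" using assms by (intro Lim_eqI) (auto simp: chr_def)
lemma coh_shift: "fl.coh i m==>fl.coh i (%r. m (Suc r))" using VF_Suc by (auto simp: chr_def)

lemma W_frob_lift: "frobenius_lift p (deg0 W) (frob W 0)" unfolding frobenius_lift_def
proof (intro conjI ballI)
 show "frob W 0 : rhom (deg0 W) (deg0 W)" using frob_W_hom unfolding grh_def by (intro rhI) (auto simp: hom_def Pi_iff simp del: W_s dest: spec[of _ 0] spec[of "%j. \<forall>x\<in>_. _ j x" 0])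
 fix x assume "x:[deg0 W]"
 then obtain m where m: "fl.coh 0 m" "x=fl.Lim 0 m" "!!r. m r:[gr A 0]" by (metis Lim_cs deg0_s(1))
 have "\<exists>w\<in>carrier (gr A 0). F 0 (m r) -[gr A 0]m r [^][deg0 A] p=p .[gr A 0] w" for r
 proof (rule frob_liftD[OF frob_lift, of "m r"])
  show "m r:[deg0 A]" using m(3) by simp
 qed auto
 then obtain w where w: "!!r. w r:[gr A 0]"
  "!!r. F 0 (m r) -[gr A 0]m r [^][deg0 A] p=p .[gr A 0] w r" by metis
 \<comment> \<open>The quotients lose one filtration step against \<open>m\<close>
   (\<open>theta_cg\<close>); shifting the index restores coherence.\<close>
 let ?w = "%r. w (Suc r)"
 have wc: "fl.coh 0 ?w" unfolding chr_def
 proof (intro allI conjI w(1))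
  fix r
  have "m (Suc (Suc r)) -[gr A 0]m (Suc r) : VF 0 (Suc r)" using m(1) by (simp add: chr_def)
  thus "w (Suc (Suc r)) -[gr A 0]w (Suc r) : VF 0 r" by (rule theta_cg[OF m(3) m(3) _ w(1) w(2) w(1) w(2)])
 qed
 note pw = Lim_pow[OF m(1), of p]
 have "x [^][deg0 W] p=fl.Lim 0 (%r. m (Suc r) [^][deg0 A] p)" using pw Lim_shift[of 0 "%r. m r [^][deg0 A] p"] m by simp
 hence "frob W 0 x -[gr W 0]x [^][deg0 W] p=fl.Lim 0 (%r. F 0 (m (Suc r)) -[gr A 0]m (Suc r) [^][deg0 A] p)" using Lim_sub[OF coh_F[OF m(1)] coh_shift[OF pw[THEN conjunct2]]] by (simp add: m(2) frob_Lim[OF m(1)])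
 also have "\<dots>=p .[gr W 0] fl.Lim 0 ?w" by (simp only: w(2) Lim_nm[OF wc])
 finally show "frob W 0 x -[deg0 W]x [^][deg0 W] p : mults p (deg0 W)" using fl.Lim_cl[OF wc] by (auto simp: mults_def)
qed

lemma W_dieudonne: "dieudonne_algebra R W p FR"
proof (intro dieudonne_algebra.intro dieudonne_algebra_axioms.intro W_strict_dg frob_W_hom W_frob_lift)
 fix x i assume "x:[gr W i]"
 then obtain m where m: "fl.coh i m" "x=fl.Lim i m" "!!r. m r:[gr A i]" by (rule Lim_cs) blast
 have "dif W i (frob W i x)=fl.Lim (Suc i) (%r. p .[gr A (Suc i)] F (Suc i) (dif A i (m (Suc r))))" by (simp add: m frob_Lim fl.dif_Lim coh_F dif_frob)
 also have "\<dots>=p .[gr W (Suc i)] frob W (Suc i) (dif W i x)" using Lim_nm[OF coh_F[OF fl.coh_dif[OF m(1)]], of p] by (simp add: m fl.dif_Lim frob_Lim fl.coh_dif)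
 finally show "dif W i (frob W i x)=p .[gr W (Suc i)] frob W (Suc i) (dif W i x)" .
next
 fix r assume r: "r:[R]"
 show "frob W 0 (rmap W r)=rmap W (FR r)" using frob_Lim[OF fl.coh_const[OF rmap_closed[OF r]]] frob_rmap[OF r] by (simp add: fl.rmap_lim)
qed

lemma W_saturated: "saturated p W" unfolding saturated_def
proof (intro conjI allI W_tf)
 interpret D: dieudonne_algebra R W p FR by (rule W_dieudonne)
 fix i
 show "bij_betw (frob W i) (carrier (gr W i)) {x : carrier (gr W i). dif W i x : mults p (gr W (Suc i))}"
 proof (rule bij_betwI')
  fix x y assume xy: "x:[gr W i]" "y:[gr W i]"
  obtain m where m: "fl.coh i m" "x=fl.Lim i m" "!!r. m r:[gr A i]" using xy(1) by (rule Lim_cs) blast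
  obtain n where n: "fl.coh i n" "y=fl.Lim i n" "!!r. n r:[gr A i]" using xy(2) by (rule Lim_cs) blast
  have "x=y" if "frob W i x=frob W i y"
  proof -
   have "F i (m (Suc r)) -[gr A i]F i (n (Suc r)) : VF i r" for r using that m n by (simp add: frob_Lim fl.fil.lim_eq_iff F_cl)
   hence "m (Suc r) -[gr A i]n (Suc r) : VF i r" for r using F_div[of "m (Suc r) -[gr A i]n (Suc r)" i r] m(3) n(3) by (simp add: F_sub)
   hence "fl.Lim i (%r. m (Suc r))=fl.Lim i (%r. n (Suc r))" using m n by (intro Lim_eqI)
   thus ?thesis using m n by (simp add: Lim_shift)
  qed
  thus "frob W i x=frob W i y \<longleftrightarrow> x=y" by blast
 next
  fix x assume "x:[gr W i]"
  thus "frob W i x : {x : carrier (gr W i). dif W i x : mults p (gr W (Suc i))}" using D.F_cl D.dif_frob D.gr.muls_mem D.dif_closed by (simp del: W_s)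
 next
  fix x assume "x : {x : carrier (gr W i). dif W i x : mults p (gr W (Suc i))}"
  hence x: "x:[gr W i]" and "dif W i x : mults p (gr W (Suc i))" by auto
  then obtain w where w: "w:[gr W (Suc i)]" "dif W i x=p .[gr W (Suc i)] w" by (auto simp: mults_def simp del: W_s)
  obtain m where m: "fl.coh i m" "x=fl.Lim i m" "!!r. m r:[gr A i]" using x by (rule Lim_cs) blast
  obtain n where n: "fl.coh (Suc i) n" "w=fl.Lim (Suc i) n" "!!r. n r:[gr A (Suc i)]" using w(1) by (rule Lim_cs) blast
  have "fl.Lim (Suc i) (%r. dif A i (m r))=fl.Lim (Suc i) (%r. p .[gr A (Suc i)] n r)" using w(2) unfolding m(2) n(2) Lim_nm[OF n(1)] by (simp add: fl.dif_Lim[OF m(1)])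
  hence "dif A i (m r) -[gr A (Suc i)]p .[gr A (Suc i)] n r : VF (Suc i) r" for r using m n by (simp add: fl.fil.lim_eq_iff dif_closed)
  hence "\<exists>z\<in>carrier (gr A i). m (Suc r) -[gr A i]F i z : VF i (Suc r)" for r using dif_div[OF m(3) n(3)] by metis
  then obtain z where z: "!!r. z r:[gr A i]" "!!r. m (Suc r) -[gr A i]F i (z r) : VF i (Suc r)" by metis
  note Fz = F_cl[OF z(1)]
  \<comment> \<open>The roots were chosen level by level without any compatibility. Their coherence
    is forced by injectivity of \<open>F\<close> modulo the filtration
    (\<open>F_div\<close>).\<close>
  have zc: "fl.coh i z" unfolding chr_def
  proof (intro allI conjI z(1))
   fix r
   have a: "F i (z (Suc r)) -[gr A i]m (Suc (Suc r)) : VF i (Suc r)" using gr.sub_sub_cm[OF VF_sub m(3) Fz z(2), of "Suc r"] VF_Suc by blast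
   have b: "m (Suc (Suc r)) -[gr A i]m (Suc r) : VF i (Suc r)" using m(1) by (simp add: chr_def)
   have "F i (z (Suc r)) -[gr A i]F i (z r) : VF i (Suc r)" using gr.sub_sub_tr[OF VF_sub Fz m(3) Fz a gr.sub_sub_tr[OF VF_sub m(3) m(3) Fz b z(2)]] .
   hence "z (Suc r) -[gr A i]z r : VF i (Suc r)" using F_div[of "z (Suc r) -[gr A i]z r" i "Suc r"] by (simp add: F_sub z(1))
   thus "z (Suc r) -[gr A i]z r : VF i r" using VF_Suc by blast
  qed
  \<comment> \<open>Two shifts: one from \<open>frob_Lim\<close>, one because \<open>z r\<close> is
    a root of \<open>m (Suc r)\<close>.\<close>
  have "x=fl.Lim i (%r. m (Suc (Suc r)))" using m Lim_shift[OF coh_shift[OF m(1)]] by (simp add: Lim_shift)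
  also have "\<dots>=frob W i (fl.Lim i z)" unfolding frob_Lim[OF zc] using z(2) VF_Suc m(3) Fz by (intro Lim_eqI) blast+
  finally show "\<exists>z\<in>carrier (gr W i). x=frob W i z" using fl.Lim_cl[OF zc] by (metis W_s(1))
 qed
qed

section \<open>The V-filtration of the strictification\<close>

interpretation WS: satd R W p FR by (intro satd.intro tfd.intro tfd_axioms.intro
   satd_axioms.intro W_dieudonne W_saturated W_tf p_pos prime_p)

text \<open>The termwise \<open>V\<close> is checked against the defining equation
  \<open>F V = p\<close>; \<open>Lim_shift\<close> undoes the shift from
  \<open>frob_Lim\<close>.\<close>

lemma ver_Lim: assumes "fl.coh i m" shows "(ver p W i ^^ k) (fl.Lim i m)=fl.Lim i (%r. (V i ^^ k) (m r))"
proof (induction k)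
 case (Suc k)
 note c = coh_V[OF assms, of k] and c' = coh_V[OF assms, of "Suc k"]
 have "ver p W i (fl.Lim i (%r. (V i ^^ k) (m r)))=fl.Lim i (%r. (V i ^^ Suc k) (m r))"
 proof (rule WS.V_eqI)
  show "fl.Lim i (%r. (V i ^^ Suc k) (m r)):[gr W i]" using fl.Lim_cl[OF c'] by simp
  show "frob W i (fl.Lim i (%r. (V i ^^ Suc k) (m r)))=p .[gr W i] fl.Lim i (%r. (V i ^^ k) (m r))" unfolding frob_Lim[OF c'] Lim_nm[OF c] using Lim_shift[OF fl.fil.coh_nm[OF c, of p]] fl.fil.coh_car[OF assms] by (simp add: F_V V_pow_cl)
 qed
 thus ?case using Suc by simp
qed simp

text \<open>Elements of the kernel of \<open>W \<rightarrow> A / (V\<^sup>r A + d V\<^sup>r A)\<close> are convergent series of terms \<open>V\<^sup>s a + d V\<^sup>s b\<close>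
 with \<open>s \<ge> r\<close>.\<close>

lemma series:
 assumes c: "!!s. c s:[gr A i]"
 obtains \<alpha> where "fl.coh i \<alpha>" "\<alpha> 0=c 0" "!!s. \<alpha> (Suc s)=\<alpha> s +[gr A i](V i ^^ s) (c (Suc s))"
  "!!s. \<alpha> s:[gr A i]"
proof -
 define \<alpha> where "\<alpha>=rec_nat (c 0) (%s t. t +[gr A i](V i ^^ s) (c (Suc s)))"
 have a: "\<alpha> 0=c 0" "!!s. \<alpha> (Suc s)=\<alpha> s +[gr A i](V i ^^ s) (c (Suc s))" by (simp_all add: \<alpha>_def)
 have ac: "\<alpha> s:[gr A i]" for s by (induction s) (simp_all add: a c V_pow_cl)
 have "fl.coh i \<alpha>" using VF_V[OF c] by (simp add: chr_def ac a(2) gr.add_diff_l V_pow_cl c)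
 thus ?thesis using that a ac by blast
qed

lemma V_fil_W: "V_fil p W i r=lim_fil (gr A i) (V_fil p A i) r"
proof (intro equalityI subsetI)
 fix x assume x: "x : V_fil p W i r"
 have L: "asub (lim_fil (gr A i) (V_fil p A i) r) (gr W i)" using filg.Fil_sub[OF fl.fil.lim_filt] by simp
 have "(%x. x) x : lim_fil (gr A i) (V_fil p A i) r"
 proof (rule WS.VF_ind[OF x L ah_id])
  fix a assume "a:[gr W i]"
  then obtain m where m: "fl.coh i m" "a=fl.Lim i m" "!!r. m r:[gr A i]" by (rule Lim_cs) blast
  thus "(ver p W i ^^ r) a : lim_fil (gr A i) (V_fil p A i) r" by (simp add: ver_Lim fl.fil.lim_fil_iff coh_V VF_V)
 next
  fix j b assume j: "i=Suc j" and "b:[gr W j]"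
  then obtain m where m: "fl.coh j m" "b=fl.Lim j m" "!!r. m r:[gr A j]" by (metis Lim_cs)
  thus "dif W j ((ver p W j ^^ r) b) : lim_fil (gr A i) (V_fil p A i) r" using fl.fil.lim_fil_iff[OF fl.coh_dif[OF coh_V[OF m(1)]]] by (simp add: j ver_Lim fl.dif_Lim coh_V VF_dV)
 qed (rule WS.gr_group)
 thus "x : lim_fil (gr A i) (V_fil p A i) r" .
next
 fix x assume x: "x : lim_fil (gr A i) (V_fil p A i) r"
 hence "x:[gr W i]" by (simp add: lim_fil_def)
 then obtain m where m: "fl.coh i m" "x=fl.Lim i m" "!!r. m r:[gr A i]" by (rule Lim_cs) blast
 have m0: "m r : VF i r" using x m by (simp add: fl.fil.lim_fil_iff)
 \<comment> \<open>\<open>m (r + s)\<close> is telescoped into increments \<open>D\<close>. The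
   truncated subtraction in \<open>l\<close> gives \<open>l 0 = r\<close> and
   \<open>l (Suc s) = r + s\<close>, the filtration level of each increment.\<close>
 define D where "D s=(case s of 0 => m r | Suc t => m (r + s) -[gr A i]m (r + t))" for s
 define l where "l s=r + (s - 1)" for s :: nat
 have "D s : VF i (l s)" for s using m0 m(1) by (auto simp: D_def l_def chr_def split: nat.split)
 hence "\<forall>s. \<exists>a. \<exists>w. a:[gr A i] & w : dV_img i (l s) & D s=(V i ^^ l s) a +[gr A i]w" unfolding VF_iff by blast
 from choice[OF this] obtain a where
  "\<forall>s. \<exists>w. a s:[gr A i] & w : dV_img i (l s) & D s=(V i ^^ l s) (a s) +[gr A i]w" ..
 from choice[OF this] obtain w where
  aw: "\<forall>s. a s:[gr A i] & w s : dV_img i (l s) & D s=(V i ^^ l s) (a s) +[gr A i]w s" ..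
 have a: "a s:[gr A i]" and w: "w s : dV_img i (l s)"
  and D: "D s=(V i ^^ l s) (a s) +[gr A i]w s" for s using aw by simp_all
 \<comment> \<open>Pulling \<open>V^r\<close> out of the terms \<open>V^(r+s) a\<close> leaves the
   partial sums of a convergent series with terms \<open>V^s a\<close>; in positive degree the exact
   parts are summed in the same way.\<close>
 obtain \<alpha> where \<alpha>: "fl.coh i \<alpha>" "\<alpha> 0=a 0" "!!s. \<alpha> (Suc s)=\<alpha> s +[gr A i](V i ^^ s) (a (Suc s))"
  "!!s. \<alpha> s:[gr A i]" by (rule series[of a, OF a]) blast
 have l: "l 0=r" "l (Suc s)=r + s" for s by (simp_all add: l_def)
 have mS: "m (r + Suc s)=m (r + s) +[gr A i]D (Suc s)" for s by (simp add: D_def gr.add_minus_cancel m)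
 have tail: "m s -[gr A i]m (r + s) : VF i s" for s using fl.fil.coh_le[OF m(1), of s "r + s"] by (auto intro: gr.sub_sub_cm[OF VF_sub] m(3))
 have WV: "(ver p W i ^^ r) (fl.Lim i \<alpha>) : V_fil p W i r" using fl.Lim_cl[OF \<alpha>(1)] by (intro WS.VF_V) simp
 show "x : V_fil p W i r"
 proof (cases i)
  case 0
  hence w0: "w s=0[gr A i]" for s using w[of s] by (simp add: dV_img_def)
  have "m (r + s)=(V i ^^ r) (\<alpha> s)" for s
  proof (induction s)
   case 0
   thus ?case using D[of 0] a by (simp add: D_def l w0 \<alpha> V_pow_cl)
  next
   case (Suc s)
   show ?case unfolding mS Suc D \<alpha>(3) l w0 using a \<alpha>(4) by (simp add: V_pow_add V_pow_cl funpow_add)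
  qed
  hence "fl.Lim i m=fl.Lim i (%s. (V i ^^ r) (\<alpha> s))" using tail by (intro Lim_eqI) (simp_all add: m V_pow_cl \<alpha>)
  thus ?thesis using WV m(2) ver_Lim[OF \<alpha>(1)] by simp
 next
  case (Suc j)
  have "\<exists>b\<in>carrier (gr A j). w s=dif A j ((V j ^^ l s) b)" for s using w[of s] by (auto simp: dV_img_def Suc)
  then obtain b where b: "!!s. b s:[gr A j]" "!!s. w s=dif A j ((V j ^^ l s) (b s))" by metis
  obtain \<beta> where \<beta>: "fl.coh j \<beta>" "\<beta> 0=b 0" "!!s. \<beta> (Suc s)=\<beta> s +[gr A j](V j ^^ s) (b (Suc s))"
   "!!s. \<beta> s:[gr A j]" by (rule series[of b, OF b(1)]) blast
  let ?v = "%s. (V i ^^ r) (\<alpha> s)" and ?w = "%s. dif A j ((V j ^^ r) (\<beta> s))"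
  have c: "?v s:[gr A i]" "?w s:[gr A i]" for s using \<alpha>(4) \<beta>(4) Suc by (simp_all add: V_pow_cl dif_closed)
  have "m (r + s)=?v s +[gr A i]?w s" for s
  proof (induction s)
   case 0
   thus ?case using D[of 0] by (simp add: D_def l \<alpha> \<beta> b(2))
  next
   case (Suc s)
   have e: "w (Suc s)=dif A j ((V j ^^ r) ((V j ^^ s) (b (Suc s))))" by (simp add: b(2) l funpow_add)
   have f: "?w (Suc s)=?w s +[gr A i]w (Suc s)" unfolding \<beta>(3) e using \<beta>(4) b(1) \<open>i = Suc j\<close> by (simp add: V_pow_add V_pow_cl dif_add)
   have g: "?v (Suc s)=?v s +[gr A i](V i ^^ (r + s)) (a (Suc s))" unfolding \<alpha>(3) using \<alpha>(4) a by (simp add: V_pow_add V_pow_cl funpow_add)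
   have wc: "w (Suc s):[gr A i]" using w by (rule dV_img_cl)
   show ?case unfolding mS Suc D l f g using c wc a by (simp add: gr.a_ac V_pow_cl)
  qed
  hence "fl.Lim i m=fl.Lim i (%s. ?v s +[gr A i]?w s)" using tail c by (intro Lim_eqI) (simp_all add: m)
  also have "\<dots>=(ver p W i ^^ r) (fl.Lim i \<alpha>) +[gr W i]dif W j ((ver p W j ^^ r) (fl.Lim j \<beta>))" unfolding ver_Lim[OF \<alpha>(1)] ver_Lim[OF \<beta>(1)] W_s fl.dif_Lim[OF coh_V[OF \<beta>(1)]] using fl.fil.lim_add[of ?v i ?w] c Suc by simp
  finally show ?thesis using WS.VF_add[OF WV] WS.VF_dV[of "fl.Lim j \<beta>" j r] fl.Lim_cl[OF \<beta>(1)] m(2) Suc by simp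
 qed
qed

lemma W_strict: "strict p W" unfolding strict_def
proof (intro conjI allI W_saturated)
 fix i
 have "V_fil p W i=lim_fil (gr A i) (V_fil p A i)" by (simp add: fun_eq_iff V_fil_W)
 thus "lim_complete (gr W i) (V_fil p W i)" using fl.fil.lim_cmp_lim by simp
qed

lemma W_unit: "dieu_hom R A W fl.\<tau>" unfolding dieu_hom_def
proof (intro conjI allI ballI)
 show "graded_ring_hom A W fl.\<tau>" using fl.tau_gr by (simp add: grh_def)
 fix i x assume x: "x:[gr A i]"
 show "fl.\<tau> (Suc i) (dif A i x)=dif W i (fl.\<tau> i x)" using fl.tau_dif[OF x] by simp
 show "fl.\<tau> i (F i x)=frob W i (fl.\<tau> i x)" by (simp add: fl.fil.to_lim_eq frob_Lim[OF fl.coh_const[OF x]])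
next
 fix r show "fl.\<tau> 0 (rmap A r)=rmap W r" using fl.tau_rmap by simp
qed

end

lemma (in abelian_group) neg_diff_diff:
 "x:[G]==>y:[G]==>\<ominus> x \<ominus> (y \<ominus> x)=\<ominus> y" by algebra

section \<open>Strict Dieudonne algebras: reduced quotient and Teichmueller lifts\<close>

locale strd = satd R A p FR
 for R :: "('r, 'y) ring_scheme" and A :: "('a, 'r, 'z) dieu_scheme" and p FR +
 assumes strict: "strict p A"
begin

lemma VF_cmp: "lim_complete (gr A i) (V_fil p A i)" using strict by (simp add: strict_def)
lemma VF_sep: "x:[gr A i]==>(!!r. x : VF i r)==>x=0[gr A i]" by (rule fl.fil.cmp_sep[OF VF_cmp])
lemma p_sep: "p_sep p (gr A i)" unfolding p_sep_def using VF_sep p_VF by blast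

definition theta :: "'a => 'a" where
 "theta m=(SOME w. w:[gr A 0] & F 0 m -[gr A 0]m [^][deg0 A] p=p .[gr A 0] w)"

lemma theta: assumes "m:[gr A 0]"
 shows "theta m:[gr A 0]" "F 0 m -[gr A 0]m [^][deg0 A] p=p .[gr A 0] theta m"
proof -
 have "\<exists>w. w:[gr A 0] & F 0 m -[gr A 0]m [^][deg0 A] p=p .[gr A 0] w" by (rule frob_liftD[OF frob_lift, of m]) (use assms in auto)
 from someI_ex[OF this] show "theta m:[gr A 0]"
  "F 0 m -[gr A 0]m [^][deg0 A] p=p .[gr A 0] theta m" by (simp_all add: theta_def)
qed

definition teich :: "'a => bool" where
 "teich t \<longleftrightarrow> t:[gr A 0] & F 0 t=t [^][deg0 A] p"

lemma pow_cl: "x:[gr A 0]==>x [^][deg0 A] (n::nat):[gr A 0]" using deg0.nat_pow_closed[of x n] by simp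
lemma V_inj: assumes "x:[gr A i]" "y:[gr A i]" "V i x=V i y" shows "x=y" using gr.nm_inj[OF tf_gr assms(1,2)] assms by (metis F_V)

text \<open>For Teichmueller elements the quotients in \<open>theta_expand\<close> vanish, so
  \<open>V^r a\<close> itself lies one step deeper; applying \<open>V\<close> gives the same for the
  difference \<open>V^(r+1) a\<close>.\<close>

lemma te_uniq_step:
 assumes t: "teich t" and t': "teich t'" and d: "t' -[gr A 0]t : VF 0 (Suc r)"
 shows "t' -[gr A 0]t : VF 0 (Suc (Suc r))"
proof -
 have z: "F 0 u -[gr A 0]u [^][deg0 A] p=p .[gr A 0] 0[gr A 0]" if "teich u" for u using that by (simp add: teich_def pow_cl)
 have c: "t:[gr A 0]" "t':[gr A 0]" using t t' by (auto simp: teich_def)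
 obtain a where a: "a:[gr A 0]" "t' -[gr A 0]t=(V 0 ^^ Suc r) a"
  "(V 0 ^^ r) a -[gr A 0](0[gr A 0] -[gr A 0]0[gr A 0]) : VF 0 (Suc r)" using theta_expand[OF c d _ z[OF t] _ z[OF t']] by blast
 hence "V 0 ((V 0 ^^ r) a) : VF 0 (Suc (Suc r))" by (intro VF_Ver) (simp add: V_pow_cl)
 thus ?thesis using a by simp
qed

lemma te_uniq:
 assumes "teich t" "teich t'" "t' -[gr A 0]t : VF 0 1" shows "t'=t"
proof (rule fl.fil.cmp_eqI[OF VF_cmp])
 fix r
 have "t' -[gr A 0]t : VF 0 (Suc r)" by (induction r) (use assms te_uniq_step in auto)
 thus "t' -[gr A 0]t : VF 0 r" using VF_Suc by blast
qed (use assms in \<open>auto simp: teich_def\<close>)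

text \<open>Here \<open>m' - m = - V theta(m)\<close>. As \<open>V\<close> is injective, the linear
  term \<open>V^r a\<close> of \<open>theta_expand\<close> equals \<open>- theta m\<close> and
  cancels the error to first order.\<close>

lemma te_step:
 assumes m: "m:[gr A 0]" and w: "theta m : VF 0 r"
 defines "m' \<equiv> m -[gr A 0]V 0 (theta m)"
 shows "m':[gr A 0]" "m' -[gr A 0]m : VF 0 (Suc r)" "theta m' : VF 0 (Suc r)"
proof -
 note th = theta[OF m]
 have Vw: "V 0 (theta m):[gr A 0]" by (rule V_cl[OF th(1)])
 show m': "m':[gr A 0]" using m Vw by (simp add: m'_def)
 have d: "m' -[gr A 0]m=-[gr A 0]V 0 (theta m)" unfolding m'_def using m Vw by (simp add: gr.minus_eq gr.a_ac gr.r_neg2 gr.r_neg1)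
 show D: "m' -[gr A 0]m : VF 0 (Suc r)" unfolding d using additive_subgroup.a_inv_closed[OF VF_sub VF_Ver[OF w]] .
 obtain a where a: "a:[gr A 0]" "m' -[gr A 0]m=(V 0 ^^ Suc r) a"
  "(V 0 ^^ r) a -[gr A 0](theta m' -[gr A 0]theta m) : VF 0 (Suc r)" using theta_expand[OF m m' D th theta[OF m']] by blast
 have v: "(V 0 ^^ r) a:[gr A 0]" using a(1) by (rule V_pow_cl)
 have "V 0 ((V 0 ^^ r) a)=V 0 (-[gr A 0] theta m)" using a(2) th(1) unfolding d by (simp add: gpair.ah_neg[OF gr_pair V_hom])
 hence "(V 0 ^^ r) a=-[gr A 0]theta m" using V_inj v th(1) by simp
 hence "-[gr A 0] theta m -[gr A 0](theta m' -[gr A 0]theta m) : VF 0 (Suc r)" using a(3) by simp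
 moreover have "-[gr A 0] theta m -[gr A 0](theta m' -[gr A 0]theta m)=-[gr A 0]theta m'" using gr.neg_diff_diff[OF th(1) theta(1)[OF m']] .
 ultimately show "theta m' : VF 0 (Suc r)" using additive_subgroup.a_inv_closed[OF VF_sub, of "-[gr A 0] theta m'" 0 "Suc r"]
   gr.minus_minus[OF theta(1)[OF m']] by simp
qed

text \<open>Newton iteration \<open>m \<mapsto> m - V \<theta>(m)\<close>.\<close>

lemma te_ex:
 assumes x: "x:[gr A 0]"
 obtains t where "teich t" "t -[gr A 0]x : VF 0 1"
proof -
 define m where "m n=((%m. m -[gr A 0]V 0 (theta m)) ^^ n) x" for n
 have m0: "m 0=x" and mS: "m (Suc n)=m n -[gr A 0]V 0 (theta (m n))" for n by (simp_all add: m_def)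
 have *: "m n:[gr A 0] & theta (m n) : VF 0 n" for n
 proof (induction n)
  case 0
  thus ?case using x theta(1)[OF x] VF_V[of "theta x" 0 0] by (simp add: m0)
 next
  case (Suc n)
  thus ?case using te_step[of "m n" n] by (simp add: mS)
 qed
 have d: "m (Suc n) -[gr A 0]m n : VF 0 (Suc n)" for n using te_step(2)[of "m n" n] * by (simp add: mS)
 hence "m (Suc n) -[gr A 0]m n : VF 0 n" for n using VF_Suc by blast
 hence "fl.coh 0 m" using * by (simp add: chr_def)
 then obtain t where t: "t:[gr A 0]" "!!r. t -[gr A 0]m r : VF 0 r" using VF_cmp fl.fil.lim_cmp_iff by blast
 have "theta t=0[gr A 0]"
 proof (rule VF_sep[OF theta(1)[OF t(1)]])
  fix r
  have c: "m (Suc r):[gr A 0]" using * by blast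
  have "theta t -[gr A 0]theta (m (Suc r)) : VF 0 r" by (rule theta_cg[OF c t(1) t(2) theta[OF c] theta[OF t(1)]])
  moreover have "theta (m (Suc r)) : VF 0 r" using * VF_Suc by blast
  ultimately show "theta t : VF 0 r" using gr.sub_mem_cg[OF VF_sub] theta(1)[OF c] theta(1)[OF t(1)] by blast
 qed
 hence "teich t" using theta(2)[OF t(1)] t(1) by (simp add: teich_def gr.sub_0_iff F_cl pow_cl)
 moreover have "t -[gr A 0]x : VF 0 1" using gr.sub_sub_tr[OF VF_sub t(1) _ x t(2)[of 1]] d[of 0] * by (simp add: m0)
 ultimately show ?thesis using that by blast
qed

lemma te_0: "teich 0[gr A 0]" using deg0.nat_pow_zero[of p] p_pos by (simp add: teich_def F_0)
lemma VF_1_idl: "x:[gr A 0]==>y : VF 0 1==>gmul A 0 0 x y : VF 0 1" using VF_idl[of x 0 y 0 1] by simp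
lemma muls_VF: "x : mults p (gr A 0)==>x : VF 0 1" using p_VF[of x 1 0] by simp

text \<open>Modulo \<open>p\<close>, hence modulo the filtration step 1, the \<open>p\<close>-th
  power is \<open>F\<close>, and \<open>F\<close> is injective modulo the filtration by
  \<open>F_div\<close>. So the quotient by \<open>V E^0\<close> is reduced, which gives one
  inclusion of \<open>rad_eq\<close>.\<close>

lemma pow_VF: assumes "y:[gr A 0]" "y [^][deg0 A] p : VF 0 1" shows "y : VF 0 1"
proof -
 have "F 0 y -[gr A 0]y [^][deg0 A] p : VF 0 1" using theta[OF assms(1)] muls_VF gr.muls_mem by metis
 hence "F 0 y : VF 0 1" using gr.sub_mem_cg[OF VF_sub F_cl[OF assms(1)] pow_cl[OF assms(1)]] assms(2) by blast
 thus ?thesis by (rule F_div[OF assms(1)])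
qed

lemma rad_eq: "rad p (deg0 A)=VF 0 1"
proof (intro equalityI subsetI)
 fix x assume "x : VF 0 1"
 hence x: "x : VF 0 (Suc 0)" by simp
 obtain e where e: "e : VF 0 (Suc 0)" "x [^][deg0 A] p=p .[gr A 0] e" using VF_pow[OF x] .
 hence "x [^][deg0 A] p : mults p (gr A 0)" using gr.muls_mem[OF VF_car[OF e(1)]] by simp
 thus "x : rad p (deg0 A)" using VF_car[OF x] unfolding rad_def by auto
next
 fix x assume "x : rad p (deg0 A)"
 then obtain n :: nat where x: "x:[gr A 0]" and n: "x [^][deg0 A] n : mults p (gr A 0)" by (auto simp: rad_def)
 \<comment> \<open>The exponent is enlarged to a power of \<open>p\<close>, because
   \<open>pow_VF\<close> removes one \<open>p\<close>-th power at a time.\<close>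
 have "n <= p ^ n" using power_gt_expt[of p n] prime_gt_1_nat[OF prime_p] by simp
 then obtain l where l: "p ^ n=l + n" by (metis add.commute le_Suc_ex)
 have "x [^][deg0 A] (p ^ n)=gmul A 0 0 (x [^][deg0 A] l) (x [^][deg0 A] n)" using deg0.nat_pow_mult[of x l n] x by (simp add: l)
 hence "x [^][deg0 A] (p ^ n) : VF 0 1" using VF_1_idl[OF pow_cl[OF x] muls_VF[OF n], of l] by simp
 moreover have "x : VF 0 1" if "x [^][deg0 A] (p ^ k) : VF 0 1" for k using that
 proof (induction k)
  case 0 thus ?case using x deg0.l_one[of x] by simp
 next
  case (Suc k)
  have "(x [^][deg0 A] (p ^ k)) [^][deg0 A] p : VF 0 1" using Suc.prems deg0.nat_pow_pow[of x "p ^ k" p] x by (simp add: mult.commute)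
  thus ?case using Suc.IH pow_VF pow_cl[OF x] by blast
 qed
 ultimately show "x : VF 0 1" by blast
qed

lemma red_cls_eq_iff:
 "x:[gr A 0]==>y:[gr A 0] ==>
  rcl p (deg0 A) x=rcl p (deg0 A) y \<longleftrightarrow> x -[gr A 0]y : VF 0 1" by (simp add: red_class_def rad_eq gr.cos_eq_iff VF_sub)

end

section \<open>Morphisms of Dieudonne algebras\<close>

lemma dieu_homD:
 assumes "dieu_hom R A B f"
 shows "f i : ahom (gr A i) (gr B i)"
  and "x:[gr A i]==>y:[gr A j]==>f (i + j) (gmul A i j x y)=gmul B i j (f i x) (f j y)"
  and "f 0 (gone A)=gone B"
  and "x:[gr A i]==>f (Suc i) (dif A i x)=dif B i (f i x)"
  and "x:[gr A i]==>f i (frob A i x)=frob B i (f i x)"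
  and "r:[R]==>f 0 (rmap A r)=rmap B r" using assms by (auto simp: dieu_hom_def grh_def)

lemma dieu_homI:
 assumes "!!i. f i : ahom (gr A i) (gr B i)"
  and "!!i j x y. x:[gr A i]==>y:[gr A j]==>f (i + j) (gmul A i j x y)=gmul B i j (f i x) (f j y)"
  and "f 0 (gone A)=gone B"
  and "!!i x. x:[gr A i]==>f (Suc i) (dif A i x)=dif B i (f i x)"
  and "!!i x. x:[gr A i]==>f i (frob A i x)=frob B i (f i x)"
  and "!!r. r:[R]==>f 0 (rmap A r)=rmap B r"
 shows "dieu_hom R A B f" using assms by (auto simp: dieu_hom_def grh_def)

lemma dieu_hom_comp:
 assumes f: "dieu_hom R A B f" and g: "dieu_hom R B C g"
 shows "dieu_hom R A C (%i x. g i (f i x))" by (rule dieu_homI, rule ah_comp[OF dieu_homD(1)[OF f] dieu_homD(1)[OF g]])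
  (simp_all add: dieu_homD(2-6)[OF f] dieu_homD(2-6)[OF g] ah_cl[OF dieu_homD(1)[OF f]])

lemma dieu_hom_ring: "dieu_hom R A B f==>f 0 : rhom (deg0 A) (deg0 B)" using dieu_homD(1)[of R A B f 0] dieu_homD(2)[of R A B f _ 0 _ 0] dieu_homD(3)[of R A B f] by (intro rhI) (auto simp: hom_def)

locale saturated_hom = S: satd R A p FR + E: satd R E p FR
 for R :: "('r, 'y) ring_scheme" and A :: "('a, 'r, 'z) dieu_scheme"
  and E :: "('b, 'r, 'w) dieu_scheme" and p FR +
 fixes g :: "nat => 'a => 'b"
 assumes hom: "dieu_hom R A E g"
begin

lemmas g = dieu_homD[OF hom]
lemmas g_cl = ah_cl[OF g(1)]

sublocale pair: gpair "gr A i" "gr E j" for i j by unfold_locales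

lemma g_V: "x:[gr A i]==>g i (S.V i x)=E.V i (g i x)" by (rule E.V_eqI[symmetric]) (simp_all add: g_cl S.V_cl S.F_V pair.ah_nm[OF g(1)] flip: g(5))
lemma g_V_pow: "x:[gr A i]==>g i ((S.V i ^^ k) x)=(E.V i ^^ k) (g i x)" by (induction k) (simp_all add: g_V S.V_pow_cl)

lemma g_VF: assumes "x : S.VF i r" shows "g i x : E.VF i r"
proof (rule S.VF_ind[OF assms E.VF_sub g(1)])
 fix a assume "a:[gr A i]"
 thus "g i ((S.V i ^^ r) a) : E.VF i r" by (simp add: g_V_pow E.VF_V g_cl)
next
 fix j b assume "i=Suc j" "b:[gr A j]"
 thus "g i (dif A j ((S.V j ^^ r) b)) : E.VF i r" by (simp add: g(4) g_V_pow E.VF_dV g_cl S.V_pow_cl)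
qed (rule E.gr_group)

end

section \<open>The universal property of saturation and strictification\<close>

locale to_strict = A: tfd R A p FR + E: strd R E p FR
 for R :: "('r, 'y) ring_scheme" and A :: "('a, 'r, 'z) dieu_scheme"
  and E :: "('b, 'r, 'w) dieu_scheme" and p FR
begin

lemma TS: "satd R A.T p FR" by (intro satd.intro tfd.intro tfd_axioms.intro
   satd_axioms.intro A.sat_dieu A.sat_tf A.sat_saturated A.p_pos E.prime_p)

sublocale S: satd R A.T p FR by (rule TS)

sublocale pair: gpair "gr A i" "gr E j" for i j by unfold_locales

abbreviation "W \<equiv> strictification p A.T"

text \<open>One root \<open>y\<close> is taken at a time, and \<open>d y\<close> has to inherit the
  divisibility. Write \<open>F(d y) = p^n z\<close>. Then \<open>z\<close> is closed, because
  \<open>p^n d z = d F(d y) = p F(d d y) = 0\<close>, so \<open>z = F w\<close>, and injectivity of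
  \<open>F\<close> gives \<open>d y = p^n w\<close>.\<close>

lemma F_pow_div:
 assumes "x:[gr E i]" "dif E i x : mults (p ^ n) (gr E (Suc i))"
 obtains y where "y:[gr E i]" "x=(E.F i ^^ n) y" using assms
proof (induction n arbitrary: x thesis)
 case 0 thus ?case by simp
next
 case (Suc n)
 have "dif E i x : mults p (gr E (Suc i))" using Suc.prems(3) E.gr.muls_dvd[of p "p ^ Suc n" "Suc i"] by auto
 then obtain y where y: "y:[gr E i]" "x=E.F i y" using E.F_sj Suc.prems by blast
 have Fd: "E.F (Suc i) (dif E i y):[gr E (Suc i)]" using y by (simp add: E.F_cl E.dif_closed)
 have "E.F (Suc i) (dif E i y) : mults (p ^ n) (gr E (Suc i))" using E.gr.muls_can[OF E.tf_gr Fd, of "p ^ n"] Suc.prems(3) y by (simp add: E.dif_frob)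
 then obtain z where z: "z:[gr E (Suc i)]" "E.F (Suc i) (dif E i y)=(p ^ n) .[gr E (Suc i)] z" by (auto simp: mults_def)
 have "(p ^ n) .[gr E (Suc (Suc i))] dif E (Suc i) z=(p ^ n) .[gr E (Suc (Suc i))] 0[gr E (Suc (Suc i))]" using E.dif_frob[OF E.dif_closed[OF y(1)]] z by (simp add: E.dif_dif y E.F_0 flip: E.dif_nm)
 hence "dif E (Suc i) z=0[gr E (Suc (Suc i))]" by (rule E.nm_eqD[rotated 2]) (simp_all add: E.dif_closed z)
 hence "dif E (Suc i) z : mults p (gr E (Suc (Suc i)))" by (simp add: sub_zero[OF E.gr.muls_sub])
 then obtain w where w: "w:[gr E (Suc i)]" "z=E.F (Suc i) w" using E.F_sj z by blast
 have "dif E i y=(p ^ n) .[gr E (Suc i)] w" by (rule E.F_inj[of _ "Suc i"]) (use y w z in \<open>simp_all add: E.dif_closed E.F_nm\<close>)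
 hence "dif E i y : mults (p ^ n) (gr E (Suc i))" using w by (auto simp: mults_def)
 then obtain v where v: "v:[gr E i]" "y=(E.F i ^^ n) v" using Suc.IH y by blast
 thus ?case using Suc.prems(1)[of v] y by simp
qed

section \<open>Extension of a morphism over the saturation\<close>

context
 fixes f :: "nat => 'a => 'b"
 assumes f_hom: "dieu_hom R A E f"
begin

lemmas f = dieu_homD[OF f_hom]
lemmas f_closed = ah_cl[OF f(1)]

lemma f_F_pow: "x:[gr A i]==>f i ((A.F i ^^ k) x)=(E.F i ^^ k) (f i x)" by (induction k) (simp_all add: f(5) A.F_pow_cl)

text \<open>The class of \<open>(n, y)\<close> behaves as \<open>F^(-n) y\<close>, so its image has
  to be the \<open>e\<close> with \<open>F^n e = f y\<close>. Demanding this for all representatives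
  at once avoids a choice.\<close>

definition sat_ext :: "nat => (nat \<times> 'a) set => 'b" where
 "sat_ext i X=(THE e. e:[gr E i] & (\<forall>(n, y)\<in>X. (E.F i ^^ n) e=f i y))"

lemma sat_ext: assumes y: "y : A.St i n"
 shows "sat_ext i (A.cs i n y):[gr E i]" "(E.F i ^^ n) (sat_ext i (A.cs i n y))=f i y"
proof -
 note yc = A.St_cl[OF y]
 have "dif E i (f i y) : mults (p ^ n) (gr E (Suc i))" using y pair.ah_muls[OF f(1)] by (simp add: A.St_iff flip: f(4))
 then obtain e where e: "e:[gr E i]" "f i y=(E.F i ^^ n) e" using F_pow_div f_closed[OF yc] by blast
 have "(E.F i ^^ m) e=f i z" if mz: "(m, z) : A.cs i n y" for m z
 proof -
  obtain t where t: "z : A.St i m" "max m n <= t" "(A.F i ^^ (t - n)) y=(A.F i ^^ (t - m)) z" using mz by (auto simp: A.cls_mem)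
  note zc = A.St_cl[OF t(1)]
  show ?thesis
  proof (rule E.F_inj_pow[of _ _ _ "t - m"])
   have "(E.F i ^^ (t - m)) (f i z)=(E.F i ^^ (t - n)) (f i y)" using t(3) zc yc by (metis f_F_pow)
   also have "\<dots>=(E.F i ^^ t) e" using E.F_pow_diff[of 0 n t i e] e t by simp
   also have "\<dots>=(E.F i ^^ (t - m)) ((E.F i ^^ m) e)" using E.F_pow_diff[of 0 m t i e] t by simp
   finally show "(E.F i ^^ (t - m)) ((E.F i ^^ m) e)=(E.F i ^^ (t - m)) (f i z)" by simp
  qed (use e zc in \<open>simp_all add: E.F_pow_cl f_closed\<close>)
 qed
 hence P: "e:[gr E i] & (\<forall>(n, y)\<in>A.cs i n y. (E.F i ^^ n) e=f i y)" using e by auto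
 have "sat_ext i (A.cs i n y)=e" unfolding sat_ext_def
 proof (rule the_equality[of "%e. e:[gr E i] & (\<forall>(n, y)\<in>A.cs i n y. (E.F i ^^ n) e=f i y)", OF P])
  fix e' assume e': "e':[gr E i] & (\<forall>(n, y)\<in>A.cs i n y. (E.F i ^^ n) e'=f i y)"
  hence "(E.F i ^^ n) e'=f i y" using A.cls_self[OF y] by auto
  thus "e'=e" using e e' E.F_inj_pow by metis
 qed
 thus "sat_ext i (A.cs i n y):[gr E i]" "(E.F i ^^ n) (sat_ext i (A.cs i n y))=f i y" using e by auto
qed

lemma sat_ext_eqI: "y : A.St i n==>e:[gr E i]==>(E.F i ^^ n) e=f i y==>sat_ext i (A.cs i n y)=e" using sat_ext[of y i n] E.F_inj_pow by metis
lemma sat_ext_unit: "y:[gr A i]==>sat_ext i (A.cs i 0 y)=f i y" by (rule sat_ext_eqI) (simp_all add: A.St_0 f_closed)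

lemma sat_ext_hom: "dieu_hom R A.T E sat_ext"
proof (rule dieu_homI)
 fix i show "sat_ext i : ahom (gr A.T i) (gr E i)"
 proof (rule ahI)
  fix x assume x: "x:[gr A.T i]"
  thus "sat_ext i x:[gr E i]" by (auto simp: A.sat_car sat_ext)
  fix y assume "y:[gr A.T i]"
  then obtain n a b where ab: "a : A.St i n" "x=A.cs i n a" "b : A.St i n" "y=A.cs i n b" by (rule A.sat_reps2[OF x])
  show "sat_ext i (x +[gr A.T i]y)=sat_ext i x +[gr E i]sat_ext i y" unfolding ab(2,4) A.cs_add[OF ab(1,3)] by (rule sat_ext_eqI) (simp_all add: A.St_add ab(1,3) sat_ext ah_add[OF E.F_pow_hom] ah_add[OF f(1)] A.St_cl[OF ab(1)] A.St_cl[OF ab(3)])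
 qed
next
 fix i j x y assume xy: "x:[gr A.T i]" "y:[gr A.T j]"
 then obtain n a b where ab: "a : A.St i n" "x=A.cs i n a" "b : A.St j n" "y=A.cs j n b" by (rule A.sat_reps2)
 show "sat_ext (i + j) (gmul A.T i j x y)=gmul E i j (sat_ext i x) (sat_ext j y)" unfolding ab(2,4) A.cs_gmul[OF ab(1,3)] by (rule sat_ext_eqI) (simp_all add: A.St_gmul(1) ab(1,3) sat_ext E.gmul_closed E.F_pow_gmul f(2) A.St_cl[OF ab(1)] A.St_cl[OF ab(3)])
next
 show "sat_ext 0 (gone A.T)=gone E" using sat_ext_unit[OF A.gone_closed] by (simp add: A.cs_gone[of 0] f(3))
next
 fix i x assume "x:[gr A.T i]"
 then obtain n a where a: "a : A.St i n" "x=A.cs i n a" by (auto simp: A.sat_car)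
 note c = A.St_cl[OF a(1)] and s = sat_ext[OF a(1)]
 have Fd: "(E.F (Suc i) ^^ n) (dif E i (sat_ext i x))=f (Suc i) (A.dv i n a)"
 proof (rule E.nm_eqD[of _ _ _ n])
  have "(p ^ n) .[gr E (Suc i)] (E.F (Suc i) ^^ n) (dif E i (sat_ext i x))=dif E i (f i a)" using E.dif_F_pow[OF s(1), of n] s(2) a(2) by simp
  also have "\<dots>=(p ^ n) .[gr E (Suc i)] f (Suc i) (A.dv i n a)" using f(4)[OF c] A.dv[OF a(1)] by (simp flip: pair.ah_nm[OF f(1)])
  finally show "(p ^ n) .[gr E (Suc i)] (E.F (Suc i) ^^ n) (dif E i (sat_ext i x))=(p ^ n) .[gr E (Suc i)] f (Suc i) (A.dv i n a)" .
 qed (use s a A.dv[OF a(1)] in \<open>simp_all add: E.F_pow_cl E.dif_closed f_closed\<close>)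
 thus "sat_ext (Suc i) (dif A.T i x)=dif E i (sat_ext i x)" unfolding a(2) A.cs_dif[OF a(1)] using s a by (intro sat_ext_eqI A.dv_St) (simp_all add: E.dif_closed)
 show "sat_ext i (frob A.T i x)=frob E i (sat_ext i x)" unfolding a(2) A.cs_frob[OF a(1)] by (rule sat_ext_eqI) (simp_all add: A.St_F' a(1) s E.F_cl f(5) c flip: funpow_swap1)
next
 fix r assume "r:[R]"
 thus "sat_ext 0 (rmap A.T r)=rmap E r" using sat_ext_unit[OF A.rmap_closed] by (simp add: A.cs_rmap f(6))
qed

section \<open>Extension over the strictification\<close>

interpretation SE: saturated_hom R A.T E p FR sat_ext by (intro saturated_hom.intro saturated_hom_axioms.intro TS E.satd_axioms sat_ext_hom)

interpretation fm: film "gr A.T i" "V_fil p A.T i" "gr E i" "V_fil p E i" "sat_ext i" for i by (intro film.intro film_axioms.intro S.fl.fil.filg_axioms E.fl.fil.filg_axioms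
   E.VF_cmp SE.g(1) SE.g_VF)

definition wsat_ext :: "nat => (nat => (nat \<times> 'a) set set) => 'b" where
 "wsat_ext i=lim_ext (gr A.T i) (V_fil p A.T i) (gr E i) (V_fil p E i) (sat_ext i)"

interpretation WS: satd R W p FR by (intro satd.intro tfd.intro tfd_axioms.intro
   satd_axioms.intro S.W_dieudonne S.W_saturated S.W_tf A.p_pos E.prime_p)

lemma W_fil: "lim_fil (gr A.T i) (V_fil p A.T i) r=V_fil p W i r" by (simp add: S.V_fil_W)
lemma wext_hom: "wsat_ext i : ahom (gr W i) (gr E i)" using fm.ext_hom by (simp add: wsat_ext_def)
lemma wext_fil: "x : V_fil p W i r==>wsat_ext i x : E.VF i r" using fm.ext_fil by (simp add: wsat_ext_def W_fil)
lemma wext_tau: "t:[gr A.T i]==>wsat_ext i (S.fl.\<tau> i t)=sat_ext i t" using fm.ext_to_lim by (simp add: wsat_ext_def)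

text \<open>Density with one filtration step lost by the maps, as happens on composing with
  \<open>F\<close>. The loss is absorbed by comparing against the reindexed filtration
  \<open>VF j (r - 1)\<close> of the target, in which level 0 occurs twice.\<close>

lemma W_eqI:
 assumes "h : ahom (gr W i) (gr E j)" "k : ahom (gr W i) (gr E j)"
  and "!!r x. x : V_fil p W i (Suc r)==>h x : E.VF j r" "!!r x. x : V_fil p W i (Suc r)==>k x : E.VF j r"
  and "!!t. t:[gr A.T i]==>h (S.fl.\<tau> i t)=k (S.fl.\<tau> i t)"
  and "x:[gr W i]"
 shows "h x=k x"
proof (rule lim_hom_eqI[of "gr A.T i" "V_fil p A.T i" "gr E j" "%r. E.VF j (r - 1)" h k])
 show "filg (gr E j) (%r. E.VF j (r - 1))" using E.VF_Suc[of j] by (intro filg.intro filg_axioms.intro E.gr_group E.VF_sub) 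
   (metis diff_Suc_1 Suc_pred gr0I subset_refl diff_0_eq_0)
 have *: "h x : E.VF j (r - 1)" if "h : ahom (gr W i) (gr E j)" "!!r x. x : V_fil p W i (Suc r)==>h x : E.VF j r"
  "x : lim_fil (gr A.T i) (V_fil p A.T i) r" for h r x
 proof (cases r)
  case 0
  have "x:[gr W i]" using that(3) by (simp add: lim_fil_def)
  hence "(E.V j ^^ 0) (h x) : E.VF j 0" by (intro E.VF_V ah_cl[OF that(1)])
  thus ?thesis using 0 by simp
 next
  case (Suc s)
  thus ?thesis using that by (simp add: W_fil)
 qed
 show "!!r x. x : lim_fil (gr A.T i) (V_fil p A.T i) r==>h x : E.VF j (r - 1)" by (rule *[OF assms(1,3)])
 show "!!r x. x : lim_fil (gr A.T i) (V_fil p A.T i) r==>k x : E.VF j (r - 1)" by (rule *[OF assms(2,4)])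
 fix e assume e: "e:[gr E j]" "!!r. e : E.VF j (r - 1)"
 show "e=0[gr E j]" using E.VF_sep[OF e(1)] e(2)[of "Suc _"] by simp
qed (use assms S.fl.fil.filg_axioms in simp_all)

lemma wext_fil': "x : V_fil p W i (Suc r)==>wsat_ext i x : E.VF i r" using wext_fil E.VF_Suc by blast

lemma wsat_ext_hom: "dieu_hom R W E wsat_ext"
proof (rule dieu_homI)
 note tau = dieu_homD[OF S.W_unit] and se = dieu_homD[OF sat_ext_hom]
 note tauc = ah_cl[OF tau(1)] and wc = ah_cl[OF wext_hom]
 fix i show "wsat_ext i : ahom (gr W i) (gr E i)" by (rule wext_hom)
 { fix x assume x: "x:[gr W i]"
  show "wsat_ext (Suc i) (dif W i x)=dif E i (wsat_ext i x)" by (rule W_eqI[OF ah_comp[OF WS.dif_hom wext_hom] ah_comp[OF wext_hom E.dif_hom] _ _ _ x])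
    (auto simp: wext_tau A.T.dif_closed se(4) simp del: S.W_s simp flip: tau(4)
     intro: wext_fil' WS.VF_dif E.VF_dif)
  show "wsat_ext i (frob W i x)=frob E i (wsat_ext i x)" by (rule W_eqI[OF ah_comp[OF WS.F_hom wext_hom] ah_comp[OF wext_hom E.F_hom] _ _ _ x])
    (auto simp: wext_tau S.F_cl se(5) simp del: S.W_s simp flip: tau(5)
     intro: wext_fil WS.VF_F E.VF_F) }
 fix j x y assume x: "x:[gr W i]" and y: "y:[gr W j]"
 \<comment> \<open>Multiplicativity by density in one argument at a time: first with the second
   factor from the dense image, then in general.\<close>
 have 1: "wsat_ext (i + j) (gmul W i j x (S.fl.\<tau> j s))=gmul E i j (wsat_ext i x) (wsat_ext j (S.fl.\<tau> j s))"
  if s: "s:[gr A.T j]" for s by (rule W_eqI[OF ah_comp[OF WS.rmul_hom[OF tauc[OF s]] wext_hom]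
     ah_comp[OF wext_hom E.rmul_hom[OF wc[OF tauc[OF s]]]] _ _ _ x])
   (auto simp: wext_tau A.T.gmul_closed se(2) s tauc ah_cl[OF se(1) s] simp del: S.W_s simp flip: tau(2)
    intro!: wext_fil' cfil.idl_l[OF WS.VF_filt] cfil.idl_l[OF E.VF_filt] wc)
 show "wsat_ext (i + j) (gmul W i j x y)=gmul E i j (wsat_ext i x) (wsat_ext j y)" by (rule W_eqI[OF ah_comp[OF WS.lmul_hom[OF x] wext_hom] ah_comp[OF wext_hom E.lmul_hom[OF wc[OF x]]] _ _ _ y])
   (use x in \<open>auto simp: 1 simp del: S.W_s intro!: wext_fil' WS.VF_idl E.VF_idl wc\<close>)
next
 show "wsat_ext 0 (gone W)=gone E" using wext_tau[OF A.T.gone_closed] dieu_homD(3)[OF sat_ext_hom] dieu_homD(3)[OF S.W_unit] by simp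
next
 fix r assume r: "r:[R]"
 thus "wsat_ext 0 (rmap W r)=rmap E r" using wext_tau[OF S.rmap_closed[OF r]] dieu_homD(6)[OF sat_ext_hom] dieu_homD(6)[OF S.W_unit] by simp
qed

lemma wsat_ext_unit: "x:[gr A i]==>wsat_ext i (wsat_unit p A i x)=f i x" by (simp add: wsat_unit_def wext_tau A.cs_cl A.St_0 sat_ext_unit)

end

text \<open>An element of the saturation comes from \<open>A\<close> after a power of
  \<open>F\<close>, and \<open>F\<close> is injective on \<open>E\<close>. This settles the dense
  image of the saturation, and density does the rest.\<close>

lemma wsat_uniq:
 assumes g: "dieu_hom R W E g" and h: "dieu_hom R W E h"
  and eq: "!!i x. x:[gr A i]==>g i (wsat_unit p A i x)=h i (wsat_unit p A i x)"
  and x: "x:[gr W i]"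
 shows "g i x=h i x"
proof -
 have WS: "satd R W p FR" by (intro satd.intro tfd.intro tfd_axioms.intro
   satd_axioms.intro S.W_dieudonne S.W_saturated S.W_tf A.p_pos E.prime_p)
 interpret WS: satd R W p FR by (rule WS)
 note tau = dieu_homD[OF S.W_unit]
 have fil: "k i x : E.VF i r" if "dieu_hom R W E k" "x : lim_fil (gr A.T i) (V_fil p A.T i) r" for k r x using saturated_hom.g_VF[of R W E p FR k] that WS E.satd_axioms by (simp add: saturated_hom_def saturated_hom_axioms_def S.V_fil_W)
 have *: "(E.F i ^^ n) (k i (S.fl.\<tau> i (A.cs i n y)))=k i (wsat_unit p A i y)"
  if k: "dieu_hom R W E k" and y: "y : A.St i n" for k n y
 proof -
  have c: "A.cs i n y:[gr A.T i]" using y by (rule A.cs_cl)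
  have kF: "(E.F i ^^ m) (k i z)=k i ((frob W i ^^ m) z)" if "z:[gr W i]" for z m using that by (induction m) (simp_all add: dieu_homD(5)[OF k] WS.F_pow_cl del: S.W_s)
  have tF: "(frob W i ^^ m) (S.fl.\<tau> i z)=S.fl.\<tau> i ((frob A.T i ^^ m) z)" if "z:[gr A.T i]" for z m using that by (induction m) (simp_all add: tau(5) S.F_pow_cl)
  have "(frob A.T i ^^ m) (A.cs i n y)=A.cs i n ((A.F i ^^ m) y)" for m
  proof (induction m)
   case (Suc m)
   have "(A.F i ^^ m) y : A.St i n" using y by (induction m) (simp_all add: A.St_F')
   thus ?case using Suc by (simp add: A.cs_frob)
  qed simp
  hence "(frob A.T i ^^ n) (A.cs i n y)=A.cs i 0 y" using A.cls_shift[of i 0 n y] by simp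
  thus ?thesis using kF[OF ah_cl[OF tau(1) c], of n] tF[OF c, of n] by (simp add: wsat_unit_def)
 qed
 show ?thesis
 proof (rule lim_hom_eqI[of "gr A.T i" "V_fil p A.T i" "gr E i" "V_fil p E i" "g i" "h i"])
  fix t assume "t:[gr A.T i]"
  then obtain n y where t: "y : A.St i n" "t=A.cs i n y" by (auto simp: A.sat_car)
  have tc: "S.fl.\<tau> i t:[gr W i]" using t A.cs_cl ah_cl[OF tau(1)] by metis
  show "g i (S.fl.\<tau> i t)=h i (S.fl.\<tau> i t)"
  proof (rule E.F_inj_pow[of _ _ _ n])
   show "(E.F i ^^ n) (g i (S.fl.\<tau> i t))=(E.F i ^^ n) (h i (S.fl.\<tau> i t))" unfolding t(2) *[OF g t(1)]*[OF h t(1)] by (rule eq[OF A.St_cl[OF t(1)]])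
  qed (use ah_cl[OF dieu_homD(1)[OF g] tc] ah_cl[OF dieu_homD(1)[OF h] tc] in simp_all)
 qed (use S.fl.fil.filg_axioms E.fl.fil.filg_axioms E.VF_sep fil[OF g] fil[OF h] x
   dieu_homD(1)[OF g, of i] dieu_homD(1)[OF h, of i] in auto)
qed

end

section \<open>Polynomial rings\<close>

text \<open>The coefficient of a product is a sum over the submultisets of its exponent; without
  finiteness \<open>finsum\<close> would return its default value.\<close>

lemma finite_submulisets: "finite {U. U <=# M}"
proof (induction M)
 case empty
 have "{U. U <=# {#}}={{#}}" by auto
 thus ?case by simp
next
 case (add x M)
 have "{U. U <=# add_mset x M} <= {U. U <=# M} \<union> add_mset x ` {U. U <=# M}"
 proof
  fix U assume U: "U : {U. U <=# add_mset x M}"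
  show "U : {U. U <=# M} \<union> add_mset x ` {U. U <=# M}"
  proof (cases "x \<in># U")
   case True
   then obtain W where W: "U=add_mset x W" by (metis mset_add)
   hence "W <=# M" using U by simp
   thus ?thesis using W by blast
  next
   case False
   have "U <=# M"
   proof (rule mset_subset_eqI)
    fix a show "count U a <= count M a" using False U mset_subset_eq_count[of U "add_mset x M" a] by (cases "a=x") (auto simp: not_in_iff)
   qed
   thus ?thesis by simp
  qed
 qed
 thus ?case using add finite_subset by blast
qed

locale mpolys = R: cring R for R :: "('r, 'm) ring_scheme" +
 fixes nm :: "nat \<times> nat"
begin

abbreviation "P \<equiv> mpr R nm"
abbreviation "mnm \<equiv> mpoly_monom R"
abbreviation "vmsets \<equiv> {M. set_mset M <= vars nm}"

lemma P_s [simp]: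
 "0[P]=(%M. 0[R])" "f +[P]g=(%M. f M +[R]g M)"
 "1[P]=mnm 1[R] {#}" by (auto simp: mpoly_ring_def mpoly_monom_def)

lemma P_car: "f:[P] \<longleftrightarrow> (\<forall>M. f M:[R]) & finite {M. f M ~= 0[R]} & {M. f M ~= 0[R]} <= vmsets" by (auto simp: mpoly_ring_def)
lemma P_coeff: "f:[P]==>f M:[R]" by (simp add: P_car)

lemma P_grp: "abelian_group P"
proof (rule abelian_groupI)
 fix f g assume f: "f:[P]" and g: "g:[P]"
 have s: "{M. f M +[R]g M ~= 0[R]} <= {M. f M ~= 0[R]} \<union> {M. g M ~= 0[R]}" by auto
 have u: "finite ({M. f M ~= 0[R]} \<union> {M. g M ~= 0[R]})"
  "{M. f M ~= 0[R]} \<union> {M. g M ~= 0[R]} <= vmsets" using f g unfolding P_car by blast+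
 show "f +[P]g:[P]" using f g finite_subset[OF s u(1)] order_trans[OF s u(2)] by (simp add: P_car)
 show "f +[P]g=g +[P]f" using f g by (simp add: P_coeff R.a_comm fun_eq_iff)
next
 fix f assume f: "f:[P]"
 have "-[R] f M=0[R] \<longleftrightarrow> f M=0[R]" for M using P_coeff[OF f, of M] R.minus_minus[of "f M"] by force
 hence "(%M. -[R]f M):[P]" using f by (simp add: P_car)
 moreover have "(%M. -[R]f M) +[P]f=0[P]" using f by (simp add: P_coeff R.l_neg)
 ultimately show "\<exists>y\<in>carrier P. y +[P]f=0[P]" by blast
qed (simp_all add: P_car R.a_assoc)

sublocale Pg: abelian_group P by (rule P_grp)

lemma P_neg: assumes f: "f:[P]" shows "-[P] f=(%M. -[R]f M)"
proof -
 have "-[R] f M=0[R] \<longleftrightarrow> f M=0[R]" for M using P_coeff[OF f, of M] R.minus_minus[of "f M"] by force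
 hence "(%M. -[R]f M):[P]" using f by (simp add: P_car)
 thus ?thesis using f by (intro Pg.minus_equality) (simp_all add: P_coeff R.l_neg)
qed

lemma P_sub: "f:[P]==>g:[P]==>f -[P]g=(%M. f M -[R]g M)" by (simp add: Pg.minus_eq P_neg R.minus_eq)
lemma P_nm: "n .[P] f=(%M. (n::nat) .[R] f M)" by (induction n) (simp_all add: Pg.nm_Suc R.nm_Suc)

lemma mon_cl: "c:[R]==>set_mset M <= vars nm==>mnm c M:[P]"
proof -
 assume "c:[R]" "set_mset M <= vars nm"
 moreover have "{N. mnm c M N ~= 0[R]} <= {M}" by (auto simp: mpoly_monom_def)
 ultimately show ?thesis by (auto simp: P_car mpoly_monom_def intro: finite_subset)
qed

lemma mon_add: "c:[R]==>d:[R]==>mnm (c +[R]d) M=mnm c M +[P]mnm d M" by (simp add: mpoly_monom_def fun_eq_iff)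
lemma mon_ah: "set_mset M <= vars nm==>(%c. mnm c M) : ahom R P" by (rule ahI) (simp_all add: mon_cl mon_add del: P_s)
lemma mon_0 [simp]: "mnm 0[R] M=(%M. 0[R])" by (auto simp: mpoly_monom_def)

lemma P_ind [consumes 1, case_names zero mon add]:
 assumes "f:[P]" and z: "Q 0[P]"
  and m: "!!c M. c:[R]==>set_mset M <= vars nm==>Q (mnm c M)"
  and a: "!!f g. f:[P]==>g:[P]==>Q f==>Q g==>Q (f +[P]g)"
 shows "Q f"
proof -
 have "finite S==>f:[P]==>{M. f M ~= 0[R]} <= S==>Q f" for S f
 proof (induction S arbitrary: f rule: finite_induct)
  case empty
  hence "f=0[P]" by auto
  thus ?case using z by simp
 next
  case (insert M S)
  let ?g = "f(M := 0[R])"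
  have g: "?g:[P]" using insert.prems(1) by (auto simp: P_car elim: finite_subset[rotated])
  have "Q ?g" using insert.prems by (intro insert.IH g) auto
  show ?case
  proof (cases "f M=0[R]")
   case True
   hence "?g=f" by auto
   thus ?thesis using \<open>Q ?g\<close> by simp
  next
   case False
   hence "set_mset M <= vars nm" using insert.prems(1) by (auto simp: P_car)
   hence "Q (mnm (f M) M)" "mnm (f M) M:[P]" using m mon_cl P_coeff[OF insert.prems(1)] by blast+
   moreover have "f=mnm (f M) M +[P]?g" using P_coeff[OF insert.prems(1)] by (auto simp: mpoly_monom_def fun_eq_iff)
   ultimately show ?thesis using a[OF _ g _ \<open>Q ?g\<close>] by metis
  qed
 qed
 thus ?thesis using assms(1) by (metis P_car order_refl)
qed

lemma P_ah_eqI: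
 assumes "abelian_group G" "h : ahom P G" "k : ahom P G"
  and "!!c M. c:[R]==>set_mset M <= vars nm==>h (mnm c M)=k (mnm c M)"
  and "f:[P]"
 shows "h f=k f" using assms(5)
proof (induction rule: P_ind)
 case zero
 thus ?case using gpair.ah_0[OF gpairI[OF P_grp assms(1)]] assms(2,3) by metis
next
 case (add f g)
 thus ?case using ah_add[OF assms(2)] ah_add[OF assms(3)] by metis
qed (rule assms(4))

text \<open>The additive map with prescribed values \<open>\<phi> M c\<close> on monomials.
  Evaluation maps and partial derivatives are instances.\<close>

definition mp_lin :: "('b, 'n) ring_scheme => ((nat + nat) multiset => 'r => 'b) => 'r mpoly => 'b" where
 "mp_lin G \<phi> f=finsum G (%M. \<phi> M (f M)) {M. f M ~= 0[R]}"

lemma mp_lin: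
 assumes "abelian_group G" and \<phi>: "!!M. set_mset M <= vars nm==>\<phi> M : ahom R G"
 shows mp_lin_hom: "mp_lin G \<phi> : ahom P G"
  and mp_lin_mon: "c:[R]==>set_mset M <= vars nm==>mp_lin G \<phi> (mnm c M)=\<phi> M c"
proof -
 interpret G: abelian_group G by fact
 interpret gpair R G by unfold_locales
 have z: "\<phi> M 0[R]=0[G]" if "set_mset M <= vars nm" for M using ah_0[OF \<phi>[OF that]] .
 have c: "\<phi> M x:[G]" if "set_mset M <= vars nm" "x:[R]" for M x using ah_cl[OF \<phi>] that .
 have big: "mp_lin G \<phi> f=finsum G (%M. \<phi> M (f M)) S"
  if "finite S" "{M. f M ~= 0[R]} <= S" "S <= vmsets" "f:[P]" for f S unfolding mp_lin_def by (rule G.add.finprod_mono_neutral_cong_left) (use that z c in \<open>auto simp: P_coeff\<close>)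
 show "mp_lin G \<phi> : ahom P G"
 proof (rule ahI)
  fix f assume f: "f:[P]"
  thus "mp_lin G \<phi> f:[G]" unfolding mp_lin_def using c by (intro G.finsum_closed) (auto simp: P_car)
  fix g assume g: "g:[P]"
  let ?S = "{M. f M ~= 0[R]} \<union> {M. g M ~= 0[R]}"
  have S: "finite ?S" "?S <= vmsets" using f g by (auto simp: P_car)
  have "mp_lin G \<phi> (f +[P]g)=finsum G (%M. \<phi> M ((f +[P]g) M)) ?S" by (rule big) (use S f g Pg.a_closed[OF f g] in auto)
  also have "\<dots>=finsum G (%M. \<phi> M (f M) +[G]\<phi> M (g M)) ?S" using S(2) c f g by (intro G.finsum_cong') (auto simp: P_coeff ah_add[OF \<phi>])
  also have "\<dots>=finsum G (%M. \<phi> M (f M)) ?S +[G]finsum G (%M. \<phi> M (g M)) ?S" using S(2) c f g by (intro G.finsum_addf) (auto simp: P_coeff)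
  also have "\<dots>=mp_lin G \<phi> f +[G]mp_lin G \<phi> g" using big[OF S(1) _ S(2) f] big[OF S(1) _ S(2) g] by simp
  finally show "mp_lin G \<phi> (f +[P]g)=mp_lin G \<phi> f +[G]mp_lin G \<phi> g" .
 qed
 show "mp_lin G \<phi> (mnm d M)=\<phi> M d" if "d:[R]" "set_mset M <= vars nm" for d M
 proof -
  have "mp_lin G \<phi> (mnm d M)=finsum G (%N. \<phi> N (mnm d M N)) {M}" by (rule big) (use that mon_cl in \<open>auto simp: mpoly_monom_def\<close>)
  thus ?thesis using c[OF that(2,1)] by (simp add: mpoly_monom_def)
 qed
qed

lemma P_mul: "(f *[P]g) M=(\<Oplus>\<^bsub>R\<^esub>U\<in>{U. U <=# M}. f U *[R]g (M - U))" by (simp add: mpoly_ring_def)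

lemma P_dist_l:
 assumes "!!M. f M:[R]" "!!M. g M:[R]" "!!M. h M:[R]"
 shows "(%M. f M +[R]g M) *[P]h=f *[P]h +[P]g *[P]h" using assms by (auto simp: fun_eq_iff P_mul R.l_distr Pi_iff intro!: R.finsum_addf)

lemma P_dist_r:
 assumes "!!M. f M:[R]" "!!M. g M:[R]" "!!M. h M:[R]"
 shows "h *[P](%M. f M +[R]g M)=h *[P]f +[P]h *[P]g" using assms by (auto simp: fun_eq_iff P_mul R.r_distr Pi_iff intro!: R.finsum_addf)

lemma mon_mul:
 assumes "c:[R]" "d:[R]"
 shows "mnm c M *[P]mnm d N=mnm (c *[R]d) (M + N)"
proof
 fix L :: "(nat + nat) multiset"
 let ?A = "{U. U <=# L}"
 have "(mnm c M *[P]mnm d N) L=(\<Oplus>\<^bsub>R\<^esub>U\<in>?A. if M=U then c *[R]mnm d N (L - U) else 0[R])" unfolding P_mul by (rule R.finsum_cong') (use assms in \<open>auto simp: mpoly_monom_def\<close>)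
 also have "\<dots>=mnm (c *[R]d) (M + N) L"
 proof (cases "M <=# L")
  case True
  have "(\<Oplus>\<^bsub>R\<^esub>U\<in>?A. if M=U then c *[R]mnm d N (L - U) else 0[R])=c *[R]mnm d N (L - M)" by (rule R.add.finprod_singleton) (use True assms in \<open>auto simp: finite_submulisets mpoly_monom_def\<close>)
  moreover have "L - M=N \<longleftrightarrow> L=M + N" using True by (metis add_diff_cancel_left' subset_mset.add_diff_inverse)
  ultimately show ?thesis using assms by (simp add: mpoly_monom_def)
 next
  case False
  hence "(\<Oplus>\<^bsub>R\<^esub>U\<in>?A. if M=U then c *[R]mnm d N (L - U) else 0[R])=(\<Oplus>\<^bsub>R\<^esub>U\<in>?A. 0[R])" by (intro R.finsum_cong') auto
  moreover have "L ~= M + N" using False by auto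
  ultimately show ?thesis by (simp add: mpoly_monom_def)
 qed
 finally show "(mnm c M *[P]mnm d N) L=mnm (c *[R]d) (M + N) L" .
qed

lemma P_mul_0:
 assumes "!!M. f M:[R]" shows "0[P] *[P]f=0[P]" "f *[P]0[P]=0[P]"
proof -
 have "(\<Oplus>\<^bsub>R\<^esub>U\<in>{U. U <=# M}. g U)=0[R]" if "!!U. g U=0[R]" for g :: "(nat + nat) multiset => 'r" and M
 proof -
  have "g=(%U. 0[R])" using that by auto
  thus ?thesis by simp
 qed
 thus "0[P] *[P]f=0[P]" "f *[P]0[P]=0[P]" using assms by (auto simp: fun_eq_iff P_mul)
qed

lemma P_mul_cl:
 assumes "f:[P]" "g:[P]" shows "f *[P]g:[P]" using assms(1)
proof (induction rule: P_ind)
 case zero thus ?case using P_mul_0(1)[of g] assms(2) Pg.zero_closed by (metis P_coeff)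
next
 case (mon c M)
 note cM = this
 from assms(2) show ?case
 proof (induction rule: P_ind)
  case zero thus ?case using P_mul_0(2)[of "mnm c M"] mon_cl[OF cM] Pg.zero_closed by (metis P_coeff)
 next
  case (mon d N)
  thus ?case using cM by (simp add: mon_mul mon_cl)
 next
  case (add g h)
  have "mnm c M *[P](g +[P]h)=mnm c M *[P]g +[P]mnm c M *[P]h" using P_dist_r[of g h "mnm c M"] add mon_cl[OF cM] by (simp add: P_coeff)
  thus ?case using add Pg.a_closed by metis
 qed
next
 case (add f h)
 have "(f +[P]h) *[P]g=f *[P]g +[P]h *[P]g" using P_dist_l[of f h g] add assms(2) by (simp add: P_coeff)
 thus ?case using add Pg.a_closed by metis
qed

lemma P_l_distr: "f:[P]==>g:[P]==>h:[P] ==>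
  (f +[P]g) *[P]h=f *[P]h +[P]g *[P]h" using P_dist_l[of f g h] by (simp add: P_coeff)

lemma P_r_distr: "f:[P]==>g:[P]==>h:[P] ==>
  h *[P](f +[P]g)=h *[P]f +[P]h *[P]g" using P_dist_r[of f g h] by (simp add: P_coeff)

lemma P_rmul: "g:[P]==>(%f. f *[P]g) : ahom P P" by (rule ahI) (simp_all add: P_mul_cl P_l_distr del: P_s)
lemma P_lmul: "g:[P]==>(%f. g *[P]f) : ahom P P" by (rule ahI) (simp_all add: P_mul_cl P_r_distr del: P_s)

lemma P_cm: assumes "f:[P]" "g:[P]" shows "f *[P]g=g *[P]f"
proof (rule P_ah_eqI[OF P_grp P_rmul[OF assms(2)] P_lmul[OF assms(2)] _ assms(1)])
 fix c M assume cM: "c:[R]" "set_mset M <= vars nm"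
 note m = mon_cl[OF cM]
 show "mnm c M *[P]g=g *[P]mnm c M" by (rule P_ah_eqI[OF P_grp P_lmul[OF m] P_rmul[OF m] _ assms(2)])
   (use cM in \<open>simp add: mon_mul R.m_comm add.commute\<close>)
qed

lemma P_as:
 assumes "f:[P]" "g:[P]" "h:[P]" shows "f *[P]g *[P]h=f *[P](g *[P]h)"
proof (rule P_ah_eqI[OF P_grp ah_comp[OF P_rmul[OF assms(2)] P_rmul[OF assms(3)]]
   P_rmul[OF P_mul_cl[OF assms(2,3)]] _ assms(1)])
 fix c M assume cM: "c:[R]" "set_mset M <= vars nm"
 note m = mon_cl[OF cM]
 show "mnm c M *[P]g *[P]h=mnm c M *[P](g *[P]h)"
 proof (rule P_ah_eqI[OF P_grp ah_comp[OF P_lmul[OF m] P_rmul[OF assms(3)]]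
    ah_comp[OF P_rmul[OF assms(3)] P_lmul[OF m]] _ assms(2)])
  fix d N assume dN: "d:[R]" "set_mset N <= vars nm"
  note n = mon_cl[OF dN]
  show "mnm c M *[P]mnm d N *[P]h=mnm c M *[P](mnm d N *[P]h)" by (rule P_ah_eqI[OF P_grp P_lmul[OF P_mul_cl[OF m n]] ah_comp[OF P_lmul[OF n] P_lmul[OF m]] _ assms(3)])
    (use cM dN in \<open>simp add: mon_mul R.m_assoc add.assoc\<close>)
 qed
qed

lemma P_one: "1[P]:[P]" by (simp add: mon_cl)
lemma P_l_one: assumes "f:[P]" shows "1[P] *[P]f=f" by (rule P_ah_eqI[OF P_grp P_lmul[OF P_one] ah_id _ assms]) (simp add: mon_mul)

lemma P_cring: "cring P" by (rule cringI, rule P_grp, rule comm_monoidI)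
  (rule P_mul_cl P_one P_as P_l_one P_cm P_l_distr; assumption)+

sublocale PR: cring P by (rule P_cring)

text \<open>Products are biadditive, so \<open>P_ah_eqI\<close>, applied once in each factor,
  reduces multiplicativity to pairs of monomials.\<close>

lemma P_rhI:
 assumes S: "ring S" and h: "h : ahom P S" and one: "h 1[P]=1[S]"
  and m: "!!c M d N. c:[R]==>set_mset M <= vars nm==>d:[R]==>set_mset N <= vars nm ==>
   h (mnm (c *[R]d) (M + N))=h (mnm c M) *[S]h (mnm d N)"
 shows "h : rhom P S"
proof (rule rhI)
 interpret S: ring S by fact
 fix f assume f: "f:[P]"
 show "h f:[S]" by (rule ah_cl[OF h f])
 have r: "y:[S]==>(%x. x *[S]y) : ahom S S" "y:[S]==>(%x. y *[S]x) : ahom S S" for y by (rule ahI; simp add: S.l_distr S.r_distr)+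
 fix g assume g: "g:[P]"
 show "h (f +[P]g)=h f +[S]h g" by (rule ah_add[OF h f g])
 show "h (f *[P]g)=h f *[S]h g"
 proof (rule P_ah_eqI[OF S.abelian_group_axioms ah_comp[OF P_rmul[OF g] h] ah_comp[OF h r(1)[OF ah_cl[OF h g]]] _ f])
  fix c M assume cM: "c:[R]" "set_mset M <= vars nm"
  note mc = mon_cl[OF cM]
  show "h (mnm c M *[P]g)=h (mnm c M) *[S]h g" by (rule P_ah_eqI[OF S.abelian_group_axioms ah_comp[OF P_lmul[OF mc] h] ah_comp[OF h r(2)[OF ah_cl[OF h mc]]] _ g])
    (use cM m in \<open>simp add: mon_mul\<close>)
 qed
qed (rule one)

section \<open>Evaluation homomorphisms\<close>

text \<open>The product runs over all of \<open>vars nm\<close> and not over the support of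
  \<open>M\<close>, so the index set stays fixed when exponents are added.\<close>

definition mset_val :: "('b, 'n) ring_scheme => (nat + nat => 'b) => (nat + nat) multiset => 'b" where
 "mset_val S t M=finprod S (%x. t x [^][S] count M x) (vars nm)"

lemma vars_finite: "finite (vars nm)" by (auto simp: vars_def split: prod.split)

lemma mset_val:
 assumes "cring S" and t: "!!x. x : vars nm==>t x:[S]"
 shows mset_val_cl: "mset_val S t M:[S]"
  and mset_val_add: "mset_val S t (M + N)=mset_val S t M *[S]mset_val S t N"
  and mset_val_empty: "mset_val S t {#}=1[S]"
  and mset_val_single: "x : vars nm==>mset_val S t {#x#}=t x"
proof -
 interpret S: cring S by fact
 have c: "(%x. t x [^][S] count M x) : vars nm \<rightarrow> carrier S" for M using t by auto
 show "mset_val S t M:[S]" using c by (simp add: mset_val_def S.finprod_closed)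
 show "mset_val S t (M + N)=mset_val S t M *[S]mset_val S t N" unfolding mset_val_def by (subst S.finprod_multf[OF c c, symmetric]) (rule S.finprod_cong', use t in \<open>auto simp: S.nat_pow_mult\<close>)
 show "mset_val S t {#}=1[S]" by (simp add: mset_val_def)
 assume x: "x : vars nm"
 have "mset_val S t {#x#}=finprod S (%y. if x=y then t y else 1[S]) (vars nm)" unfolding mset_val_def by (rule S.finprod_cong') (use t in auto)
 also have "\<dots>=t x" by (rule S.finprod_singleton) (use x t vars_finite in auto)
 finally show "mset_val S t {#x#}=t x" .
qed

definition eval :: "('b, 'n) ring_scheme => ('r => 'b) => (nat + nat => 'b) => 'r mpoly => 'b" where
 "eval S \<phi> t=mp_lin S (%M c. \<phi> c *[S]mset_val S t M)"

lemma eval: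
 assumes "cring S" and \<phi>: "\<phi> : rhom R S" and t: "!!x. x : vars nm==>t x:[S]"
 shows eval_mon: "c:[R]==>set_mset M <= vars nm==>eval S \<phi> t (mnm c M)=\<phi> c *[S]mset_val S t M"
  and eval_hom: "eval S \<phi> t : rhom P S"
proof -
 interpret S: cring S by fact
 note mv = mset_val[OF assms(1), of t, OF t]
 have a: "(%c. \<phi> c *[S]mset_val S t M) : ahom R S" for M by (intro ahI) (simp_all add: rh_cl[OF \<phi>] rh_add[OF \<phi>] mv(1) S.l_distr)
 note l = mp_lin[OF S.abelian_group_axioms, of "%M c. \<phi> c *[S]mset_val S t M", OF a, folded eval_def]
 show em: "eval S \<phi> t (mnm c M)=\<phi> c *[S]mset_val S t M" if "c:[R]" "set_mset M <= vars nm" for c M using l(2) that .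
 show "eval S \<phi> t : rhom P S"
 proof (rule P_rhI[OF S.ring_axioms l(1)])
  show "eval S \<phi> t 1[P]=1[S]" using em[of "1[R]" "{#}"] mv(3) rh_one[OF \<phi>] by simp
  fix c M d N assume "c:[R]" "set_mset M <= vars nm" "d:[R]" "set_mset N <= vars nm"
  thus "eval S \<phi> t (mnm (c *[R]d) (M + N))=eval S \<phi> t (mnm c M) *[S]eval S \<phi> t (mnm d N)" by (simp add: em mv(1,2) rh_cl[OF \<phi>] rh_mul[OF \<phi>] S.m_ac)
 qed
qed

lemma mon_spl:
 "c:[R]==>mnm c (add_mset x M)=mnm c M *[P]mnm 1[R] {#x#}" by (simp add: mon_mul)

lemma P_rh_eqI:
 assumes S: "ring S" and h: "h : rhom P S" and k: "k : rhom P S"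
  and c: "!!c. c:[R]==>h (mnm c {#})=k (mnm c {#})"
  and x: "!!x. x : vars nm==>h (mnm 1[R] {#x#})=k (mnm 1[R] {#x#})"
  and f: "f:[P]"
 shows "h f=k f"
proof (rule P_ah_eqI[OF _ rh_ah[OF h] rh_ah[OF k] _ f])
 show "abelian_group S" by (rule ring.is_abelian_group[OF S])
 fix c M assume c': "c:[R]" and "set_mset M <= vars nm"
 thus "h (mnm c M)=k (mnm c M)"
 proof (induction M)
  case empty thus ?case using c by simp
 next
  case (add y M)
  have "mnm c M:[P]" "mnm 1[R] {#y#}:[P]" using add by (auto intro: mon_cl)
  thus ?case using add x unfolding mon_spl[OF c', of y M] by (simp add: rh_mul[OF h] rh_mul[OF k])
 qed
qed

end

lemma (in abelian_group) add_diff_diff: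
 "[|a:[G]; z:[G]; b:[G]|]==>(a \<oplus> (z \<ominus> b)) \<ominus> z=a \<ominus> b" by algebra

section \<open>Contractions\<close>

text \<open>A log derivation of \<open>A\<close> over \<open>S\<close> with values in
  \<open>A\<close> itself, given by its values on symbols. Its axioms are what the interior product
  along it needs in order to respect the relations of degree one.\<close>

locale contraction = prelog_algebra S A
 for S :: "('s, 'n, 'y) prelog_scheme" and A :: "('a, 'l, 's, 'n, 'z) prelog_alg_scheme" +
 fixes dval :: "('a, 'l) dsym => 'a"
 assumes dval_closed: "s : dsyms A==>dval s:[pr A]"
  and dval_add: "[|a:[pr A]; b:[pr A]|] ==>
   dval (Dsym (a +[pr A]b))=dval (Dsym a) +[pr A]dval (Dsym b)"
  and dval_mul: "[|a:[pr A]; b:[pr A]|] ==>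
   dval (Dsym (a *[pr A]b))=a *[pr A]dval (Dsym b) +[pr A]b *[pr A]dval (Dsym a)"
  and dval_base: "r:[pr S]==>dval (Dsym (rstr A r))=0[pr A]"
  and dval_dlog_mul: "[|l:[pmon A]; m:[pmon A]|] ==>
   dval (Lsym (l *[pmon A]m))=dval (Lsym l) +[pr A]dval (Lsym m)"
  and dval_dlog_base: "n:[pmon S]==>dval (Lsym (nstr A n))=0[pr A]"
  and dval_log: "l:[pmon A]==>dval (Dsym (palpha A l))=palpha A l *[pr A]dval (Lsym l)"
begin

abbreviation "ofr w \<equiv> frg (1[pr A], w)"

text \<open>The interior product on words, with the sign of an antiderivation built into the
  recursion.\<close>

fun cw :: "('a, 'l) dsym list => ('a, 'l) form" where
 "cw []=0"
| "cw (s # w)=frg (dval s, w) - ofr [s] ** cw w"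

definition con :: "('a, 'l) form => ('a, 'l) form" where
 "con=frag_extend (%(a, w). frg (a, []) ** cw w)"

lemma con_of: "con (frg (a, w))=frg (a, []) ** cw w" by (simp add: con_def)
lemma con_lin: "con 0=0" "con (x - y)=con x - con y" "con (x + y)=con x + con y" "con (- x)=- con x" by (simp_all add: con_def frag_extend_diff frag_extend_add frag_extend_minus)

lemma con_word_cl: "w : words (Suc i)==>cw w : FF i"
proof (induction w arbitrary: i)
 case (Cons s w)
 have 1: "frg (dval s, w) : FF i" using Cons.prems by (simp add: FF_of dval_closed)
 have "ofr [s] ** cw w : FF i"
 proof (cases w)
  case Nil thus ?thesis by simp
 next
  case (Cons t v)
  then obtain j where j: "i=Suc j" "w : words (Suc j)" using Cons.prems by (cases i) auto
  hence "ofr [s] ** cw w : FF (1 + j)" using Cons.IH[OF j(2)] Cons.prems by (intro star_cl) (simp_all add: FF_of)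
  thus ?thesis using j by simp
 qed
 thus ?case using FF_diff[OF 1] by simp
qed simp

lemma con_word_cl': "set w <= dsyms A==>cw w : FF (length w - 1)" using con_word_cl[of w "length w - 1"] by (cases w) auto

lemma con_word_append:
 assumes "set u <= dsyms A" "set v <= dsyms A"
 shows "cw (u @ v)=cw u ** ofr v + fsgn (length u) (ofr u ** cw v)" using assms(1)
proof (induction u)
 case Nil
 show ?case using star_one[OF con_word_cl'[OF assms(2)]] by simp
next
 case (Cons s u)
 have c: "ofr [s] : FF 1" "ofr u : FF (length u)" "ofr v : FF (length v)" using Cons.prems assms(2) by (auto simp: FF_of)
 note cu = con_word_cl'[of u] and cv = con_word_cl'[OF assms(2)]
 have s: "set u <= dsyms A" "s : dsyms A" using Cons.prems by auto
 have "ofr [s] ** (cw u ** ofr v) = ofr [s] ** cw u ** ofr v" using star_as[OF c(1) cu[OF s(1)] c(3)] by simp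
 moreover have "ofr [s] ** (ofr u ** cw v) = ofr (s # u) ** cw v" using star_as[OF c(1) c(2) cv] by (simp add: star_of)
 moreover have "frg (dval s, u @ v)=frg (dval s, u) ** ofr v" using dval_closed[OF s(2)] by (simp add: star_of)
 ultimately show ?case using Cons.IH[OF s(1)] by (simp add: star_lin fsgn_def)
qed

lemma con_cl: assumes "x : FF (Suc i)" shows "con x : FF i" using assms
proof (induction rule: FF_ind)
 case (of a w)
 hence "frg (a, []) ** cw w : FF (0 + i)" by (intro star_cl con_word_cl) (auto simp: FF_of)
 thus ?case by (simp add: con_of)
qed (auto simp: con_lin FF_diff)

lemma con_0: "x : FF 0==>con x=0" by (induction rule: FF_ind) (auto simp: con_lin con_of)
lemma con_cl': "x : FF i==>con x : FF (i - 1)" using con_cl con_0 by (cases i) auto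

text \<open>The antiderivation rule. It is reduced to words by moving the coefficients
  \<open>a\<close> and \<open>b\<close> past them, scalars being central.\<close>

lemma con_star:
 assumes "x : FF i" "y : FF j" shows "con (x ** y)=con x ** y + fsgn i (x ** con y)" using assms(1)
proof (induction rule: FF_ind)
 case (of a w)
 note aw = this
 from assms(2) show ?case
 proof (induction rule: FF_ind)
  case (of b v)
  have c: "frg (a, []) : FF 0" "frg (b, []) : FF 0" "ofr v : FF j" "ofr w : FF i" using aw of by (auto simp: FF_of)
  note cw = con_word_cl'[OF aw(3)] and cv = con_word_cl'[OF of(3)]
  let ?a = "frg (a, [])" and ?b = "frg (b, [])"
  have ab: "frg (a *[pr A]b, [])=?a ** ?b" by (simp add: star_of)
  have "con (frg (a, w) ** frg (b, v))=?a ** ?b ** (cw w ** ofr v + fsgn i (ofr w ** cw v))" using aw of by (simp add: star_of con_of con_word_append ab[symmetric])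
  also have "\<dots>=?a ** ?b ** (cw w ** ofr v) + fsgn i (?a ** ?b ** (ofr w ** cw v))" by (simp add: star_lin fsgn_def)
  also have "?a ** ?b ** (cw w ** ofr v)=?a ** cw w ** frg (b, v)"
  proof -
   have "?a ** ?b ** (cw w ** ofr v)=?a ** (?b ** cw w ** ofr v)" using star_as[OF c(1,2) star_cl[OF cw c(3)]] star_as[OF c(2) cw c(3)] by simp
   also have "?b ** cw w=cw w ** ?b" using star_scalar_cm[OF cw of(1)] by simp
   also have "?a ** (cw w ** ?b ** ofr v)=?a ** cw w ** (?b ** ofr v)" using star_as[OF cw c(2,3)] star_as[OF c(1) cw star_cl[OF c(2,3)]] by simp
   finally show ?thesis using of by (simp add: star_of)
  qed
  also have "?a ** ?b ** (ofr w ** cw v)=frg (a, w) ** (?b ** cw v)"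
  proof -
   have "?a ** ?b ** (ofr w ** cw v)=?a ** (?b ** ofr w ** cw v)" using star_as[OF c(1,2) star_cl[OF c(4) cv]] star_as[OF c(2) c(4) cv] by simp
   also have "?b ** ofr w = ofr w ** ?b" using star_scalar_cm[OF c(4) of(1)] by simp
   also have "?a ** (ofr w ** ?b ** cw v)=?a ** ofr w ** (?b ** cw v)" using star_as[OF c(4) c(2) cv] star_as[OF c(1) c(4) star_cl[OF c(2) cv]] by simp
   finally show ?thesis using aw by (simp add: star_of)
  qed
  finally show ?case by (simp add: con_of)
 next
  case (diff x y)
  thus ?case by (simp add: star_lin con_lin fsgn_diff algebra_simps)
 qed (simp add: con_lin)
next
 case (diff x x')
 thus ?case by (simp add: star_lin con_lin fsgn_diff algebra_simps)
qed (simp add: con_lin)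

lemma rel_0_0: "frg (0[pr A], []) : rel 0" using rel_neg[OF brel_rel[OF b_coeff[of "0[pr A]" A "0[pr A]" S]]] by simp

lemma con_brel: assumes "brel S A e x" shows "con x : rel (e - 1)" using assms
proof (cases rule: brel.cases)
 case (b_coeff a b)
 thus ?thesis by (simp add: con_lin con_of form_rel.rel_zero)
next
 case (b_d_add b c)
 thus ?thesis using brel_rel[OF brel.b_coeff[of "dval (Dsym b)" A "dval (Dsym c)" S]] by (simp add: con_lin con_of star_of dval_closed dval_add)
next
 case (b_d_mult b c)
 thus ?thesis using brel_rel[OF brel.b_coeff[of "b *[pr A]dval (Dsym c)" A "c *[pr A]dval (Dsym b)" S]] by (simp add: con_lin con_of star_of dval_closed dval_mul)
next
 case (b_d_base s)
 thus ?thesis using rel_0_0 by (simp add: con_of star_of dval_base)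
next
 case (b_dlog_mult l m)
 thus ?thesis using brel_rel[OF brel.b_coeff[of "dval (Lsym l)" A "dval (Lsym m)" S]] by (simp add: con_lin con_of star_of dval_closed dval_dlog_mul)
next
 case (b_dlog_base n)
 thus ?thesis using rel_0_0 by (simp add: con_of star_of dval_dlog_base)
next
 case (b_log l)
 thus ?thesis by (simp add: con_lin con_of star_of dval_closed dval_log form_rel.rel_zero)
next
 case (b_square s)
 thus ?thesis by (simp add: con_of star_lin dval_closed form_rel.rel_zero)
next
 case (b_swap s t)
 thus ?thesis by (simp add: con_lin con_of star_lin dval_closed form_rel.rel_zero)
qed

lemma con_rel: assumes "x : rel (Suc i)" shows "con x : rel i" using assms
proof (induction rule: rel_ind)
 case (gen a u v e x)
 let ?U = "frg (a, u)" and ?V = "ofr v"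
 have U: "?U : FF (length u)" "?V : FF (length v)" using gen by (auto simp: FF_of)
 note X = brel_cl[OF gen(5)] and x = brel_rel[OF gen(5)]
 have i: "length u + e + length v=Suc i" by fact
 \<comment> \<open>In each of the three terms a contracted factor of degree 0 gives 0 and is treated
   apart, since there the degree cannot drop by one.\<close>
 have 1: "con ?U ** x ** ?V : rel i"
 proof (cases u)
  case Nil thus ?thesis using U by (simp add: con_0 form_rel.rel_zero)
 next
  case (Cons s w)
  thus ?thesis using rel_idl_r[OF rel_idl_l[OF con_cl'[OF U(1)] x] U(2)] i by simp
 qed
 have 2: "fsgn (length u) (?U ** con x ** ?V) : rel i"
 proof (cases e)
  case 0 thus ?thesis using X by (simp add: con_0 form_rel.rel_zero)
 next
  case (Suc j)
  thus ?thesis using rel_idl_r[OF rel_idl_l[OF U(1) con_brel[OF gen(5)]] U(2)] i by (intro rel_fsgn) simp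
 qed
 have 3: "fsgn (length u + e) (?U ** x ** con ?V) : rel i"
 proof (cases v)
  case Nil thus ?thesis using U by (simp add: con_0 form_rel.rel_zero)
 next
  case (Cons s w)
  thus ?thesis using rel_idl_r[OF rel_idl_l[OF U(1) x] con_cl'[OF U(2)]] i by (intro rel_fsgn) simp
 qed
 have "con (?U ** x ** ?V)=con ?U ** x ** ?V + fsgn (length u) (?U ** con x ** ?V) + fsgn (length u + e) (?U ** x ** con ?V)" by (simp add: con_star[OF star_cl[OF U(1) X] U(2)] con_star[OF U(1) X] star_lin fsgn_def)
 thus ?case using rel_add[OF rel_add[OF 1 2] 3] by simp
qed (auto simp: con_lin form_rel.rel_zero form_rel.rel_diff)

definition kap :: "nat => ('a, 'l) form set => ('a, 'l) form set" where
 "kap i X=cl i (con (SOME x. x : X))"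

lemma kap_cl: assumes "x : FF (Suc i)" shows "kap i (cl (Suc i) x)=cl i (con x)"
proof -
 let ?y = "SOME y. y : cl (Suc i) x"
 have "?y : cl (Suc i) x" using FF.cos_self[OF rel_sub assms] by (rule someI)
 hence y: "?y : FF (Suc i)" "?y - x : rel (Suc i)" using assms by (auto simp: FF.cos_mem[OF rel_sub assms])
 thus ?thesis using con_rel[OF y(2)] assms con_cl by (simp add: kap_def cl_eq_iff con_lin)
qed

lemma kap_hom: "kap i : ahom (gr om (Suc i)) (gr om i)" by (rule ahI) (auto simp: om_car kap_cl con_cl cl_add FF_add con_lin)

lemma kap_mul:
 assumes s: "s : dsyms A" and z: "z:[gr om (Suc i)]"
 shows "kap (Suc i) (gmul om 1 (Suc i) (cl 1 (ofr [s])) z) =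
   gmul om 0 (Suc i) (cl 0 (frg (dval s, []))) z -[gr om (Suc i)]gmul om 1 i (cl 1 (ofr [s])) (kap i z)"
proof -
 obtain x where x: "x : FF (Suc i)" "z=cl (Suc i) x" using z by (auto simp: om_car)
 have c: "ofr [s] : FF 1" "frg (dval s, []) : FF 0" using s by (auto simp: FF_of dval_closed)
 have sc: "ofr [s] ** x : FF (Suc (Suc i))" "frg (dval s, []) ** x : FF (Suc i)" "ofr [s] ** con x : FF (Suc i)" using star_cl[OF c(1) x(1)] star_cl[OF c(2) x(1)] star_cl[OF c(1) con_cl[OF x(1)]] by simp_all
 have "con (ofr [s] ** x)=frg (dval s, []) ** x - ofr [s] ** con x" unfolding con_star[OF c(1) x(1)] using s by (simp add: con_of star_of dval_closed)
 thus ?thesis using gmul_cl[OF c(1) x(1)] gmul_cl[OF c(2) x(1)] gmul_cl[OF c(1) con_cl[OF x(1)]] sc by (simp add: x(2) kap_cl cl_diff x(1))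
qed

lemma kap_mul_0:
 assumes s: "s : dsyms A" and z: "z:[gr om 0]"
 shows "kap 0 (gmul om 1 0 (cl 1 (ofr [s])) z)=gmul om 0 0 (cl 0 (frg (dval s, []))) z"
proof -
 obtain x where x: "x : FF 0" "z=cl 0 x" using z by (auto simp: om_car)
 have c: "ofr [s] : FF 1" "frg (dval s, []) : FF 0" using s by (auto simp: FF_of dval_closed)
 have sc: "ofr [s] ** x : FF (Suc 0)" using star_cl[OF c(1) x(1)] by simp
 have "con (ofr [s] ** x)=frg (dval s, []) ** x" unfolding con_star[OF c(1) x(1)] using s x by (simp add: con_of star_of dval_closed con_0)
 thus ?thesis using gmul_cl[OF c(1) x(1)] gmul_cl[OF c(2) x(1)] sc by (simp add: x(2) kap_cl)
qed

end

section \<open>Torsion in the log de Rham complex of a framed algebra\<close>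

context prelog_algebra
begin


text \<open>Summing coefficients is an additive map from the free group on empty words to
  \<open>A\<close>. Among the generating relations only additivity of coefficients occurs in this
  degree, and the map respects it. So forms of degree 0 are the ring itself.\<close>

lemma om_0_inj:
 assumes "a:[pr A]" "b:[pr A]" "cl 0 (frg (a, []))=cl 0 (frg (b, []))"
 shows "a=b"
proof -
 let ?S = "carrier (pr A) \<times> words 0"
 have im: "fst ` ?S <= carrier (add_monoid (pr A))" by auto
 obtain h where h: "h : hom (free_Abelian_group ?S) (add_monoid (pr A))" "!!g. g : ?S==>h (frg g)=fst g" by (rule comm_group.free_Abelian_group_universal[OF K.a_comm_group im]) blast
 hence hh: "h : ahom (free_forms A 0) (pr A)" by (auto simp: hom_def free_forms_def)
 have hg: "h (frg (c, []))=c" if "c:[pr A]" for c using h(2)[of "(c, [])"] that by simp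
 interpret hp: gpair "free_forms A 0" "pr A" by unfold_locales
 have "h x=0[pr A]" if "x : rel 0" for x using that
 proof (induction rule: rel_ind)
  case zero
  thus ?case using hp.ah_0[OF hh] by simp
 next
  case (diff x y)
  thus ?case using hp.ah_sub[OF hh, of x y] by (simp add: rel_FF)
 next
  case (gen a u v e x)
  from gen(5) show ?case
  proof (cases rule: brel.cases)
   case (b_coeff b c)
   have F: "frg (d, []) : FF 0" if "d:[pr A]" for d using that by (simp add: FF_of)
   have "h (frg (a *[pr A](b +[pr A]c), []) - (frg (a *[pr A]b, []) + frg (a *[pr A]c, [])))=0[pr A]" using hp.ah_sub[OF hh F FF_add[OF F F], of "a *[pr A](b +[pr A]c)" "a *[pr A]b" "a *[pr A]c"]
     ah_add[OF hh F F, of "a *[pr A]b" "a *[pr A]c"] F FF_add gen b_coeff by (simp add: hg K.r_distr)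
   thus ?thesis using gen b_coeff by (simp add: star_lin)
  qed (use gen in auto)
 qed
 moreover have "frg (a, []) - frg (b, []) : rel 0" using assms by (simp add: cl_eq_iff FF_of)
 ultimately have "h (frg (a, []) - frg (b, []))=0[pr A]" by blast
 moreover have "h (frg (a, []) - frg (b, []))=a -[pr A]b" using hp.ah_sub[OF hh, of "frg (a, [])" "frg (b, [])"] assms by (simp add: FF_of hg)
 ultimately show ?thesis using assms by (simp add: K.sub_0_iff)
qed

lemma om_0_hom: "(%a. cl 0 (frg (a, []))) : ahom (pr A) (gr om 0)" by (rule ahI) (simp_all add: cl_cl FF_of rel_0_add)

lemma om_0_sj:
 assumes "x:[gr om 0]" obtains a where "a:[pr A]" "x=cl 0 (frg (a, []))"
proof -
 interpret hp: gpair "pr A" "gr om 0" by unfold_locales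
 obtain y where y: "y : FF 0" "x=cl 0 y" using assms by (auto simp: om_car)
 from y(1) have "\<exists>a\<in>carrier (pr A). cl 0 y=cl 0 (frg (a, []))"
 proof (induction rule: FF_ind)
  case zero
  thus ?case using hp.ah_0[OF om_0_hom] by (auto simp: cl_0 intro!: bexI[of _ "0[pr A]"])
 next
  case (diff x y)
  then obtain a b where "a:[pr A]" "b:[pr A]" "cl 0 x=cl 0 (frg (a, []))" "cl 0 y=cl 0 (frg (b, []))" by blast
  hence "cl 0 (x - y)=cl 0 (frg (a -[pr A]b, []))" using hp.ah_sub[OF om_0_hom] diff(1,2) by (simp flip: cl_diff)
  thus ?case using \<open>a : _\<close> \<open>b : _\<close> by blast
 qed auto
 thus ?thesis using that y by blast
qed

lemma om_0_tf: assumes "torsion_free p (pr A)" shows "torsion_free p (gr om 0)" unfolding torsion_free_def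
proof (intro ballI impI)
 interpret hp: gpair "pr A" "gr om 0" by unfold_locales
 fix x assume x: "x:[gr om 0]" "p .[gr om 0] x=0[gr om 0]"
 obtain a where a: "a:[pr A]" "x=cl 0 (frg (a, []))" using om_0_sj[OF x(1)] .
 have "cl 0 (frg (p .[pr A] a, []))=cl 0 (frg (0[pr A], []))" using x(2) hp.ah_nm[OF om_0_hom a(1), of p] hp.ah_0[OF om_0_hom] a by simp
 hence "p .[pr A] a=0[pr A]" using a by (intro om_0_inj) auto
 hence "a=0[pr A]" using assms a by (simp add: torsion_free_def)
 thus "x=0[gr om 0]" using a hp.ah_0[OF om_0_hom] by simp
qed

end

declare One_nat_def [simp del] One_nat_def [symmetric, simp] plus_1_eq_Suc [simp] Suc_eq_plus1 [symmetric, simp]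

text \<open>An algebra with log coordinates: symbols \<open>e\<^sub>k\<close> with dual log derivations, which generate the
 one-forms modulo every power of \<open>p\<close>.\<close>

locale framed_algebra = prelog_algebra S A
 for S :: "('s, 'n, 'y) prelog_scheme" and A :: "('a, 'l, 's, 'n, 'z) prelog_alg_scheme" +
 fixes ks :: "'k list" and e :: "'k => ('a, 'l) dsym" and dv :: "'k => ('a, 'l) dsym => 'a" and p :: nat
 assumes dual: "k : set ks==>contraction S A (dv k)"
  and ks: "distinct ks" and e: "k : set ks==>e k : dsyms A"
  and dv_e: "[|k : set ks; l : set ks|]==>dv k (e l)=(if k=l then 1[pr A] else 0[pr A])"
  and tf_A: "torsion_free p (pr A)"
  and gen: "[|asub H (gr om 1);
    !!a x. a:[pr A]==>x : H==>gmul om 0 1 (form_class S A 0 (a, [])) x : H;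
    mults (p ^ n) (gr om 1) <= H; !!k. k : set ks==>form_class S A 1 (1[pr A], [e k]) : H; s : dsyms A|] ==>
    form_class S A 1 (1[pr A], [s]) : H"
begin

abbreviation "E k \<equiv> cl 1 (frg (1[pr A], [e k]))"
abbreviation "\<kappa> k \<equiv> contraction.kap S A (dv k)"
abbreviation "PM n i \<equiv> mults (p ^ n) (gr om i)"

text \<open>The span of products of distinct \<open>E k\<close> with \<open>k\<close> in the list,
  enlarged by the multiples of \<open>p ^ n\<close>. Each entry contributes \<open>y + E k z\<close>
  with \<open>y\<close> and \<open>z\<close> built from the later entries; in degree 0 it is
  everything.\<close>

fun Sp :: "nat => 'k list => nat => ('a, 'l) form set set" where
 "Sp n [] i=(if i=0 then carrier (gr om 0) else PM n i)"
| "Sp n (k # l) 0=carrier (gr om 0)"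
| "Sp n (k # l) (Suc i)={y +[gr om (Suc i)]gmul om 1 i (E k) z | y z. y : Sp n l (Suc i) & z : Sp n l i}"

lemma Sp_0: "Sp n l 0=carrier (gr om 0)" by (cases l) auto
lemma E_cl: "k : set ks==>E k:[gr om 1]" using e by (intro cl_cl) (simp add: FF_of)
lemma E_mul_cl: "k : set ks==>z:[gr om i]==>gmul om 1 i (E k) z:[gr om (Suc i)]" using omega.gmul_closed[OF E_cl] by fastforce
lemma E_mul_hom: "k : set ks==>gmul om 1 i (E k) : ahom (gr om i) (gr om (Suc i))" using omega.lmul_hom[OF E_cl] by fastforce

lemma Sp_cl: "set l <= set ks==>x : Sp n l i==>x:[gr om i]"
proof (induction n l i arbitrary: x rule: Sp.induct)
 case (1 n i) thus ?case by (auto simp: omega.gr.muls_car split: if_splits)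
next
 case (3 n k l i) thus ?case by (auto simp: E_mul_cl)
qed auto

lemma Sp_sub: "set l <= set ks==>asub (Sp n l i) (gr om i)"
proof (induction n l i rule: Sp.induct)
 case (1 n i)
 have "asub (carrier (gr om 0)) (gr om 0)" by (rule omega.gr.subgroupI) auto
 thus ?case by (simp add: omega.gr.muls_sub)
next
 case (2 n k l)
 thus ?case by (auto intro: omega.gr.subgroupI)
next
 case (3 n k l i)
 have eq: "Sp n (k # l) (Suc i)=Sp n l (Suc i) <+>[gr om (Suc i)] (gmul om 1 i (E k) ` Sp n l i)" by (auto simp: set_add_def')
 show ?case unfolding eq using 3 by (intro omega.gr.add_additive_subgroups gpair.ah_img[OF omega.gr_pair E_mul_hom]) auto
qed

lemma PM_Sp: "set l <= set ks==>x : PM n i==>x : Sp n l i"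
proof (induction n l i arbitrary: x rule: Sp.induct)
 case (1 n i) thus ?case by (auto simp: omega.gr.muls_car)
next
 case (3 n k l i)
 have "x=x +[gr om (Suc i)]gmul om 1 i (E k) 0[gr om i]" using 3 gpair.ah_0[OF omega.gr_pair E_mul_hom] omega.gr.muls_car by simp
 moreover have "x : Sp n l (Suc i)" "0[gr om i] : Sp n l i" using 3 sub_zero[OF Sp_sub[of l n i]] by auto
 ultimately show ?case by auto
qed (auto simp: omega.gr.muls_car)

lemma Sp_scalar: "set l <= set ks==>x : Sp n l i==>a:[gr om 0]==>gmul om 0 i a x : Sp n l i"
proof (induction n l i arbitrary: x rule: Sp.induct)
 case (1 n i)
 have "gmul om 0 i a x : PM n i" if "x : PM n i" using gpair.ah_muls[OF omega.gr_pair omega.lmul_hom[OF 1(3), of i] that] by simp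
 thus ?case using 1 omega.gmul_closed[of a 0 x 0] by (auto split: if_splits)
next
 case (2 n k l)
 thus ?case using omega.gmul_closed[of a 0 x 0] by auto
next
 case (3 n k l i)
 from 3(4) obtain y z where yz: "x=y +[gr om (Suc i)]gmul om 1 i (E k) z" "y : Sp n l (Suc i)" "z : Sp n l i" by auto
 have l: "set l <= set ks" "k : set ks" using 3(3) by auto
 note c = Sp_cl[OF l(1) yz(2)] Sp_cl[OF l(1) yz(3)] E_cl[OF l(2)]
 have "gmul om 0 (Suc i) a (gmul om 1 i (E k) z)=gmul om 1 i (gmul om 0 1 a (E k)) z" using omega.assoc[OF 3(5) c(3,2)] by simp
 also have "gmul om 0 1 a (E k)=gmul om 1 0 (E k) a" using omega.gcomm[OF 3(5) c(3)] by (simp add: gsign_def)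
 also have "gmul om 1 i (gmul om 1 0 (E k) a) z=gmul om 1 i (E k) (gmul om 0 i a z)" using omega.assoc[OF c(3) 3(5) c(2)] by simp
 finally have "gmul om 0 (Suc i) a x=gmul om 0 (Suc i) a y +[gr om (Suc i)]gmul om 1 i (E k) (gmul om 0 i a z)" using omega.distrib_r[OF 3(5) c(1) E_mul_cl[OF l(2) c(2)]] by (simp add: yz(1))
 moreover have "gmul om 0 (Suc i) a y : Sp n l (Suc i)" "gmul om 0 i a z : Sp n l i" using 3 yz l by blast+
 ultimately show ?case by auto
qed

lemma E_E: assumes "k : set ks" "l : set ks" "z:[gr om i]"
 shows "gmul om 1 (Suc i) (E k) (gmul om 1 i (E l) z)=-[gr om (Suc (Suc i))]gmul om 1 (Suc i) (E l) (gmul om 1 i (E k) z)"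
  "gmul om 1 (Suc i) (E k) (gmul om 1 i (E k) z)=0[gr om (Suc (Suc i))]"
proof -
 note c = E_cl[OF assms(1)] E_cl[OF assms(2)]
 have kl: "gmul om 1 1 (E k) (E l)=-[gr om 2]gmul om 1 1 (E l) (E k)" by (subst omega.gcomm[OF c]) (simp add: gsign_def)
 have lk: "gmul om 1 1 (E l) (E k):[gr om 2]" using omega.gmul_closed[OF c(2,1)] by simp
 show "gmul om 1 (Suc i) (E k) (gmul om 1 i (E l) z)=-[gr om (Suc (Suc i))]gmul om 1 (Suc i) (E l) (gmul om 1 i (E k) z)" using omega.assoc[OF c assms(3), unfolded kl] omega.assoc[OF c(2,1) assms(3)] omega.gmul_neg_l[OF assms(3) lk] by simp
 have "gmul om 1 1 (E k) (E k)=0[gr om 2]" using omega.odd_square[OF _ c(1)] by simp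
 thus "gmul om 1 (Suc i) (E k) (gmul om 1 i (E k) z)=0[gr om (Suc (Suc i))]" using omega.assoc[OF c(1,1) assms(3)] omega.gmul_0_l[OF assms(3), of 2] by simp
qed

text \<open>\<open>E k\<close> anticommutes past the earlier entries until it meets its own, where
  its square vanishes or it supplies the missing factor.\<close>

lemma E_Sp: "set l <= set ks==>k : set l==>x : Sp n l i==>gmul om 1 i (E k) x : Sp n l (Suc i)"
proof (induction l arbitrary: i x)
 case (Cons m l)
 have l: "set l <= set ks" "m : set ks" "k : set ks" using Cons.prems by auto
 have z: "0[gr om j] : Sp n l j" for j using sub_zero[OF Sp_sub[OF l(1)]] .
 have x: "x:[gr om i]" using Cons.prems Sp_cl by blast
 show ?case
 proof (cases i)
  case 0
  show ?thesis
  proof (cases "k=m")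
   case True
   have "gmul om 1 i (E k) x=0[gr om (Suc i)] +[gr om (Suc i)]gmul om 1 i (E m) x" using E_mul_cl[OF l(2) x] True by simp
   thus ?thesis using z[of "Suc i"] x 0 Sp.simps(3)[of n m l 0] by (auto simp: Sp_0)
  next
   case False
   hence "gmul om 1 i (E k) x : Sp n l (Suc i)" using Cons.IH[where i = 0 and x = x] Cons.prems l x 0 by (auto simp: Sp_0)
   moreover have "gmul om 1 i (E k) x=gmul om 1 i (E k) x +[gr om (Suc i)]gmul om 1 i (E m) 0[gr om i]" using gpair.ah_0[OF omega.gr_pair E_mul_hom[OF l(2)]] E_mul_cl[OF l(3) x] by simp
   ultimately show ?thesis using z[of i] 0 Sp.simps(3)[of n m l 0] by auto
  qed
 next
  case (Suc j)
  then obtain y w where yw: "x=y +[gr om (Suc j)]gmul om 1 j (E m) w" "y : Sp n l (Suc j)" "w : Sp n l j" using Cons.prems by auto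
  note c = Sp_cl[OF l(1) yw(2)] Sp_cl[OF l(1) yw(3)]
  have ex: "gmul om 1 i (E k) x=gmul om 1 (Suc j) (E k) y +[gr om (Suc (Suc j))]gmul om 1 (Suc j) (E k) (gmul om 1 j (E m) w)" using ah_add[OF E_mul_hom[OF l(3)] c(1) E_mul_cl[OF l(2) c(2)]] by (simp add: yw(1) Suc)
  show ?thesis
  proof (cases "k=m")
   case True
   have "gmul om 1 i (E k) x=0[gr om (Suc (Suc j))] +[gr om (Suc (Suc j))]gmul om 1 (Suc j) (E m) y" using ex True E_E(2)[OF l(2,2) c(2)] E_mul_cl[OF l(2) c(1)] by (simp add: omega.gr.a_comm)
   thus ?thesis using z[of "Suc (Suc j)"] yw(2) Suc by auto
  next
   case False
   hence k: "k : set l" using Cons.prems by simp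
   have "gmul om 1 (Suc j) (E k) (gmul om 1 j (E m) w)=gmul om 1 (Suc j) (E m) (-[gr om (Suc j)] gmul om 1 j (E k) w)" using E_E(1)[OF l(3,2) c(2)] gpair.ah_neg[OF omega.gr_pair E_mul_hom[OF l(2)] E_mul_cl[OF l(3) c(2)]] by simp
   moreover have "-[gr om (Suc j)] gmul om 1 j (E k) w : Sp n l (Suc j)" using Cons.IH[OF l(1) k yw(3)] additive_subgroup.a_inv_closed[OF Sp_sub[OF l(1)]] by blast
   moreover have "gmul om 1 (Suc j) (E k) y : Sp n l (Suc (Suc j))" by (rule Cons.IH[OF l(1) k yw(2)])
   ultimately show ?thesis using ex Suc by auto
  qed
 qed
qed simp

text \<open>The one-forms \<open>H\<close> that multiply every span into the next one form a
  submodule containing the frame and the multiples of \<open>p ^ n\<close>. By \<open>gen\<close> it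
  contains every symbol, and words follow letter by letter.\<close>

lemma Sp_full: assumes "x:[gr om i]" shows "x : Sp n ks i"
proof -
 define H where "H={t : carrier (gr om 1). \<forall>i. \<forall>z\<in>Sp n ks i. gmul om 1 i t z : Sp n ks (Suc i)}"
 note Spc = Sp_cl[OF order_refl] and Sps = Sp_sub[OF order_refl]
 have "asub H (gr om 1)"
 proof (rule omega.gr.subgroupI)
  show "H <= carrier (gr om 1)" by (auto simp: H_def)
  show "0[gr om 1] : H"
  proof -
   have "gmul om 1 i 0[gr om 1] z : Sp n ks (Suc i)" if "z : Sp n ks i" for i z using omega.gmul_0_l[OF Spc[OF that], of 1] sub_zero[OF Sps[of n "Suc i"]] by simp
   thus ?thesis by (simp add: H_def)
  qed
  fix s t assume "s : H" "t : H"
  thus "s -[gr om 1]t : H" using omega.gmul_sub_l[of _ _ s 1 t] Spc omega.gr.sub_sub[OF Sps] by (auto simp: H_def)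
 qed
 moreover have "gmul om 0 1 (form_class S A 0 (a, [])) t : H" if "a:[pr A]" "t : H" for a t
 proof -
  have a: "form_class S A 0 (a, []):[gr om 0]" using that form_class_closed[of a "[]"] by simp
  have t: "t:[gr om 1]" using that by (simp add: H_def)
  have "gmul om 1 i (gmul om 0 1 (form_class S A 0 (a, [])) t) z : Sp n ks (Suc i)" if z: "z : Sp n ks i" for i z using omega.assoc[OF a t Spc[OF z]] Sp_scalar[OF order_refl _ a, of "gmul om 1 i t z" n "Suc i"] \<open>t : H\<close> z by (simp add: H_def)
  thus ?thesis using omega.gmul_closed[OF a t] by (simp add: H_def)
 qed
 moreover have "PM n 1 <= H"
 proof
  fix t assume t: "t : PM n 1"
  have "gmul om 1 i t z : Sp n ks (Suc i)" if "z : Sp n ks i" for i z using gpair.ah_muls[OF omega.gr_pair omega.rmul_hom[OF Spc[OF that]] t] PM_Sp[OF order_refl] by simp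
  thus "t : H" using omega.gr.muls_car[OF t] by (simp add: H_def)
 qed
 moreover have "form_class S A 1 (1[pr A], [e k]) : H" if "k : set ks" for k using E_cl[OF that] E_Sp[OF order_refl that] by (simp add: H_def fcl_cl)
 ultimately have sym: "form_class S A 1 (1[pr A], [s]) : H" if "s : dsyms A" for s using gen[of H n s] that by blast
 have word: "form_class S A (length w) (1[pr A], w) : Sp n ks (length w)" if "set w <= dsyms A" for w using that
 proof (induction w)
  case Nil thus ?case using form_class_closed[of "1[pr A]" "[]" 0] by (simp add: Sp_0)
 next
  case (Cons s w)
  have "form_class S A (length (s # w)) (1[pr A], s # w) =
    gmul om 1 (length w) (form_class S A 1 (1[pr A], [s])) (form_class S A (length w) (1[pr A], w))" using fcl_mul[of "1[pr A]" "1[pr A]" "[s]" 1 w "length w"] Cons.prems by simp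
  thus ?case using sym[of s] Cons by (simp add: H_def)
 qed
 obtain y where y: "y : FF i" "x=cl i y" using assms by (auto simp: om_car)
 from y(1) have "cl i y : Sp n ks i"
 proof (induction rule: FF_ind)
  case zero
  thus ?case using sub_zero[OF Sps[of n i]] by (simp add: cl_0)
 next
  case (of a w)
  have "form_class S A i (a, w)=gmul om 0 i (form_class S A 0 (a, [])) (form_class S A i (1[pr A], w))" using fcl_mul[of a "1[pr A]" "[]" 0 w i] of by simp
  thus ?case using Sp_scalar[OF order_refl _ form_class_closed, of "form_class S A i (1[pr A], w)" n i a "[]"] word[of w] of by (simp add: fcl_cl)
 next
  case (diff x y)
  thus ?case using omega.gr.sub_sub[OF Sps] by (simp flip: cl_diff)
 qed
 thus ?thesis using y by simp
qed

lemma dval_cl: "k : set ks==>l : set ks ==>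
  cl 0 (frg (dv k (e l), []))=(if k=l then gone om else 0[gr om 0])" using gpair.ah_0[OF _ om_0_hom] K.abelian_group_axioms om_grp by (auto simp: dv_e gone_cl gpair_def)

lemma kappa_E:
 assumes k: "k : set ks" and l: "l : set ks" and z: "z:[gr om i]"
 shows "\<kappa> k i (gmul om 1 i (E l) z)=(if k=l then z else 0[gr om i]) -[gr om i]
   (case i of 0 => 0[gr om 0] | Suc j => gmul om 1 j (E l) (\<kappa> k j z))"
proof (cases i)
 case 0
 interpret k: contraction S A "dv k" by (rule dual[OF k])
 show ?thesis using k.kap_mul_0[OF e[OF l], of z] z 0 omega.gmul_0_l[of z 0 0] by (simp add: dval_cl[OF k l] omega.gone_l)
next
 case (Suc j)
 interpret k: contraction S A "dv k" by (rule dual[OF k])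
 show ?thesis using k.kap_mul[OF e[OF l], of z j] z Suc omega.gmul_0_l[of z "Suc j" 0] by (simp add: dval_cl[OF k l] omega.gone_l)
qed

lemma kappa_hom: "k : set ks==>\<kappa> k i : ahom (gr om (Suc i)) (gr om i)" using contraction.kap_hom[OF dual] .
lemma E_PM: "k : set ks==>z : PM n i==>gmul om 1 i (E k) z : PM n (Suc i)" using gpair.ah_muls[OF omega.gr_pair E_mul_hom] .

text \<open>Contraction along \<open>k\<close> passes through every factor \<open>E m\<close> with
  \<open>m\<close> different from \<open>k\<close>, and in the end meets only multiples of
  \<open>p ^ n\<close>.\<close>

lemma kappa_Sp:
 "set l <= set ks==>k : set ks==>k \<notin> set l==>x : Sp n l (Suc i)==>\<kappa> k i x : PM n i"
proof (induction l arbitrary: i x)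
 case Nil
 thus ?case using gpair.ah_muls[OF omega.gr_pair kappa_hom] by auto
next
 case (Cons m l)
 obtain y z where yz: "x=y +[gr om (Suc i)]gmul om 1 i (E m) z" "y : Sp n l (Suc i)" "z : Sp n l i" using Cons.prems by auto
 have l: "set l <= set ks" "m : set ks" "k ~= m" "k \<notin> set l" using Cons.prems by auto
 note c = Sp_cl[OF l(1) yz(2)] Sp_cl[OF l(1) yz(3)]
 have zero: "0[gr om i] : PM n i" by (rule sub_zero[OF omega.gr.muls_sub])
 have "(case i of 0 => 0[gr om 0] | Suc j => gmul om 1 j (E m) (\<kappa> k j z)) : PM n i" using zero Cons.IH[OF l(1) Cons.prems(2) l(4)] yz(3) E_PM[OF l(2)] by (cases i) auto
 hence "\<kappa> k i (gmul om 1 i (E m) z) : PM n i" unfolding kappa_E[OF Cons.prems(2) l(2) c(2)] using l(3) omega.gr.sub_sub[OF omega.gr.muls_sub zero] by simp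
 moreover have "\<kappa> k i y : PM n i" by (rule Cons.IH[OF l(1) Cons.prems(2) l(4) yz(2)])
 ultimately show ?case unfolding yz(1) ah_add[OF kappa_hom[OF Cons.prems(2)] c(1) E_mul_cl[OF l(2) c(2)]] by (intro sub_plus[OF omega.gr.muls_sub])
qed

fun kappas :: "'k list => ('a, 'l) form set => ('a, 'l) form set" where
 "kappas [] x=x"
| "kappas (k # I) x=kappas I (\<kappa> k (length I) x)"

lemma kappas_hom: "set I <= set ks==>kappas I : ahom (gr om (length I)) (gr om 0)"
proof (induction I)
 case Nil thus ?case by (intro ahI) auto
next
 case (Cons k I)
 have "(%x. kappas I (\<kappa> k (length I) x)) : ahom (gr om (Suc (length I))) (gr om 0)" by (rule ah_comp[OF kappa_hom Cons.IH]) (use Cons.prems in auto)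
 moreover have "kappas (k # I)=(%x. kappas I (\<kappa> k (length I) x))" by auto
 ultimately show ?case by simp
qed

lemma kappas_PM: "set I <= set ks==>x : PM n (length I)==>kappas I x : PM n 0" using gpair.ah_muls[OF omega.gr_pair kappas_hom] .

text \<open>Iterated contractions read off coefficients. In \<open>x = y + E k z\<close> neither
  \<open>y\<close> nor \<open>z\<close> involves \<open>E k\<close>, so contracting along
  \<open>k\<close> returns \<open>z\<close> modulo \<open>p ^ n\<close>. By induction
  \<open>z\<close> is divisible, then so are \<open>E k z\<close> and finally
  \<open>y\<close>.\<close>

lemma kappas_detect:
 assumes "set l <= set ks" "distinct l" "x : Sp n l i"
  and "!!I. length I=i==>set I <= set ks==>kappas I x : PM n 0"
 shows "x : PM n i" using assms
proof (induction l arbitrary: i x)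
 case Nil
 show ?case
 proof (cases i)
  case 0 thus ?thesis using Nil.prems(4)[of "[]"] by simp
 next
  case (Suc j) thus ?thesis using Nil.prems(3) by simp
 qed
next
 case (Cons k l)
 show ?case
 proof (cases i)
  case 0 thus ?thesis using Cons.prems(4)[of "[]"] by simp
 next
  case (Suc j)
  obtain y z where yz: "x=y +[gr om (Suc j)]gmul om 1 j (E k) z" "y : Sp n l (Suc j)" "z : Sp n l j" using Cons.prems(3) Suc by auto
  have l: "set l <= set ks" "k : set ks" "k \<notin> set l" "distinct l" using Cons.prems by auto
  note c = Sp_cl[OF l(1) yz(2)] Sp_cl[OF l(1) yz(3)]
  have Ez: "gmul om 1 j (E k) z:[gr om (Suc j)]" by (rule E_mul_cl[OF l(2) c(2)])
  have xc: "x:[gr om (Suc j)]" using yz(1) c(1) Ez by simp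
  note S = omega.gr.muls_sub[of "p ^ n"]
  have "\<kappa> k j x -[gr om j]z : PM n j"
  proof -
   let ?r = "case j of 0 => 0[gr om 0] | Suc i => gmul om 1 i (E k) (\<kappa> k i z)"
   have r: "?r : PM n j" using sub_zero[OF S[of 0]] kappa_Sp[OF l(1,2,3)] yz(3) E_PM[OF l(2)] by (cases j) auto
   have ky: "\<kappa> k j y : PM n j" by (rule kappa_Sp[OF l(1,2,3) yz(2)])
   note rc = omega.gr.muls_car[OF r] omega.gr.muls_car[OF ky]
   have "\<kappa> k j x=\<kappa> k j y +[gr om j](z -[gr om j]?r)" unfolding yz(1) ah_add[OF kappa_hom[OF l(2)] c(1) Ez] kappa_E[OF l(2,2) c(2)] by simp
   also have "\<dots> -[gr om j]z=\<kappa> k j y -[gr om j]?r" using rc c(2) by (intro omega.gr.add_diff_diff)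
   finally show ?thesis using omega.gr.sub_sub[OF S ky r] by simp
  qed
  hence kz: "\<kappa> k j x -[gr om j]z : PM n j" .
  note kx = ah_cl[OF kappa_hom[OF l(2)] xc]
  have "kappas I z : PM n 0" if I: "length I=j" "set I <= set ks" for I
  proof -
   have "kappas I (\<kappa> k j x -[gr om j]z) : PM n 0" using kappas_PM[OF I(2)] kz I(1) by simp
   moreover have "kappas I (\<kappa> k j x -[gr om j]z)=kappas I (\<kappa> k j x) -[gr om 0]kappas I z" using gpair.ah_sub[OF omega.gr_pair kappas_hom[OF I(2)]] kx c(2) I(1) by simp
   moreover have "kappas I (\<kappa> k j x) : PM n 0" using Cons.prems(4)[of "k # I"] I l Suc by simp
   moreover have "kappas I z:[gr om 0]" "kappas I (\<kappa> k j x):[gr om 0]" using ah_cl[OF kappas_hom[OF I(2)]] kx c(2) I(1) by simp_all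
   ultimately show ?thesis using omega.gr.sub_mem_cg[OF S] by metis
  qed
  hence "z : PM n j" using Cons.IH[OF l(1,4) yz(3)] by blast
  hence Ezp: "gmul om 1 j (E k) z : PM n (Suc j)" by (rule E_PM[OF l(2)])
  have "kappas I y : PM n 0" if I: "length I=Suc j" "set I <= set ks" for I
  proof -
   have "kappas I x=kappas I y +[gr om 0]kappas I (gmul om 1 j (E k) z)" using ah_add[OF kappas_hom[OF I(2)]] c(1) Ez I(1) by (simp add: yz(1))
   moreover have "kappas I (gmul om 1 j (E k) z) : PM n 0" using kappas_PM[OF I(2)] Ezp I(1) by simp
   moreover have "kappas I x : PM n 0" using Cons.prems(4) I Suc by simp
   moreover have "kappas I y:[gr om 0]" using ah_cl[OF kappas_hom[OF I(2)]] c(1) I(1) by simp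
   moreover have "kappas I (gmul om 1 j (E k) z):[gr om 0]" using ah_cl[OF kappas_hom[OF I(2)]] Ez I(1) by simp
   ultimately show ?thesis using omega.gr.sub_sub[OF S, of "kappas I x" 0 "kappas I (gmul om 1 j (E k) z)"]
     omega.gr.add_diff_l[of "kappas I (gmul om 1 j (E k) z)" 0 "kappas I y"] by (simp add: omega.gr.a_comm)
  qed
  hence "y : PM n (Suc j)" using Cons.IH[OF l(1,4) yz(2)] by blast
  thus ?thesis using sub_plus[OF S _ Ezp] yz(1) Suc by simp
 qed
qed

text \<open>Divisibility is tested on coefficients, which lie in degree 0, and there it is
  torsion-freeness of the ring.\<close>

lemma om_p_div:
 assumes x: "x:[gr om i]" and px: "p .[gr om i] x : PM (Suc n) i"
 shows "x : PM n i"
proof (rule kappas_detect[OF order_refl ks Sp_full[OF x]])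
 fix I assume I: "length I=i" "set I <= set ks"
 have "p .[gr om 0] kappas I x : PM (Suc n) 0" using kappas_PM[OF I(2), of "p .[gr om i] x" "Suc n"] px gpair.ah_nm[OF omega.gr_pair kappas_hom[OF I(2)], of x p] x I(1) by (simp del: power_Suc)
 thus "kappas I x : PM n 0" using omega.gr.muls_can[OF om_0_tf[OF tf_A] ah_cl[OF kappas_hom[OF I(2)]], of x "p ^ n"]
   x I(1) by simp
qed

end

declare One_nat_def [simp] One_nat_def [symmetric, simp del] plus_1_eq_Suc [simp del] Suc_eq_plus1 [symmetric, simp del]

section \<open>Completed rings\<close>

context cring
begin

lemma mul_diff:
 "[|a:[R]; b:[R]; c:[R]; d:[R]|]==>a \<otimes> b \<ominus> c \<otimes> d=a \<otimes> (b \<ominus> d) \<oplus> (a \<ominus> c) \<otimes> d" by algebra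

lemma muls_idl: "ideal (mults (q::nat) R) R"
proof (rule idealI[OF ring_axioms])
 show "subgroup (mults q R) (add_monoid R)" by (rule additive_subgroup.a_subgroup[OF muls_sub])
 fix a x assume "a : mults q R" "x:[R]"
 thus "x \<otimes> a : mults q R" "a \<otimes> x : mults q R" by (auto simp: mults_def nm_m_l nm_m_r)
qed

lemma idl_pow_cg:
 assumes I: "ideal I R" and "x:[R]" "y:[R]" "x \<ominus> y : I"
 shows "x [^] (n::nat) \<ominus> y [^] n : I"
proof (induction n)
 case 0 show ?case using sub_zero[OF ideal.axioms(1)[OF I]] by (simp add: r_neg minus_eq)
next
 case (Suc n)
 have "x [^] Suc n \<ominus> y [^] Suc n=x [^] n \<otimes> (x \<ominus> y) \<oplus> (x [^] n \<ominus> y [^] n) \<otimes> y" using assms by (simp add: mul_diff)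
 thus ?case using sub_plus[OF ideal.axioms(1)[OF I]] ideal.I_l_closed[OF I] idl_r[OF I] Suc assms by simp
qed

text \<open>The \<open>p\<close>-th power is additive modulo \<open>p\<close> by
  \<open>prime_binomial\<close>, so the Frobenius congruence can be checked on additive
  generators.\<close>

lemma frob_cg_add:
 assumes p: "prime p" and h: "h : ahom R R" and x: "x:[R]" "y:[R]"
  and c: "h x \<ominus> x [^] p : mults p R" "h y \<ominus> y [^] p : mults p R"
 shows "h (x \<oplus> y) \<ominus> (x \<oplus> y) [^] p : mults p R"
proof -
 obtain z where z: "z:[R]" "(x \<oplus> y) [^] p=x [^] p \<oplus> y [^] p \<oplus> [p] \<cdot> (y \<otimes> z)" using prime_binomial[OF p x] by blast
 note hc = ah_cl[OF h x(1)] ah_cl[OF h x(2)]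
 have "h (x \<oplus> y) \<ominus> (x \<oplus> y) [^] p=(h x \<ominus> x [^] p) \<oplus> (h y \<ominus> y [^] p) \<ominus> [p] \<cdot> (y \<otimes> z)" using x z hc by (simp add: ah_add[OF h x] minus_eq minus_add a_ac)
 thus ?thesis using sub_sub[OF muls_sub sub_plus[OF muls_sub c] muls_mem] x z by simp
qed

end

locale cring_c = cring G for G :: "('a, 'm) ring_scheme" (structure) +
 fixes p :: nat
begin

sublocale filg G "p_fil p G" by (rule pf_filt[OF abelian_group_axioms])

abbreviation "coh \<equiv> chr G (p_fil p G)"
abbreviation "Lim \<equiv> lim_of G (p_fil p G)"

lemma fil_idl: "ideal (p_fil p G r) G" by (rule muls_idl)

lemma coh_mul: assumes "coh m" "coh m'" shows "coh (%r. m r \<otimes> m' r)" unfolding chr_def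
proof (intro allI conjI)
 fix r
 have c: "m r:[G]" "m' r:[G]" "m (Suc r):[G]" "m' (Suc r):[G]"
  and d: "m (Suc r) \<ominus> m r : p_fil p G r" "m' (Suc r) \<ominus> m' r : p_fil p G r" using assms by (auto simp: chr_def)
 show "m r \<otimes> m' r:[G]" using c by simp
 have "m (Suc r) \<otimes> m' (Suc r) \<ominus> m r \<otimes> m' r=m (Suc r) \<otimes> (m' (Suc r) \<ominus> m' r) \<oplus> (m (Suc r) \<ominus> m r) \<otimes> m' r" using c by (simp add: mul_diff)
 thus "m (Suc r) \<otimes> m' (Suc r) \<ominus> m r \<otimes> m' r : p_fil p G r" using sub_plus[OF Fil_sub] ideal.I_l_closed[OF fil_idl d(2)] idl_r[OF fil_idl d(1)] c by simp
qed

lemma Lim_mul: assumes "coh m" "coh m'" shows "Lim m *[L]Lim m'=Lim (%r. m r \<otimes> m' r)" using ideal.rcoset_mult_add[OF fil_idl] coh_car[OF assms(1)] coh_car[OF assms(2)] by (simp add: lim_ring_def lim_of_def FactRing_def fun_eq_iff)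
lemma L_one: "1[L]=Lim (%_. \<one>)" by (simp add: lim_ring_def lim_of_def FactRing_def)
lemma L_mul_cl: "x:[L]==>y:[L]==>x *[L]y:[L]" by (elim lim_cs) (simp add: Lim_mul lim_of_carrier coh_mul)

lemma L_cring: "cring L"
proof (rule cringI[OF lim_grp])
 show "Group.comm_monoid L"
 proof (rule comm_monoidI)
  show "1[L]:[L]" by (simp add: L_one lim_of_carrier chr_const)
  fix x y assume xy: "x:[L]" "y:[L]"
  show "x *[L]y:[L]" using xy by (rule L_mul_cl)
  show "x *[L]y=y *[L]x" using xy by (elim lim_cs) (simp add: Lim_mul coh_car m_comm)
  show "1[L] *[L]x=x" using xy(1) by (elim lim_cs) (simp add: L_one Lim_mul chr_const coh_car)
  fix z assume "z:[L]"
  thus "x *[L]y *[L]z=x *[L](y *[L]z)" using xy by (elim lim_cs) (simp add: Lim_mul coh_mul coh_car m_assoc)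
 qed
 fix x y z assume "x:[L]" "y:[L]" "z:[L]"
 thus "(x +[L]y) *[L]z=x *[L]z +[L]y *[L]z" by (elim lim_cs) (simp add: Lim_mul lim_add coh_add coh_mul coh_car l_distr)
qed

sublocale Lr: cring L by (rule L_cring)

lemma to_lim_rh: "to_lim G (p_fil p G) : rhom G L" by (rule rhI) (simp_all add: to_lim_eq lim_of_carrier chr_const Lim_mul lim_add L_one)
lemma L_tf: assumes "torsion_free p G" shows "torsion_free p L" by (rule lim_tf[OF filg_axioms]) (use muls_can[OF assms] in auto)

lemma L_dn: assumes "x:[L]"
 obtains g b where "g:[G]" "b:[L]" "x=to_lim G (p_fil p G) g +[L](p ^ r) .[L] b"
proof -
 obtain g where g: "g:[G]" "x -[L]to_lim G (p_fil p G) g : mults (p ^ r) L" using lim_dn[OF assms, of r] unfolding lim_fil_p[OF abelian_group_axioms] by blast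
 then obtain b where b: "b:[L]" "x -[L]to_lim G (p_fil p G) g=(p ^ r) .[L] b" by (auto simp: mults_def)
 thus ?thesis using that[OF g(1) b(1)] lim.add_minus_cancel[of "to_lim G (p_fil p G) g" x] assms g(1)
   ah_cl[OF to_lim_hom g(1)] by simp
qed


definition lmap :: "('a => 'a) => (nat => 'a set) => nat => 'a set" where
 "lmap h x=(%r. coset_map G (p_fil p G r) h (x r))"

context
 fixes h assumes h: "h : ahom G G"
begin

interpretation hp: gpair G G by unfold_locales

lemma coh_map: "coh m==>coh (%r. h (m r))" using hp.ah_muls[OF h] by (auto simp: chr_def ah_cl[OF h] hp.ah_sub[OF h, symmetric])

lemma lmap_Lim: assumes "coh m" shows "lmap h (Lim m)=Lim (%r. h (m r))" unfolding lmap_def lim_of_def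
proof (rule ext, rule cos_map_cos[OF Fil_sub])
 have m: "m r:[G]" for r using coh_car[OF assms] .
 show "m r:[G]" for r by (rule m)
 fix r z assume z: "z:[G]" "z \<ominus> m r : p_fil p G r"
 show "p_fil p G r +> h z=p_fil p G r +> h (m r)" using m[of r] hp.ah_muls[OF h z(2)] z by (simp add: cos_eq_iff[OF Fil_sub] ah_cl[OF h] hp.ah_sub[OF h])
qed

lemma lmap_to_lim: "g:[G]==>lmap h (to_lim G (p_fil p G) g)=to_lim G (p_fil p G) (h g)" using lmap_Lim[OF chr_const] by (simp add: to_lim_eq)

lemma lmap_ah: "lmap h : ahom L L"
proof (rule ahI)
 fix x y assume x: "x:[L]" and y: "y:[L]"
 obtain m where m: "coh m" "x=Lim m" using lim_cs[OF x] .
 obtain n where n: "coh n" "y=Lim n" using lim_cs[OF y] .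
 show "lmap h x:[L]" by (simp add: m lmap_Lim lim_of_carrier coh_map)
 show "lmap h (x +[L]y)=lmap h x +[L]lmap h y" using m(1) n(1) lim_add[of "%r. h (m r)" "%r. h (n r)"] by (simp add: m(2) n(2) lmap_Lim coh_map lim_add coh_add coh_car ah_add[OF h] ah_cl[OF h])
qed

end

lemma lmap_rh: assumes h: "h : rhom G G" shows "lmap h : rhom L L"
proof (rule rhI)
 note h' = rh_ah[OF h]
 fix x y assume xy: "x:[L]" "y:[L]"
 show "lmap h x:[L]" "lmap h (x +[L]y)=lmap h x +[L]lmap h y" using ah_cl[OF lmap_ah[OF h']] ah_add[OF lmap_ah[OF h']] xy by auto
 show "lmap h (x *[L]y)=lmap h x *[L]lmap h y" using xy by (elim lim_cs) (simp add: lmap_Lim[OF h'] coh_map[OF h'] Lim_mul coh_mul coh_car rh_mul[OF h])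
next
 show "lmap h 1[L]=1[L]" by (simp add: L_one lmap_Lim[OF rh_ah[OF h]] chr_const rh_one[OF h])
qed

text \<open>Modulo \<open>p\<close> every element comes from \<open>G\<close>, where the congruence
  is given; on the remaining multiple of \<open>p\<close> both terms are divisible by
  \<open>p\<close>. The two cases are joined by \<open>frob_cg_add\<close>.\<close>

lemma lmap_frob: assumes p: "prime p" and h: "frobenius_lift p G h" shows "frobenius_lift p L (lmap h)" unfolding frobenius_lift_def
proof (intro conjI ballI)
 have h': "h : rhom G G" and hf: "!!x. x:[G]==>h x \<ominus> x [^] p : mults p G" using h by (auto simp: frobenius_lift_def)
 show rh: "lmap h : rhom L L" by (rule lmap_rh[OF h'])
 interpret lp: gpair L L by unfold_locales
 interpret tp: gpair G L by unfold_locales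
 note lh = rh_ah[OF rh]
 let ?t = "to_lim G (p_fil p G)"
 fix x assume x: "x:[L]"
 obtain g b where gb: "g:[G]" "b:[L]" "x=?t g +[L](p ^ 1) .[L] b" using L_dn[OF x] by blast
 note tg = ah_cl[OF to_lim_hom gb(1)]
 have 1: "lmap h (?t g) -[L]?t g [^][L] p : mults p L" using tp.ah_muls[OF to_lim_hom hf[OF gb(1)]] rh_cl[OF h' gb(1)] gb(1) by (simp add: lmap_to_lim[OF rh_ah[OF h']] tp.ah_sub[OF to_lim_hom] rh_pow[OF to_lim_rh monoid_axioms])
 have pb: "p .[L] b : mults p L" using gb(2) by (rule lim.muls_mem)
 have pp: "(p .[L] b) [^][L] p : mults p L"
 proof -
  obtain n where n: "p=Suc n" using prime_gt_0_nat[OF p] gr0_implies_Suc by blast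
  have "(p .[L] b) [^][L] Suc n=(p .[L] b) [^][L] n *[L](p .[L] b)" by simp
  thus ?thesis unfolding n[symmetric] using ideal.I_l_closed[OF Lr.muls_idl pb Lr.nat_pow_closed[OF lim.muls_car[OF pb]]] by simp
 qed
 have 2: "lmap h (p .[L] b) -[L](p .[L] b) [^][L] p : mults p L" by (rule lim.sub_sub[OF lim.muls_sub lp.ah_muls[OF lh pb] pp])
 show "lmap h x -[L]x [^][L] p : mults p L" using Lr.frob_cg_add[OF p lh tg _ 1 2] gb by simp
qed

end

section \<open>Symbols in degree one\<close>

context prelog_algebra
begin

abbreviation "sform a \<equiv> form_class S A 0 (a, [])"
abbreviation "dform a \<equiv> form_class S A 1 (1[pr A], [Dsym a])"
abbreviation "lform l \<equiv> form_class S A 1 (1[pr A], [Lsym l])"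

lemma sform_rh: "sform : rhom (pr A) (deg0 om)" by (rule rhI) (simp_all add: form_class_closed fcl_mul gone_cl fcl_cl cl_cl FF_of rel_0_add gmul_cl star_of)
lemma sform_cl: "a:[pr A]==>sform a:[gr om 0]" using rh_cl[OF sform_rh] by simp
lemma rmap_sform: "rmap om s=sform (rstr A s)" by (simp add: rmap_cl fcl_cl)
lemma dform_dif: "a:[pr A]==>dform a=dif om 0 (sform a)" using fcl_dif[of a "[]" 0] by simp

lemma dform_hom: "dform : ahom (pr A) (gr om 1)"
proof (rule ahI)
 have h: "(%a. dif om 0 (sform a)) : ahom (pr A) (gr om 1)" using ah_comp[OF rh_ah[OF sform_rh, unfolded add_mon_deg0] omega.dif_hom] by simp
 fix a b assume "a:[pr A]" "b:[pr A]"
 thus "dform a:[gr om 1]" "dform (a +[pr A]b)=dform a +[gr om 1]dform b" using ah_cl[OF h, of a] ah_add[OF h, of a b] by (simp_all only: dform_dif[of a] dform_dif[of b] dform_dif[of "a +[pr A]b"] K.a_closed)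
qed

lemma dform_mul:
 "a:[pr A]==>b:[pr A] ==>
  dform (a *[pr A]b)=gmul om 0 1 (sform a) (dform b) +[gr om 1]gmul om 0 1 (sform b) (dform a)" using brel_rel[OF b_d_mult[of a A b S]] fcl_mul[of a "1[pr A]" "[]" 0 "[Dsym b]" 1]
  fcl_mul[of b "1[pr A]" "[]" 0 "[Dsym a]" 1] by (simp add: fcl_cl cl_add FF_of cl_eq_iff FF_add dsyms_def)

lemma lform_cl: "l:[pmon A]==>lform l:[gr om 1]" by (rule form_class_closed) (auto simp: dsyms_def)

lemma lform_mul:
 "l:[pmon A]==>m:[pmon A]==>lform (l *[pmon A]m)=lform l +[gr om 1]lform m" using brel_rel[OF b_dlog_mult[of l A m S]] by (simp add: fcl_cl cl_add FF_of cl_eq_iff FF_add dsyms_def monoid.m_closed[OF comm_monoid.axioms(1)[OF mon_A]])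

lemma lform_base: "n:[pmon S]==>lform (nstr A n)=0[gr om 1]" using brel_rel[OF b_dlog_base[of n S A]] nstr_A by (auto simp: fcl_cl cl_0 FF_of cl_eq_iff dsyms_def mm_def hom_def)
lemma dform_base: "s:[pr S]==>dform (rstr A s)=0[gr om 1]" using brel_rel[OF b_d_base[of s S A]] rh_cl[OF rstr_A] by (auto simp: fcl_cl cl_0 FF_of cl_eq_iff dsyms_def)
lemma dform_log: "l:[pmon A]==>dform (palpha A l)=gmul om 0 1 (sform (palpha A l)) (lform l)" using brel_rel[OF b_log[of l A S]] fcl_mul[of "palpha A l" "1[pr A]" "[]" 0 "[Lsym l]" 1] al_A by (auto simp: fcl_cl FF_of cl_eq_iff dsyms_def mm_def hom_def)

end

section \<open>The standard lift of a free pre-log algebra\<close>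

lemma free_mon_s [simp]:
 "carrier (free_mon m)={v. set_mset v <= {..<m}}" "x *[free_mon m]y=x + y" "1[free_mon m]={#}" by (simp_all add: free_mon_def)

lemma free_mon_cm: "Group.comm_monoid (free_mon m)" by (rule comm_monoidI) auto

lemma prod_cm_mon: "Group.comm_monoid G==>Group.comm_monoid H==>Group.comm_monoid (G \<times>\<times> H)" by (rule comm_monoidI) (auto simp: DirProd_def comm_monoid.m_comm monoid.m_closed monoid.m_assoc monoid.l_one monoid.one_closed
   dest: comm_monoid.axioms(1))

lemma set_repeat_mset: "n > 0==>set_mset (repeat_mset n M)=set_mset M" by (auto simp flip: count_greater_zero_iff)
lemma vars_s [simp]: "Inl i : vars nm \<longleftrightarrow> i < fst nm" "Inr j : vars nm \<longleftrightarrow> j < snd nm" by (auto simp: vars_def split: prod.split)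
lemma repeat_mset_inj: "p > 0==>repeat_mset p U=repeat_mset p V \<longleftrightarrow> U=V" by (auto simp: multiset_eq_iff)

context log_base
begin

abbreviation "R \<equiv> pr B"
abbreviation "FR \<equiv> pfrob B"

lemma p_pos: "p > 0" using prime_p by (rule prime_gt_0_nat)
lemma R_cring: "cring R" using prelog by (simp add: prelog_ring_def)
lemma mon_B: "Group.comm_monoid (pmon B)" using prelog by (simp add: prelog_ring_def)
lemma al_B: "palpha B : monoid_maps (pmon B) R" using prelog by (simp add: prelog_ring_def)
lemma FR_hom: "FR : rhom R R" using frobenius by (simp add: frobenius_lift_def)

sublocale R: cring R by (rule R_cring)
sublocale MB: Group.comm_monoid "pmon B" by (rule mon_B)

lemma al_B_cl [simp]: "n:[pmon B]==>palpha B n:[R]" using al_B by (auto simp: mm_def hom_def)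
lemma al_B_mul: "n:[pmon B]==>m:[pmon B]==>palpha B (n *[pmon B]m)=palpha B n *[R]palpha B m" using al_B by (auto simp: mm_def hom_def)
lemma al_B_one [simp]: "palpha B 1[pmon B]=1[R]" using al_B by (auto simp: mm_def)

end

locale std_poly = log_base p k \<iota> B N1 N2
 for p :: nat and k :: "'k ring" and \<iota> :: "(nat => 'k) => 'r" and B :: "('r, 'n) fprelog" and N1 N2 :: "'n set" +
 fixes nm :: "nat \<times> nat"
begin

sublocale mpolys R nm by unfold_locales
sublocale C: cring_c P p by unfold_locales

declare P_s [simp del] mon_0 [simp del]

abbreviation "A \<equiv> std_lift p B nm"
abbreviation "\<tau> \<equiv> to_lim P (p_fil p P)"

lemma A_s [simp]:
 "pr A=C.L" "pmon A=free_mon (snd nm) \<times>\<times> pmon B"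
 "palpha A (v, n)=\<tau> (mnm (palpha B n) (image_mset Inr v))"
 "rstr A r=\<tau> (mnm r {#})" "nstr A n=({#}, n)" by (simp_all add: std_lift_def lpoly_obj_def Let_def)

lemma A_mon [simp]:
 "carrier (free_mon (snd nm) \<times>\<times> pmon B)={v. set_mset v <= {..<snd nm}} \<times> carrier (pmon B)"
 "(v, n) *[free_mon (snd nm) \<times>\<times> pmon B](v', n')=(v + v', n *[pmon B]n')"
 "1[free_mon (snd nm) \<times>\<times> pmon B]=({#}, 1[pmon B])" by (simp_all add: DirProd_def)

lemma P_one_mon: "1[P]=mnm 1[R] {#}" by (simp add: mpoly_monom_def P_s)
lemma Y_vars: "set_mset v <= {..<snd nm}==>set_mset (image_mset Inr v) <= vars nm" by (auto simp: vars_def split: prod.split)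
lemma Y_mon_cl: "c:[R]==>set_mset v <= {..<snd nm}==>mnm c (image_mset Inr v):[P]" by (rule mon_cl[OF _ Y_vars])

lemma tau_rh: "\<tau> : rhom P C.L" by (rule C.to_lim_rh)
lemmas tau_cl = rh_cl[OF tau_rh]
 and tau_mult = rh_mul[OF tau_rh]
 and tau_add = rh_add[OF tau_rh]

lemma const_hom: "(%c. mnm c {#}) : rhom R P" by (rule rhI) (simp_all add: mon_cl mon_add mon_mul P_one_mon)

lemma A_pl: "prelog_algebra B A"
proof (intro prelog_algebra.intro)
 show "cring (pr A)" using C.L_cring by simp
 show "Group.comm_monoid (pmon A)" using prod_cm_mon[OF free_mon_cm mon_B] by simp
 show "rstr A : rhom (pr B) (pr A)" by (rule rhI) (simp_all add: tau_cl mon_cl mon_add tau_add rh_one[OF const_hom] rh_one[OF tau_rh] flip: mon_mul[where M = "{#}" and N = "{#}", simplified] tau_mult)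
 show "nstr A : monoid_maps (pmon B) (pmon A)" by (auto simp: mm_def hom_def)
 show "1[pr B]:[pr B]" by simp
 show "palpha A : monoid_maps (pmon A) (pr A)" using rh_one[OF tau_rh] by (auto simp: mm_def hom_def tau_cl Y_mon_cl al_B_mul P_one_mon tau_mult[OF Y_mon_cl Y_mon_cl, symmetric] mon_mul)
qed

lemma P_tf: "torsion_free p P" using p_torsion_free by (auto simp: torsion_free_def P_nm P_s fun_eq_iff P_coeff)

subsection \<open>Derivations\<close>

text \<open>The exponent after differentiation: \<open>d/dX_i\<close> lowers it,
  \<open>Y_j d/dY_j\<close> leaves the monomial alone.\<close>

definition del :: "nat + nat => (nat + nat) multiset => (nat + nat) multiset" where
 "del x M=(case x of Inl _ => M - {#x#} | Inr _ => M)"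

text \<open>The derivation \<open>\<partial>/\<partial>X\<^sub>i\<close> or \<open>Y\<^sub>j \<partial>/\<partial>Y\<^sub>j\<close>.\<close>

definition pd :: "nat + nat => 'r mpoly => 'r mpoly" where
 "pd x=mp_lin P (%M c. mnm ((count M x) .[R] c) (del x M))"

lemma del_vars: "set_mset M <= vars nm==>set_mset (del x M) <= vars nm" by (auto simp: del_def split: sum.splits dest: in_diffD)
lemma pd_coeff_hom: "set_mset M <= vars nm==>(%c. mnm ((count M x) .[R] c) (del x M)) : ahom R P" using ah_comp[OF R.nm_ah mon_ah[OF del_vars]] .
lemma pd_hom: "pd x : ahom P P" unfolding pd_def by (rule mp_lin_hom[OF P_grp pd_coeff_hom])
lemma pd_mon: "c:[R]==>set_mset M <= vars nm==>pd x (mnm c M)=mnm ((count M x) .[R] c) (del x M)" unfolding pd_def by (rule mp_lin_mon[OF P_grp pd_coeff_hom])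

text \<open>If \<open>x\<close> does not occur in \<open>N\<close> the coefficient is 0, which makes
  up for the truncated subtraction in \<open>del\<close>.\<close>

lemma mon_del: "mnm ((count N x) .[R] c) (M + del x N)=mnm ((count N x) .[R] c) (del x (M + N))"
proof (cases "x \<in># N")
 case True
 thus ?thesis by (auto simp: del_def split: sum.split)
next
 case False
 thus ?thesis by (simp add: not_in_iff mpoly_monom_def)
qed

lemma pd_mul: assumes f: "f:[P]" and g: "g:[P]"
 shows "pd x (f *[P]g)=f *[P]pd x g +[P]g *[P]pd x f" using f
proof (induction rule: P_ind)
 note pc = ah_cl[OF pd_hom]
 case zero
 interpret gp: gpair P P by unfold_locales
 show ?case using g gp.ah_0[OF pd_hom] pc[OF g] by simp
next
 note pc = ah_cl[OF pd_hom]
 case (add f f')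
 thus ?case using g pc[OF g, of x] pc[OF add(1), of x] pc[OF add(2), of x] by (simp add: PR.l_distr PR.r_distr ah_add[OF pd_hom] Pg.a_ac)
next
 note pc = ah_cl[OF pd_hom]
 case (mon c M)
 note cM = this
 have m: "mnm c M:[P]" using mon by (rule mon_cl)
 from g show ?case
 proof (induction rule: P_ind)
  case zero
  interpret gp: gpair P P by unfold_locales
  show ?case using m gp.ah_0[OF pd_hom] pc[OF m] by simp
 next
  case (add f f')
  thus ?case using m pc[OF m, of x] pc[OF add(1), of x] pc[OF add(2), of x] by (simp add: PR.l_distr PR.r_distr ah_add[OF pd_hom] Pg.a_ac)
 next
  case (mon d N)
  have "pd x (mnm c M *[P]mnm d N)=mnm ((count M x) .[R] (c *[R]d) +[R](count N x) .[R] (c *[R]d)) (del x (M + N))" using cM mon by (simp add: mon_mul pd_mon R.nm_add)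
  also have "\<dots>=mnm ((count M x) .[R] (c *[R]d)) (N + del x M) +[P]mnm ((count N x) .[R] (c *[R]d)) (M + del x N)" using cM mon by (simp add: mon_add mon_del add.commute[of N M])
  also have "\<dots>=mnm d N *[P]pd x (mnm c M) +[P]mnm c M *[P]pd x (mnm d N)" using cM mon by (simp add: mon_mul pd_mon R.nm_m_r R.m_comm)
  finally show ?case using cM mon pc by (simp add: Pg.a_comm mon_cl)
 qed
qed

abbreviation "Pd x \<equiv> C.lmap (pd x)"

lemma Pd_mul: assumes "a:[C.L]" "b:[C.L]"
 shows "Pd x (a *[C.L]b)=a *[C.L]Pd x b +[C.L]b *[C.L]Pd x a"
proof -
 obtain m n where m: "C.coh m" "a=C.Lim m" and n: "C.coh n" "b=C.Lim n" using C.lim_cs[OF assms(1)] C.lim_cs[OF assms(2)] by metis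
 note c = C.coh_car[OF m(1)] C.coh_car[OF n(1)] ah_cl[OF pd_hom]
 show ?thesis unfolding m n using m(1) n(1) c by (simp add: C.Lim_mul C.lmap_Lim[OF pd_hom] C.coh_mul C.coh_map[OF pd_hom] pd_mul C.lim_add)
qed

text \<open>\<open>Y_j d/dY_j\<close> multiplies \<open>Y^v\<close> by the exponent
  \<open>v_j\<close>, so this exponent is its value on \<open>dlog\<close>. For \<open>X_i\<close>
  the count is 0, because only \<open>Inr\<close> letters occur.\<close>

definition dval :: "nat + nat => (nat => 'r mpoly set, nat multiset \<times> 'n) dsym => nat => 'r mpoly set" where
 "dval x s=(case s of Dsym a => Pd x a | Lsym l => \<tau> (mnm ((count (image_mset Inr (fst l)) x) .[R] 1[R]) {#}))"

lemma dval_contraction: "contraction B A (dval x)"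
proof (intro contraction.intro A_pl contraction_axioms.intro)
 note Pd = C.lmap_ah[OF pd_hom, of x]
 have nc: "n .[R] 1[R]:[R]" for n :: nat by simp
 show "dval x s:[pr A]" if "s : dsyms A" for s
 proof (cases s)
  case (Dsym a)
  hence "a:[C.L]" using that by (auto simp: dsyms_def)
  thus ?thesis using ah_cl[OF Pd, of a] Dsym by (simp add: dval_def)
 next
  case (Lsym l)
  thus ?thesis using tau_cl[OF mon_cl[OF nc, of "{#}"]] by (simp add: dval_def)
 qed
 show "dval x (Dsym (a +[pr A]b))=dval x (Dsym a) +[pr A]dval x (Dsym b)"
  if "a:[pr A]" "b:[pr A]" for a b using that ah_add[OF Pd] by (simp add: dval_def)
 show "dval x (Dsym (a *[pr A]b))=a *[pr A]dval x (Dsym b) +[pr A]b *[pr A]dval x (Dsym a)"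
  if "a:[pr A]" "b:[pr A]" for a b using that Pd_mul by (simp add: dval_def)
 have t0: "\<tau> (mnm 0[R] M)=0[C.L]" for M using gpair.ah_0[OF gpairI[OF P_grp C.lim_grp] C.to_lim_hom] by (simp add: mon_0 P_s)
 show "dval x (Dsym (rstr A r))=0[pr A]" if "r:[R]" for r using that t0 by (simp add: dval_def C.lmap_to_lim[OF pd_hom] mon_cl pd_mon)
 show "dval x (Lsym (nstr A n))=0[pr A]" if "n:[pmon B]" for n using t0 by (simp add: dval_def)
 show "dval x (Lsym (l *[pmon A]m))=dval x (Lsym l) +[pr A]dval x (Lsym m)"
  if "l:[pmon A]" "m:[pmon A]" for l m using that by (cases l; cases m) (simp add: dval_def R.nm_add mon_add tau_add mon_cl)
 show "dval x (Dsym (palpha A l))=palpha A l *[pr A]dval x (Lsym l)" if "l:[pmon A]" for l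
 proof -
  obtain v n where l: "l=(v, n)" by (cases l)
  have v: "set_mset (image_mset Inr v) <= vars nm" and n: "n:[pmon B]" using that l Y_vars by auto
  have "mnm ((count (image_mset Inr v) x) .[R] palpha B n) (del x (image_mset Inr v)) =
    mnm ((count (image_mset Inr v) x) .[R] palpha B n) (image_mset Inr v)"
  proof (cases x)
   case (Inl i)
   hence "count (image_mset Inr v) x=0" by (auto simp: not_in_iff[symmetric])
   thus ?thesis by (simp add: mpoly_monom_def)
  qed (simp add: del_def)
  thus ?thesis using n v by (simp add: l dval_def C.lmap_to_lim[OF pd_hom] mon_cl pd_mon tau_mult[symmetric] mon_mul R.nm_m_r)
 qed
qed

definition frame :: "nat + nat => (nat => 'r mpoly set, nat multiset \<times> 'n) dsym" where
 "frame x=(case x of Inl i => Dsym (\<tau> (mnm 1[R] {#Inl i#})) | Inr j => Lsym ({#j#}, 1[pmon B]))"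

abbreviation "kset \<equiv> map Inl [0..<fst nm] @ map Inr [0..<snd nm]"

lemma kset: "set kset=vars nm" "distinct kset" by (auto simp: vars_def distinct_map inj_on_def split: prod.splits)

sublocale A: prelog_algebra B A by (rule A_pl)

text \<open>From the frame one reaches \<open>dlog\<close> of all monoid elements, since
  \<open>dlog\<close> vanishes on the base monoid, then \<open>d Y_j = Y_j dlog Y_j\<close>, then
  polynomials by the Leibniz rule. An element of the completed ring is a polynomial plus a multiple
  of \<open>p ^ n\<close>, and the differential of that multiple is covered by
  \<open>Hp\<close>.\<close>

lemma A_gen:
 assumes H: "asub H (gr A.om 1)"
  and Hs: "!!a x. a:[pr A]==>x : H==>gmul A.om 0 1 (A.sform a) x : H"
  and Hp: "mults (p ^ n) (gr A.om 1) <= H"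
  and He: "!!x. x : vars nm==>form_class B A 1 (1[pr A], [frame x]) : H"
  and s: "s : dsyms A"
 shows "form_class B A 1 (1[pr A], [s]) : H"
proof -
 note Hz = sub_zero[OF H] and Ha = sub_plus[OF H]
 interpret gp: gpair "C.L" "gr A.om 1" by unfold_locales
 note dh = A.dform_hom[unfolded A_s]
 have L: "A.lform (v, n) : H" if "set_mset v <= {..<snd nm}" "n:[pmon B]" for v n using that
 proof (induction v)
  case empty
  thus ?case using A.lform_base[of n] Hz by simp
 next
  case (add j v)
  have "A.lform (({#j#}, 1[pmon B]) *[pmon A](v, n))=A.lform ({#j#}, 1[pmon B]) +[gr A.om 1]A.lform (v, n)" using add.prems by (intro A.lform_mul) auto
  moreover have "A.lform ({#j#}, 1[pmon B]) : H" using He[of "Inr j"] add.prems by (simp add: frame_def)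
  ultimately show ?case using Ha add by simp
 qed
 have x: "A.dform (\<tau> (mnm 1[R] {#x#})) : H" if "x : vars nm" for x
 proof (cases x)
  case (Inl i)
  thus ?thesis using He[OF that] by (simp add: frame_def)
 next
  case (Inr j)
  have j: "({#j#}, 1[pmon B]):[pmon A]" using that Inr by simp
  have "palpha A ({#j#}, 1[pmon B]):[pr A]" using A.al_A j by (simp only: mm_def hom_def) blast
  thus ?thesis using A.dform_log[OF j] Hs L[of "{#j#}" "1[pmon B]"] j Inr by simp
 qed
 have M: "A.dform (\<tau> (mnm c M)) : H" if c: "c:[R]" and "set_mset M <= vars nm" for c M using that(2)
 proof (induction M)
  case empty
  thus ?case using A.dform_base[of c] c Hz by simp
 next
  case (add x M)
  have t: "\<tau> (mnm c M):[pr A]" "\<tau> (mnm 1[R] {#x#}):[pr A]" using add.prems c by (auto simp: tau_cl mon_cl)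
  have "\<tau> (mnm c (add_mset x M))=\<tau> (mnm c M) *[pr A]\<tau> (mnm 1[R] {#x#})" using add.prems c unfolding mon_spl[OF c, of x M] by (simp add: tau_mult mon_cl)
  thus ?case using A.dform_mul[OF t] Ha[OF Hs[OF t(1) x[of x]] Hs[OF t(2)]] add by simp
 qed
 have P: "A.dform (\<tau> f) : H" if "f:[P]" for f using that
 proof (induction rule: P_ind)
  case zero
  thus ?case using gp.ah_0[OF dh] gpair.ah_0[OF gpairI[OF P_grp C.lim_grp] C.to_lim_hom] Hz by simp
 next
  case (add f g)
  thus ?case using ah_add[OF dh, of "\<tau> f" "\<tau> g"] Ha by (simp add: tau_add tau_cl)
 qed (rule M)
 have D: "A.dform a : H" if a: "a:[C.L]" for a
 proof -
  obtain g b where g: "g:[P]" "b:[C.L]" "a=\<tau> g +[C.L](p ^ n) .[C.L] b" using C.L_dn[OF a] by blast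
  have "A.dform a=A.dform (\<tau> g) +[gr A.om 1](p ^ n) .[gr A.om 1] A.dform b" using ah_add[OF dh, of "\<tau> g" "(p ^ n) .[C.L] b"] gp.ah_nm[OF dh g(2)] g by (simp add: tau_cl)
  moreover have "(p ^ n) .[gr A.om 1] A.dform b : H" using Hp A.omega.gr.muls_mem[OF ah_cl[OF dh g(2)]] by auto
  ultimately show ?thesis using P[OF g(1)] Ha by simp
 qed
 show ?thesis using s L D by (auto simp: dsyms_def)
qed

lemma A_framed: "framed_algebra B A kset frame dval p"
proof (intro framed_algebra.intro framed_algebra_axioms.intro A_pl dval_contraction)
 show "distinct kset" by (rule kset)
 show "torsion_free p (pr A)" using C.L_tf[OF P_tf] by simp
 fix x assume "x : set kset"
 hence x: "x : vars nm" by (simp only: kset)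
 thus "frame x : dsyms A" by (cases x) (simp_all add: frame_def dsyms_def tau_cl mon_cl)
 fix y assume "y : set kset"
 hence y: "y : vars nm" by (simp only: kset)
 have t0: "\<tau> (mnm 0[R] M)=0[C.L]" for M using gpair.ah_0[OF gpairI[OF P_grp C.lim_grp] C.to_lim_hom] by (simp add: mon_0 P_s)
 have t1: "\<tau> (mnm 1[R] {#})=1[C.L]" using rh_one[OF tau_rh] by (simp add: P_one_mon)
 show "dval x (frame y)=(if x=y then 1[pr A] else 0[pr A])"
 proof (cases y)
  case (Inl i)
  thus ?thesis using y t0 t1 by (simp add: dval_def frame_def C.lmap_to_lim[OF pd_hom] mon_cl pd_mon del_def)
 qed (use t0 t1 in \<open>simp add: dval_def frame_def\<close>)
next
 fix H n s
 assume "asub H (gr A.om 1)" "s : dsyms A"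
  "!!a x. a:[pr A]==>x : H==>gmul A.om 0 1 (A.sform a) x : H"
  "mults (p ^ n) (gr A.om 1) <= H"
  "!!x. x : set kset==>form_class B A 1 (1[pr A], [frame x]) : H"
 thus "form_class B A 1 (1[pr A], [s]) : H" using A_gen[of H n s] by (simp only: kset)
qed

lemmas om_p_div = framed_algebra.om_p_div[OF A_framed]

subsection \<open>The Frobenius lift\<close>

abbreviation "\<Phi> \<equiv> mpoly_frob p B"

lemma Phi_repeat: "\<Phi> f (repeat_mset p U)=FR (f U)" by (auto simp: mpoly_frob_def repeat_mset_inj[OF p_pos])
lemma Phi_other: "(!!U. M ~= repeat_mset p U)==>\<Phi> f M=0[R]" by (auto simp: mpoly_frob_def)

lemma Phi_ah: "\<Phi> : ahom P P"
proof (rule ahI)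
 interpret gp: gpair R R by unfold_locales
 have F0: "FR 0[R]=0[R]" by (rule gp.ah_0[OF rh_ah[OF FR_hom]])
 fix f assume f: "f:[P]"
 have 1: "\<Phi> f M:[R]" for M using P_coeff[OF f] rh_cl[OF FR_hom] by (cases "\<exists>U. M=repeat_mset p U") (auto simp: Phi_repeat Phi_other)
 have 2: "{M. \<Phi> f M ~= 0[R]} <= repeat_mset p ` {U. f U ~= 0[R]}"
 proof
  fix M assume "M : {M. \<Phi> f M ~= 0[R]}"
  thus "M : repeat_mset p ` {U. f U ~= 0[R]}" using Phi_other[of M f] F0 by (cases "\<exists>U. M=repeat_mset p U") (auto simp: Phi_repeat)
 qed
 have 3: "finite {U. f U ~= 0[R]}" "{U. f U ~= 0[R]} <= vmsets" using f by (auto simp: P_car)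
 have "repeat_mset p ` {U. f U ~= 0[R]} <= vmsets" using 3(2) by (auto simp: set_repeat_mset[OF p_pos] subset_iff)
 thus "\<Phi> f:[P]" unfolding P_car using 1 2 finite_subset[OF 2 finite_imageI[OF 3(1)]] by blast
 fix g assume g: "g:[P]"
 show "\<Phi> (f +[P]g)=\<Phi> f +[P]\<Phi> g"
 proof
  fix M
  show "\<Phi> (f +[P]g) M=(\<Phi> f +[P]\<Phi> g) M" using P_coeff[OF f] P_coeff[OF g] by (cases "\<exists>U. M=repeat_mset p U") (auto simp: Phi_repeat Phi_other P_s rh_add[OF FR_hom])
 qed
qed

lemma Phi_mon: assumes "c:[R]" shows "\<Phi> (mnm c M)=mnm (FR c) (repeat_mset p M)"
proof
 interpret gp: gpair R R by unfold_locales
 have F0: "FR 0[R]=0[R]" by (rule gp.ah_0[OF rh_ah[OF FR_hom]])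
 fix N show "\<Phi> (mnm c M) N=mnm (FR c) (repeat_mset p M) N" by (cases "\<exists>U. N=repeat_mset p U") (auto simp: Phi_repeat Phi_other F0 mpoly_monom_def repeat_mset_inj[OF p_pos])
qed

lemma Phi_rh: "\<Phi> : rhom P P" by (rule P_rhI[OF PR.ring_axioms Phi_ah])
  (simp_all add: P_one_mon Phi_mon rh_one[OF FR_hom] rh_mul[OF FR_hom] rh_cl[OF FR_hom] mon_mul)

lemma mon_pow: "c:[R]==>set_mset M <= vars nm==>mnm c M [^][P] n=mnm (c [^][R] n) (repeat_mset n M)" for n :: nat by (induction n) (simp_all add: P_one_mon mon_mul add.commute[of "repeat_mset _ _"])

lemma Phi_frob: "frobenius_lift p P \<Phi>" unfolding frobenius_lift_def
proof (intro conjI ballI Phi_rh)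
 interpret gp: gpair P P by unfold_locales
 fix f assume "f:[P]"
 thus "\<Phi> f -[P]f [^][P] p : mults p P"
 proof (induction rule: P_ind)
  case zero
  have "0[P] [^][P] p=0[P]" using p_pos by (simp add: PR.nat_pow_zero)
  thus ?case using gp.ah_0[OF Phi_ah] sub_zero[OF Pg.muls_sub] by (simp add: Pg.minus_eq)
 next
  case (mon c M)
  have "FR c -[R]c [^][R] p : mults p R" using frobenius mon by (simp add: frobenius_lift_def)
  hence "mnm (FR c -[R]c [^][R] p) (repeat_mset p M) : mults p P" using gpair.ah_muls[OF gpairI[OF R.abelian_group_axioms P_grp] mon_ah[of "repeat_mset p M"]] mon by (simp add: set_repeat_mset[OF p_pos])
  moreover have "mnm (FR c -[R]c [^][R] p) (repeat_mset p M)=\<Phi> (mnm c M) -[P]mnm c M [^][P] p" using gpair.ah_sub[OF gpairI[OF R.abelian_group_axioms P_grp] mon_ah[of "repeat_mset p M"]] mon by (simp add: Phi_mon mon_pow rh_cl[OF FR_hom] set_repeat_mset[OF p_pos])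
  ultimately show ?case by simp
 next
  case (add f g)
  thus ?case by (intro PR.frob_cg_add[OF prime_p Phi_ah])
 qed
qed

lemma std_frob_eq: "std_frob p B nm=C.lmap \<Phi>" by (simp add: std_frob_def C.lmap_def fun_eq_iff Let_def lpoly_obj_def)
lemma std_frob_frob: "frobenius_lift p C.L (std_frob p B nm)" unfolding std_frob_eq by (rule C.lmap_frob[OF prime_p Phi_frob])
lemma std_frob_tau: "f:[P]==>std_frob p B nm (\<tau> f)=\<tau> (\<Phi> f)" unfolding std_frob_eq by (rule C.lmap_to_lim[OF Phi_ah])
lemma std_frob_rstr: "r:[R]==>std_frob p B nm (rstr A r)=rstr A (FR r)" by (simp add: std_frob_tau Phi_mon mon_cl)

lemma std_frob_Y:
 "set_mset v <= {..<snd nm}==>std_frob p B nm (palpha A (v, 1[pmon B]))=palpha A (v, 1[pmon B]) [^][C.L] p" using mon_cl[of "1[R]" "image_mset Inr v"] Y_vars[of v] by (simp add: std_frob_tau Phi_mon mon_pow rh_one[OF FR_hom]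
   rh_pow[OF tau_rh PR.monoid_axioms, symmetric] del: set_image_mset)

end

section \<open>The completed log de Rham complex\<close>

locale hat_prelog = prelog_algebra S A
 for S :: "('s, 'n, 'y) prelog_scheme" and A :: "('a, 'l, 's, 'n, 'z) prelog_alg_scheme" +
 fixes p :: nat
begin

sublocale hat: cfil "pr S" om "%i. p_fil p (gr om i)" by (rule omega.pft)

abbreviation "Dh \<equiv> hat.C"
abbreviation "hc \<equiv> hat_class p S A"
abbreviation "hs a \<equiv> hc 0 (a, [])"
abbreviation "hdf a \<equiv> hc 1 (1[pr A], [Dsym a])"
abbreviation "hl l \<equiv> hc 1 (1[pr A], [Lsym l])"

lemma hat_eq: "log_de_rham_hat p S A=Dh" by (simp add: log_de_rham_hat_def Let_def)
lemma hc_tau: "hc i g=hat.\<tau> i (form_class S A i g)" by (simp add: hat_class_def Let_def)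
lemma hc_cl: "a:[pr A]==>w : words i==>hc i (a, w):[gr Dh i]" unfolding hc_tau by (rule ah_cl[OF hat.tau_hom form_class_closed])

lemma hc_mul:
 "a:[pr A]==>b:[pr A]==>w : words i==>v : words j ==>
  gmul Dh i j (hc i (a, w)) (hc j (b, v))=hc (i + j) (a *[pr A]b, w @ v)" unfolding hc_tau by (subst hat.tau_gmul[symmetric]) (simp_all add: form_class_closed fcl_mul)

lemma hs_rh: "hs : rhom (pr A) (deg0 Dh)"
proof (rule rhI)
 show "hs 1[pr A]=1[deg0 Dh]" using rh_one[OF sform_rh] hat.tau_gone by (simp add: hc_tau)
 fix a b assume ab: "a:[pr A]" "b:[pr A]"
 show "hs a:[deg0 Dh]" using hc_cl[of a "[]" 0] ab by simp
 show "hs (a *[pr A]b)=hs a *[deg0 Dh]hs b" using hc_mul[of a b "[]" 0 "[]" 0] ab by simp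
 show "hs (a +[pr A]b)=hs a +[deg0 Dh]hs b" using rh_add[OF sform_rh ab] ah_add[OF hat.tau_hom sform_cl sform_cl] ab by (simp add: hc_tau)
qed

lemma hs_ah: "hs : ahom (pr A) (gr Dh 0)" using rh_ah[OF hs_rh] by (simp only: add_mon_deg0)
lemma hs_cl: "a:[pr A]==>hs a:[gr Dh 0]" by (rule ah_cl[OF hs_ah])
lemma hdf_dif: "a:[pr A]==>hdf a=dif Dh 0 (hs a)" using hat.tau_dif[OF sform_cl] by (simp add: hc_tau dform_dif[simplified])
lemma hdf_cl: "a:[pr A]==>hdf a:[gr Dh 1]" by (rule hc_cl) (auto simp: dsyms_def)
lemma hl_cl: "l:[pmon A]==>hl l:[gr Dh 1]" by (rule hc_cl) (auto simp: dsyms_def)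
lemma hl_mul: "l:[pmon A]==>m:[pmon A]==>hl (l *[pmon A]m)=hl l +[gr Dh 1]hl m" unfolding hc_tau by (simp only: lform_mul ah_add[OF hat.tau_hom lform_cl lform_cl])
lemma hl_base: "n:[pmon S]==>hl (nstr A n)=0[gr Dh 1]" unfolding hc_tau by (simp only: lform_base gpair.ah_0[OF gpairI[OF omega.gr_group hat.lim.gr_group] hat.tau_hom])

lemma hl_dif: "l:[pmon A]==>dif Dh 1 (hl l)=0[gr Dh 2]"
proof -
 assume l: "l:[pmon A]"
 have "dif om 1 (lform l)=form_class S A 2 (1[pr A], [Dsym 1[pr A], Lsym l])" using fcl_dif[of "1[pr A]" "[Lsym l]" 1] l by (simp add: dsyms_def numeral_2_eq_2)
 also have "\<dots>=gmul om 1 1 (dform 1[pr A]) (lform l)" using fcl_mul[of "1[pr A]" "1[pr A]" "[Dsym 1[pr A]]" 1 "[Lsym l]" 1] l by (simp add: dsyms_def numeral_2_eq_2)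
 also have "dform 1[pr A]=0[gr om 1]" using dform_base[OF one_S] rh_one[OF rstr_A] by simp
 also have "gmul om 1 1 0[gr om 1] (lform l)=0[gr om 2]" using omega.gmul_0_l[OF lform_cl[OF l], of 1] by (simp add: numeral_2_eq_2)
 finally show ?thesis using hat.tau_dif[OF lform_cl[OF l]] gpair.ah_0[OF gpairI[OF omega.gr_group hat.lim.gr_group] hat.tau_hom, of 2] by (simp add: hc_tau numeral_2_eq_2)
qed

lemma hdf_log: assumes l: "l:[pmon A]"
 shows "dif Dh 0 (hs (palpha A l))=gmul Dh 0 1 (hs (palpha A l)) (hl l)"
proof -
 have a: "palpha A l:[pr A]" using al_A l by (auto simp: mm_def hom_def)
 show ?thesis using hat.tau_gmul[OF sform_cl[OF a] lform_cl[OF l]] dform_log[OF l] hdf_dif[OF a] by (simp add: hc_tau)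
qed

lemma rmap_hs: "rmap Dh s=hs (rstr A s)" by (simp only: hc_tau rmap_sform[symmetric] hat.tau_rmap)

text \<open>The class of \<open>(a, w)\<close> is a product of a coefficient and symbols
  \<open>d a\<close>, \<open>dlog l\<close>. A property closed under products, such as agreement of
  two multiplicative maps, is checked on these three kinds.\<close>

lemma hat_ind:
 assumes "!!a. a:[pr A]==>Q 0 (hs a)" "!!a. a:[pr A]==>Q 1 (hdf a)"
  "!!l. l:[pmon A]==>Q 1 (hl l)"
  and mult: "!!i j x y. x:[gr Dh i]==>y:[gr Dh j]==>Q i x==>Q j y==>Q (i + j) (gmul Dh i j x y)"
  and a: "a:[pr A]" and w: "w : words i"
 shows "Q i (hc i (a, w))"
proof -
 have one: "1[pr A]:[pr A]" by simp
 have 1: "Q (length w) (hc (length w) (1[pr A], w))" if "set w <= dsyms A" for w using that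
 proof (induction w)
  case Nil thus ?case using assms(1)[OF one] by simp
 next
  case (Cons s w)
  hence s: "[s] : words 1" "w : words (length w)" by auto
  have "Q 1 (hc 1 (1[pr A], [s]))" using Cons.prems assms(2,3) by (auto simp: dsyms_def)
  from mult[OF hc_cl[OF one s(1)] hc_cl[OF one s(2)] this] show ?case unfolding hc_mul[OF one one s] using Cons by simp
 qed
 have n: "[] : words 0" by simp
 have "Q i (hc i (1[pr A], w))" using 1 w by auto
 from mult[OF hc_cl[OF a n] hc_cl[OF one w] assms(1)[OF a] this] show ?thesis unfolding hc_mul[OF a one n w] using a by simp
qed

lemma hat_hom_eqI:
 assumes "abelian_group G" "p_sep p G" and h: "h : ahom (gr Dh i) G" and k: "k : ahom (gr Dh i) G"
  and eq: "!!a w. a:[pr A]==>w : words i==>h (hc i (a, w))=k (hc i (a, w))"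
  and x: "x:[gr Dh i]"
 shows "h x=k x"
proof (rule lim_p_hom_eqI[OF omega.gr_group assms(1,2)])
 show "h : ahom (lim_ring (gr om i) (p_fil p (gr om i))) G" "k : ahom (lim_ring (gr om i) (p_fil p (gr om i))) G"
  "x:[lim_ring (gr om i) (p_fil p (gr om i))]" using h k x by simp_all
 fix g assume g: "g:[gr om i]"
 show "h (hat.\<tau> i g)=k (hat.\<tau> i g)" by (rule om_hom_eqI[OF assms(1) ah_comp[OF hat.tau_hom h] ah_comp[OF hat.tau_hom k] _ g])
   (use eq in \<open>simp add: hc_tau\<close>)
qed

end

text \<open>The filtration of the target is left open: the Frobenius of the completed complex uses
  the p-adic one, maps into a strict algebra use the V-filtration. Containing the multiples of
  \<open>p ^ r\<close> makes the evaluation continuous.\<close>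

locale hat_derivation = log_derivation S A RE E f D \<delta>
 for S :: "('s, 'n, 'y) prelog_scheme" and A :: "('a, 'l, 's, 'n, 'z) prelog_alg_scheme"
  and RE :: "('r, 'w) ring_scheme" and E :: "('e, 'r, 'v) cdga_scheme" and f D \<delta> +
 fixes p :: nat and FilE :: "nat => nat => 'e set"
 assumes FilE: "filg (gr E i) (FilE i)" and FilE_cmp: "lim_complete (gr E i) (FilE i)"
  and p_FilE: "mults (p ^ r) (gr E i) <= FilE i r"
begin

sublocale hat_prelog S A p by unfold_locales

lemma E_sep: "p_sep p (gr E i)" unfolding p_sep_def using filg.cmp_sep[OF FilE FilE_cmp] p_FilE by blast

definition hext :: "nat => (nat => ('a, 'l) form set set) => 'e" where
 "hext i=lim_ext (gr om i) (p_fil p (gr om i)) (gr E i) (FilE i) (omega_val i)"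

lemmas oval = om_val_gr[unfolded grh_def]
lemma oval_hom: "omega_val i : ahom (gr om i) (gr E i)" using oval by blast
lemma hext_filt: "film (gr om i) (p_fil p (gr om i)) (gr E i) (FilE i) (omega_val i)" using gpair.ah_muls[OF gpairI[OF omega.gr_group E.gr_group] oval_hom] p_FilE by (intro film.intro film_axioms.intro hat.fil.filg_axioms FilE FilE_cmp oval_hom) blast
lemma hext_tau: "x:[gr om i]==>hext i (hat.\<tau> i x) = omega_val i x" unfolding hext_def by (rule film.ext_to_lim[OF hext_filt])
lemma hext_hom: "hext i : ahom (gr Dh i) (gr E i)" using film.ext_hom[OF hext_filt] by (simp add: hext_def)
lemma hext_0: "a:[pr A]==>hext 0 (hs a)=f a" by (simp add: hc_tau hext_tau sform_cl om_val_0)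
lemma hext_sym: "s : dsyms A==>hext 1 (hc 1 (1[pr A], [s]))=sym_val s" using hext_tau[OF form_class_closed, of "1[pr A]" "[s]" 1] om_val_1 by (simp add: hc_tau)
lemma hext_d: "a:[pr A]==>hext 1 (hdf a)=D a" by (subst hext_sym) (auto simp: dsyms_def)
lemma hext_dlog: "l:[pmon A]==>hext 1 (hl l)=\<delta> l" by (subst hext_sym) (auto simp: dsyms_def)

lemma hext_gmul:
 assumes x: "x:[gr Dh i]" and y: "y:[gr Dh j]"
 shows "hext (i + j) (gmul Dh i j x y)=gmul E i j (hext i x) (hext j y)"
proof -
 have eq: "hext (i + j) (gmul Dh i j x (hat.\<tau> j z))=gmul E i j (hext i x) (hext j (hat.\<tau> j z))"
  if z: "z:[gr om j]" for z
 proof (rule lim_p_hom_eqI[OF omega.gr_group E.gr_group E_sep _ _ _ x[simplified]])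
  have t: "hat.\<tau> j z:[gr Dh j]" by (rule ah_cl[OF hat.tau_hom z])
  show "(%x. hext (i + j) (gmul Dh i j x (hat.\<tau> j z))) : ahom (lim_ring (gr om i) (p_fil p (gr om i))) (gr E (i + j))" using ah_comp[OF hat.lim.rmul_hom[OF t] hext_hom] by simp
  show "(%x. gmul E i j (hext i x) (hext j (hat.\<tau> j z))) : ahom (lim_ring (gr om i) (p_fil p (gr om i))) (gr E (i + j))" using ah_comp[OF hext_hom E.rmul_hom[OF ah_cl[OF hext_hom t]]] by simp
  fix g assume g: "g:[gr om i]"
  have "hext (i + j) (gmul Dh i j (hat.\<tau> i g) (hat.\<tau> j z)) = omega_val (i + j) (gmul om i j g z)" using g z by (simp only: hat.tau_gmul[symmetric] hext_tau omega.gmul_closed)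
  thus "hext (i + j) (gmul Dh i j (hat.\<tau> i g) (hat.\<tau> j z))=gmul E i j (hext i (hat.\<tau> i g)) (hext j (hat.\<tau> j z))" using g z oval by (simp add: hext_tau)
 qed
 show ?thesis
 proof (rule lim_p_hom_eqI[OF omega.gr_group E.gr_group E_sep _ _ _ y[simplified]])
  show "(%y. hext (i + j) (gmul Dh i j x y)) : ahom (lim_ring (gr om j) (p_fil p (gr om j))) (gr E (i + j))" using ah_comp[OF hat.lim.lmul_hom[OF x] hext_hom] by simp
  show "(%y. gmul E i j (hext i x) (hext j y)) : ahom (lim_ring (gr om j) (p_fil p (gr om j))) (gr E (i + j))" using ah_comp[OF hext_hom E.lmul_hom[OF ah_cl[OF hext_hom x]]] by simp
 qed (rule eq)
qed

lemma hext_gr: "graded_ring_hom Dh E hext" unfolding grh_def using hext_hom hext_gmul hext_tau[OF omega.gone_closed] oval hat.tau_gone by simp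

text \<open>Compatibility with \<open>d\<close> is an extra property, available when
  \<open>D\<close> is the differential of \<open>f\<close>. The Frobenius instead satisfies
  \<open>d F = p F d\<close>, which is why \<open>D\<close> is a separate datum.\<close>

lemma hext_dif:
 assumes Dd: "!!a. a:[pr A]==>D a=dif E 0 (f a)"
  and dl: "!!l. l:[pmon A]==>dif E 1 (\<delta> l)=0[gr E 2]"
  and x: "x:[gr Dh i]"
 shows "hext (Suc i) (dif Dh i x)=dif E i (hext i x)"
proof (rule hat_hom_eqI[OF E.gr_group E_sep ah_comp[OF hat.lim.dif_hom hext_hom] ah_comp[OF hext_hom E.dif_hom] _ x])
 fix a w assume "a:[pr A]" "w : words i"
 thus "hext (Suc i) (dif Dh i (hc i (a, w)))=dif E i (hext i (hc i (a, w)))"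
 proof (rule hat_ind[rotated 4])
  fix a assume a: "a:[pr A]"
  have d: "hext 1 (dif Dh 0 (hs a))=D a" using hext_d[OF a] hdf_dif[OF a] by simp
  thus "hext (Suc 0) (dif Dh 0 (hs a))=dif E 0 (hext 0 (hs a))" using a by (simp add: hext_0 Dd)
  have "hext 2 (dif Dh 1 (hdf a))=0[gr E 2]" using gpair.ah_0[OF gpairI[OF hat.lim.gr_group E.gr_group] hext_hom, of 2] hat.lim.dif_dif[OF hs_cl[OF a]] by (simp add: hdf_dif[OF a, simplified] numeral_2_eq_2)
  thus "hext (Suc 1) (dif Dh 1 (hdf a))=dif E 1 (hext 1 (hdf a))" using E.dif_dif[OF rh_cl[OF f a, simplified]] hext_d[OF a] by (simp add: Dd[OF a] numeral_2_eq_2)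
 next
  fix l assume l: "l:[pmon A]"
  show "hext (Suc 1) (dif Dh 1 (hl l))=dif E 1 (hext 1 (hl l))" using gpair.ah_0[OF gpairI[OF hat.lim.gr_group E.gr_group] hext_hom, of 2] hl_dif[OF l] hext_dlog[OF l] dl[OF l] by (simp add: numeral_2_eq_2)
 next
  fix i j x y
  assume x: "x:[gr Dh i]" and y: "y:[gr Dh j]"
   and dx: "hext (Suc i) (dif Dh i x)=dif E i (hext i x)" and dy: "hext (Suc j) (dif Dh j y)=dif E j (hext j y)"
  note c = hat.lim.dif_closed[OF x] hat.lim.dif_closed[OF y] ah_cl[OF hext_hom x] ah_cl[OF hext_hom y]
  interpret gp: gpair "gr Dh (Suc (i + j))" "gr E (Suc (i + j))" by unfold_locales
  have xy: "gmul Dh i (Suc j) x (dif Dh j y):[gr Dh (Suc (i + j))]"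
   "gmul Dh (Suc i) j (dif Dh i x) y:[gr Dh (Suc (i + j))]" using hat.lim.gmul_closed[OF x c(2)] hat.lim.gmul_closed[OF c(1) y] by simp_all
  have sg: "hext (Suc (i + j)) (gsign i (gr Dh (Suc (i + j))) z)=gsign i (gr E (Suc (i + j))) (hext (Suc (i + j)) z)"
   if "z:[gr Dh (Suc (i + j))]" for z using gp.ah_neg[OF hext_hom that] by (simp add: gsign_def)
  show "hext (Suc (i + j)) (dif Dh (i + j) (gmul Dh i j x y))=dif E (i + j) (hext (i + j) (gmul Dh i j x y))" unfolding hat.lim.leibniz[OF x y] hext_gmul[OF x y] E.leibniz[OF c(3,4)]
    ah_add[OF hext_hom xy(2) hat.lim.gsign_closed[OF xy(1)]] sg[OF xy(1)] using hext_gmul[OF x c(2)] hext_gmul[OF c(1) y] dx dy by simp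
 qed
qed

end

section \<open>The Frobenius of the completed complex\<close>

context strict_cdga
begin

lemma dif_mul0: assumes "x:[gr A 0]" "y:[gr A 0]"
 shows "dif A 0 (gmul A 0 0 x y)=gmul A 0 1 x (dif A 0 y) +[gr A 1]gmul A 0 1 y (dif A 0 x)"
proof -
 note d = dif_closed[OF assms(1)] dif_closed[OF assms(2)]
 have "gmul A 1 0 (dif A 0 x) y=gmul A 0 1 y (dif A 0 x)" using gcomm[OF d(1) assms(2)] by (simp add: gsign_def)
 thus ?thesis using leibniz[OF assms] gmul_closed[OF assms(1) d(2)] gmul_closed[OF assms(2) d(1)] by (simp add: gsign_def gr.a_comm)
qed

text \<open>The formula for \<open>F(dx)\<close> in the definition of the Frobenius is \<open>d F(x) / p\<close>.\<close>

lemma dif_frob_formula: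
 assumes p: "(p::nat) > 0" and x: "x:[gr A 0]" and y: "y:[gr A 0]" and u: "u:[gr A 0]"
  and eq: "p .[gr A 0] y=u -[gr A 0]x [^][deg0 A] p"
 shows "p .[gr A 1] (gmul A 0 1 (x [^][deg0 A] (p - 1)) (dif A 0 x) +[gr A 1]dif A 0 y)=dif A 0 u"
proof -
 obtain n where n: "p=Suc n" using p gr0_implies_Suc by blast
 have xc: "x [^][deg0 A] m:[gr A 0]" for m :: nat using deg0.nat_pow_closed[of x m] x by simp
 have g: "gmul A 0 1 (x [^][deg0 A] n) (dif A 0 x):[gr A 1]" using gmul_closed[OF xc dif_closed[OF x]] by simp
 have d: "dif A 0 y:[gr A 1]" using dif_closed[OF y] by simp
 have "u=x [^][deg0 A] p +[gr A 0]p .[gr A 0] y" unfolding eq using gr.add_minus_cancel[OF xc u] by simp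
 hence "dif A 0 u=dif A 0 (x [^][deg0 A] p) +[gr A 1]p .[gr A 1] dif A 0 y" using dif_add[OF xc gr.nm_cl[OF y]] dif_nm[OF y] by simp
 also have "dif A 0 (x [^][deg0 A] p)=p .[gr A 1] gmul A 0 1 (x [^][deg0 A] n) (dif A 0 x)" unfolding n by (rule dif_pow[OF x])
 finally show ?thesis using n by (simp only: gr.nm_dist[OF g d] diff_Suc_1)
qed

end

context std_poly
begin

sublocale A: hat_prelog B A p by unfold_locales

abbreviation "\<sigma> \<equiv> std_frob p B nm"

lemma sigma_hom: "\<sigma> : rhom C.L C.L" using std_frob_frob by (simp add: frobenius_lift_def)
lemmas sigma_cl = rh_cl[OF sigma_hom]

lemma Om_tf: "torsion_free p (gr A.Dh i)" using lim_tf[OF A.hat.fil.filg_axioms, of i p] om_p_div by simp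
lemma Om_sep: "p_sep p (gr A.Dh i)" using lim_p_sep[OF A.omega.gr_group] by simp
lemma Om_cmp: "lim_complete (gr A.Dh i) (p_fil p (gr A.Dh i))" using lim_p_cmp[OF A.omega.gr_group] by simp

lemmas hs_hom = A.hs_rh[unfolded A_s(1)]
lemmas hs_ah = A.hs_ah[unfolded A_s(1)]
lemmas hs_cl = ah_cl[OF hs_ah]

text \<open>\<open>dif_frob_formula\<close> with \<open>y = (sigma(a) - a^p) / p\<close> writes down
  the quotient of \<open>d sigma(a)\<close> by \<open>p\<close>. Torsion-freeness makes it unique,
  so the rules for \<open>FD\<close> result from those for \<open>d\<close> by dividing by
  \<open>p\<close>.\<close>

lemma FD_ex: assumes a: "a:[C.L]"
 shows "\<exists>z\<in>carrier (gr A.Dh 1). p .[gr A.Dh 1] z=dif A.Dh 0 (A.hs (\<sigma> a))"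
proof -
 obtain y where y: "y:[C.L]" "\<sigma> a -[C.L]a [^][C.L] p=p .[C.L] y" using frob_liftD[OF std_frob_frob a] .
 interpret gp: gpair C.L "gr A.Dh 0" by unfold_locales
 have "p .[gr A.Dh 0] A.hs y=A.hs (\<sigma> a) -[gr A.Dh 0]A.hs a [^][deg0 A.Dh] p" using gp.ah_nm[OF hs_ah y(1), of p] gp.ah_sub[OF hs_ah sigma_cl[OF a], of "a [^][C.L] p"]
   rh_pow[OF hs_hom C.Lr.monoid_axioms a, of p] a by (simp add: y(2)[symmetric])
 note eq = A.hat.lim.dif_frob_formula[OF p_pos hs_cl[OF a] hs_cl[OF y(1)] hs_cl[OF sigma_cl[OF a]] this]
 have "gmul A.Dh 0 1 (A.hs a [^][deg0 A.Dh] (p - 1)) (dif A.Dh 0 (A.hs a)) +[gr A.Dh 1]dif A.Dh 0 (A.hs y):[gr A.Dh 1]" using A.hat.lim.gmul_closed[OF _ A.hat.lim.dif_closed[OF hs_cl[OF a]], of "A.hs a [^][deg0 A.Dh] (p - 1)" 0]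
   A.hat.lim.dif_closed[OF hs_cl[OF y(1)]] A.hat.lim.deg0.nat_pow_closed[of "A.hs a" "p - 1"] hs_cl[OF a] by (intro A.hat.lim.gr.a_closed) simp_all
 thus ?thesis using eq by blast
qed

definition FD :: "(nat => 'r mpoly set) => nat => (nat => 'r mpoly set, nat multiset \<times> 'n) form set set" where
 "FD a=(THE z. z:[gr A.Dh 1] & p .[gr A.Dh 1] z=dif A.Dh 0 (A.hs (\<sigma> a)))"

lemma FD_eqI: "z:[gr A.Dh 1]==>p .[gr A.Dh 1] z=dif A.Dh 0 (A.hs (\<sigma> a))==>FD a=z" unfolding FD_def by (rule the_equality) (auto intro: A.hat.lim.gr.nm_inj[OF Om_tf])

lemma FD: assumes "a:[C.L]"
 shows FD_cl: "FD a:[gr A.Dh 1]" and FD_p: "p .[gr A.Dh 1] FD a=dif A.Dh 0 (A.hs (\<sigma> a))" using FD_ex[OF assms] FD_eqI by auto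

lemma al_spl: assumes "v:[free_mon (snd nm)]" "n:[pmon B]"
 shows "palpha A (v, n)=palpha A (v, 1[pmon B]) *[C.L]rstr A (palpha B n)" using assms by (simp add: tau_mult[OF Y_mon_cl mon_cl, symmetric] mon_mul)

lemma al_cl: "set_mset v <= {..<snd nm}==>n:[pmon B]==>palpha A (v, n):[C.L]" by (simp add: tau_cl Y_mon_cl)
lemma rstr_cl: "r:[R]==>rstr A r:[C.L]" by (simp add: tau_cl mon_cl)
lemma hl_spl: "set_mset v <= {..<snd nm}==>n:[pmon B]==>A.hl (v, n)=A.hl (v, 1[pmon B])" using A.hl_mul[of "(v, 1[pmon B])" "({#}, n)"] A.hl_base[of n] A.hl_cl[of "(v, 1[pmon B])"] by simp

text \<open>Write \<open>alpha(v, n) = Y^v r\<close> with \<open>r\<close> from the base;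
  \<open>sigma\<close> sends it to \<open>Y^(pv) F(r)\<close>. The base factor has differential 0
  whatever \<open>F(r)\<close> is, so the differential is
  \<open>p Y^(pv) F(r) dlog Y^v\<close>.\<close>

lemma FD_pal:
 assumes v: "set_mset v <= {..<snd nm}" and n: "n:[pmon B]"
 shows "FD (palpha A (v, n))=gmul A.Dh 0 1 (A.hs (\<sigma> (palpha A (v, n)))) (A.hl (v, n))"
proof (rule FD_eqI)
 let ?y = "A.hs (palpha A (v, 1[pmon B]))" and ?r = "A.hs (rstr A (FR (palpha B n)))" and ?l = "A.hl (v, 1[pmon B])"
 obtain q where q: "p=Suc q" using p_pos gr0_implies_Suc by blast
 have Fn: "FR (palpha B n):[R]" using n rh_cl[OF FR_hom] by simp
 note a = al_cl[OF v MB.one_closed]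
 have y: "?y:[gr A.Dh 0]" and r: "?r:[gr A.Dh 0]" using hs_cl[OF a] hs_cl[OF rstr_cl[OF Fn]] .
 have l: "?l:[gr A.Dh 1]" using A.hl_cl[of "(v, 1[pmon B])"] v by simp
 have yc: "?y [^][deg0 A.Dh] m:[gr A.Dh 0]" for m :: nat using A.hat.lim.deg0.nat_pow_closed[of ?y m] y by simp
 have s: "A.hs (\<sigma> (palpha A (v, n)))=gmul A.Dh 0 0 ?r (?y [^][deg0 A.Dh] p)"
 proof -
  have "\<sigma> (palpha A (v, n))=palpha A (v, 1[pmon B]) [^][C.L] p *[C.L]rstr A (FR (palpha B n))" using al_spl[of v n] v n std_frob_Y[OF v] std_frob_rstr[of "palpha B n"] rh_mul[OF sigma_hom a rstr_cl, of "palpha B n"] by (simp del: A_s)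
  thus ?thesis using rh_mul[OF hs_hom C.Lr.nat_pow_closed[OF a] rstr_cl[OF Fn], of p] rh_pow[OF hs_hom C.Lr.monoid_axioms a, of p]
    A.hat.lim.deg0.m_comm[of "?y [^][deg0 A.Dh] p" ?r] yc r by (simp del: A_s)
 qed
 have dy: "dif A.Dh 0 ?y=gmul A.Dh 0 1 ?y ?l" using A.hdf_log[of "(v, 1[pmon B])"] v by simp
 have yl: "gmul A.Dh 0 1 ?y ?l:[gr A.Dh 1]" using A.hat.lim.gmul_closed[OF y l] by simp
 have ypl: "gmul A.Dh 0 1 (?y [^][deg0 A.Dh] q) (gmul A.Dh 0 1 ?y ?l)=gmul A.Dh 0 1 (?y [^][deg0 A.Dh] p) ?l" using A.hat.lim.assoc[OF yc y l, of q] by (simp add: q)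
 have dr: "dif A.Dh 0 ?r=0[gr A.Dh 1]" using A.hat.lim.dif_rmap[OF Fn] by (simp only: A.rmap_hs)
 have dyp: "dif A.Dh 0 (?y [^][deg0 A.Dh] p)=p .[gr A.Dh 1] gmul A.Dh 0 1 (?y [^][deg0 A.Dh] p) ?l" using A.hat.lim.dif_pow[OF y, of q] by (simp only: dy ypl q[symmetric])
 have pl: "gmul A.Dh 0 1 (?y [^][deg0 A.Dh] p) ?l:[gr A.Dh 1]" using A.hat.lim.gmul_closed[OF yc l] by simp
 have rpl: "gmul A.Dh 0 1 (gmul A.Dh 0 0 ?r (?y [^][deg0 A.Dh] p)) ?l=gmul A.Dh 0 1 ?r (gmul A.Dh 0 1 (?y [^][deg0 A.Dh] p) ?l)" using A.hat.lim.assoc[OF r yc l, of p] by simp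
 have rplc: "gmul A.Dh 0 1 ?r (gmul A.Dh 0 1 (?y [^][deg0 A.Dh] p) ?l):[gr A.Dh 1]" using A.hat.lim.gmul_closed[OF r pl] by simp
 show "gmul A.Dh 0 1 (A.hs (\<sigma> (palpha A (v, n)))) (A.hl (v, n)):[gr A.Dh 1]" unfolding s hl_spl[OF v n] rpl by (rule rplc)
 have "dif A.Dh 0 (gmul A.Dh 0 0 ?r (?y [^][deg0 A.Dh] p)) =
   gmul A.Dh 0 1 ?r (p .[gr A.Dh 1] gmul A.Dh 0 1 (?y [^][deg0 A.Dh] p) ?l) +[gr A.Dh 1]gmul A.Dh 0 1 (?y [^][deg0 A.Dh] p) 0[gr A.Dh 1]" unfolding A.hat.lim.dif_mul0[OF r yc] dr dyp ..
 also have "gmul A.Dh 0 1 (?y [^][deg0 A.Dh] p) 0[gr A.Dh 1]=0[gr A.Dh 1]" using A.hat.lim.gmul_0_r[OF yc, of 1 p] by simp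
 also have "gmul A.Dh 0 1 ?r (p .[gr A.Dh 1] gmul A.Dh 0 1 (?y [^][deg0 A.Dh] p) ?l) =
   p .[gr A.Dh 1] gmul A.Dh 0 1 ?r (gmul A.Dh 0 1 (?y [^][deg0 A.Dh] p) ?l)" using A.hat.lim.gmul_nm_r[OF r pl, of p] by simp
 finally show "p .[gr A.Dh 1] gmul A.Dh 0 1 (A.hs (\<sigma> (palpha A (v, n)))) (A.hl (v, n))=dif A.Dh 0 (A.hs (\<sigma> (palpha A (v, n))))" unfolding s hl_spl[OF v n] rpl using A.hat.lim.gr.r_zero[OF A.hat.lim.gr.nm_cl[OF rplc, of p]] by simp
qed

lemma FD_der: "log_derivation B A R A.Dh (%a. A.hs (\<sigma> a)) FD A.hl"
proof (intro log_derivation.intro A_pl A.hat.lim.strict_cdga_axioms log_derivation_axioms.intro)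
 show "(%a. A.hs (\<sigma> a)) : rhom (pr A) (deg0 A.Dh)" using ring_hom_trans[OF sigma_hom hs_hom] by (simp add: comp_def)
 fix a assume "a:[pr A]"
 hence a: "a:[C.L]" by simp
 show "FD a:[gr A.Dh 1]" by (rule FD_cl[OF a])
 fix b assume "b:[pr A]"
 hence b: "b:[C.L]" by simp
 note sc = hs_cl[OF sigma_cl[OF a]] hs_cl[OF sigma_cl[OF b]]
 show "FD (a +[pr A]b)=FD a +[gr A.Dh 1]FD b" by (rule FD_eqI)
   (use FD[OF a] FD[OF b] a b A.hat.lim.dif_add[OF sc] ah_add[OF hs_ah sigma_cl sigma_cl, of a b]
    A.hat.lim.gr.nm_dist[of "FD a" 1 "FD b" p] in \<open>simp_all add: rh_add[OF sigma_hom]\<close>)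
 have ab: "gmul A.Dh 0 1 (A.hs (\<sigma> a)) (FD b):[gr A.Dh 1]" "gmul A.Dh 0 1 (A.hs (\<sigma> b)) (FD a):[gr A.Dh 1]" using A.hat.lim.gmul_closed[OF sc(1) FD_cl[OF b]] A.hat.lim.gmul_closed[OF sc(2) FD_cl[OF a]] by simp_all
 show "FD (a *[pr A]b)=gmul A.Dh 0 1 (A.hs (\<sigma> a)) (FD b) +[gr A.Dh 1]gmul A.Dh 0 1 (A.hs (\<sigma> b)) (FD a)"
 proof (rule FD_eqI)
  show "gmul A.Dh 0 1 (A.hs (\<sigma> a)) (FD b) +[gr A.Dh 1]gmul A.Dh 0 1 (A.hs (\<sigma> b)) (FD a):[gr A.Dh 1]" by (rule A.hat.lim.gr.a_closed[OF ab])
  have "A.hs (\<sigma> (a *[pr A]b))=gmul A.Dh 0 0 (A.hs (\<sigma> a)) (A.hs (\<sigma> b))" using rh_mul[OF sigma_hom a b] rh_mul[OF hs_hom sigma_cl[OF a] sigma_cl[OF b]] by simp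
  thus "p .[gr A.Dh 1] (gmul A.Dh 0 1 (A.hs (\<sigma> a)) (FD b) +[gr A.Dh 1]gmul A.Dh 0 1 (A.hs (\<sigma> b)) (FD a))=dif A.Dh 0 (A.hs (\<sigma> (a *[pr A]b)))" using A.hat.lim.dif_mul0[OF sc] A.hat.lim.gr.nm_dist[OF ab, of p] FD_p[OF a] FD_p[OF b]
    A.hat.lim.gmul_nm_r[OF sc(1) FD_cl[OF b], of p] A.hat.lim.gmul_nm_r[OF sc(2) FD_cl[OF a], of p] by simp
 qed
next
 fix r assume r: "r:[pr B]"
 have "dif A.Dh 0 (A.hs (\<sigma> (rstr A r)))=0[gr A.Dh 1]" using A.hat.lim.dif_rmap[OF rh_cl[OF FR_hom r]] by (simp only: A.rmap_hs std_frob_rstr[OF r])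
 thus "FD (rstr A r)=0[gr A.Dh 1]" by (intro FD_eqI) simp_all
next
 fix l m assume l: "l:[pmon A]"
 thus "A.hl l:[gr A.Dh 1]" by (rule A.hl_cl)
 show "FD (palpha A l)=gmul A.Dh 0 1 (A.hs (\<sigma> (palpha A l))) (A.hl l)" using l FD_pal by (cases l) (simp del: A_s(3) add: A_mon A_s(2))
 assume "m:[pmon A]"
 thus "A.hl (l *[pmon A]m)=A.hl l +[gr A.Dh 1]A.hl m" by (rule A.hl_mul[OF l])
qed (rule A.hl_base)

sublocale FE: hat_derivation B A R A.Dh "%a. A.hs (\<sigma> a)" FD A.hl p "%i. p_fil p (gr A.Dh i)" by (intro hat_derivation.intro hat_derivation_axioms.intro FD_der pf_filt A.hat.lim.gr_group Om_cmp order_refl)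

lemma FE_dif:
 assumes x: "x:[gr A.Dh i]"
 shows "dif A.Dh i (FE.hext i x)=p .[gr A.Dh (Suc i)] FE.hext (Suc i) (dif A.Dh i x)"
proof (rule A.hat_hom_eqI[OF A.hat.lim.gr_group Om_sep ah_comp[OF FE.hext_hom A.hat.lim.dif_hom] _ _ x])
 show "(%x. p .[gr A.Dh (Suc i)] FE.hext (Suc i) (dif A.Dh i x)) : ahom (gr A.Dh i) (gr A.Dh (Suc i))" by (rule ah_comp[OF ah_comp[OF A.hat.lim.dif_hom FE.hext_hom] A.hat.lim.gr.nm_ah])
 note hz = gpair.ah_0[OF gpairI[OF A.hat.lim.gr_group A.hat.lim.gr_group] FE.hext_hom]
 fix a w assume "a:[pr A]" "w : A.words i"
 thus "dif A.Dh i (FE.hext i (A.hc i (a, w)))=p .[gr A.Dh (Suc i)] FE.hext (Suc i) (dif A.Dh i (A.hc i (a, w)))"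
 proof (rule A.hat_ind[rotated 4])
  fix a assume a: "a:[pr A]"
  hence a': "a:[C.L]" by simp
  show "dif A.Dh 0 (FE.hext 0 (A.hs a))=p .[gr A.Dh (Suc 0)] FE.hext (Suc 0) (dif A.Dh 0 (A.hs a))" using FE.hext_0[OF a] FE.hext_d[OF a] FD_p[OF a'] A.hdf_dif[OF a] by simp
  \<comment> \<open>\<open>FD a\<close> is closed: \<open>d d = 0\<close> shows this after
    multiplication by \<open>p\<close>, and torsion-freeness cancels the factor.\<close>
  have "p .[gr A.Dh 2] dif A.Dh 1 (FD a)=dif A.Dh 1 (p .[gr A.Dh 1] FD a)" using A.hat.lim.dif_nm[OF FD_cl[OF a'], of p] by (simp add: numeral_2_eq_2)
  also have "\<dots>=0[gr A.Dh 2]" unfolding FD_p[OF a'] using A.hat.lim.dif_dif[OF hs_cl[OF sigma_cl[OF a']]] by (simp add: numeral_2_eq_2)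
  finally have "p .[gr A.Dh 2] dif A.Dh 1 (FD a)=p .[gr A.Dh 2] 0[gr A.Dh 2]" by simp
  hence "dif A.Dh 1 (FD a)=0[gr A.Dh 2]" by (rule A.hat.lim.gr.nm_inj[OF Om_tf, rotated 2]) (use A.hat.lim.dif_closed[OF FD_cl[OF a']] in \<open>simp_all add: numeral_2_eq_2\<close>)
  moreover have "dif A.Dh 1 (A.hdf a)=0[gr A.Dh 2]" using A.hat.lim.dif_dif[OF hs_cl[OF a']] A.hdf_dif[OF a] by (simp add: numeral_2_eq_2)
  ultimately show "dif A.Dh 1 (FE.hext 1 (A.hdf a))=p .[gr A.Dh (Suc 1)] FE.hext (Suc 1) (dif A.Dh 1 (A.hdf a))" using FE.hext_d[OF a] hz[of 2] by (simp add: numeral_2_eq_2)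
 next
  fix l assume l: "l:[pmon A]"
  show "dif A.Dh 1 (FE.hext 1 (A.hl l))=p .[gr A.Dh (Suc 1)] FE.hext (Suc 1) (dif A.Dh 1 (A.hl l))" using FE.hext_dlog[OF l] A.hl_dif[OF l] hz[of 2] by (simp add: numeral_2_eq_2)
 next
  fix i j x y
  assume x: "x:[gr A.Dh i]" and y: "y:[gr A.Dh j]"
   and dx: "dif A.Dh i (FE.hext i x)=p .[gr A.Dh (Suc i)] FE.hext (Suc i) (dif A.Dh i x)"
   and dy: "dif A.Dh j (FE.hext j y)=p .[gr A.Dh (Suc j)] FE.hext (Suc j) (dif A.Dh j y)"
  note c = A.hat.lim.dif_closed[OF x] A.hat.lim.dif_closed[OF y]
  note hc = ah_cl[OF FE.hext_hom x] ah_cl[OF FE.hext_hom y] ah_cl[OF FE.hext_hom c(1)] ah_cl[OF FE.hext_hom c(2)]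
  let ?G = "gr A.Dh (Suc (i + j))"
  interpret gp: gpair ?G ?G by unfold_locales
  have xy: "gmul A.Dh (Suc i) j (dif A.Dh i x) y : carrier ?G" "gmul A.Dh i (Suc j) x (dif A.Dh j y) : carrier ?G" using A.hat.lim.gmul_closed[OF x c(2)] A.hat.lim.gmul_closed[OF c(1) y] by simp_all
  have sg: "FE.hext (Suc (i + j)) (gsign i ?G z)=gsign i ?G (FE.hext (Suc (i + j)) z)" "p .[?G] gsign i ?G z=gsign i ?G (p .[?G] z)"
   if "z : carrier ?G" for z using gp.ah_neg[OF FE.hext_hom that] A.hat.lim.gr.nm_neg[OF that, of p] by (simp_all add: gsign_def)
  have 1: "FE.hext (Suc (i + j)) (dif A.Dh (i + j) (gmul A.Dh i j x y)) =
   gmul A.Dh (Suc i) j (FE.hext (Suc i) (dif A.Dh i x)) (FE.hext j y) +[?G]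
    gsign i ?G (gmul A.Dh i (Suc j) (FE.hext i x) (FE.hext (Suc j) (dif A.Dh j y)))" unfolding A.hat.lim.leibniz[OF x y] ah_add[OF FE.hext_hom xy(1) A.hat.lim.gsign_closed[OF xy(2)]] sg(1)[OF xy(2)] using FE.hext_gmul[OF c(1) y] FE.hext_gmul[OF x c(2)] by simp
  have gc: "gmul A.Dh (Suc i) j (FE.hext (Suc i) (dif A.Dh i x)) (FE.hext j y) : carrier ?G"
   "gmul A.Dh i (Suc j) (FE.hext i x) (FE.hext (Suc j) (dif A.Dh j y)) : carrier ?G" using A.hat.lim.gmul_closed[OF hc(3,2)] A.hat.lim.gmul_closed[OF hc(1,4)] by simp_all
  show "dif A.Dh (i + j) (FE.hext (i + j) (gmul A.Dh i j x y))=p .[?G] FE.hext (Suc (i + j)) (dif A.Dh (i + j) (gmul A.Dh i j x y))" unfolding 1 FE.hext_gmul[OF x y] A.hat.lim.leibniz[OF hc(1,2)] dx dy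
    A.hat.lim.gr.nm_dist[OF gc(1) A.hat.lim.gsign_closed[OF gc(2)]] sg(2)[OF gc(2)] using A.hat.lim.gmul_nm_l[OF hc(2,3), of p] A.hat.lim.gmul_nm_r[OF hc(1,4), of p] by simp
 qed
qed

lemma FE_rh: "FE.hext 0 : rhom (deg0 A.Dh) (deg0 A.Dh)" using FE.hext_gr ah_cl[OF FE.hext_hom] ah_add[OF FE.hext_hom] FE.hext_gmul[of _ 0 _ 0] by (intro rhI) (auto simp: grh_def)

lemma Om0_dn: assumes "x:[gr A.Dh 0]"
 obtains a b where "a:[C.L]" "b:[gr A.Dh 0]" "x=A.hs a +[gr A.Dh 0]p .[gr A.Dh 0] b"
proof -
 obtain g where g: "g:[gr A.om 0]" "x -[gr A.Dh 0]A.hat.\<tau> 0 g : mults p (gr A.Dh 0)" using A.hat.fil.lim_dn[of x 0 1] assms unfolding lim_fil_p[OF A.omega.gr_group] by auto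
 obtain a where a: "a:[C.L]" "g=A.sform a" using A.om_0_sj[OF g(1)] by (auto simp: A.fcl_cl)
 obtain b where b: "b:[gr A.Dh 0]" "x -[gr A.Dh 0]A.hs a=p .[gr A.Dh 0] b" using g(2) by (auto simp: mults_def a(2) A.hc_tau)
 show ?thesis using that[OF a(1) b(1)] A.hat.lim.gr.add_minus_cancel[OF hs_cl[OF a(1)] assms] b(2) by simp
qed

lemma FE_frob: "frobenius_lift p (deg0 A.Dh) (FE.hext 0)" unfolding frobenius_lift_def
proof (intro conjI ballI FE_rh)
 interpret dp: gpair "deg0 A.Dh" "deg0 A.Dh" by unfold_locales
 interpret gp: gpair C.L "deg0 A.Dh" by unfold_locales
 note h = rh_ah[OF FE_rh] and s = rh_ah[OF hs_hom]
 fix x assume "x:[deg0 A.Dh]"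
 then obtain a b where ab: "a:[C.L]" "b:[gr A.Dh 0]" "x=A.hs a +[gr A.Dh 0]p .[gr A.Dh 0] b" using Om0_dn[of x] by auto
 have "\<sigma> a -[C.L]a [^][C.L] p : mults p C.L" using std_frob_frob ab(1) by (simp add: frobenius_lift_def)
 from gp.ah_muls[OF s this]
 have 1: "FE.hext 0 (A.hs a) -[deg0 A.Dh]A.hs a [^][deg0 A.Dh] p : mults p (deg0 A.Dh)" using gp.ah_sub[OF s sigma_cl[OF ab(1)] C.Lr.nat_pow_closed[OF ab(1)], of p] rh_pow[OF hs_hom C.Lr.monoid_axioms ab(1), of p] FE.hext_0[of a] ab(1) by simp
 have pb: "p .[deg0 A.Dh] b : mults p (deg0 A.Dh)" using ab(2) by (intro A.hat.lim.deg0.muls_mem) simp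
 have "(p .[deg0 A.Dh] b) [^][deg0 A.Dh] p : mults p (deg0 A.Dh)"
 proof -
  obtain n where n: "p=Suc n" using p_pos gr0_implies_Suc by blast
  have "(p .[deg0 A.Dh] b) [^][deg0 A.Dh] Suc n=(p .[deg0 A.Dh] b) [^][deg0 A.Dh] n *[deg0 A.Dh](p .[deg0 A.Dh] b)" by (rule A.hat.lim.deg0.nat_pow_Suc)
  thus ?thesis unfolding n[symmetric] using ideal.I_l_closed[OF A.hat.lim.deg0.muls_idl pb A.hat.lim.deg0.nat_pow_closed[OF A.hat.lim.deg0.muls_car[OF pb]]] by (simp only:)
 qed
 from A.hat.lim.deg0.sub_sub[OF A.hat.lim.deg0.muls_sub dp.ah_muls[OF h pb] this]
 show "FE.hext 0 x -[deg0 A.Dh]x [^][deg0 A.Dh] p : mults p (deg0 A.Dh)" using A.hat.lim.deg0.frob_cg_add[OF prime_p h _ _ 1, of "p .[deg0 A.Dh] b"] ab hs_cl[OF ab(1)] by simp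
qed

text \<open>Restriction to the carriers makes the maps extensional, as \<open>is_log_frob\<close>
  demands so that uniqueness is equality of functions.\<close>

definition FO :: "nat => (nat => (nat => 'r mpoly set, nat multiset \<times> 'n) form set set) => nat => (nat => 'r mpoly set, nat multiset \<times> 'n) form set set" where
 "FO i=restrict (FE.hext i) (carrier (gr A.Dh i))"

lemma FO_eq: "x:[gr A.Dh i]==>FO i x=FE.hext i x" by (simp add: FO_def)

lemma FO_gr: "graded_ring_hom A.Dh A.Dh FO" unfolding grh_def
proof (intro conjI allI ballI)
 fix i show "FO i : ahom (gr A.Dh i) (gr A.Dh i)" by (rule ahI) (simp_all only: FO_eq ah_cl[OF FE.hext_hom] ah_add[OF FE.hext_hom] A.hat.lim.gr.a_closed)
qed (use FE.hext_gr A.hat.lim.gmul_closed A.hat.lim.gone_closed in \<open>simp_all add: FO_eq FE.hext_gmul grh_def del: A.hat.gr_lim\<close>)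

lemma FO_log_frob: "is_log_frob p B A \<sigma> FO" unfolding is_log_frob_def A.hat_eq Let_def
proof (intro conjI ballI allI FO_gr)
 fix i show "FO i : extensional (carrier (gr A.Dh i))" by (simp add: FO_def)
next
 fix a assume "a:[pr A]"
 thus "FO 0 (A.hs a)=A.hs (\<sigma> a)" using A.hs_cl[of a] FE.hext_0[of a] by (simp add: FO_eq)
next
 fix l assume l: "l:[pmon A]"
 show "FO 1 (A.hl l)=A.hl l" using A.hl_cl[OF l] FE.hext_dlog[OF l] by (simp add: FO_eq)
next
 fix x assume x: "x:[gr A.Dh 0]"
 note dx = A.hat.lim.dif_closed[OF x] and hx = ah_cl[OF FE.hext_hom x]
 obtain y where y: "y:[deg0 A.Dh]" "FE.hext 0 x -[deg0 A.Dh]x [^][deg0 A.Dh] p=p .[deg0 A.Dh] y" using frob_liftD[OF FE_frob, of x] x by (auto simp del: A.hat.gr_lim)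
 have y': "y:[gr A.Dh 0]" "p .[gr A.Dh 0] y=FE.hext 0 x -[gr A.Dh 0]x [^][deg0 A.Dh] p" using y by simp_all
 have xc: "x [^][deg0 A.Dh] (p - 1):[gr A.Dh 0]" using A.hat.lim.deg0.nat_pow_closed[of x "p - 1"] x by simp
 have gc: "gmul A.Dh 0 1 (x [^][deg0 A.Dh] (p - 1)) (dif A.Dh 0 x) +[gr A.Dh 1]dif A.Dh 0 y:[gr A.Dh 1]" using A.hat.lim.gr.a_closed[of "gmul A.Dh 0 1 (x [^][deg0 A.Dh] (p - 1)) (dif A.Dh 0 x)" 1 "dif A.Dh 0 y"]
   A.hat.lim.gmul_closed[OF xc dx] A.hat.lim.dif_closed[OF y'(1)] by simp
 have hd: "FE.hext 1 (dif A.Dh 0 x):[gr A.Dh 1]" using ah_cl[OF FE.hext_hom dx] by simp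
 have "FE.hext 1 (dif A.Dh 0 x)=gmul A.Dh 0 1 (x [^][deg0 A.Dh] (p - 1)) (dif A.Dh 0 x) +[gr A.Dh 1]dif A.Dh 0 y" using A.hat.lim.dif_frob_formula[OF p_pos x y'(1) hx y'(2)] FE_dif[OF x] by (intro A.hat.lim.gr.nm_inj[OF Om_tf hd gc]) simp
 thus "\<exists>y\<in>carrier (gr A.Dh 0). p .[deg0 A.Dh] y=FO 0 x -[deg0 A.Dh]x [^][deg0 A.Dh] p &
   FO 1 (dif A.Dh 0 x)=gmul A.Dh 0 1 (x [^][deg0 A.Dh] (p - 1)) (dif A.Dh 0 x) +[gr A.Dh 1]dif A.Dh 0 y" using y x dx by (intro bexI[OF _ y'(1)] conjI) (simp_all add: FO_eq del: A.hat.gr_lim)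
qed

text \<open>Multiplied by \<open>p\<close>, the prescribed value on \<open>d x\<close> is
  \<open>d sigma(x)\<close>, so every candidate takes the value \<open>FD\<close> there. Products
  and density determine the rest.\<close>

lemma FO_uniq: assumes "is_log_frob p B A \<sigma> G" shows "G=FO"
proof (rule ext)
 fix i
 note G = assms[unfolded is_log_frob_def A.hat_eq Let_def grh_def]
 have Gh: "G i : ahom (gr A.Dh i) (gr A.Dh i)" for i using G by blast
 have Fh: "FO i : ahom (gr A.Dh i) (gr A.Dh i)" for i using FO_gr unfolding grh_def by blast
 have "G i x=FO i x" if x: "x:[gr A.Dh i]" for x
 proof (rule A.hat_hom_eqI[OF A.hat.lim.gr_group Om_sep Gh Fh _ x])
  fix a w assume "a:[pr A]" "w : A.words i"
  thus "G i (A.hc i (a, w))=FO i (A.hc i (a, w))"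
  proof (rule A.hat_ind[rotated 4])
   fix a assume a: "a:[pr A]"
   hence a': "a:[C.L]" by simp
   have G0: "G 0 (A.hs a)=A.hs (\<sigma> a)" using G a by blast
   thus "G 0 (A.hs a)=FO 0 (A.hs a)" using A.hs_cl[OF a] FE.hext_0[OF a] by (simp add: FO_eq)
   obtain y where y: "y:[gr A.Dh 0]" "p .[deg0 A.Dh] y=G 0 (A.hs a) -[deg0 A.Dh]A.hs a [^][deg0 A.Dh] p"
    "G 1 (dif A.Dh 0 (A.hs a))=gmul A.Dh 0 1 (A.hs a [^][deg0 A.Dh] (p - 1)) (dif A.Dh 0 (A.hs a)) +[gr A.Dh 1]dif A.Dh 0 y" using G A.hs_cl[OF a] by blast
   have "p .[gr A.Dh 1] G 1 (dif A.Dh 0 (A.hs a))=dif A.Dh 0 (A.hs (\<sigma> a))" unfolding y(3) using y(2) G0 hs_cl[OF sigma_cl[OF a']] by (intro A.hat.lim.dif_frob_formula[OF p_pos hs_cl[OF a'] y(1)]) simp_all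
   moreover have "G 1 (dif A.Dh 0 (A.hs a)):[gr A.Dh 1]" using ah_cl[OF Gh[of 1]] A.hat.lim.dif_closed[OF hs_cl[OF a']] by simp
   ultimately have "FD a=G 1 (dif A.Dh 0 (A.hs a))" by (intro FD_eqI)
   thus "G 1 (A.hdf a)=FO 1 (A.hdf a)" using FE.hext_d[OF a] A.hdf_cl[OF a] A.hdf_dif[OF a] by (simp add: FO_eq)
  next
   fix l assume l: "l:[pmon A]"
   have "G 1 (A.hl l)=A.hl l" using G l by blast
   thus "G 1 (A.hl l)=FO 1 (A.hl l)" using FE.hext_dlog[OF l] A.hl_cl[OF l] FO_eq[of "A.hl l" 1] by simp
  next
   fix i j x y assume "x:[gr A.Dh i]" "y:[gr A.Dh j]" "G i x=FO i x" "G j y=FO j y"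
   thus "G (i + j) (gmul A.Dh i j x y)=FO (i + j) (gmul A.Dh i j x y)" using G FO_gr unfolding grh_def by simp
  qed
 qed
 thus "G i=FO i" using G FO_log_frob[unfolded is_log_frob_def A.hat_eq Let_def] by (intro extensionalityI[of _ "carrier (gr A.Dh i)"]) blast+
qed

lemma FO_the: "(THE F. is_log_frob p B A \<sigma> F)=FO" by (rule the_equality, rule FO_log_frob, rule FO_uniq)

section \<open>The completed complex as a special log Dieudonne algebra\<close>

abbreviation "Om \<equiv> Omega_std p B nm"

lemma O_s [simp]:
 "gr Om=gr A.Dh" "gmul Om=gmul A.Dh" "gone Om=gone A.Dh" "dif Om=dif A.Dh" "rmap Om=rmap A.Dh"
 "frob Om=FO" "lmon Om=pmon A" "lalpha Om l=A.hs (palpha A l)" "lnstr Om=nstr A" "dlog Om l=A.hl l" by (simp_all only: Omega_hat_def FO_the A.hat_eq dieu.extend_def dieu.fields_def cdga.extend_def log_dieu.fields_def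
   cdga.select_convs dieu.select_convs log_dieu.select_convs)

lemma O_deg0: "deg0 Om=deg0 A.Dh" by (simp add: deg0_def)

lemma O_dieu: "dieudonne_algebra R Om p FR"
proof (intro dieudonne_algebra.intro dieudonne_algebra_axioms.intro)
 show "strict_cdga R Om" using strict_dg_cg[of Om A.Dh R] A.hat.lim.strict_cdga_axioms by simp
 show "graded_ring_hom Om Om (frob Om)" using FO_gr by (simp add: grh_def)
 fix x i assume "x:[gr Om i]"
 thus "dif Om i (frob Om i x)=p .[gr Om (Suc i)] frob Om (Suc i) (dif Om i x)" using FE_dif[of x i] A.hat.lim.dif_closed[of x i] by (simp add: FO_eq del: A.hat.gr_lim)
next
 have "FO 0 : rhom (deg0 A.Dh) (deg0 A.Dh)" using FO_gr unfolding grh_def by (intro rhI) (auto simp: hom_def Pi_iff simp del: A.hat.gr_lim dest: spec[of _ 0] spec[of "%j. \<forall>x\<in>_. _ j x" 0])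
 thus "frobenius_lift p (deg0 Om) (frob Om 0)" using FE_frob by (simp add: frobenius_lift_def O_deg0 FO_eq del: A.hat.gr_lim)
next
 fix r assume r: "r:[R]"
 show "frob Om 0 (rmap Om r)=rmap Om (FR r)" using hs_cl[OF rstr_cl[OF r]] FE.hext_0[of "rstr A r"] rstr_cl[OF r] std_frob_rstr[OF r] by (simp add: FO_eq A.rmap_hs del: A_s(4))
qed

lemma O_tf: "dieu_torsion_free p Om" using Om_tf by (simp add: dieu_torsion_free_def del: A.hat.gr_lim)

lemma O_log: "log_dieudonne_algebra B Om p"
proof (intro log_dieudonne_algebra.intro log_dieudonne_algebra_axioms.intro O_dieu)
 have a: "palpha A : monoid_maps (pmon A) C.L" and n: "nstr A : monoid_maps (pmon B) (pmon A)" using A.al_A A.nstr_A by simp_all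
 show "Group.comm_monoid (lmon Om)" using A.mon_A by simp
 show "lalpha Om : monoid_maps (lmon Om) (deg0 Om)" using a rh_mul[OF hs_hom] rh_one[OF hs_hom] hs_cl unfolding mm_def hom_def Pi_iff O_deg0 O_s by (simp add: del: A.hat.gr_lim A_s(2-5))
 show "lnstr Om : monoid_maps (pmon B) (lmon Om)" using n by (simp only: O_s)
 show "dlog Om : monoid_maps (lmon Om) (add_monoid (gr Om 1))" using A.hl_cl A.hl_mul A.hl_base[of "1[pmon B]"] by (auto simp: mm_def hom_def simp del: A.hat.gr_lim)
 fix l assume l: "l:[lmon Om]"
 show "frob Om 1 (dlog Om l)=dlog Om l" using l A.hl_cl[of l] FE.hext_dlog[of l] by (simp add: FO_eq del: A.hat.gr_lim)
 show "dif Om 1 (dlog Om l)=0[gr Om 2]" using l A.hl_dif[of l] by simp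
 show "dif Om 0 (lalpha Om l)=gmul Om 0 1 (lalpha Om l) (dlog Om l)" using l A.hdf_log[of l] by simp
next
 fix n assume n: "n:[pmon B]"
 show "lalpha Om (lnstr Om n)=rmap Om (palpha B n)" using n by (simp add: A.rmap_hs)
 show "dlog Om (lnstr Om n)=0[gr Om 1]" using A.hl_base[OF n] by simp
qed

lemma O_special: "special p B Om" unfolding special_def
proof (intro exI[of _ "{v. set_mset v <= {..<snd nm}} \<times> {1[pmon B]}"] conjI ballI)
 show "submonoid ({v. set_mset v <= {..<snd nm}} \<times> {1[pmon B]}) (lmon Om)" by (rule submonoid.intro) auto
 show "bij_betw (%(l, n). l *[lmon Om]lnstr Om n) (({v. set_mset v <= {..<snd nm}} \<times> {1[pmon B]}) \<times> carrier (pmon B)) (carrier (lmon Om))" by (rule bij_betwI[where g = "%(v, n). ((v, 1[pmon B]), n)"]) auto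
 fix l assume "l : {v. set_mset v <= {..<snd nm}} \<times> {1[pmon B]}"
 then obtain v where v: "l=(v, 1[pmon B])" "set_mset v <= {..<snd nm}" by auto
 note a = al_cl[OF v(2) MB.one_closed]
 show "frob Om 0 (lalpha Om l)=lalpha Om l [^][deg0 Om] p" unfolding v O_s O_deg0 using FO_eq[OF hs_cl[OF a]] FE.hext_0[of "palpha A (v, 1[pmon B])"] a std_frob_Y[OF v(2)] rh_pow[OF hs_hom C.Lr.monoid_axioms a, of p] by (simp del: A_s(3))
qed

lemma O_DA: "Om : DA_log_s p B" using O_log O_tf O_special by (simp add: DA_log_s_def)

end

section \<open>Reduction modulo the radical\<close>

context cring
begin

lemma frob_pow_add:
 assumes p: "prime p" and x: "x:[R]" "y:[R]"
 shows "(x \<oplus> y) [^] (p ^ k) \<ominus> (x [^] (p ^ k) \<oplus> y [^] (p ^ k)) : mults p R"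
proof (induction k)
 case 0
 thus ?case using x sub_zero[OF muls_sub] by (simp add: r_neg minus_eq)
next
 case (Suc k)
 let ?a = "(x \<oplus> y) [^] (p ^ k)" and ?b = "x [^] (p ^ k)" and ?c = "y [^] (p ^ k)"
 have c: "?a:[R]" "?b:[R]" "?c:[R]" using x by auto
 obtain z where z: "z:[R]" "(?b \<oplus> ?c) [^] p=?b [^] p \<oplus> ?c [^] p \<oplus> [p] \<cdot> (?c \<otimes> z)" using prime_binomial[OF p c(2,3)] by blast
 have "(?b \<oplus> ?c) [^] p \<ominus> (?b [^] p \<oplus> ?c [^] p)=[p] \<cdot> (?c \<otimes> z)" unfolding z(2) using c z(1) by (simp add: add_diff_l)
 hence "(?b \<oplus> ?c) [^] p \<ominus> (?b [^] p \<oplus> ?c [^] p) : mults p R" using c z(1) by (simp add: muls_mem)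
 hence "?a [^] p \<ominus> (?b [^] p \<oplus> ?c [^] p) : mults p R" using sub_sub_tr[OF muls_sub _ _ _ idl_pow_cg[OF muls_idl c(1) _ Suc]] c by simp
 thus ?case using x by (simp add: nat_pow_pow mult.commute)
qed

lemma rad_iff: assumes p: "prime p"
 shows "x : rad p R \<longleftrightarrow> x:[R] & (\<exists>k. x [^] (p ^ k) : mults p R)"
proof -
 have "x [^] (p ^ n) : mults p R" if "x:[R]" "x [^] n : mults p R" for n :: nat
 proof -
  have "n <= p ^ n" using power_gt_expt[of p n] prime_gt_1_nat[OF p] by simp
  then obtain l where l: "p ^ n=l + n" by (metis add.commute le_Suc_ex)
  show ?thesis using ideal.I_l_closed[OF muls_idl that(2)] that(1) by (simp add: l flip: nat_pow_mult)
 qed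
 thus ?thesis by (auto simp: rad_def)
qed

lemma rad_car: "x : rad p R==>x:[R]" by (simp add: rad_def)

lemma rad_mul: "r:[R]==>x : rad p R==>r \<otimes> x : rad p R"
proof -
 assume r: "r:[R]" and "x : rad p R"
 then obtain n :: nat where x: "x:[R]" "x [^] n : mults p R" by (auto simp: rad_def)
 hence "(r \<otimes> x) [^] n : mults p R" using r ideal.I_l_closed[OF muls_idl x(2), of "r [^] n"] by (simp add: nat_pow_distrib)
 thus ?thesis using r x(1) by (auto simp: rad_def)
qed

text \<open>Exponents may be taken to be powers of \<open>p\<close>, and such powers are additive
  modulo \<open>p\<close>; the exponent \<open>p^(j + k)\<close> serves both summands.\<close>

lemma rad_idl: assumes p: "prime p" shows "ideal (rad p R) R"
proof (rule idealI[OF ring_axioms])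
 have neg: "\<ominus> x : rad p R" if "x : rad p R" for x using rad_mul[OF a_inv_closed[OF one_closed] that] rad_car[OF that] by (simp add: l_minus)
 have add: "x \<oplus> y : rad p R" if xy: "x : rad p R" "y : rad p R" for x y
 proof -
  have up: "z [^] (p ^ (l + k)) : mults p R" if "z:[R]" "z [^] (p ^ k) : mults p R" for z k l
  proof -
   have "p ^ k <= p ^ (l + k)" using prime_gt_0_nat[OF p] by (simp add: power_increasing)
   then obtain m where m: "p ^ (l + k)=m + p ^ k" by (metis add.commute le_Suc_ex)
   show ?thesis using ideal.I_l_closed[OF muls_idl that(2)] that(1) by (simp add: m flip: nat_pow_mult)
  qed
  obtain j k where jk: "x [^] (p ^ j) : mults p R" "y [^] (p ^ k) : mults p R" using xy by (auto simp: rad_iff[OF p])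
  have c: "x:[R]" "y:[R]" using xy by (auto simp: rad_car)
  have "x [^] (p ^ (j + k)) \<oplus> y [^] (p ^ (j + k)) : mults p R" using up[OF c(1) jk(1), of k] up[OF c(2) jk(2), of j] sub_plus[OF muls_sub] by (simp add: add.commute)
  hence "(x \<oplus> y) [^] (p ^ (j + k)) : mults p R" using sub_mem_cg[OF muls_sub _ _ frob_pow_add[OF p c, of "j + k"]] c by simp
  thus ?thesis using c by (auto simp: rad_iff[OF p])
 qed
 have "asub (rad p R) R"
 proof (rule subgroupI)
  have "\<zero> [^] (1::nat) : mults p R" using sub_zero[OF muls_sub] by simp
  thus "\<zero> : rad p R" unfolding rad_def by blast
 qed (auto simp: rad_car minus_eq intro!: add neg)
 thus "subgroup (rad p R) (add_monoid R)" by (rule additive_subgroup.a_subgroup)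
 fix a x assume "a : rad p R" "x:[R]"
 thus "x \<otimes> a : rad p R" "a \<otimes> x : rad p R" using rad_mul[of x a p] rad_car[of a p] by (simp_all add: m_comm[of a x])
qed

lemma rad_sub: "prime p==>asub (rad p R) R" by (rule ideal.axioms(1)[OF rad_idl])
lemma red_cring: "prime p==>cring (rdr p R)" unfolding red_ring_def by (rule ideal.quotient_is_cring[OF rad_idl cring_axioms])
lemma red_hom: "prime p==>rcl p R : rhom R (rdr p R)" using ideal.rcos_ring_hom[OF rad_idl] by (simp add: red_class_def[abs_def] red_ring_def)
lemma red_sj: "X:[rdr p R] \<longleftrightarrow> (\<exists>x\<in>carrier R. X=rcl p R x)" by (simp add: red_ring_def red_class_def quot_car)
lemma red_eq_iff: "prime p==>x:[R]==>y:[R]==>rcl p R x=rcl p R y \<longleftrightarrow> x \<ominus> y : rad p R" by (simp add: red_class_def cos_eq_iff[OF rad_sub])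

end

lemma rh_rad:
 assumes "cring A" "cring E" "h : rhom A E" "x : rad p A" shows "h x : rad p E"
proof -
 interpret A: cring A by fact
 interpret E: cring E by fact
 interpret gp: gpair A E by unfold_locales
 obtain n :: nat where "x:[A]" "x [^][A] n : mults p A" using assms(4) by (auto simp: rad_def)
 thus ?thesis using gp.ah_muls[OF rh_ah[OF assms(3)]] rh_pow[OF assms(3) A.monoid_axioms] rh_cl[OF assms(3)] unfolding rad_def by (metis (mono_tags, lifting) mem_Collect_eq)
qed

lemma (in abelian_group) finsum_sub:
 assumes "asub H G" shows "finite S==>f ` S <= H==>finsum G f S : H"
proof (induction S rule: finite_induct)
 case (insert x S)
 have "f : insert x S \<rightarrow> carrier G" using insert.prems additive_subgroup.a_Hcarr[OF assms] by auto
 thus ?case using insert sub_plus[OF assms] by simp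
qed (simp add: sub_zero[OF assms])

lemma cos_map_red:
 assumes "prime p" "cring A" "cring E" "h : rhom A E" "x:[A]"
 shows "coset_map E (rad p E) h (rcl p A x)=rcl p E (h x)"
proof -
 interpret A: cring A by fact
 interpret E: cring E by fact
 interpret gp: gpair A E by unfold_locales
 note h = assms(4)
 show ?thesis unfolding red_class_def
 proof (rule A.cos_map_cos[OF A.rad_sub[OF assms(1)] assms(5)])
  fix z assume "z:[A]" "z -[A]x : rad p A"
  thus "rad p E +>[E] h z=rad p E +>[E] h x" using rh_rad[OF assms(2-4), of "z -[A]x" p] gp.ah_sub[OF rh_ah[OF h]] assms(5) rh_cl[OF h] by (simp add: E.cos_eq_iff[OF E.rad_sub[OF assms(1)]])
 qed
qed

context mpolys
begin

lemma cmap: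
 assumes "cring S" and \<rho>: "\<rho> : rhom R S"
 shows cmap_hom: "(%f M. \<rho> (f M)) : rhom P (mpr S nm)"
  and cmap_mon: "c:[R]==>(%N. \<rho> (mnm c M N))=mpoly_monom S (\<rho> c) M"
  and cmap_sj: "(!!s. s:[S]==>\<exists>c\<in>carrier R. s=\<rho> c)==>g:[mpr S nm]==>\<exists>f\<in>carrier P. (%M. \<rho> (f M))=g"
proof -
 interpret S: cring S by fact
 interpret S: mpolys S nm by unfold_locales
 interpret gp: gpair R S by unfold_locales
 have r0: "\<rho> 0[R]=0[S]" by (rule gp.ah_0[OF rh_ah[OF \<rho>]])
 show m: "(%N. \<rho> (mnm c M N))=mpoly_monom S (\<rho> c) M" for c M by (auto simp: mpoly_monom_def r0)
 show "(%f M. \<rho> (f M)) : rhom P S.P"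
 proof (rule P_rhI[OF S.PR.ring_axioms])
  show "(%f M. \<rho> (f M)) : ahom P S.P"
  proof (rule ahI)
   fix f assume f: "f:[P]"
   have "{M. \<rho> (f M) ~= 0[S]} <= {M. f M ~= 0[R]}" using r0 by auto
   thus "(%M. \<rho> (f M)):[S.P]" using f rh_cl[OF \<rho>] finite_subset unfolding P_car S.P_car by blast
   fix g assume "g:[P]"
   thus "(%M. \<rho> ((f +[P]g) M))=(%M. \<rho> (f M)) +[S.P](%M. \<rho> (g M))" using f by (simp add: rh_add[OF \<rho>] P_coeff)
  qed
  show "(%M. \<rho> (1[P] M))=1[S.P]" by (simp add: m rh_one[OF \<rho>])
 qed (simp add: m S.mon_mul rh_mul[OF \<rho>] rh_cl[OF \<rho>])
 assume su: "!!s. s:[S]==>\<exists>c\<in>carrier R. s=\<rho> c" and g: "g:[S.P]"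
 \<comment> \<open>Zero coefficients are lifted to zero, so the support stays finite.\<close>
 define f where "f M=(if g M=0[S] then 0[R] else SOME c. c:[R] & g M=\<rho> c)" for M
 have f: "f M:[R] & g M=\<rho> (f M)" for M
 proof (cases "g M=0[S]")
  case False
  have "\<exists>c. c:[R] & g M=\<rho> c" using su[OF S.P_coeff[OF g]] by blast
  from someI_ex[OF this] show ?thesis using False by (simp add: f_def)
 qed (simp add: f_def r0)
 have "{M. f M ~= 0[R]} <= {M. g M ~= 0[S]}" by (auto simp: f_def)
 hence "f:[P]" using g f finite_subset unfolding P_car S.P_car by blast
 thus "\<exists>f\<in>carrier P. (%M. \<rho> (f M))=g" using f by (intro bexI[of _ f]) auto
qed

lemma P_coeff_sub:
 assumes J: "asub J P" and m: "!!c M. c : I==>set_mset M <= vars nm==>mnm c M : J"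
  and f: "f:[P]" and I: "!!M. f M : I"
 shows "f : J"
proof -
 have id: "(%f. f) : ahom P P" by (rule ahI) (simp_all del: P_s)
 have "mp_lin P (%M c. mnm c M) f=f" by (rule P_ah_eqI[OF P_grp mp_lin_hom[OF P_grp mon_ah] id _ f]) (simp_all add: mp_lin_mon[OF P_grp mon_ah])
 moreover have "mp_lin P (%M c. mnm c M) f : J" unfolding mp_lin_def using f m[OF I] by (intro Pg.finsum_sub[OF J]) (auto simp: P_car)
 ultimately show ?thesis by simp
qed

end

section \<open>The saturated complex of a free algebra\<close>

lemma dieu_cg:
 assumes "gr A'=gr A" "gmul A'=gmul A" "gone A'=gone A" "dif A'=dif A" "rmap A'=rmap A" "frob A'=frob A"
 shows "dieudonne_algebra R A' p FR \<longleftrightarrow> dieudonne_algebra R A p FR"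
  and "dieu_torsion_free p A' \<longleftrightarrow> dieu_torsion_free p A" and "saturated p A' \<longleftrightarrow> saturated p A"
  and "strict p A' \<longleftrightarrow> strict p A"
proof -
 have V: "ver p A'=ver p A" by (simp add: ver_def fun_eq_iff assms)
 have d: "deg0 A'=deg0 A" by (simp add: deg0_def assms)
 have VF: "V_fil p A'=V_fil p A" by (intro ext) (simp only: V_fil_def assms V)
 show "dieudonne_algebra R A' p FR \<longleftrightarrow> dieudonne_algebra R A p FR" by (simp add: dieudonne_algebra_def dieudonne_algebra_axioms_def strict_dg_cg[OF assms(1-5)] assms d grh_def)
 show tf: "dieu_torsion_free p A' \<longleftrightarrow> dieu_torsion_free p A" by (simp add: dieu_torsion_free_def assms)
 show sat: "saturated p A' \<longleftrightarrow> saturated p A" by (simp add: saturated_def tf assms)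
 show "strict p A' \<longleftrightarrow> strict p A" by (simp add: strict_def sat assms VF)
qed

context std_poly
begin

sublocale OD: tfd R Om p FR by (intro tfd.intro tfd_axioms.intro O_dieu O_tf p_pos)

sublocale OS: satd R OD.T p FR by (intro satd.intro tfd.intro tfd_axioms.intro
   satd_axioms.intro OD.sat_dieu OD.sat_tf OD.sat_saturated p_pos prime_p)

abbreviation "Wo \<equiv> W_obj p B nm"
abbreviation "u \<equiv> W_unit p B nm"

lemma Wo_s:
 "gr Wo=gr OS.W" "gmul Wo=gmul OS.W" "gone Wo=gone OS.W" "dif Wo=dif OS.W" "rmap Wo=rmap OS.W" "frob Wo=frob OS.W"
 "lmon Wo=pmon A" "lalpha Wo l=u 0 (lalpha Om l)" "lnstr Wo=nstr A" "dlog Wo l=u 1 (dlog Om l)" by (simp_all add: W_obj_def W_unit_def WSat_def dieu.extend_def log_dieu.fields_def del: OS.W_s One_nat_def)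

lemmas Wo_cg = dieu_cg[OF Wo_s(1-6)]

sublocale E: strd R Wo p FR by (intro strd.intro satd.intro tfd.intro tfd_axioms.intro
   satd_axioms.intro strd_axioms.intro p_pos prime_p)
  (simp_all add: Wo_cg OS.W_dieudonne OS.W_tf OS.W_saturated OS.W_strict)

lemma Wo_hom_iff: "dieu_hom R Wo X g \<longleftrightarrow> dieu_hom R OS.W X g" "dieu_hom R Y Wo h \<longleftrightarrow> dieu_hom R Y OS.W h" by (simp_all only: dieu_hom_def grh_def Wo_s)
lemma u_hom: "dieu_hom R Om Wo u" using dieu_hom_comp[OF OD.sat_unit OS.W_unit] unfolding Wo_hom_iff W_unit_def by (simp add: wsat_unit_def[abs_def])

lemmas u = dieu_homD[OF u_hom, unfolded O_s]
lemmas u_cl = ah_cl[OF u(1)]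
lemma u_rh: "u 0 : rhom (deg0 A.Dh) (deg0 Wo)" using dieu_hom_ring[OF u_hom] by (simp only: O_deg0)

sublocale OL: log_dieudonne_algebra B Om p by (rule O_log)

lemma Wo_log: "log_dieudonne_algebra B Wo p"
proof (intro log_dieudonne_algebra.intro log_dieudonne_algebra_axioms.intro E.dieudonne_algebra_axioms)
 note u' = dieu_homD[OF u_hom]
 interpret gp: gpair "gr Om i" "gr Wo j" for i j by unfold_locales
 have al: "lalpha Om l:[gr Om 0]" "dlog Om l:[gr Om 1]" if "l:[lmon Om]" for l using OL.lalpha OL.dlog that by (auto simp only: mm_def hom_def Pi_iff deg0_s mem_Collect_eq partial_object.select_convs)
 have lm: "lmon Wo=lmon Om" "lnstr Wo=lnstr Om" by (simp_all only: Wo_s O_s)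
 show "Group.comm_monoid (lmon Wo)" "lnstr Wo : monoid_maps (pmon B) (lmon Wo)" unfolding lm by (rule OL.lmon, rule OL.lnstr)
 have h: "u 0 : rhom (deg0 Om) (deg0 Wo)" by (rule dieu_hom_ring[OF u_hom])
 show "lalpha Wo : monoid_maps (lmon Wo) (deg0 Wo)" using OL.lalpha rh_mul[OF h] rh_one[OF h] rh_cl[OF h] unfolding mm_def hom_def Pi_iff lm Wo_s(8) by (simp del: O_s OS.W_s A_s deg0_s)
 show "dlog Wo : monoid_maps (lmon Wo) (add_monoid (gr Wo 1))" using OL.dlog u'(1)[of 1] gp.ah_0[OF u'(1), of 1] unfolding mm_def hom_def Pi_iff lm Wo_s(10) by (simp del: O_s OS.W_s A_s One_nat_def)
 fix l assume "l:[lmon Wo]"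
 hence l: "l:[lmon Om]" by (simp only: lm)
 show "frob Wo 1 (dlog Wo l)=dlog Wo l" unfolding Wo_s(10) u'(5)[OF al(2)[OF l], symmetric] OL.frob_dlog[OF l] ..
 show "dif Wo 1 (dlog Wo l)=0[gr Wo 2]" using u'(4)[OF al(2)[OF l]] OL.dif_dlog[OF l] gp.ah_0[OF u'(1), of 2] unfolding Wo_s(10) by (simp only: numeral_2_eq_2 One_nat_def)
 show "dif Wo 0 (lalpha Wo l)=gmul Wo 0 1 (lalpha Wo l) (dlog Wo l)" using u'(4)[OF al(1)[OF l]] u'(2)[OF al[OF l]] OL.dif_lalpha[OF l] unfolding Wo_s(8,10) by (simp only: One_nat_def add_0)
next
 fix n assume n: "n:[pmon B]"
 have lm: "lnstr Wo=lnstr Om" by (simp only: Wo_s O_s)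
 show "lalpha Wo (lnstr Wo n)=rmap Wo (palpha B n)" unfolding Wo_s(8) lm OL.lalpha_lnstr[OF n] by (rule dieu_homD(6)[OF u_hom al_B_cl[OF n]])
 interpret gp: gpair "gr Om 1" "gr Wo 1" by unfold_locales
 show "dlog Wo (lnstr Wo n)=0[gr Wo 1]" unfolding Wo_s(10) lm OL.dlog_lnstr[OF n] by (rule gp.ah_0[OF dieu_homD(1)[OF u_hom]])
qed

sublocale WL: log_dieudonne_algebra B Wo p by (rule Wo_log)

lemma Wo_special: "special p B Wo"
proof -
 obtain L where L: "submonoid L (lmon Om)" "\<forall>l\<in>L. frob Om 0 (lalpha Om l)=lalpha Om l [^][deg0 Om] p"
  "bij_betw (%(l, n). l *[lmon Om]lnstr Om n) (L \<times> carrier (pmon B)) (carrier (lmon Om))" using O_special unfolding special_def by blast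
 have lm: "lmon Wo=lmon Om" "lnstr Wo=lnstr Om" by (simp_all only: Wo_s O_s)
 have "frob Wo 0 (lalpha Wo l)=lalpha Wo l [^][deg0 Wo] p" if "l : L" for l
 proof -
  have "l:[lmon Om]" using that submonoid.subset[OF L(1)] by blast
  hence a: "lalpha Om l:[deg0 Om]" using OL.lalpha by (auto simp only: mm_def hom_def Pi_iff mem_Collect_eq)
  have "u 0 (frob Om 0 (lalpha Om l))=u 0 (lalpha Om l) [^][deg0 Wo] p" using that L(2) rh_pow[OF dieu_hom_ring[OF u_hom] OD.deg0.monoid_axioms a, of p] by simp
  thus ?thesis using dieu_homD(5)[OF u_hom, of "lalpha Om l" 0] a by (simp only: Wo_s(8) deg0_s)
 qed
 thus ?thesis using L unfolding special_def lm by blast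
qed

lemma Wo_DA: "Wo : DA_log_s_str p B" using Wo_log E.tf Wo_special E.strict by (simp add: DA_log_s_str_def DA_log_s_def)

lemma u_log: "log_dieu_hom p B Om Wo u (%l. l)" unfolding log_dieu_hom_def
proof (intro conjI u_hom ballI)
 show "(%l. l) : monoid_maps (lmon Om) (lmon Wo)" by (auto simp only: Wo_s O_s mm_def hom_def Pi_iff mem_Collect_eq)
qed (simp_all only: Wo_s O_s)

text \<open>The unit in degree zero, as a ring map on the completed polynomial ring.\<close>

definition q :: "(nat => 'r mpoly set) => nat => (nat \<times> (nat => (nat => 'r mpoly set, nat multiset \<times> 'n) form set set)) set set" where
 "q x=u 0 (A.hs x)"

lemma q_hom: "q : rhom C.L (deg0 Wo)" using ring_hom_trans[OF hs_hom u_rh] by (simp add: q_def[abs_def] comp_def)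
lemma Wo_cring: "cring (deg0 Wo)" by (rule E.deg0_cring)

section \<open>Reduction of the unit in degree zero\<close>

lemma mon_rad: assumes "c : rad p R" "set_mset M <= vars nm" shows "mnm c M : rad p P"
proof -
 obtain n :: nat where n: "c:[R]" "c [^][R] n : mults p R" using assms(1) by (auto simp: rad_def)
 have s: "set_mset (repeat_mset n M) <= vars nm" using assms(2) by (cases "n=0") (auto simp: set_repeat_mset)
 have "mnm c M [^][P] n : mults p P" using gpair.ah_muls[OF gpairI[OF R.abelian_group_axioms P_grp] mon_ah[OF s] n(2)] mon_pow[OF n(1) assms(2)] by simp
 thus ?thesis using mon_cl[OF n(1) assms(2)] by (auto simp: rad_def)
qed

abbreviation "redP h \<equiv> (%M. rcl p R (h M))"

text \<open>A polynomial whose coefficients lie in the radical is a sum of monomials in the radical,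
  hence lies in it. So the set in \<open>std_ident\<close> is a singleton and
  \<open>the_elem\<close> returns its member.\<close>

lemma redP_eq: assumes h: "h:[P]" "h':[P]" and eq: "redP h=redP h'"
 shows "rcl p C.L (\<tau> h)=rcl p C.L (\<tau> h')"
proof -
 have "(h -[P]h') M : rad p R" for M using fun_cong[OF eq, of M] P_coeff[OF h(1), of M] P_coeff[OF h(2), of M] h by (simp add: P_sub R.red_eq_iff[OF prime_p])
 hence "h -[P]h' : rad p P" using P_coeff_sub[OF PR.rad_sub[OF prime_p] mon_rad] h by simp
 from rh_rad[OF P_cring C.L_cring tau_rh this] show ?thesis using h by (simp add: C.Lr.red_eq_iff[OF prime_p] tau_cl gpair.ah_sub[OF gpairI[OF P_grp C.lim_grp] C.to_lim_hom])
qed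

lemma std_ident: assumes "h:[P]" shows "std_ident p B nm (redP h)=rcl p C.L (\<tau> h)"
proof -
 have "(%h. rcl p C.L (\<tau> h)) ` {h' : carrier P. redP h'=redP h}={rcl p C.L (\<tau> h)}" using assms redP_eq[OF _ assms] by blast
 thus ?thesis by (simp add: std_ident_def lpoly_obj_def Let_def)
qed

lemma e_ring: "h:[P]==>e_ring p B nm (redP h)=rcl p (deg0 Wo) (q (\<tau> h))" using cos_map_red[OF prime_p C.L_cring Wo_cring q_hom tau_cl] by (simp add: e_ring_def std_ident q_def[abs_def])

abbreviation "P0 \<equiv> mpr (rdr p R) nm"

lemma redP_hom: "(%h. redP h) : rhom P P0" by (rule cmap_hom[OF R.red_cring[OF prime_p] R.red_hom[OF prime_p]])
lemma redP_sj: assumes "g:[P0]" obtains h where "h:[P]" "g=redP h" using cmap_sj[OF R.red_cring[OF prime_p] R.red_hom[OF prime_p] _ assms] R.red_sj by blast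
lemma redP_mon: "c:[R]==>redP (mnm c M)=mpoly_monom (rdr p R) (rcl p R c) M" by (rule cmap_mon[OF R.red_cring[OF prime_p] R.red_hom[OF prime_p]])

lemma e_rh: "e_ring p B nm : rhom P0 (rdr p (deg0 Wo))"
proof -
 interpret W: cring "deg0 Wo" by (rule Wo_cring)
 define r where "r h=rcl p (deg0 Wo) (q (\<tau> h))" for h
 have r: "r : rhom P (rdr p (deg0 Wo))" using ring_hom_trans[OF ring_hom_trans[OF tau_rh q_hom] E.deg0.red_hom[OF prime_p]] by (simp add: r_def[abs_def] comp_def)
 have e: "e_ring p B nm (redP h)=r h" if "h:[P]" for h using e_ring[OF that] by (simp add: r_def)
 show ?thesis
 proof (rule rhI)
  show "e_ring p B nm 1[P0]=1[rdr p (deg0 Wo)]" using e[of "1[P]"] rh_one[OF redP_hom] rh_one[OF r] by simp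
  fix x y assume x: "x:[P0]" and y: "y:[P0]"
  obtain h where h: "h:[P]" "x=redP h" using redP_sj[OF x] .
  obtain h' where h': "h':[P]" "y=redP h'" using redP_sj[OF y] .
  show "e_ring p B nm x:[rdr p (deg0 Wo)]" using rh_cl[OF r h(1)] e[OF h(1)] h(2) by simp
  show "e_ring p B nm (x *[P0]y)=e_ring p B nm x *[rdr p (deg0 Wo)]e_ring p B nm y" unfolding h(2) h'(2) rh_mul[OF redP_hom h(1) h'(1), symmetric] e[OF PR.m_closed[OF h(1) h'(1)]] e[OF h(1)] e[OF h'(1)] by (rule rh_mul[OF r h(1) h'(1)])
  show "e_ring p B nm (x +[P0]y)=e_ring p B nm x +[rdr p (deg0 Wo)]e_ring p B nm y" unfolding h(2) h'(2) rh_add[OF redP_hom h(1) h'(1), symmetric] e[OF Pg.a_closed[OF h(1) h'(1)]] e[OF h(1)] e[OF h'(1)] by (rule rh_add[OF r h(1) h'(1)])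
 qed
qed

lemma e_pl: "prelog_hom (lob (base_red p B) nm) (red_prelog p Wo) (e_ring p B nm) (%l. l)" unfolding prelog_hom_def
proof (intro conjI ballI)
 show "e_ring p B nm : rhom (pr (lob (base_red p B) nm)) (pr (red_prelog p Wo))" using e_rh by (simp add: lpoly_obj_def base_red_def red_prelog_def)
 show "(%l. l) : monoid_maps (pmon (lob (base_red p B) nm)) (pmon (red_prelog p Wo))" by (simp add: lpoly_obj_def base_red_def red_prelog_def Wo_s mm_def hom_def)
 fix l assume "l:[pmon (lob (base_red p B) nm)]"
 then obtain v n where l: "l=(v, n)" "set_mset v <= {..<snd nm}" "n:[pmon B]" by (auto simp: lpoly_obj_def base_red_def)
 show "e_ring p B nm (palpha (lob (base_red p B) nm) l)=palpha (red_prelog p Wo) l" using e_ring[OF Y_mon_cl[OF al_B_cl[OF l(3)] l(2)]] l by (simp add: lpoly_obj_def base_red_def red_prelog_def redP_mon Wo_s(8) q_def)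
qed

end

section \<open>Lifting morphisms\<close>

text \<open>Multiplicativity of the continuous extension follows by density, in each factor
  separately.\<close>

lemma (in cring_c) lim_ext_rh:
 assumes S: "cring S" and Fil: "filg S FilS" "lim_complete S FilS" "!!r. mults (p ^ r) S <= FilS r"
  and \<phi>: "\<phi> : rhom G S"
 defines "e \<equiv> lim_ext G (p_fil p G) S FilS \<phi>"
 shows "e : rhom L S" and "x:[G]==>e (to_lim G (p_fil p G) x)=\<phi> x"
proof -
 interpret S: cring S by fact
 interpret gp: gpair G S by unfold_locales
 interpret fm: film G "p_fil p G" S FilS \<phi> using gp.ah_muls[OF rh_ah[OF \<phi>]] Fil(3) by (intro film.intro film_axioms.intro filg_axioms Fil rh_ah[OF \<phi>]) blast
 have sep: "p_sep p S" unfolding p_sep_def using filg.cmp_sep[OF Fil(1,2)] Fil(3) by blast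
 note eh = fm.ext_hom[folded e_def]
 show et: "e (to_lim G (p_fil p G) x)=\<phi> x" if "x:[G]" for x using fm.ext_to_lim[OF that] by (simp add: e_def)
 have m: "y:[S]==>(%x. x *[S]y) : ahom S S" "y:[S]==>(%x. y *[S]x) : ahom S S" for y by (rule ahI; simp add: S.l_distr S.r_distr)+
 have l: "y:[L]==>(%x. x *[L]y) : ahom L L" "y:[L]==>(%x. y *[L]x) : ahom L L" for y by (rule ahI; simp add: Lr.l_distr Lr.r_distr)+
 note ag = abelian_group_axioms S.abelian_group_axioms sep
 have t: "to_lim G (p_fil p G) x:[L]" if "x:[G]" for x using ah_cl[OF to_lim_hom that] .
 have 1: "e (x *[L]to_lim G (p_fil p G) z)=e x *[S]e (to_lim G (p_fil p G) z)" if x: "x:[L]" and z: "z:[G]" for x z by (rule lim_p_hom_eqI[OF ag ah_comp[OF l(1)[OF t[OF z]] eh] ah_comp[OF eh m(1)[OF ah_cl[OF eh t[OF z]]]] _ x])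
   (use z in \<open>simp add: et rh_mul[OF \<phi>] flip: rh_mul[OF to_lim_rh]\<close>)
 show "e : rhom L S"
 proof (rule rhI)
  fix x y assume x: "x:[L]" and y: "y:[L]"
  show "e x:[S]" "e (x +[L]y)=e x +[S]e y" using ah_cl[OF eh x] ah_add[OF eh x y] .
  show "e (x *[L]y)=e x *[S]e y" by (rule lim_p_hom_eqI[OF ag ah_comp[OF l(2)[OF x] eh] ah_comp[OF eh m(2)[OF ah_cl[OF eh x]]] 1[OF x] y])
 next
  show "e 1[L]=1[S]" using et[OF one_closed] rh_one[OF to_lim_rh] rh_one[OF \<phi>] by simp
 qed
qed

lemma deg0_lim_cmp: "lim_complete (deg0 A) Fil \<longleftrightarrow> lim_complete (gr A 0) Fil" unfolding lim_complete_def to_lim_def[abs_def] lim_ring_def FactRing_def A_RCOSETS_def a_r_coset_def add_mon_deg0 by simp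

context std_poly
begin

lemma q_rstr: "r:[R]==>q (rstr A r)=rmap Wo r" using dieu_homD(6)[OF u_hom, of r] by (simp only: q_def O_s A.rmap_hs)
lemma q_sigma: assumes a: "a:[C.L]" shows "q (\<sigma> a)=E.F 0 (q a)" using dieu_homD(5)[OF u_hom, of "A.hs a" 0] hs_cl[OF a] FO_eq[OF hs_cl[OF a]] FE.hext_0[of a] a by (simp add: q_def del: A.hat.gr_lim)
lemma q_al: "lalpha Wo l=q (palpha A l)" by (simp only: Wo_s O_s q_def)

text \<open>\<open>sigma\<close> raises \<open>Y^v\<close> to the \<open>p\<close>-th power, and
  \<open>alpha_N1\<close> says the same for the base factor. So these values of \<open>alpha\<close>
  are their own Teichmueller lifts.\<close>

lemma te_al: assumes v: "set_mset v <= {..<snd nm}" and n: "n : N1" shows "E.teich (lalpha Wo (v, n))"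
proof -
 have nc: "n:[pmon B]" using submonoid.subset[OF N1] n by blast
 note a = al_cl[OF v MB.one_closed] and r = rstr_cl[OF al_B_cl[OF nc]]
 have "\<sigma> (palpha A (v, n))=palpha A (v, n) [^][C.L] p" using al_spl[of v n] v nc rh_mul[OF sigma_hom a r] std_frob_Y[OF v] std_frob_rstr[OF al_B_cl[OF nc]]
   alpha_N1 n C.Lr.nat_pow_distrib[OF a r, of p] rh_pow[OF A.rstr_A R.monoid_axioms al_B_cl[OF nc], of p] by (simp del: A_s(3,4))
 thus ?thesis using q_sigma[OF al_cl[OF v nc]] rh_pow[OF q_hom C.Lr.monoid_axioms al_cl[OF v nc], of p]
   rh_cl[OF q_hom al_cl[OF v nc]] unfolding E.teich_def q_al by simp
qed

text \<open>A nontrivial factor from \<open>N2\<close> makes \<open>alpha\<close> divisible by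
  \<open>p\<close>, hence puts it into the radical. Its class is that of 0, so its Teichmueller lift
  is 0, which need not be \<open>alpha\<close> itself.\<close>

lemma al_N2_red:
 assumes v: "set_mset v <= {..<snd nm}" and n: "n1 : N1" "n2 : N2" "n2 ~= 1[pmon B]"
 shows "rcl p (deg0 Wo) (lalpha Wo (v, n1 *[pmon B]n2))=rcl p (deg0 Wo) 0[gr Wo 0]"
proof -
 have nc: "n1:[pmon B]" "n2:[pmon B]" using submonoid.subset[OF N1] submonoid.subset[OF N2] n by auto
 let ?n = "n1 *[pmon B]n2"
 have "palpha B n2 : mults p R" using alpha_N2 n by blast
 hence "palpha B ?n : mults p R" using ideal.I_l_closed[OF R.muls_idl] nc by (simp add: al_B_mul)
 hence "palpha A (v, ?n) : mults p C.L" using gpair.ah_muls[OF gpairI[OF R.abelian_group_axioms P_grp] mon_ah[OF Y_vars[OF v]]]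
   gpair.ah_muls[OF gpairI[OF P_grp C.lim_grp] C.to_lim_hom] by simp
 from gpair.ah_muls[OF gpairI[OF C.lim_grp E.deg0.abelian_group_axioms] rh_ah[OF q_hom] this]
 have m: "lalpha Wo (v, ?n) : mults p (deg0 Wo)" unfolding q_al .
 hence "lalpha Wo (v, ?n) [^][deg0 Wo] (1::nat) : mults p (deg0 Wo)" using m E.deg0.l_one[OF E.deg0.muls_car[OF m]] by simp
 hence "lalpha Wo (v, ?n) : rad p (deg0 Wo)" using E.deg0.muls_car[OF m] unfolding rad_def by blast
 thus ?thesis using E.deg0.muls_car[OF m] E.deg0.red_eq_iff[OF prime_p, of "lalpha Wo (v, ?n)" "0[gr Wo 0]"] by (simp add: E.deg0.minus_eq E.gr.minus_eq)
qed

end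

locale std_mor = P: std_poly p k \<iota> B N1 N2 nP + Q: std_poly p k \<iota> B N1 N2 nQ
 for p :: nat and k :: "'k ring" and \<iota> :: "(nat => 'k) => 'r" and B :: "('r, 'n) fprelog" and N1 N2 :: "'n set"
  and nP nQ :: "nat \<times> nat" +
 fixes m :: "'r set mpoly => 'r set mpoly" and \<chi> :: "nat multiset \<times> 'n => nat multiset \<times> 'n"
 assumes mor: "prelog_alg_hom (base_red p B) (lob (base_red p B) nP) (lob (base_red p B) nQ) m \<chi>"
begin

abbreviation "WQ \<equiv> Q.Wo"
abbreviation "eQ \<equiv> e_ring p B nQ"
abbreviation "redQ \<equiv> rcl p (deg0 WQ)"
abbreviation "M \<equiv> free_mon (snd nP) \<times>\<times> pmon B"

lemma m_hom: "m : rhom P.P0 Q.P0" using mor by (simp add: prelog_alg_hom_def prelog_hom_def lpoly_obj_def base_red_def)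
lemma chi: "\<chi> : monoid_maps M (free_mon (snd nQ) \<times>\<times> pmon B)" using mor by (simp add: prelog_alg_hom_def prelog_hom_def lpoly_obj_def base_red_def)
lemma chi_cl: "l:[M]==>\<chi> l:[free_mon (snd nQ) \<times>\<times> pmon B]" using chi by (auto simp only: mm_def hom_def Pi_iff mem_Collect_eq)
lemma chi_mul: "l:[M]==>l':[M]==>\<chi> (l *[M]l')=\<chi> l *[free_mon (snd nQ) \<times>\<times> pmon B]\<chi> l'" using chi by (auto simp only: mm_def hom_def mem_Collect_eq)
lemma chi_base: "n:[pmon B]==>\<chi> ({#}, n)=({#}, n)" using mor by (simp add: prelog_alg_hom_def lpoly_obj_def base_red_def)
lemma m_al: "l:[M]==>m (palpha (lob (base_red p B) nP) l)=palpha (lob (base_red p B) nQ) (\<chi> l)" using mor by (cases l) (simp add: prelog_alg_hom_def prelog_hom_def lpoly_obj_def base_red_def)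
lemma m_const: "c:[pr B]==>m (P.redP (P.mnm c {#}))=Q.redP (Q.mnm c {#})" using mor rh_cl[OF P.R.red_hom[OF P.prime_p]] by (simp add: prelog_alg_hom_def lpoly_obj_def base_red_def P.redP_mon Q.redP_mon)

lemma eQ_al: assumes "l:[M]" shows "eQ (m (P.redP (P.mnm (palpha B (snd l)) (image_mset Inr (fst l)))))=redQ (lalpha WQ (\<chi> l))"
proof -
 have "eQ (palpha (lob (base_red p B) nQ) (\<chi> l))=redQ (lalpha WQ (\<chi> l))" using Q.e_pl chi_cl[OF assms] by (cases "\<chi> l") (simp add: prelog_hom_def lpoly_obj_def base_red_def red_prelog_def)
 moreover have "P.redP (P.mnm (palpha B (snd l)) (image_mset Inr (fst l)))=palpha (lob (base_red p B) nP) l" using assms by (cases l) (simp add: lpoly_obj_def base_red_def P.redP_mon)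
 ultimately show ?thesis using m_al[OF assms] by simp
qed

text \<open>What a morphism satisfying \<open>lifts_mor\<close> becomes after composition with the
  unit \<open>P.u\<close>. The universal property of \<open>WSat\<close> makes the two descriptions
  equivalent, and the conditions now concern a complex with explicit generators.\<close>

definition lifting :: "(nat => (nat => (nat => 'r mpoly set, nat multiset \<times> 'n) form set set) =>
  nat => (nat \<times> (nat => (nat => 'r mpoly set, nat multiset \<times> 'n) form set set)) set set) => bool" where
 "lifting H \<longleftrightarrow> dieu_hom (pr B) P.Om WQ H &
  (\<forall>h\<in>carrier P.P. redQ (H 0 (P.A.hs (P.\<tau> h)))=eQ (m (P.redP h))) &
  (\<forall>l\<in>carrier M. H 1 (P.A.hl l)=dlog WQ (\<chi> l))"

lemma var_mon: "x : vars nP==>P.mnm 1[pr B] {#x#}:[P.P]" by (rule P.mon_cl) auto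

lemma sigma_var: assumes "x : vars nP" shows "P.\<sigma> (P.\<tau> (P.mnm 1[pr B] {#x#}))=P.\<tau> (P.mnm 1[pr B] {#x#}) [^][P.C.L] p" using assms by (simp add: P.std_frob_tau[OF var_mon] P.Phi_mon rh_one[OF P.FR_hom] P.mon_pow
   flip: rh_pow[OF P.tau_rh P.PR.monoid_axioms var_mon])

text \<open>The images of the variables are Teichmueller lifts, hence determined by their residue classes.\<close>

lemma lift_uniq:
 assumes H: "lifting H" and K: "lifting K" and x: "x:[gr P.A.Dh i]"
 shows "H i x=K i x"
proof -
 have hom: "J i : ahom (gr P.A.Dh i) (gr WQ i)" if "lifting J" for J i using dieu_homD(1)[of "pr B" P.Om WQ J i] that by (simp add: lifting_def del: P.A.hat.gr_lim)
 have rh: "(%a. J 0 (P.A.hs a)) : rhom P.C.L (deg0 WQ)" if "lifting J" for J using ring_hom_trans[OF P.hs_hom, of "J 0" "deg0 WQ"] dieu_hom_ring[of "pr B" P.Om WQ J] that by (simp add: lifting_def comp_def P.O_deg0)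
 have tei: "Q.E.teich (J 0 (P.A.hs (P.\<tau> (P.mnm 1[pr B] {#x#}))))" if J: "lifting J" and x: "x : vars nP" for J x
 proof -
  let ?a = "P.\<tau> (P.mnm 1[pr B] {#x#})"
  have a: "?a:[P.C.L]" by (rule P.tau_cl[OF var_mon[OF x]])
  have "frob WQ 0 (J 0 (P.A.hs ?a))=J 0 (P.A.hs (P.\<sigma> ?a))" using dieu_homD(5)[of "pr B" P.Om WQ J "P.A.hs ?a" 0] J P.hs_cl[OF a] P.FO_eq[OF P.hs_cl[OF a]] P.FE.hext_0[of ?a] a by (simp add: lifting_def del: P.A.hat.gr_lim)
  thus ?thesis using rh_pow[OF rh[OF J] P.C.Lr.monoid_axioms a, of p] rh_cl[OF rh[OF J] a] unfolding sigma_var[OF x] Q.E.teich_def by simp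
 qed
 have c0: "H 0 (P.A.hs a)=K 0 (P.A.hs a)" if a: "a:[P.C.L]" for a
 proof (rule lim_p_hom_eqI[OF P.P_grp Q.E.gr_group Q.E.p_sep
   rh_ah[OF rh[OF H], unfolded add_mon_deg0] rh_ah[OF rh[OF K], unfolded add_mon_deg0] _ a])
  fix f assume f: "f:[P.P]"
  show "H 0 (P.A.hs (P.\<tau> f))=K 0 (P.A.hs (P.\<tau> f))"
  proof (rule P.P_rh_eqI[OF Q.E.deg0.ring_axioms _ _ _ _ f])
   show "(%f. H 0 (P.A.hs (P.\<tau> f))) : rhom P.P (deg0 WQ)" "(%f. K 0 (P.A.hs (P.\<tau> f))) : rhom P.P (deg0 WQ)" using ring_hom_trans[OF P.tau_rh rh[OF H]] ring_hom_trans[OF P.tau_rh rh[OF K]] by (simp_all add: comp_def)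
   fix c assume "c:[pr B]"
   hence "J 0 (P.A.hs (P.\<tau> (P.mnm c {#})))=rmap WQ c" if "lifting J" for J using dieu_homD(6)[of "pr B" P.Om WQ J c] that by (simp add: lifting_def P.A.rmap_hs)
   thus "H 0 (P.A.hs (P.\<tau> (P.mnm c {#})))=K 0 (P.A.hs (P.\<tau> (P.mnm c {#})))" using H K by simp
  next
   fix x assume x: "x : vars nP"
   let ?z = "P.mnm 1[pr B] {#x#}"
   have "redQ (H 0 (P.A.hs (P.\<tau> ?z)))=redQ (K 0 (P.A.hs (P.\<tau> ?z)))" using H K var_mon[OF x] by (simp add: lifting_def)
   thus "H 0 (P.A.hs (P.\<tau> ?z))=K 0 (P.A.hs (P.\<tau> ?z))" using Q.E.red_cls_eq_iff tei[OF H x] tei[OF K x] by (intro Q.E.te_uniq) (auto simp: Q.E.teich_def)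
  qed
 qed
 show ?thesis
 proof (rule P.A.hat_hom_eqI[OF Q.E.gr_group Q.E.p_sep hom[OF H] hom[OF K] _ x])
  fix a w assume "a:[pr P.A]" "w : P.A.words i"
  thus "H i (P.A.hc i (a, w))=K i (P.A.hc i (a, w))"
  proof (rule P.A.hat_ind[rotated 4])
   fix a assume a: "a:[pr P.A]"
   thus 1: "H 0 (P.A.hs a)=K 0 (P.A.hs a)" using c0 by simp
   have "J 1 (P.A.hdf a)=dif WQ 0 (J 0 (P.A.hs a))" if "lifting J" for J using dieu_homD(4)[of "pr B" P.Om WQ J "P.A.hs a" 0] that P.A.hs_cl[OF a] P.A.hdf_dif[OF a] by (simp add: lifting_def del: P.A.hat.gr_lim)
   thus "H 1 (P.A.hdf a)=K 1 (P.A.hdf a)" using H K 1 by simp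
  next
   fix l assume "l:[pmon P.A]"
   thus "H 1 (P.A.hl l)=K 1 (P.A.hl l)" using H K by (cases l) (simp add: lifting_def)
  next
   fix i j x y assume "x:[gr P.A.Dh i]" "y:[gr P.A.Dh j]" "H i x=K i x" "H j y=K j y"
   thus "H (i + j) (gmul P.A.Dh i j x y)=K (i + j) (gmul P.A.Dh i j x y)" using H K dieu_homD(2)[of "pr B" P.Om WQ _ x i y j] by (simp add: lifting_def del: P.A.hat.gr_lim)
  qed
 qed
qed

text \<open>The two cases of the decomposition of the monoid. For \<open>n2 = 1\<close> the lift is
  \<open>alpha\<close> itself, a Teichmueller element with \<open>d alpha = alpha dlog\<close>.
  Otherwise the residue class is 0, and \<open>t = 0\<close> satisfies the same equation trivially;
  there \<open>t\<close> and \<open>alpha\<close> are compared only in the reduced quotient.\<close>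

lemma var_spl: assumes "n=n1 *[pmon B]n2" "n1 : N1" "n2 : N2" "set_mset v <= {..<snd nQ}"
 obtains t where "Q.E.teich t" "redQ t=redQ (lalpha WQ (v, n))" "dif WQ 0 t=gmul WQ 0 1 t (dlog WQ (v, n))"
proof (cases "n2=1[pmon B]")
 case True
 have n1: "n1:[pmon B]" using submonoid.subset[OF P.N1] assms by blast
 hence n: "n=n1" using assms True by simp
 have "(v, n1):[lmon WQ]" using n1 assms by (simp add: Q.Wo_s)
 thus ?thesis using that[OF Q.te_al[OF assms(4,2)]] Q.WL.dif_lalpha n by simp
next
 case False
 have nc: "n:[pmon B]" using submonoid.subset[OF P.N1] submonoid.subset[OF P.N2] assms by auto
 have "(v, n):[lmon WQ]" using nc assms by (simp add: Q.Wo_s)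
 hence d: "dlog WQ (v, n):[gr WQ 1]" using Q.WL.dlog by (auto simp only: mm_def hom_def Pi_iff mem_Collect_eq partial_object.select_convs)
 have "dif WQ 0 0[gr WQ 0]=gmul WQ 0 1 0[gr WQ 0] (dlog WQ (v, n))" using Q.E.gmul_0_l[OF d, of 0] Q.E.dif_0[of 0] by simp
 thus ?thesis using that[OF Q.E.te_0] Q.al_N2_red[OF assms(4,2,3) False] assms(1) by simp
qed

text \<open>For \<open>X_i\<close> any residue class may be lifted. For \<open>Y_j\<close> the lift
  must also satisfy the log differential equation for the prescribed monoid element, which
  \<open>var_spl\<close> provides.\<close>

lemma var_te:
 obtains t where "!!x. x : vars nP==>Q.E.teich (t x)"
  "!!x. x : vars nP==>redQ (t x)=eQ (m (P.redP (P.mnm 1[pr B] {#x#})))"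
  "!!j. j < snd nP==>dif WQ 0 (t (Inr j))=gmul WQ 0 1 (t (Inr j)) (dlog WQ (\<chi> ({#j#}, 1[pmon B])))"
proof -
 have "\<exists>t. Q.E.teich t & redQ t=eQ (m (P.redP (P.mnm 1[pr B] {#x#}))) &
  (\<forall>j. x=Inr j --> dif WQ 0 t=gmul WQ 0 1 t (dlog WQ (\<chi> ({#j#}, 1[pmon B]))))" if x: "x : vars nP" for x
 proof (cases x)
  case (Inl i)
  have "eQ (m (P.redP (P.mnm 1[pr B] {#x#}))):[rdr p (deg0 WQ)]" using rh_cl[OF Q.e_rh rh_cl[OF m_hom rh_cl[OF P.redP_hom var_mon[OF x]]]] .
  then obtain z where z: "z:[deg0 WQ]" "eQ (m (P.redP (P.mnm 1[pr B] {#x#})))=redQ z" using Q.E.deg0.red_sj by blast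
  obtain t where t: "Q.E.teich t" "t -[gr WQ 0]z : Q.E.VF 0 1" using Q.E.te_ex[of z] z(1) by auto
  hence "redQ t=redQ z" using Q.E.red_cls_eq_iff z(1) by (auto simp: Q.E.teich_def)
  thus ?thesis using t z Inl by auto
 next
  case (Inr j)
  let ?l = "({#j#}, 1[pmon B])"
  have l: "?l:[M]" using x Inr by simp
  obtain v n where vn: "\<chi> ?l=(v, n)" by fastforce
  have v: "set_mset v <= {..<snd nQ}" "n:[pmon B]" using chi_cl[OF l] vn by auto
  obtain n1 n2 where n: "n1 : N1" "n2 : N2" "n=n1 *[pmon B]n2"
  proof -
   have "n : (%(a, b). a *[pmon B]b) ` (N1 \<times> N2)" using v(2) P.decomp by (simp only: bij_betw_def)
   thus ?thesis using that by auto
  qed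
  obtain t where "Q.E.teich t" "redQ t=redQ (lalpha WQ (v, n))" "dif WQ 0 t=gmul WQ 0 1 t (dlog WQ (v, n))" using var_spl[OF n(3,1,2) v(1)] .
  thus ?thesis using eQ_al[OF l] vn Inr by auto
 qed
 then obtain t where *: "!!x. x : vars nP==>Q.E.teich (t x) & redQ (t x)=eQ (m (P.redP (P.mnm 1[pr B] {#x#}))) &
  (\<forall>j. x=Inr j --> dif WQ 0 (t x)=gmul WQ 0 1 (t x) (dlog WQ (\<chi> ({#j#}, 1[pmon B]))))" by metis
 show ?thesis
 proof (rule that[of t])
  fix j assume "j < snd nP"
  thus "dif WQ 0 (t (Inr j))=gmul WQ 0 1 (t (Inr j)) (dlog WQ (\<chi> ({#j#}, 1[pmon B])))" using *[of "Inr j"] by simp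
 qed (use * in blast)+
qed

lemma lift_ex: obtains H where "lifting H"
proof -
 obtain t where t: "!!x. x : vars nP==>Q.E.teich (t x)"
  "!!x. x : vars nP==>redQ (t x)=eQ (m (P.redP (P.mnm 1[pr B] {#x#})))"
  "!!j. j < snd nP==>dif WQ 0 (t (Inr j))=gmul WQ 0 1 (t (Inr j)) (dlog WQ (\<chi> ({#j#}, 1[pmon B])))" using var_te by blast
 have tc: "x : vars nP==>t x:[deg0 WQ]" for x using t(1) by (simp add: Q.E.teich_def)
 note S = Q.E.deg0_cring and rm = Q.E.rmap_hom
 define f where "f=P.eval (deg0 WQ) (rmap WQ) t"
 have fh: "f : rhom P.P (deg0 WQ)" unfolding f_def by (rule P.eval_hom[OF S rm tc])
 note fm = P.eval_mon[where t = t, OF S rm tc, folded f_def] and mv = P.mset_val[OF S, of t, OF tc]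
 have fc: "f (P.mnm c {#})=rmap WQ c" if "c:[pr B]" for c using fm[of c "{#}"] that mv(3) Q.E.deg0.r_one[OF rh_cl[OF rm that]] by simp
 have fx: "f (P.mnm 1[pr B] {#x#})=t x" if "x : vars nP" for x using fm[of "1[pr B]" "{#x#}"] that mv(4)[of x] tc[of x] rh_one[OF rm] Q.E.deg0.l_one[OF tc[OF that]] by simp
 \<comment> \<open>The extension over the completion uses the V-filtration, for which a strict
   algebra is complete by definition.\<close>
 define g where "g=lim_ext P.P (p_fil p P.P) (deg0 WQ) (Q.E.VF 0) f"
 have Fil: "filg (deg0 WQ) (Q.E.VF 0)" using Q.E.fl.fil.Fil_sub[of 0] Q.E.fl.fil.Fil_Suc[of 0] by (intro filg.intro filg_axioms.intro Q.E.deg0.abelian_group_axioms) (auto simp: additive_subgroup_def add_mon_deg0)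
 have Filp: "mults (p ^ r) (gr WQ i) <= Q.E.VF i r" for i r using Q.E.p_VF by blast
 have Filp0: "mults (p ^ r) (deg0 WQ) <= Q.E.VF 0 r" for r using Filp[of r 0] by simp
 have Filc: "lim_complete (deg0 WQ) (Q.E.VF 0)" unfolding deg0_lim_cmp by (rule Q.E.VF_cmp)
 note ge = P.C.lim_ext_rh[OF S Fil Filc Filp0 fh, folded g_def]
 note gh = ge(1) and gt = ge(2)
 have gc: "g a:[gr WQ 0]" if "a:[P.C.L]" for a using rh_cl[OF gh that] by simp
 have grstr: "g (rstr P.A c)=rmap WQ c" if "c:[pr B]" for c using gt[OF P.mon_cl[of c "{#}"]] fc that by simp
 have dl: "dlog WQ (\<chi> l):[gr WQ 1]" if "l:[M]" for l using Q.WL.dlog chi_cl[OF that] unfolding Q.Wo_s by (auto simp: mm_def hom_def simp del: Q.OS.W_s)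
 have dlm: "dlog WQ (\<chi> (l *[M]l'))=dlog WQ (\<chi> l) +[gr WQ 1]dlog WQ (\<chi> l')" if "l:[M]" "l':[M]" for l l'
 proof -
  have "dlog WQ : hom (lmon WQ) (add_monoid (gr WQ 1))" using Q.WL.dlog by (simp add: mm_def del: One_nat_def)
  hence "dlog WQ (\<chi> l *[lmon WQ]\<chi> l')=dlog WQ (\<chi> l) +[gr WQ 1]dlog WQ (\<chi> l')" using chi_cl[OF that(1)] chi_cl[OF that(2)] hom_mult[of "dlog WQ" "lmon WQ" "add_monoid (gr WQ 1)" "\<chi> l" "\<chi> l'"] by (simp add: Q.Wo_s(7) del: One_nat_def)
  thus ?thesis using chi_mul[OF that] by (simp only: Q.Wo_s(7) Q.A_s(2))
 qed
 \<comment> \<open>The equation \<open>d y = y dlog\<close> is stable under products. It holds on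
   the base, where both sides vanish, and for each \<open>Y_j\<close> by the choice of
   \<open>t\<close>; induction over the exponent gives it for all monoid elements.\<close>
 have logd: "dif WQ 0 (f (P.mnm (palpha B n) (image_mset Inr v)))=gmul WQ 0 1 (f (P.mnm (palpha B n) (image_mset Inr v))) (dlog WQ (\<chi> (v, n)))"
  if "set_mset v <= {..<snd nP}" and n: "n:[pmon B]" for v n using that(1)
 proof (induction v)
  case empty
  have "dlog WQ (\<chi> ({#}, n))=0[gr WQ 1]" using Q.WL.dlog_lnstr[OF n] chi_base[OF n] by (simp only: Q.Wo_s(9) Q.A_s(5))
  thus ?case using fc[of "palpha B n"] n Q.E.dif_rmap[of "palpha B n"] Q.E.gmul_0_r[OF Q.E.rmap_closed[of "palpha B n"], of 1] by simp
 next
  case (add j v)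
  let ?y = "f (P.mnm (palpha B n) (image_mset Inr v))" and ?t = "t (Inr j)"
  have v: "set_mset v <= {..<snd nP}" "j < snd nP" using add.prems by auto
  have y: "?y:[gr WQ 0]" using rh_cl[OF fh P.Y_mon_cl[OF P.al_B_cl[OF n] v(1)]] by simp
  have tt: "?t:[gr WQ 0]" using tc[of "Inr j"] v by simp
  have e: "f (P.mnm (palpha B n) (image_mset Inr (add_mset j v)))=gmul WQ 0 0 ?y ?t" using rh_mul[OF fh P.Y_mon_cl[OF P.al_B_cl[OF n] v(1)] var_mon[of "Inr j"]] v n fx[of "Inr j"]
    P.mon_spl[of "palpha B n" "Inr j" "image_mset Inr v"] by simp
  have l: "(v, n):[M]" "({#j#}, 1[pmon B]):[M]" using v n by simp_all
  note d = dl[OF l(1)] dl[OF l(2)]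
  have ce: "\<chi> (add_mset j v, n)=\<chi> ((v, n) *[M]({#j#}, 1[pmon B]))" using n by simp
  have 1: "gmul WQ 0 1 ?t (gmul WQ 0 1 ?y (dlog WQ (\<chi> (v, n))))=gmul WQ 0 1 (gmul WQ 0 0 ?y ?t) (dlog WQ (\<chi> (v, n)))" using Q.E.assoc[OF tt y d(1)] Q.E.gcomm[OF tt y] by (simp add: gsign_def)
  have 2: "gmul WQ 0 1 ?y (gmul WQ 0 1 ?t (dlog WQ (\<chi> ({#j#}, 1[pmon B]))))=gmul WQ 0 1 (gmul WQ 0 0 ?y ?t) (dlog WQ (\<chi> ({#j#}, 1[pmon B])))" using Q.E.assoc[OF y tt d(2)] by simp
  have yt: "gmul WQ 0 0 ?y ?t:[gr WQ 0]" using Q.E.gmul_closed[OF y tt] by simp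
  note g1 = Q.E.gmul_closed[OF yt d(1), simplified] Q.E.gmul_closed[OF yt d(2), simplified]
  show ?case unfolding e ce dlm[OF l] Q.E.dif_mul0[OF y tt] add.IH[OF v(1)] t(3)[OF v(2)] 1 2 using Q.E.distrib_r[OF yt d] g1 by (simp add: Q.E.gr.a_comm)
 qed
 interpret LD: log_derivation B P.A "pr B" WQ g "%a. dif WQ 0 (g a)" "%l. dlog WQ (\<chi> l)"
 proof (intro log_derivation.intro P.A_pl Q.E.strict_cdga_axioms log_derivation_axioms.intro)
  show "g : rhom (pr P.A) (deg0 WQ)" using gh by simp
  fix a assume "a:[pr P.A]"
  hence a: "a:[P.C.L]" by simp
  show "dif WQ 0 (g a):[gr WQ 1]" using Q.E.dif_closed[OF gc[OF a]] by simp
  fix b assume "b:[pr P.A]"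
  hence b: "b:[P.C.L]" by simp
  show "dif WQ 0 (g (a +[pr P.A]b))=dif WQ 0 (g a) +[gr WQ 1]dif WQ 0 (g b)" using rh_add[OF gh a b] Q.E.dif_add[OF gc[OF a] gc[OF b]] by simp
  show "dif WQ 0 (g (a *[pr P.A]b))=gmul WQ 0 1 (g a) (dif WQ 0 (g b)) +[gr WQ 1]gmul WQ 0 1 (g b) (dif WQ 0 (g a))" using rh_mul[OF gh a b] Q.E.dif_mul0[OF gc[OF a] gc[OF b]] by simp
 next
  fix s assume "s:[pr B]"
  thus "dif WQ 0 (g (rstr P.A s))=0[gr WQ 1]" using Q.E.dif_rmap grstr by simp
 next
  fix l l' assume l: "l:[pmon P.A]"
  thus "dlog WQ (\<chi> l):[gr WQ 1]" using dl by simp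
  show "dif WQ 0 (g (palpha P.A l))=gmul WQ 0 1 (g (palpha P.A l)) (dlog WQ (\<chi> l))" using l gt P.Y_mon_cl logd by (cases l) simp
  assume "l':[pmon P.A]"
  thus "dlog WQ (\<chi> (l *[pmon P.A]l'))=dlog WQ (\<chi> l) +[gr WQ 1]dlog WQ (\<chi> l')" using dlm l by (simp only: P.A_s)
 next
  fix n assume n: "n:[pmon B]"
  show "dlog WQ (\<chi> (nstr P.A n))=0[gr WQ 1]" using Q.WL.dlog_lnstr[OF n] chi_base[OF n] by (simp only: Q.Wo_s(9) Q.A_s(5) P.A_s(5))
 qed
 interpret HD: hat_derivation B P.A "pr B" WQ g "%a. dif WQ 0 (g a)" "%l. dlog WQ (\<chi> l)" p "V_fil p WQ" by (intro hat_derivation.intro hat_derivation_axioms.intro LD.log_derivation_axioms Q.E.fl.fil.filg_axioms Q.E.VF_cmp Filp)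
 have dd: "dif WQ 1 (dlog WQ (\<chi> l))=0[gr WQ 2]" "frob WQ 1 (dlog WQ (\<chi> l))=dlog WQ (\<chi> l)" if "l:[pmon P.A]" for l using Q.WL.dif_dlog[of "\<chi> l"] Q.WL.frob_dlog[of "\<chi> l"] chi_cl[of l] that by (simp_all only: Q.Wo_s(7) P.A_s(2) Q.A_s(2))
 have hdif: "HD.hext (Suc i) (dif P.A.Dh i x)=dif WQ i (HD.hext i x)" if "x:[gr P.A.Dh i]" for i x by (rule HD.hext_dif[OF refl _ that]) (rule dd(1))
 \<comment> \<open>On variables this is the Teichmueller equation \<open>F t = t^p\<close>, on
   constants it is compatibility with the structure map; density passes to the completion.\<close>
 have gF: "g (P.\<sigma> a)=frob WQ 0 (g a)" if a: "a:[P.C.L]" for a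
 proof (rule lim_p_hom_eqI[OF P.P_grp Q.E.gr_group Q.E.p_sep _ _ _ a])
  show "(%a. g (P.\<sigma> a)) : ahom P.C.L (gr WQ 0)" using ah_comp[OF rh_ah[OF P.sigma_hom] rh_ah[OF gh]] by (simp only: add_mon_deg0)
  show "(%a. frob WQ 0 (g a)) : ahom P.C.L (gr WQ 0)" using ah_comp[OF rh_ah[OF gh, unfolded add_mon_deg0] Q.E.F_hom] .
  fix h assume h: "h:[P.P]"
  have "f (P.\<Phi> h)=frob WQ 0 (f h)"
  proof (rule P.P_rh_eqI[OF Q.E.deg0.ring_axioms _ _ _ _ h])
   show "(%h. f (P.\<Phi> h)) : rhom P.P (deg0 WQ)" "(%h. frob WQ 0 (f h)) : rhom P.P (deg0 WQ)" using ring_hom_trans[OF P.Phi_rh fh] ring_hom_trans[OF fh Q.E.F_rh] by (simp_all add: comp_def)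
   fix c assume c: "c:[pr B]"
   thus "f (P.\<Phi> (P.mnm c {#}))=frob WQ 0 (f (P.mnm c {#}))" using Q.E.frob_rmap[OF c] rh_cl[OF P.FR_hom c] by (simp add: P.Phi_mon fc)
  next
   fix x assume x: "x : vars nP"
   have "P.\<Phi> (P.mnm 1[pr B] {#x#})=P.mnm 1[pr B] {#x#} [^][P.P] p" using x by (simp add: P.Phi_mon rh_one[OF P.FR_hom] P.mon_pow)
   thus "f (P.\<Phi> (P.mnm 1[pr B] {#x#}))=frob WQ 0 (f (P.mnm 1[pr B] {#x#}))" using rh_pow[OF fh P.PR.monoid_axioms var_mon[OF x], of p] t(1)[OF x] fx[OF x] by (simp add: Q.E.teich_def)
  qed
  thus "g (P.\<sigma> (P.\<tau> h))=frob WQ 0 (g (P.\<tau> h))" using P.std_frob_tau[OF h] gt[OF h] gt[OF rh_cl[OF P.Phi_rh h]] by simp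
 qed
 have FOc: "P.FO i x:[gr P.A.Dh i]" if "x:[gr P.A.Dh i]" for i x using ah_cl[OF P.FE.hext_hom that] P.FO_eq[OF that] by simp
 have FOh: "P.FO i : ahom (gr P.A.Dh i) (gr P.A.Dh i)" for i using P.FO_gr unfolding grh_def by blast
 have hF: "HD.hext i (P.FO i x)=frob WQ i (HD.hext i x)" if x: "x:[gr P.A.Dh i]" for i x
 proof (rule P.A.hat_hom_eqI[OF Q.E.gr_group Q.E.p_sep ah_comp[OF FOh HD.hext_hom] ah_comp[OF HD.hext_hom Q.E.F_hom] _ x])
  fix a w assume "a:[pr P.A]" "w : P.A.words i"
  thus "HD.hext i (P.FO i (P.A.hc i (a, w)))=frob WQ i (HD.hext i (P.A.hc i (a, w)))"
  proof (rule P.A.hat_ind[rotated 4])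
   fix a assume a: "a:[pr P.A]"
   hence a': "a:[P.C.L]" by simp
   note ha = P.A.hs_cl[OF a] and da = P.A.hdf_cl[OF a]
   have s: "P.\<sigma> a:[pr P.A]" using P.sigma_cl[OF a'] by simp
   show 0: "HD.hext 0 (P.FO 0 (P.A.hs a))=frob WQ 0 (HD.hext 0 (P.A.hs a))" using P.FO_eq[OF ha] P.FE.hext_0[OF a] HD.hext_0[OF a] HD.hext_0[OF s] gF[OF a'] by simp
   have F1: "HD.hext 1 (P.FO 1 (P.A.hdf a))=HD.hext 1 (P.FD a)" using P.FO_eq[OF da] P.FE.hext_d[OF a] by simp
   \<comment> \<open>The Frobenius of \<open>d a\<close> is \<open>d sigma(a)\<close> divided by
     \<open>p\<close>, so compatibility is proved after multiplication by \<open>p\<close>, and the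
     factor is cancelled in the torsion-free target.\<close>
   have "p .[gr WQ 1] HD.hext 1 (P.FD a)=HD.hext 1 (dif P.A.Dh 0 (P.A.hs (P.\<sigma> a)))" using gpair.ah_nm[OF gpairI[OF P.A.hat.lim.gr_group Q.E.gr_group] HD.hext_hom P.FD_cl[OF a'], of p] P.FD_p[OF a'] by simp
   also have "\<dots>=dif WQ 0 (frob WQ 0 (g a))" using hdif[OF P.A.hs_cl[OF s]] HD.hext_0[OF s] gF[OF a'] by simp
   also have "\<dots>=p .[gr WQ 1] frob WQ 1 (dif WQ 0 (g a))" using Q.E.dif_frob[OF gc[OF a']] by simp
   finally have "p .[gr WQ 1] HD.hext 1 (P.FD a)=p .[gr WQ 1] frob WQ 1 (dif WQ 0 (g a))" .
   hence "HD.hext 1 (P.FD a)=frob WQ 1 (dif WQ 0 (g a))" using Q.E.nm_eqD[OF ah_cl[OF HD.hext_hom P.FD_cl[OF a']], of "frob WQ 1 (dif WQ 0 (g a))" 1]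
     ah_cl[OF Q.E.F_hom Q.E.dif_closed[OF gc[OF a']]] by simp
   thus "HD.hext 1 (P.FO 1 (P.A.hdf a))=frob WQ 1 (HD.hext 1 (P.A.hdf a))" using F1 HD.hext_d[OF a] by simp
  next
   fix l assume l: "l:[pmon P.A]"
   show "HD.hext 1 (P.FO 1 (P.A.hl l))=frob WQ 1 (HD.hext 1 (P.A.hl l))" using P.FO_eq[OF P.A.hl_cl[OF l]] P.FE.hext_dlog[OF l] HD.hext_dlog[OF l] dd(2)[OF l] by simp
  next
   fix i j x y assume x: "x:[gr P.A.Dh i]" and y: "y:[gr P.A.Dh j]"
    and e: "HD.hext i (P.FO i x)=frob WQ i (HD.hext i x)" "HD.hext j (P.FO j y)=frob WQ j (HD.hext j y)"
   have "P.FO (i + j) (gmul P.A.Dh i j x y)=gmul P.A.Dh i j (P.FO i x) (P.FO j y)" using P.FO_gr x y unfolding grh_def by blast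
   thus "HD.hext (i + j) (P.FO (i + j) (gmul P.A.Dh i j x y))=frob WQ (i + j) (HD.hext (i + j) (gmul P.A.Dh i j x y))" using HD.hext_gmul[OF FOc[OF x] FOc[OF y]] HD.hext_gmul[OF x y] e
     Q.E.F_gmul[OF ah_cl[OF HD.hext_hom x] ah_cl[OF HD.hext_hom y]] by simp
  qed
 qed
 have dh: "dieu_hom (pr B) P.Om WQ HD.hext" unfolding dieu_hom_def P.O_s
 proof (intro conjI allI ballI)
  show "graded_ring_hom P.Om WQ HD.hext" using HD.hext_gr unfolding grh_def P.O_s .
  fix c assume c: "c:[pr B]"
  show "HD.hext 0 (rmap P.A.Dh c)=rmap WQ c" unfolding P.A.rmap_hs using HD.hext_0[of "rstr P.A c"] P.rstr_cl[OF c] grstr[OF c] by simp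
 qed (rule hdif hF; assumption)+
 have red: "redQ (f h)=eQ (m (P.redP h))" if h: "h:[P.P]" for h
 proof (rule P.P_rh_eqI[OF cring.axioms(1)[OF Q.E.deg0.red_cring[OF P.prime_p]] _ _ _ _ h])
  show "(%h. redQ (f h)) : rhom P.P (rdr p (deg0 WQ))" "(%h. eQ (m (P.redP h))) : rhom P.P (rdr p (deg0 WQ))" using ring_hom_trans[OF fh Q.E.deg0.red_hom[OF P.prime_p]] ring_hom_trans[OF ring_hom_trans[OF P.redP_hom m_hom] Q.e_rh] by (simp_all add: comp_def)
  fix c assume c: "c:[pr B]"
  show "redQ (f (P.mnm c {#}))=eQ (m (P.redP (P.mnm c {#})))" using Q.e_ring[OF Q.mon_cl[of c "{#}"]] Q.q_rstr[OF c] c by (simp add: m_const fc)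
 next
  fix x assume "x : vars nP"
  thus "redQ (f (P.mnm 1[pr B] {#x#}))=eQ (m (P.redP (P.mnm 1[pr B] {#x#})))" using t(2) fx by simp
 qed
 have "lifting HD.hext" unfolding lifting_def
 proof (intro conjI dh ballI)
  fix h assume h: "h:[P.P]"
  show "redQ (HD.hext 0 (P.A.hs (P.\<tau> h)))=eQ (m (P.redP h))" using HD.hext_0[of "P.\<tau> h"] P.tau_cl[OF h] gt[OF h] red[OF h] by simp
 next
  fix l assume "l:[M]"
  thus "HD.hext 1 (P.A.hl l)=dlog WQ (\<chi> l)" using HD.hext_dlog[of l] by simp
 qed
 thus ?thesis by (rule that)
qed

end

context std_mor
begin

section \<open>From maps on the completed complex to morphisms of strict algebras\<close>

interpretation TS: to_strict "pr B" P.Om WQ p "pfrob B" by (intro to_strict.intro P.OD.tfd_axioms Q.E.strd_axioms)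

lemma lobj_red:
 "pr (lob (base_red p B) nP)=P.P0" "pmon (lob (base_red p B) nP)=M"
 "lmon P.Wo=M" "lmon WQ=free_mon (snd nQ) \<times>\<times> pmon B" "lnstr P.Wo n=({#}, n)" "lnstr WQ n=({#}, n)" by (simp_all add: lpoly_obj_def base_red_def P.Wo_s Q.Wo_s)

lemma dlog_P: "dlog P.Wo l=P.u 1 (P.A.hl l)" by (simp only: P.Wo_s P.O_s)
lemma e_P: "h:[P.P]==>e_ring p B nP (P.redP h)=rcl p (deg0 P.Wo) (P.u 0 (P.A.hs (P.\<tau> h)))" using P.e_ring by (simp add: P.q_def)
lemma q_P_cl: "h:[P.P]==>P.u 0 (P.A.hs (P.\<tau> h)):[deg0 P.Wo]" using rh_cl[OF P.q_hom P.tau_cl] by (simp add: P.q_def)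

lemma hom_lift:
 assumes g: "(f, \<psi>) : log_dieu_Hom p B P.Wo WQ" and l: "lifts_mor p B nP nQ (m, \<chi>) (f, \<psi>)"
 shows "lifting (%i x. f i (P.u i x))" "l:[M]==>\<psi> l=\<chi> l"
proof -
 have f: "dieu_hom (pr B) P.Wo WQ f" "\<forall>l\<in>carrier (lmon P.Wo). f 1 (dlog P.Wo l)=dlog WQ (\<psi> l)" using g by (auto simp only: log_dieu_Hom_def log_dieu_hom_def mem_Collect_eq prod.case)
 show c: "\<psi> l=\<chi> l" if "l:[M]" for l using l that by (simp only: lifts_mor_def prod.case lobj_red)
 show "lifting (%i x. f i (P.u i x))" unfolding lifting_def
 proof (intro conjI ballI dieu_hom_comp[OF P.u_hom f(1)])
  fix h assume h: "h:[P.P]"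
  show "redQ (f 0 (P.u 0 (P.A.hs (P.\<tau> h))))=eQ (m (P.redP h))" using l rh_cl[OF P.redP_hom h]
    cos_map_red[OF P.prime_p P.Wo_cring Q.Wo_cring dieu_hom_ring[OF f(1)] q_P_cl[OF h]] by (simp only: lifts_mor_def prod.case lobj_red e_P[OF h, symmetric])
 next
  fix l assume "l:[M]"
  thus "f 1 (P.u 1 (P.A.hl l))=dlog WQ (\<chi> l)" using f(2) c by (simp only: lobj_red dlog_P)
 qed
qed

lemma lift_hom:
 assumes H: "lifting H" and ext: "\<chi> : extensional (carrier M)"
 shows "\<exists>f. (f, \<chi>) : log_dieu_Hom p B P.Wo WQ & lifts_mor p B nP nQ (m, \<chi>) (f, \<chi>)"
proof -
 have H': "dieu_hom (pr B) P.Om WQ H" using H by (simp add: lifting_def)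
 define g where "g=TS.wsat_ext H"
 have g: "dieu_hom (pr B) P.Wo WQ g" unfolding g_def P.Wo_hom_iff by (rule TS.wsat_ext_hom[OF H'])
 have gu: "g i (P.u i x)=H i x" if "x:[gr P.Om i]" for i x unfolding g_def W_unit_def by (rule TS.wsat_ext_unit[OF H' that])
 \<comment> \<open>The extension is cut down to the carriers, because members of
   \<open>log_dieu_Hom\<close> are extensional.\<close>
 define f where "f i=restrict (g i) (carrier (gr P.Wo i))" for i
 have fg: "f i x=g i x" if "x:[gr P.Wo i]" for i x using that by (simp add: f_def)
 have f: "dieu_hom (pr B) P.Wo WQ f"
 proof (rule dieu_homI)
  fix i show "f i : ahom (gr P.Wo i) (gr WQ i)" using dieu_homD(1)[OF g, of i] by (intro ahI) (simp_all add: fg ah_cl[OF dieu_homD(1)[OF g]] ah_add[OF dieu_homD(1)[OF g]])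
 qed (simp_all add: fg P.E.gmul_closed P.E.gone_closed P.E.dif_closed P.E.F_cl P.E.rmap_closed dieu_homD(2-6)[OF g])
 have fu: "f i (P.u i x)=H i x" if "x:[gr P.Om i]" for i x using gu[OF that] fg[OF ah_cl[OF dieu_homD(1)[OF P.u_hom] that]] by simp
 have fh: "redQ (f 0 (P.u 0 (P.A.hs (P.\<tau> h))))=eQ (m (P.redP h))" if h: "h:[P.P]" for h using H h fu[of "P.A.hs (P.\<tau> h)" 0] P.hs_cl[OF P.tau_cl[OF h]] by (simp add: lifting_def)
 have "log_dieu_hom p B P.Wo WQ f \<chi>" unfolding log_dieu_hom_def lobj_red
 proof (intro conjI ballI f chi chi_base)
  fix l assume l: "l:[M]"
  have "f 1 (P.u 1 (P.A.hl l))=H 1 (P.A.hl l)" using fu[of "P.A.hl l" 1] P.A.hl_cl[of l] l by simp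
  moreover have "H 1 (P.A.hl l)=dlog WQ (\<chi> l)" using H l unfolding lifting_def by blast
  ultimately show "f 1 (dlog P.Wo l)=dlog WQ (\<chi> l)" by (simp only: dlog_P)
  obtain v n where vn: "l=(v, n)" "set_mset v <= {..<snd nP}" "n:[pmon B]" using l by auto
  show "redQ (f 0 (lalpha P.Wo l))=redQ (lalpha WQ (\<chi> l))" using fh[OF P.Y_mon_cl[OF P.al_B_cl[OF vn(3)] vn(2)]] eQ_al[OF l] vn(1) by (simp add: P.q_al P.q_def)
 qed
 moreover have "lifts_mor p B nP nQ (m, \<chi>) (f, \<chi>)" unfolding lifts_mor_def prod.case lobj_red
 proof (intro conjI ballI refl)
  fix x assume "x:[P.P0]"
  then obtain h where h: "h:[P.P]" "x=P.redP h" using P.redP_sj by blast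
  show "coset_map (deg0 WQ) (rad p (deg0 WQ)) (f 0) (e_ring p B nP x)=eQ (m x)" using cos_map_red[OF P.prime_p P.Wo_cring Q.Wo_cring dieu_hom_ring[OF f] q_P_cl[OF h(1)]] fh[OF h(1)] h e_P by simp
 qed
 ultimately show ?thesis using ext by (auto simp: log_dieu_Hom_def f_def lobj_red(3) simp del: P.A_mon)
qed

text \<open>Existence is \<open>lift_ex\<close> extended over saturation and strictification. For
  uniqueness two solutions are compared after the unit, where \<open>lift_uniq\<close> applies, and
  extensionality turns pointwise agreement into equality.\<close>

lemma mor_ex1:
 assumes ext: "\<chi> : extensional (carrier M)"
 shows "\<exists>!g. g : log_dieu_Hom p B P.Wo WQ & lifts_mor p B nP nQ (m, \<chi>) g"
proof -
 obtain H where H: "lifting H" using lift_ex .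
 have "g=g'" if g: "g : log_dieu_Hom p B P.Wo WQ" "lifts_mor p B nP nQ (m, \<chi>) g"
  and g': "g' : log_dieu_Hom p B P.Wo WQ" "lifts_mor p B nP nQ (m, \<chi>) g'" for g g'
 proof -
  obtain f \<psi> f' \<psi>' where e: "g=(f, \<psi>)" "g'=(f', \<psi>')" by (cases g; cases g')
  have d: "dieu_hom (pr B) TS.W WQ f" "dieu_hom (pr B) TS.W WQ f'" using g(1) g'(1) unfolding e P.Wo_hom_iff[symmetric] by (simp_all add: log_dieu_Hom_def log_dieu_hom_def)
  have x: "!!i. f i : extensional (carrier (gr P.Wo i))" "!!i. f' i : extensional (carrier (gr P.Wo i))"
   "\<psi> : extensional (carrier M)" "\<psi>' : extensional (carrier M)" using g(1) g'(1) unfolding e lobj_red(3)[symmetric] by (simp_all add: log_dieu_Hom_def)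
  have "f i x=f' i x" if "x:[gr P.Wo i]" for i x
  proof (rule TS.wsat_uniq[OF d])
   fix i x assume "x:[gr P.Om i]"
   thus "f i (wsat_unit p P.Om i x)=f' i (wsat_unit p P.Om i x)" using lift_uniq[OF hom_lift(1)[OF g[unfolded e]] hom_lift(1)[OF g'[unfolded e]], of x i] by (simp add: W_unit_def)
  qed (use that in \<open>simp only: P.Wo_s\<close>)
  hence "f i=f' i" for i by (rule extensionalityI[OF x(1,2)])
  hence "f=f'" by (rule HOL.ext)
  moreover have "\<psi>=\<psi>'" using x(3,4) hom_lift(2)[OF g[unfolded e]] hom_lift(2)[OF g'[unfolded e]] by (intro extensionalityI[of _ "carrier M"]) simp_all
  ultimately show ?thesis using e by simp
 qed
 thus ?thesis using lift_hom[OF H ext] by blast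
qed

end

section \<open>Functors\<close>

lemma functor_comp:
 assumes "functor_between C D F G" "functor_between D E F' G'"
 shows "functor_between C E (%a. F' (F a)) (%a b f. G' (F a) (F b) (G a b f))"
proof -
 interpret X: functor_between C D F G by fact
 interpret Y: functor_between D E F' G' by fact
 show ?thesis by unfold_locales (simp_all add: X.obj Y.obj X.hom Y.hom X.ident Y.ident X.comp Y.comp)
qed

text \<open>Meant for maps defined on a quotient through representatives: the ring laws are
  inherited from upstairs once compatibility with the surjection \<open>r\<close> is known.\<close>

lemma rh_descend:
 assumes A: "ring A" and r: "r : rhom A A0" and su: "!!x. x:[A0]==>\<exists>a\<in>carrier A. x=r a"
  and f: "f : rhom A E" and F: "!!a. a:[A]==>F (r a)=f a"
 shows "F : rhom A0 E"
proof (rule rhI)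
 interpret A: ring A by fact
 show "F 1[A0]=1[E]" using F[OF A.one_closed] rh_one[OF r] rh_one[OF f] by simp
 fix x y assume x: "x:[A0]" and y: "y:[A0]"
 obtain a b where a: "a:[A]" "x=r a" and b: "b:[A]" "y=r b" using su x y by metis
 show "F x:[E]" using F[OF a(1)] rh_cl[OF f a(1)] a by simp
 show "F (x *[A0]y)=F x *[E]F y" using F[OF A.m_closed[OF a(1) b(1)]] F a b rh_mul[OF r a(1) b(1)] rh_mul[OF f a(1) b(1)] by simp
 show "F (x +[A0]y)=F x +[E]F y" using F[OF A.a_closed[OF a(1) b(1)]] F a b rh_add[OF r a(1) b(1)] rh_add[OF f a(1) b(1)] by simp
qed

lemma lobj:
 assumes "prelog_ring S"
 shows "ring (pr (lob S nm))" "Group.monoid (pmon (lob S nm))"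
  "l:[pmon (lob S nm)]==>palpha (lob S nm) l:[pr (lob S nm)]"
  "s:[pr S]==>rstr (lob S nm) s:[pr (lob S nm)]"
  "n:[pmon S]==>nstr (lob S nm) n:[pmon (lob S nm)]"
proof -
 have S: "cring (pr S)" "Group.comm_monoid (pmon S)" "palpha S : monoid_maps (pmon S) (pr S)" using assms by (auto simp: prelog_ring_def)
 interpret S: cring "pr S" by fact
 interpret mpolys "pr S" nm by unfold_locales
 show "ring (pr (lob S nm))" using PR.ring_axioms by (simp add: lpoly_obj_def)
 show "Group.monoid (pmon (lob S nm))" using comm_monoid.axioms(1)[OF prod_cm_mon[OF free_mon_cm S(2)]] by (simp add: lpoly_obj_def)
 show "palpha (lob S nm) l:[pr (lob S nm)]" if lc: "l:[pmon (lob S nm)]"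
 proof -
  obtain v n where l: "l=(v, n)" "set_mset v <= {..<snd nm}" "n:[pmon S]" using lc by (cases l) (auto simp: lpoly_obj_def DirProd_def)
  hence "palpha S n:[pr S]" "set_mset (image_mset Inr v) <= vars nm" using S(3) by (auto simp: mm_def hom_def)
  thus ?thesis using mon_cl l by (simp add: lpoly_obj_def del: set_image_mset)
 qed
 show "rstr (lob S nm) s:[pr (lob S nm)]" if "s:[pr S]" using mon_cl[OF that, of "{#}"] by (simp add: lpoly_obj_def)
 show "nstr (lob S nm) n:[pmon (lob S nm)]" if "n:[pmon S]" using that by (simp add: lpoly_obj_def DirProd_def)
qed

lemma rh_id: "ring A==>restrict (%x. x) (carrier A) : rhom A A" by (rule rhI) (simp_all add: ring.ring_simprules)

lemma rh_compose: assumes "ring A" and f: "f : rhom A E" and g: "g : rhom E D"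
 shows "compose (carrier A) g f : rhom A D"
proof -
 interpret ring A by fact
 show ?thesis by (rule rhI) (simp_all add: compose_eq rh_cl[OF f] rh_cl[OF g] rh_mul[OF f] rh_mul[OF g]
   rh_add[OF f] rh_add[OF g] rh_one[OF f] rh_one[OF g])
qed

lemma mon_maps_id: "Group.monoid G==>restrict (%x. x) (carrier G) : monoid_maps G G" by (auto simp: mm_def hom_def monoid.m_closed monoid.one_closed)

lemma mon_maps_compose: assumes "Group.monoid G" "f : monoid_maps G H" "g : monoid_maps H K"
 shows "compose (carrier G) g f : monoid_maps G K"
proof -
 interpret Group.monoid G by fact
 show ?thesis using assms(2,3) by (simp add: mm_def hom_def Pi_iff compose_eq)
qed

section \<open>The categories of free pre-log algebras and of strict Dieudonne algebras\<close>

lemma lPoly_s: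
 "Obj (lPoly S)=UNIV"
 "(f, \<psi>) : Hom (lPoly S) P Q \<longleftrightarrow> prelog_alg_hom S (lob S P) (lob S Q) f \<psi> &
   f : extensional (carrier (pr (lob S P))) & \<psi> : extensional (carrier (pmon (lob S P)))"
 "Idm (lPoly S) P=(restrict (%x. x) (carrier (pr (lob S P))), restrict (%l. l) (carrier (pmon (lob S P))))"
 "Comp (lPoly S) P (g, \<chi>) (f, \<psi>)=(compose (carrier (pr (lob S P))) g f, compose (carrier (pmon (lob S P))) \<chi> \<psi>)" by (simp_all add: lPoly_def)

lemma lPoly_maps: assumes "prelog_alg_hom S X Y f \<psi>"
 shows "f : carrier (pr X) \<rightarrow> carrier (pr Y)" "\<psi> : carrier (pmon X) \<rightarrow> carrier (pmon Y)" using assms by (auto simp: prelog_alg_hom_def prelog_hom_def mm_def hom_def ring_hom_def)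

lemma lPoly_category: assumes S: "prelog_ring S" shows "category (lPoly S)"
proof
 let ?o = "lob S" and ?C = "lPoly S"
 note l = lobj[OF S]
 show "Idm ?C a : Hom ?C a a" for a unfolding lPoly_s prelog_alg_hom_def prelog_hom_def using rh_id[OF l(1)] mon_maps_id[OF l(2)] l by simp
 show "Comp ?C a g f : Hom ?C a c" if "f : Hom ?C a b" "g : Hom ?C b c" for a b c f g
 proof -
  obtain f1 f2 g1 g2 where e: "f=(f1, f2)" "g=(g1, g2)" by (cases f; cases g)
  have h: "prelog_alg_hom S (?o a) (?o b) f1 f2" "prelog_alg_hom S (?o b) (?o c) g1 g2" using that unfolding e lPoly_s by auto
  note m = lPoly_maps[OF h(1)] and h = h[unfolded prelog_alg_hom_def prelog_hom_def]
  show ?thesis unfolding e lPoly_s prelog_alg_hom_def prelog_hom_def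
  proof (intro conjI ballI)
   show "compose (carrier (pr (?o a))) g1 f1 : rhom (pr (?o a)) (pr (?o c))" using rh_compose[OF l(1)] h by blast
   show "compose (carrier (pmon (?o a))) g2 f2 : monoid_maps (pmon (?o a)) (pmon (?o c))" using mon_maps_compose[OF l(2)] h by blast
  qed (use h l(3-5) m in \<open>simp_all add: compose_eq Pi_iff\<close>)
 qed
 show "Comp ?C a f (Idm ?C a)=f" if "f : Hom ?C a b" for a b f using that by (cases f) (auto simp: lPoly_s intro!: compose_Id lPoly_maps)
 show "Comp ?C a (Idm ?C b) f=f" if "f : Hom ?C a b" for a b f using that by (cases f) (auto simp: lPoly_s intro!: Id_compose dest: lPoly_maps)
 show "Comp ?C a h (Comp ?C a g f)=Comp ?C a (Comp ?C b h g) f"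
  if "f : Hom ?C a b" "g : Hom ?C b c" "h : Hom ?C c d" for a b c d f g h using that by (cases f; cases g; cases h) (auto simp: lPoly_s dest: lPoly_maps intro!: compose_assoc)
qed

lemma DA_s:
 "A : Obj (DA_str p B) \<longleftrightarrow> dieudonne_algebra (pr B) A p (pfrob B) & strict p A"
 "f : Hom (DA_str p B) A A' \<longleftrightarrow> dieu_hom (pr B) A A' f & (\<forall>i. f i : extensional (carrier (gr A i)))"
 "Idm (DA_str p B) A i=restrict (%x. x) (carrier (gr A i))"
 "Comp (DA_str p B) A g f i=compose (carrier (gr A i)) (g i) (f i)" by (simp_all add: DA_str_def)

lemma dieu_hom_cg:
 assumes "dieudonne_algebra R A p FR" and f: "dieu_hom R A E f" and fg: "!!i x. x:[gr A i]==>g i x=f i x"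
 shows "dieu_hom R A E g"
proof (rule dieu_homI)
 interpret A: dieudonne_algebra R A p FR by fact
 fix i show "g i : ahom (gr A i) (gr E i)" by (intro ahI) (simp_all add: fg ah_cl[OF dieu_homD(1)[OF f]] ah_add[OF dieu_homD(1)[OF f]])
qed (simp_all add: fg dieudonne_algebra.F_cl[OF assms(1)] dieudonne_algebra.axioms(1)[OF assms(1), THEN strict_cdga.gmul_closed]
  dieudonne_algebra.axioms(1)[OF assms(1), THEN strict_cdga.gone_closed] dieudonne_algebra.axioms(1)[OF assms(1), THEN strict_cdga.dif_closed]
  cfil.rmap_closed[OF strict_cdga.pft[OF dieudonne_algebra.axioms(1)[OF assms(1)]]] dieu_homD(2-6)[OF f])

lemma dieu_hom_id: "dieudonne_algebra R A p FR==>dieu_hom R A A (%i. restrict (%x. x) (carrier (gr A i)))" by (rule dieu_hom_cg[of R A p FR _ "%i x. x"]) (auto simp: dieu_hom_def grh_def hom_def)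

lemma dieu_hom_compose: "dieudonne_algebra R A p FR==>dieu_hom R A E f==>dieu_hom R E D g ==>
  dieu_hom R A D (%i. compose (carrier (gr A i)) (g i) (f i))" by (rule dieu_hom_cg[OF _ dieu_hom_comp[of R A E f D g]]) (auto simp: compose_eq)

lemma dieu_hom_maps: "dieu_hom R A E f==>f i : carrier (gr A i) \<rightarrow> carrier (gr E i)" by (rule funcsetI) (rule ah_cl[OF dieu_homD(1)])

lemma DA_category: "category (DA_str p B)"
proof
 let ?C = "DA_str p B"
 show "Idm ?C a : Hom ?C a a" if "a : Obj ?C" for a using dieu_hom_id[of "pr B" a p "pfrob B"] that unfolding DA_s by (simp add: DA_str_def)
 show "Comp ?C a g f : Hom ?C a c" if "a : Obj ?C" "f : Hom ?C a b" "g : Hom ?C b c" for a b c f g using dieu_hom_compose[of "pr B" a p "pfrob B" b f c g] that unfolding DA_s by (simp add: DA_str_def)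
 show "Comp ?C a f (Idm ?C a)=f" if "f : Hom ?C a b" for a b f using that by (intro ext[of _ f]) (auto simp: DA_s intro!: compose_Id dieu_hom_maps)
 show "Comp ?C a (Idm ?C b) f=f" if "f : Hom ?C a b" for a b f using that by (intro ext[of _ f]) (auto simp: DA_s intro!: Id_compose dieu_hom_maps)
 show "Comp ?C a h (Comp ?C a g f)=Comp ?C a (Comp ?C b h g) f"
  if "f : Hom ?C a b" "g : Hom ?C b c" "h : Hom ?C c d" for a b c d f g h
 proof
  fix i
  have "f i : carrier (gr a i) \<rightarrow> carrier (gr b i)" using that(1) dieu_hom_maps unfolding DA_s by blast
  thus "Comp ?C a h (Comp ?C a g f) i=Comp ?C a (Comp ?C b h g) f i" unfolding DA_s by (rule compose_assoc)
 qed
qed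

lemma log_dieu_Hom_id: assumes "log_dieudonne_algebra B A p"
 shows "(%i. restrict (%x. x) (carrier (gr A i)), restrict (%l. l) (carrier (lmon A))) : log_dieu_Hom p B A A"
proof -
 interpret A: log_dieudonne_algebra B A p by fact
 have "lnstr A n:[lmon A]" if "n:[pmon B]" for n using A.lnstr that by (auto simp: mm_def hom_def)
 moreover have "lalpha A l:[gr A 0]" "dlog A l:[gr A 1]" if "l:[lmon A]" for l using A.lalpha A.dlog that by (auto simp: mm_def hom_def)
 ultimately show ?thesis using dieu_hom_id[OF A.dieudonne_algebra_axioms] mon_maps_id[OF comm_monoid.axioms(1)[OF A.lmon]] by (simp add: log_dieu_Hom_def log_dieu_hom_def)
qed

lemma log_dieu_Hom_compose:
 assumes p: "prime p" and A: "log_dieudonne_algebra B A p" and E: "log_dieudonne_algebra B E p" and D: "log_dieudonne_algebra B D p"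
  and f: "(f, \<psi>) : log_dieu_Hom p B A E" and g: "(g, \<chi>) : log_dieu_Hom p B E D"
 shows "(%i. compose (carrier (gr A i)) (g i) (f i), compose (carrier (lmon A)) \<chi> \<psi>) : log_dieu_Hom p B A D"
proof -
 interpret A: log_dieudonne_algebra B A p by fact
 interpret E: log_dieudonne_algebra B E p by fact
 interpret D: log_dieudonne_algebra B D p by fact
 note f = f[unfolded log_dieu_Hom_def log_dieu_hom_def, simplified] and g = g[unfolded log_dieu_Hom_def log_dieu_hom_def, simplified]
 have fh: "dieu_hom (pr B) A E f" and gh: "dieu_hom (pr B) E D g" using f g by blast+
 have l: "lnstr A n:[lmon A]" if "n:[pmon B]" for n using A.lnstr that by (auto simp: mm_def hom_def)
 have al: "lalpha A l:[gr A 0]" "dlog A l:[gr A 1]" if "l:[lmon A]" for l using A.lalpha A.dlog that by (auto simp: mm_def hom_def)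
 have el: "lalpha E l:[deg0 E]" if "l:[lmon E]" for l using E.lalpha that by (auto simp: mm_def hom_def)
 have ps: "\<psi> l:[lmon E]" if "l:[lmon A]" for l using f that by (auto simp: mm_def hom_def)
 \<comment> \<open>\<open>f\<close> respects \<open>alpha\<close> only modulo the radical, and
   \<open>g\<close> is applied to this congruence; it survives because a ring map sends the radical
   into the radical.\<close>
 have red: "rcl p (deg0 D) (g 0 (f 0 (lalpha A l)))=rcl p (deg0 D) (lalpha D (\<chi> (\<psi> l)))" if lc: "l:[lmon A]" for l
 proof -
  note cm = cos_map_red[OF p E.deg0_cring D.deg0_cring dieu_hom_ring[OF gh]]
  have fl: "f 0 (lalpha A l):[deg0 E]" using ah_cl[OF dieu_homD(1)[OF fh] al(1)[OF lc]] by simp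
  have "rcl p (deg0 E) (f 0 (lalpha A l))=rcl p (deg0 E) (lalpha E (\<psi> l))" using f lc by blast
  hence "rcl p (deg0 D) (g 0 (f 0 (lalpha A l)))=rcl p (deg0 D) (g 0 (lalpha E (\<psi> l)))" using cm[OF fl] cm[OF el[OF ps[OF lc]]] by simp
  thus ?thesis using g ps[OF lc] by simp
 qed
 show ?thesis using dieu_hom_compose[OF A.dieudonne_algebra_axioms fh gh] mon_maps_compose[OF comm_monoid.axioms(1)[OF A.lmon], of \<psi> "lmon E" \<chi> "lmon D"]
   f g l al ps red by (simp add: log_dieu_Hom_def log_dieu_hom_def compose_eq)
qed

lemma mon_maps_ring: "a : monoid_maps G A==>h : rhom A E==>(%n. h (a n)) : monoid_maps G E" by (auto simp: mm_def hom_def Pi_iff rh_cl rh_mul rh_one)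

context log_base
begin

section \<open>Base change along the reduction of coefficients\<close>

abbreviation "S0 \<equiv> base_red p B"
abbreviation "S1 \<equiv> base_mod p B"
abbreviation "R1 \<equiv> R Quot mults p R"
abbreviation "W \<equiv> W_obj p B"

lemmas W_log = std_poly.Wo_log[OF std_poly.intro[OF log_base_axioms]]

lemma S0_s: "pr S0=rdr p R" "pmon S0=pmon B" "palpha S0 n=rcl p R (palpha B n)" by (simp_all add: base_red_def)
lemma S1_s: "pr S1=R1" "pmon S1=pmon B" "palpha S1 n=mults p R +>[R] palpha B n" by (simp_all add: base_mod_def)
lemma mod_hom: "(%x. mults p R +>[R] x) : rhom R R1" by (rule ideal.rcos_ring_hom[OF R.muls_idl])
lemma R1_cring: "cring R1" by (rule ideal.quotient_is_cring[OF R.muls_idl R_cring])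
lemma S0_pl: "prelog_ring S0" using R.red_cring[OF prime_p] mon_B mon_maps_ring[OF al_B R.red_hom[OF prime_p]] by (simp only: prelog_ring_def base_red_def prelog.select_convs)
lemma S1_pl: "prelog_ring S1" using R1_cring mon_B mon_maps_ring[OF al_B mod_hom] by (simp only: prelog_ring_def base_mod_def prelog.select_convs)

abbreviation "\<rho> \<equiv> coset_map R (rad p R) (%x. x)"

lemma rho: assumes x: "x:[R]" shows "\<rho> (mults p R +>[R] x)=rcl p R x" unfolding red_class_def
proof (rule R.cos_map_cos[OF R.muls_sub x])
 fix z assume z: "z:[R]" "z -[R]x : mults p R"
 have "(z -[R]x) [^][R] (1::nat) : mults p R" using z x by simp
 hence "z -[R]x : rad p R" unfolding rad_def using z(1) x by blast
 thus "rad p R +>[R] z=rad p R +>[R] x" using z x by (simp add: R.cos_eq_iff[OF R.rad_sub[OF prime_p]])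
qed

lemma R1_sj: "X:[R1]==>\<exists>x\<in>carrier R. X=mults p R +>[R] x" by (simp add: R.quot_car)
lemma rho_hom: "\<rho> : rhom R1 (rdr p R)" by (rule rh_descend[OF R.ring_axioms mod_hom R1_sj R.red_hom[OF prime_p] rho])
lemma rho_sj: "s:[rdr p R]==>\<exists>c\<in>carrier R1. s=\<rho> c" using R.red_sj rho rh_cl[OF mod_hom] by metis
lemma mpolys_R1: "mpolys R1" by (intro mpolys.intro R1_cring)

abbreviation "cr \<equiv> coeff_red p B"

lemma cr_hom: "cr : rhom (mpr R1 nm) (mpr (rdr p R) nm)" using mpolys.cmap_hom[OF mpolys_R1 R.red_cring[OF prime_p] rho_hom] by (simp add: coeff_red_def[abs_def])

lemma cr_sj: "g:[mpr (rdr p R) nm]==>\<exists>h\<in>carrier (mpr R1 nm). g=cr h"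
proof -
 assume g: "g:[mpr (rdr p R) nm]"
 obtain f where "f:[mpr R1 nm]" "(%M. \<rho> (f M))=g" using mpolys.cmap_sj[OF mpolys_R1 R.red_cring[OF prime_p] rho_hom rho_sj g] by blast
 thus ?thesis by (intro bexI[of _ f]) (simp_all add: coeff_red_def)
qed

lemma cr_mon: "c:[R1]==>cr (mpoly_monom R1 c M)=mpoly_monom (rdr p R) (\<rho> c) M" using mpolys.cmap_mon[OF mpolys_R1 R.red_cring[OF prime_p] rho_hom] by (simp add: coeff_red_def)

lemma lo:
 "pr (lob S0 P)=mpr (rdr p R) P" "pr (lob S1 P)=mpr R1 P"
 "pmon (lob S0 P)=free_mon (snd P) \<times>\<times> pmon B" "pmon (lob S1 P)=free_mon (snd P) \<times>\<times> pmon B"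
 "nstr (lob S0 P)=nstr (lob S1 P)"
 "rstr (lob S0 P) s=mpoly_monom (rdr p R) s {#}" "rstr (lob S1 P) c=mpoly_monom R1 c {#}" by (simp_all add: lpoly_obj_def base_red_def base_mod_def)

lemma cr_al: assumes "l:[free_mon (snd P) \<times>\<times> pmon B]"
 shows "cr (palpha (lob S1 P) l)=palpha (lob S0 P) l"
proof -
 obtain v n where l: "l=(v, n)" "n:[pmon B]" using assms by (cases l) (auto simp: DirProd_def)
 thus ?thesis using cr_mon[OF rh_cl[OF mod_hom al_B_cl[OF l(2)]]] rho[OF al_B_cl[OF l(2)]] by (simp add: lpoly_obj_def S0_s S1_s)
qed

text \<open>The kernel of \<open>cr\<close> consists of the polynomials with coefficients in the kernel of
 \<open>\<rho>\<close>, hence is preserved by algebra maps.\<close>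

lemma cr_kernel:
 assumes f: "prelog_alg_hom S1 (lob S1 P) (lob S1 Q) f \<psi>"
  and h: "h:[mpr R1 P]" "h':[mpr R1 P]" and eq: "cr h=cr h'"
 shows "cr (f h)=cr (f h')"
proof -
 interpret R1: cring R1 by (rule R1_cring)
 interpret X: mpolys R1 P by (rule mpolys_R1)
 interpret Y: mpolys R1 Q by (rule mpolys_R1)
 interpret R0: cring "rdr p R" by (rule R.red_cring[OF prime_p])
 interpret Z: mpolys "rdr p R" Q by (intro mpolys.intro R0.cring_axioms)
 interpret Z0: mpolys "rdr p R" P by (intro mpolys.intro R0.cring_axioms)
 interpret xy: gpair X.P Z.P by unfold_locales
 interpret xx: gpair X.P Z0.P by unfold_locales
 have fh: "f : rhom X.P Y.P" and fr: "!!s. s:[R1]==>f (X.mnm s {#})=Y.mnm s {#}" using f by (simp_all add: prelog_alg_hom_def prelog_hom_def lo S1_s del: X.P_s Y.P_s)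
 have ch: "(%h. cr (f h)) : rhom X.P Z.P" using ring_hom_trans[OF fh cr_hom] by (simp add: comp_def)
 note ca = rh_ah[OF ch]
 have J: "asub {h : carrier X.P. cr (f h) : {0[Z.P]}} X.P" by (rule xy.ah_kernel[OF ca]) (rule Z.Pg.subgroupI, auto simp: Z.Pg.minus_eq Z.Pg.r_neg simp del: Z.P_s)
 have m: "X.mnm c U : {h : carrier X.P. cr (f h) : {0[Z.P]}}" if c: "c:[R1] & \<rho> c=0[rdr p R]" and U: "set_mset U <= vars P" for c U
 proof -
  have e: "X.mnm c U=X.mnm c {#} *[X.P]X.mnm 1[R1] U" using X.mon_mul[OF conjunct1[OF c] R1.one_closed, of "{#}" U] by (simp only: add_0 R1.r_one[OF conjunct1[OF c]])
  have k: "X.mnm c {#}:[X.P]" "X.mnm 1[R1] U:[X.P]" using X.mon_cl[OF conjunct1[OF c], of "{#}"] X.mon_cl[OF R1.one_closed U] by (simp_all only: set_mset_empty empty_subsetI)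
  have "cr (f (X.mnm c {#}))=0[Z.P]" using c fr[of c] cr_mon[of c "{#}"] by simp
  hence "cr (f (X.mnm c U))=0[Z.P]" unfolding e rh_mul[OF ch k] using rh_cl[OF ch k(2)] by (simp del: Z.P_s)
  thus ?thesis using X.mon_cl[OF conjunct1[OF c] U] by simp
 qed
 have d: "h -[X.P]h':[X.P]" using h by (rule X.Pg.minus_closed)
 have "cr (h -[X.P]h')=0[Z0.P]" using xx.ah_sub[OF rh_ah[OF cr_hom] h] rh_cl[OF cr_hom h(2)] by (simp add: eq Z0.Pg.minus_eq Z0.Pg.r_neg del: Z0.P_s)
 hence "\<rho> ((h -[X.P]h') U)=0[rdr p R]" for U by (auto simp: coeff_red_def dest: fun_cong)
 hence "h -[X.P]h' : {h : carrier X.P. cr (f h) : {0[Z.P]}}" using X.P_coeff[OF d] by (intro X.P_coeff_sub[OF J m d, of "{c. c:[R1] & \<rho> c=0[rdr p R]}"]) simp_all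
 hence "cr (f h) -[Z.P]cr (f h')=0[Z.P]" using xy.ah_sub[OF ca h] by simp
 thus ?thesis using Z.Pg.sub_0_iff rh_cl[OF ch h(1)] rh_cl[OF ch h(2)] by blast
qed

text \<open>By \<open>cr_kernel\<close> the images of all lifts of \<open>cr h\<close> coincide, so
  \<open>the_elem\<close> in \<open>reduce_mor\<close> returns the image of any one of them.\<close>

lemma reduce_cr:
 assumes f: "prelog_alg_hom S1 (lob S1 P) (lob S1 Q) f \<psi>" and h: "h:[mpr R1 P]"
 shows "fst (reduce_mor p B P Q (f, \<psi>)) (cr h)=cr (f h)"
proof -
 have "(%h. cr (f h)) ` {h' : carrier (mpr R1 P). cr h'=cr h}={cr (f h)}" using cr_kernel[OF f _ h] h by blast
 thus ?thesis using rh_cl[OF cr_hom h] by (simp add: reduce_mor_def lo)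
qed

lemma reduce_ext: "fst (reduce_mor p B P Q (f, \<psi>)) : extensional (carrier (mpr (rdr p R) P))" "snd (reduce_mor p B P Q (f, \<psi>))=\<psi>" by (simp_all add: reduce_mor_def lo)

lemma reduce_functor: "functor_between (lPoly S1) (lPoly S0) (%P. P) (reduce_mor p B)"
proof (intro functor_between.intro functor_between_axioms.intro lPoly_category S0_pl S1_pl)
 note S1 = lobj[OF S1_pl]
 \<comment> \<open>Every reduced polynomial lifts, so extensional morphisms are compared on the
   elements \<open>cr h\<close>.\<close>
 have eqI: "F=G" if "fst F : extensional (carrier (mpr (rdr p R) P))" "fst G : extensional (carrier (mpr (rdr p R) P))"
   "snd F=snd G" "!!h. h:[mpr R1 P]==>fst F (cr h)=fst G (cr h)"
  for F G :: "('r set mpoly => 'r set mpoly) \<times> (nat multiset \<times> 'n => nat multiset \<times> 'n)" and P using that by (intro prod_eqI extensionalityI[OF that(1,2)]) (auto dest!: cr_sj)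
 show "a : Obj (lPoly S0)" for a by (simp add: lPoly_s)
 show "reduce_mor p B P Q u : Hom (lPoly S0) P Q" if "u : Hom (lPoly S1) P Q" for P Q u
 proof -
  obtain f \<psi> where u: "u=(f, \<psi>)" by (cases u)
  have f: "prelog_alg_hom S1 (lob S1 P) (lob S1 Q) f \<psi>" and x: "\<psi> : extensional (carrier (pmon (lob S1 P)))" using that by (simp_all add: u lPoly_s)
  note f' = f[unfolded prelog_alg_hom_def prelog_hom_def lo] and r = reduce_cr[OF f]
  define F where "F=fst (reduce_mor p B P Q (f, \<psi>))"
  have F: "reduce_mor p B P Q u=(F, \<psi>)" unfolding u F_def using reduce_ext(2)[of P Q f \<psi>] by (simp add: prod_eq_iff)
  have fh: "f : rhom (mpr R1 P) (mpr R1 Q)" using f' by blast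
  have "ring (mpr R1 P)" using S1(1)[of P] by (simp add: lo)
  hence Fh: "F : rhom (mpr (rdr p R) P) (mpr (rdr p R) Q)" using ring_hom_trans[OF fh cr_hom] r cr_sj by (intro rh_descend[OF _ cr_hom, where f = "%h. cr (f h)"]) (simp_all add: comp_def F_def)
  have Fa: "F (palpha (lob S0 P) l)=palpha (lob S0 Q) (\<psi> l)" if l: "l:[free_mon (snd P) \<times>\<times> pmon B]" for l
  proof -
   have "\<psi> l:[free_mon (snd Q) \<times>\<times> pmon B]" using f' l by (auto simp only: mm_def hom_def Pi_iff mem_Collect_eq)
   moreover have "f (palpha (lob S1 P) l)=palpha (lob S1 Q) (\<psi> l)" using f' l by blast
   ultimately show ?thesis using r[of "palpha (lob S1 P) l"] S1(3)[of l P] l by (simp add: F_def lo flip: cr_al)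
  qed
  have Fr: "F (rstr (lob S0 P) s)=rstr (lob S0 Q) s" if s: "s:[rdr p R]" for s
  proof -
   obtain c where c: "c:[R1]" "s=\<rho> c" using rho_sj[OF s] by blast
   have "f (mpoly_monom R1 c {#})=mpoly_monom R1 c {#}" using f' c(1) by (simp add: S1_s)
   thus ?thesis using r[of "mpoly_monom R1 c {#}"] S1(4)[of c P] c by (simp add: F_def lo S1_s cr_mon)
  qed
  show ?thesis unfolding F lPoly_s prelog_alg_hom_def prelog_hom_def lo S0_s using Fh Fa Fr f' x reduce_ext(1)[of P Q f \<psi>] by (simp add: lo S1_s F_def)
 qed
 show "reduce_mor p B P P (Idm (lPoly S1) P)=Idm (lPoly S0) P" for P
 proof -
  have "Idm (lPoly S1) P : Hom (lPoly S1) P P" by (rule category.id_Hom[OF lPoly_category[OF S1_pl]]) (simp add: lPoly_s)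
  hence f: "prelog_alg_hom S1 (lob S1 P) (lob S1 P) (restrict (%x. x) (carrier (pr (lob S1 P)))) (restrict (%l. l) (carrier (pmon (lob S1 P))))" by (simp add: lPoly_s)
  show ?thesis by (rule eqI[of _ P]) (use reduce_ext reduce_cr[OF f] rh_cl[OF cr_hom] in \<open>simp_all add: lPoly_s lo\<close>)
 qed
 show "reduce_mor p B P T (Comp (lPoly S1) P v u)=Comp (lPoly S0) P (reduce_mor p B Q T v) (reduce_mor p B P Q u)"
  if u: "u : Hom (lPoly S1) P Q" and v: "v : Hom (lPoly S1) Q T" for P Q T u v
 proof -
  have vu: "Comp (lPoly S1) P v u : Hom (lPoly S1) P T" by (rule category.comp_Hom[OF lPoly_category[OF S1_pl] _ _ _ u v]) (simp_all add: lPoly_s)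
  obtain f \<psi> g \<chi> where e: "u=(f, \<psi>)" "v=(g, \<chi>)" by (cases u; cases v)
  note h = u[unfolded e lPoly_s, THEN conjunct1] v[unfolded e lPoly_s, THEN conjunct1] vu[unfolded e lPoly_s, THEN conjunct1]
  have fc: "f h:[mpr R1 Q]" if "h:[mpr R1 P]" for h using lPoly_maps(1)[OF h(1)] that by (auto simp: lo)
  obtain F G where FG: "reduce_mor p B P Q (f, \<psi>)=(F, \<psi>)" "reduce_mor p B Q T (g, \<chi>)=(G, \<chi>)" using reduce_ext(2)[of P Q f \<psi>] reduce_ext(2)[of Q T g \<chi>] by (metis prod.collapse)
  show ?thesis unfolding e
  proof (rule eqI[of _ P])
   fix k assume k: "k:[mpr R1 P]"
   show "fst (reduce_mor p B P T (Comp (lPoly S1) P (g, \<chi>) (f, \<psi>))) (cr k) =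
     fst (Comp (lPoly S0) P (reduce_mor p B Q T (g, \<chi>)) (reduce_mor p B P Q (f, \<psi>))) (cr k)" using reduce_cr[OF h(3) k] reduce_cr[OF h(1) k] reduce_cr[OF h(2) fc[OF k]] k rh_cl[OF cr_hom k] by (simp add: FG lPoly_s lo compose_eq)
  qed (use reduce_ext in \<open>simp_all add: FG lPoly_s lo\<close>)
 qed
qed

end

lemma truncate_s:
 "gr (dieu.truncate A)=gr A" "gmul (dieu.truncate A)=gmul A" "gone (dieu.truncate A)=gone A"
 "dif (dieu.truncate A)=dif A" "rmap (dieu.truncate A)=rmap A" "frob (dieu.truncate A)=frob A" by (simp_all add: dieu.truncate_def)

context log_base
begin

section \<open>The functor on free pre-log algebras over the reduced base\<close>

lemma W_ex1: assumes u: "u : Hom (lPoly S0) P Q"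
 shows "\<exists>!g. g : log_dieu_Hom p B (W P) (W Q) & lifts_mor p B P Q u g"
proof -
 obtain m \<chi> where e: "u=(m, \<chi>)" by (cases u)
 have "std_mor p k \<iota> B N1 N2 P Q m \<chi>" using u unfolding e lPoly_s by (intro std_mor.intro std_mor_axioms.intro std_poly.intro log_base_axioms) blast
 thus ?thesis using std_mor.mor_ex1 u unfolding e lPoly_s lo by blast
qed

lemma W_mor: assumes "u : Hom (lPoly S0) P Q"
 shows "W_mor p B P Q u : log_dieu_Hom p B (W P) (W Q)" "lifts_mor p B P Q u (W_mor p B P Q u)" using theI'[OF W_ex1[OF assms]] unfolding W_mor_def by blast+

lemma W_mor_eqI: "u : Hom (lPoly S0) P Q==>g : log_dieu_Hom p B (W P) (W Q)==>lifts_mor p B P Q u g==>W_mor p B P Q u=g" unfolding W_mor_def by (rule the1_equality[OF W_ex1]) blast+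
lemma W_cring: "cring (deg0 (W P))" by (rule std_poly.Wo_cring[OF std_poly.intro[OF log_base_axioms]])
lemma W_lmon: "lmon (W P)=free_mon (snd P) \<times>\<times> pmon B" using std_poly.Wo_s(7)[OF std_poly.intro[OF log_base_axioms]] std_poly.A_s(2)[OF std_poly.intro[OF log_base_axioms]] by simp

lemma e_cls: assumes "x:[mpr (rdr p R) P]"
 obtains z where "z:[deg0 (W P)]" "e_ring p B P x=rcl p (deg0 (W P)) z" using rh_cl[OF std_poly.e_rh[OF std_poly.intro[OF log_base_axioms]] assms] cring.red_sj[OF W_cring] by blast

lemma W_dieu: "dieudonne_algebra R (W P) p FR" "strict p (W P)" using std_poly.Wo_DA[OF std_poly.intro[OF log_base_axioms], of P] by (simp_all add: DA_log_s_str_def DA_log_s_def log_dieudonne_algebra_def)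

text \<open>Functoriality is uniqueness: the identity satisfies the condition that characterises the
  value of \<open>W_mor\<close> there. Composites are treated in the same way in
  \<open>W_comp\<close>.\<close>

lemma W_ident: "W_mor p B P P (Idm (lPoly S0) P)=(%i. restrict (%x. x) (carrier (gr (W P) i)), restrict (%l. l) (carrier (lmon (W P))))"
proof (rule W_mor_eqI)
 show "Idm (lPoly S0) P : Hom (lPoly S0) P P" by (rule category.id_Hom[OF lPoly_category[OF S0_pl]]) (simp add: lPoly_s)
 show "(%i. restrict (%x. x) (carrier (gr (W P) i)), restrict (%l. l) (carrier (lmon (W P)))) : log_dieu_Hom p B (W P) (W P)" by (rule log_dieu_Hom_id[OF W_log])
 show "lifts_mor p B P P (Idm (lPoly S0) P) (%i. restrict (%x. x) (carrier (gr (W P) i)), restrict (%l. l) (carrier (lmon (W P))))" unfolding lifts_mor_def lPoly_s prod.case lo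
 proof (intro conjI ballI)
  fix x assume x: "x:[mpr (rdr p R) P]"
  obtain z where z: "z:[deg0 (W P)]" "e_ring p B P x=rcl p (deg0 (W P)) z" using e_cls[OF x] .
  have "restrict (%x. x) (carrier (gr (W P) 0)) : rhom (deg0 (W P)) (deg0 (W P))" using rh_id[OF cring.axioms(1)[OF W_cring], of P] by simp
  from cos_map_red[OF prime_p W_cring W_cring this z(1)]
  show "coset_map (deg0 (W P)) (rad p (deg0 (W P))) (restrict (%x. x) (carrier (gr (W P) 0))) (e_ring p B P x) =
    e_ring p B P (restrict (%x. x) (carrier (mpr (rdr p R) P)) x)" using z x by simp
 qed (simp add: W_lmon)
qed

lemma W_comp:
 assumes u: "u : Hom (lPoly S0) P Q" and v: "v : Hom (lPoly S0) Q T"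
  and f: "W_mor p B P Q u=(f, \<psi>)" and g: "W_mor p B Q T v=(g, \<chi>)"
 shows "W_mor p B P T (Comp (lPoly S0) P v u)=(%i. compose (carrier (gr (W P) i)) (g i) (f i), compose (carrier (lmon (W P))) \<chi> \<psi>)"
proof (rule W_mor_eqI)
 show "Comp (lPoly S0) P v u : Hom (lPoly S0) P T" by (rule category.comp_Hom[OF lPoly_category[OF S0_pl] _ _ _ u v]) (simp_all add: lPoly_s)
 note F = W_mor[OF u, unfolded f] and G = W_mor[OF v, unfolded g]
 show "(%i. compose (carrier (gr (W P) i)) (g i) (f i), compose (carrier (lmon (W P))) \<chi> \<psi>) : log_dieu_Hom p B (W P) (W T)" by (rule log_dieu_Hom_compose[OF prime_p W_log W_log W_log F(1) G(1)])
 obtain m \<mu> m' \<mu>' where e: "u=(m, \<mu>)" "v=(m', \<mu>')" by (cases u; cases v)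
 have fh: "dieu_hom R (W P) (W Q) f" and gh: "dieu_hom R (W Q) (W T) g" using F(1) G(1) by (auto simp: log_dieu_Hom_def log_dieu_hom_def)
 note maps = lPoly_maps[OF u[unfolded e lPoly_s, THEN conjunct1], unfolded lo]
 show "lifts_mor p B P T (Comp (lPoly S0) P v u) (%i. compose (carrier (gr (W P) i)) (g i) (f i), compose (carrier (lmon (W P))) \<chi> \<psi>)" unfolding e lifts_mor_def lPoly_s prod.case lo
 proof (intro conjI ballI)
  fix x assume x: "x:[mpr (rdr p R) P]"
  obtain z where z: "z:[deg0 (W P)]" "e_ring p B P x=rcl p (deg0 (W P)) z" using e_cls[OF x] .
  have gf: "compose (carrier (gr (W P) 0)) (g 0) (f 0) : rhom (deg0 (W P)) (deg0 (W T))" using rh_compose[OF cring.axioms(1)[OF W_cring] dieu_hom_ring[OF fh] dieu_hom_ring[OF gh]] by simp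
  have fz: "f 0 z:[deg0 (W Q)]" using rh_cl[OF dieu_hom_ring[OF fh] z(1)] .
  have "coset_map (deg0 (W Q)) (rad p (deg0 (W Q))) (f 0) (e_ring p B P x)=e_ring p B Q (m x)" using F(2) x unfolding e lifts_mor_def prod.case lo by blast
  hence 1: "rcl p (deg0 (W Q)) (f 0 z)=e_ring p B Q (m x)" using cos_map_red[OF prime_p W_cring W_cring dieu_hom_ring[OF fh] z(1)] z(2) by simp
  have "coset_map (deg0 (W T)) (rad p (deg0 (W T))) (g 0) (e_ring p B Q (m x))=e_ring p B T (m' (m x))" using G(2) maps(1) x unfolding e lifts_mor_def prod.case lo by blast
  thus "coset_map (deg0 (W T)) (rad p (deg0 (W T))) (compose (carrier (gr (W P) 0)) (g 0) (f 0)) (e_ring p B P x) =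
    e_ring p B T (compose (carrier (mpr (rdr p R) P)) m' m x)" using cos_map_red[OF prime_p W_cring W_cring gf z(1)] cos_map_red[OF prime_p W_cring W_cring dieu_hom_ring[OF gh] fz] z x by (simp add: 1 compose_eq)
 next
  fix l assume l: "l:[free_mon (snd P) \<times>\<times> pmon B]"
  have "\<psi> l=\<mu> l" using F(2) l unfolding e lifts_mor_def prod.case lo by blast
  moreover have "\<chi> (\<mu> l)=\<mu>' (\<mu> l)" using G(2) maps(2) l unfolding e lifts_mor_def prod.case lo by blast
  ultimately show "compose (carrier (lmon (W P))) \<chi> \<psi> l=compose (carrier (free_mon (snd P) \<times>\<times> pmon B)) \<mu>' \<mu> l" using l unfolding W_lmon by (simp only: compose_eq)
 qed
qed

lemma WO_functor: "functor_between (lPoly S0) (DA_str p B) (WOmega p B) (WOmega_mor p B)"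
proof (intro functor_between.intro functor_between_axioms.intro lPoly_category[OF S0_pl] DA_category)
 \<comment> \<open>Truncation drops only the log data, so Dieudonne morphisms between the
   truncations are those between the full objects.\<close>
 have tr: "dieu_hom R (WOmega p B P) (WOmega p B Q) f \<longleftrightarrow> dieu_hom R (W P) (W Q) f" for P Q f unfolding dieu_hom_def grh_def WOmega_def truncate_s ..
 show "WOmega p B P : Obj (DA_str p B)" for P using W_dieu[of P] unfolding DA_s WOmega_def dieu_cg[OF truncate_s] ..
 show "WOmega_mor p B P Q u : Hom (DA_str p B) (WOmega p B P) (WOmega p B Q)" if "u : Hom (lPoly S0) P Q" for P Q u using W_mor(1)[OF that] unfolding DA_s tr WOmega_mor_def by (auto simp: log_dieu_Hom_def log_dieu_hom_def WOmega_def truncate_s)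
 show "WOmega_mor p B P P (Idm (lPoly S0) P)=Idm (DA_str p B) (WOmega p B P)" for P by (rule HOL.ext) (simp add: WOmega_mor_def W_ident DA_s WOmega_def truncate_s)
 show "WOmega_mor p B P T (Comp (lPoly S0) P v u)=Comp (DA_str p B) (WOmega p B P) (WOmega_mor p B Q T v) (WOmega_mor p B P Q u)"
  if u: "u : Hom (lPoly S0) P Q" and v: "v : Hom (lPoly S0) Q T" for P Q T u v
 proof -
  obtain f \<psi> g \<chi> where e: "W_mor p B P Q u=(f, \<psi>)" "W_mor p B Q T v=(g, \<chi>)" by (metis surj_pair)
  show ?thesis by (rule HOL.ext) (simp add: WOmega_mor_def W_comp[OF u v e] e DA_s WOmega_def truncate_s)
 qed
qed

end

theorem theorem2p24:
  fixes p :: nat and k :: "'k ring" and \<iota> :: "(nat \<Rightarrow> 'k) \<Rightarrow> 'r"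
    and B :: "('r, 'n) fprelog" and N1 N2 :: "'n set"
  assumes "log_base p k \<iota> B N1 N2"
  shows
    "(\<forall>P. Omega_std p B P \<in> DA_log_s p B \<and>
          W_obj p B P \<in> DA_log_s_str p B \<and>
          log_dieu_hom p B (Omega_std p B P) (W_obj p B P) (W_unit p B P) (\<lambda>l. l) \<and>
          prelog_hom (lpoly_obj (base_red p B) P) (red_prelog p (W_obj p B P)) (e_ring p B P) (\<lambda>l. l)) \<and>
     (\<forall>P Q. \<forall>u \<in> Hom (lPoly (base_red p B)) P Q.
        \<exists>!g. g \<in> log_dieu_Hom p B (W_obj p B P) (W_obj p B Q) \<and> lifts_mor p B P Q u g) \<and>
     functor_between (lPoly (base_red p B)) (DA_str p B) (WOmega p B) (WOmega_mor p B) \<and>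
     functor_between (lPoly (base_mod p B)) (lPoly (base_red p B)) (\<lambda>P. P) (reduce_mor p B) \<and>
     functor_between (lPoly (base_mod p B)) (DA_str p B) (WOmega p B)
       (\<lambda>P Q u. WOmega_mor p B P Q (reduce_mor p B P Q u))"
proof -
 note sp = std_poly.intro[OF assms] and lb = log_base.WO_functor[OF assms] log_base.reduce_functor[OF assms]
 show ?thesis using std_poly.O_DA[OF sp] std_poly.Wo_DA[OF sp] std_poly.u_log[OF sp] std_poly.e_pl[OF sp]
   log_base.W_ex1[OF assms] lb functor_comp[OF lb(2,1)] by blast
qed

end
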